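(* Let $v\in\mathbb{N}^{\ell+t+1}$. There exists $D_{v,n}\in\mathbb{N}$ such that for any ideal $I\subseteq R$ of type $v$ with $\alpha(I)\ge D_{v,n}$, there exists an LPP ideal $J$ (for $I$ and $v$) with the same Hilbert function as $I$ in degrees $\le\alpha(I)+t$. Furthermore, for $q\in\{n,n-1,\dots,3\}$ there exist linear forms $f_n,f_{n-1},\dots,f_q$ such that for all $k\in\{0,1,\dots,t-1\}$ we have $$\dim_K\left(R/(J,f_n,\dots,f_q)\right)_{\alpha(I)+k}\ \ge\ \dim_K\left(R/(I,f_n,\dots,f_q)\right)_{\alpha(I)+k}.$$
   Context: $\mathbb{N}=\{0,1,2,\dots\}$. $K$ is a field of characteristic $0$, $n\ge 3$, $R=K[x_1,\dots,x_n]$ is standard graded, and all ideals are homogeneous. $\alpha(I)$ is the smallest degree of a minimal generator of $I$. Type: let $\ell\ge1$, $t\ge 0$ be integers. $I$ is of type $v=(a_1,\dots,a_\ell,b_0,\dots,b_t)\in\mathbb{N}^{\ell+t+1}$ if there is a regular sequence of forms $g_1,\dots,g_\ell\in I$ with $\deg g_i=\alpha(I)+a_i$ and $\deg g_i\le\deg g_{i+1}$, and for all $j\in\{0,\dots,t\}$, $I$ has exactly $b_j$ minimal generators in degree $\alpha(I)+j$. Lex order: for monomials of the same degree, $x^p>x^q$ if the first nonzero entry of $p-q$ is positive. A lex ideal is a monomial ideal that, whenever it contains a monomial, contains every lex-larger monomial of the same degree. An LPP (lex plus powers) ideal for $I$ and $v$ is $J=L+(x_1^{\alpha(I)+a_1},\dots,x_\ell^{\alpha(I)+a_\ell})$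 with $L$ a lex ideal. Same Hilbert function in degrees $\le N$ means $\dim_K J_d=\dim_K I_d$ for all $d\le N$. *)

theory Defs
  imports Complex_Main "HOL-Library.Poly_Mapping" "HOL-Algebra.Ideal"
begin

section \<open>The graded polynomial ring\<close>

type_synonym mono = "nat \<Rightarrow>\<^sub>0 nat"
type_synonym 'k mpoly = "mono \<Rightarrow>\<^sub>0 'k"

definition monoms :: "nat \<Rightarrow> mono set" where
  "monoms n = {m. Poly_Mapping.keys m \<subseteq> {1..n}}"

definition mdeg :: "mono \<Rightarrow> nat" where
  "mdeg m = (\<Sum>i\<in>Poly_Mapping.keys m. Poly_Mapping.lookup m i)"

definition X :: "nat \<Rightarrow> 'k::field mpoly" where
  "X i = Poly_Mapping.single (Poly_Mapping.single i 1) 1"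

definition polyring :: "nat \<Rightarrow> 'k::field mpoly ring" where
  "polyring n = \<lparr>carrier = {p. Poly_Mapping.keys p \<subseteq> monoms n},
     monoid.mult = (*), one = 1, zero = 0, add = (+)\<rparr>"

definition mscale :: "'k::field \<Rightarrow> 'k mpoly \<Rightarrow> 'k mpoly" where
  "mscale c p = Poly_Mapping.single 0 c * p"

global_interpretation mp: vector_space mscale
  by unfold_locales
     (simp_all add: mscale_def distrib_left distrib_right single_add mult.assoc[symmetric] mult_single)

text \<open>The graded component of degree \<open>d\<close> of the polynomial ring; it contains \<open>0\<close> for every \<open>d\<close>.\<close>

definition forms :: "nat \<Rightarrow> nat \<Rightarrow> 'k::field mpoly set" where
  "forms n d = {p \<in> carrier (polyring n). \<forall>m\<in>Poly_Mapping.keys p. mdeg m = d}"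

lemma cring_polyring: "cring (polyring n :: 'k::field mpoly ring)"
proof (intro cringI abelian_groupI comm_monoidI)
  have add: "p + q \<in> carrier (polyring n)"
    if "p \<in> carrier (polyring n)" "q \<in> carrier (polyring n)" for p q :: "'k mpoly"
    using that keys_add[of p q] by (auto simp: polyring_def)
  have mon: "a + b \<in> monoms n" if "a \<in> monoms n" "b \<in> monoms n" for a b
    using that keys_add[of a b] by (auto simp: monoms_def)
  fix p q :: "'k mpoly"
  assume pq: "p \<in> carrier (polyring n)" "q \<in> carrier (polyring n)"
  show "p \<oplus>\<^bsub>polyring n\<^esub> q \<in> carrier (polyring n)"
    using add[OF pq] by (simp add: polyring_def)
  show "p \<otimes>\<^bsub>polyring n\<^esub> q \<in> carrier (polyring n)"
    using pq mon keys_mult[of p q] by (fastforce simp: polyring_def)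
next
  fix p :: "'k mpoly"
  assume "p \<in> carrier (polyring n)"
  then show "\<exists>q\<in>carrier (polyring n). q \<oplus>\<^bsub>polyring n\<^esub> p = \<zero>\<^bsub>polyring n\<^esub>"
    by (intro bexI[of _ "- p"]) (auto simp: polyring_def in_keys_iff subset_iff)
qed (auto simp: polyring_def monoms_def algebra_simps)


section \<open>Homogeneous ideals, minimal generators, type\<close>

definition homogeneous_ideal :: "nat \<Rightarrow> 'k::field mpoly set \<Rightarrow> bool" where
  "homogeneous_ideal n I \<longleftrightarrow> ideal I (polyring n) \<and>
     I = genideal (polyring n) (I \<inter> (\<Union>d. forms n d))"

text \<open>Minimality excludes \<open>0\<close> from \<open>G\<close>, so every element of \<open>G\<close> has a well-defined degree.\<close>

definition min_hom_gens :: "nat \<Rightarrow> 'k::field mpoly set \<Rightarrow> 'k mpoly set \<Rightarrow> bool" where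
  "min_hom_gens n I G \<longleftrightarrow> finite G \<and> G \<subseteq> (\<Union>d. forms n d) \<and>
     genideal (polyring n) G = I \<and> (\<forall>g\<in>G. genideal (polyring n) (G - {g}) \<noteq> I)"

definition alpha :: "nat \<Rightarrow> 'k::field mpoly set \<Rightarrow> nat" where
  "alpha n I = (LEAST d. \<exists>G. min_hom_gens n I G \<and> G \<inter> forms n d \<noteq> {})"

definition regular_seq :: "nat \<Rightarrow> nat \<Rightarrow> (nat \<Rightarrow> 'k::field mpoly) \<Rightarrow> bool" where
  "regular_seq n l g \<longleftrightarrow> g ` {1..l} \<subseteq> carrier (polyring n) \<and>
     genideal (polyring n) (g ` {1..l}) \<noteq> carrier (polyring n) \<and>
     (\<forall>i\<in>{1..l}. \<forall>h\<in>carrier (polyring n).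
        h * g i \<in> genideal (polyring n) (g ` {1..<i}) \<longrightarrow>
        h \<in> genideal (polyring n) (g ` {1..<i}))"

text \<open>
  A vector \<open>v = (a\<^sub>1,\<dots>,a\<^sub>l,b\<^sub>0,\<dots>,b\<^sub>t)\<close> is a list of length \<open>l + t + 1\<close>. The number of
  generators of a given degree is the same for all minimal homogeneous generating sets.
\<close>

definition a_entry :: "nat list \<Rightarrow> nat \<Rightarrow> nat" where
  "a_entry v i = v ! (i - 1)"

definition b_entry :: "nat \<Rightarrow> nat list \<Rightarrow> nat \<Rightarrow> nat" where
  "b_entry l v j = v ! (l + j)"

definition has_type :: "nat \<Rightarrow> nat \<Rightarrow> nat \<Rightarrow> nat list \<Rightarrow> 'k::field mpoly set \<Rightarrow> bool" where
  "has_type n l t v I \<longleftrightarrow>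
     (\<exists>g. regular_seq n l g \<and>
        (\<forall>i\<in>{1..l}. g i \<in> I \<and> g i \<in> forms n (alpha n I + a_entry v i)) \<and>
        (\<forall>i\<in>{1..<l}. alpha n I + a_entry v i \<le> alpha n I + a_entry v (i + 1))) \<and>
     (\<exists>G. min_hom_gens n I G \<and>
        (\<forall>j\<le>t. card (G \<inter> forms n (alpha n I + j)) = b_entry l v j))"


section \<open>Lex-plus-powers ideals\<close>

definition lex_greater :: "mono \<Rightarrow> mono \<Rightarrow> bool" where
  "lex_greater p q \<longleftrightarrow> (\<exists>i. Poly_Mapping.lookup p i > Poly_Mapping.lookup q i \<and>
     (\<forall>j<i. Poly_Mapping.lookup p j = Poly_Mapping.lookup q j))"

definition monomial_ideal :: "nat \<Rightarrow> 'k::field mpoly set \<Rightarrow> bool" where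
  "monomial_ideal n L \<longleftrightarrow>
     (\<exists>S\<subseteq>monoms n. L = genideal (polyring n) ((\<lambda>m. Poly_Mapping.single m 1) ` S))"

definition lex_ideal :: "nat \<Rightarrow> 'k::field mpoly set \<Rightarrow> bool" where
  "lex_ideal n L \<longleftrightarrow> monomial_ideal n L \<and>
     (\<forall>p\<in>monoms n. \<forall>q\<in>monoms n. mdeg p = mdeg q \<and> lex_greater p q \<and>
        Poly_Mapping.single q 1 \<in> L \<longrightarrow> Poly_Mapping.single p 1 \<in> L)"

definition lpp_ideal ::
  "nat \<Rightarrow> nat \<Rightarrow> nat list \<Rightarrow> 'k::field mpoly set \<Rightarrow> 'k mpoly set \<Rightarrow> bool" where
  "lpp_ideal n l v I J \<longleftrightarrow> (\<exists>L. lex_ideal n L \<and>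
     J = L <+>\<^bsub>polyring n\<^esub>
         genideal (polyring n) ((\<lambda>i. X i ^ (alpha n I + a_entry v i)) ` {1..l}))"


section \<open>Hilbert functions\<close>

definition same_hilbert_upto :: "nat \<Rightarrow> nat \<Rightarrow> 'k::field mpoly set \<Rightarrow> 'k mpoly set \<Rightarrow> bool" where
  "same_hilbert_upto n N I J \<longleftrightarrow>
     (\<forall>d\<le>N. mp.dim (I \<inter> forms n d) = mp.dim (J \<inter> forms n d))"

text \<open>
  \<open>indep_mod W B\<close>: the classes modulo \<open>W\<close> of the elements of \<open>B\<close> are pairwise distinct and
  linearly independent. Accordingly \<open>quot_dim U W\<close> is the dimension of the image of \<open>U\<close> in the
  quotient by \<open>W\<close>.
\<close>

definition indep_mod :: "'k::field mpoly set \<Rightarrow> 'k mpoly set \<Rightarrow> bool" where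
  "indep_mod W B \<longleftrightarrow> (\<forall>c. (\<Sum>b\<in>B. mscale (c b) b) \<in> W \<longrightarrow> (\<forall>b\<in>B. c b = 0))"

definition quot_dim :: "'k::field mpoly set \<Rightarrow> 'k mpoly set \<Rightarrow> nat" where
  "quot_dim U W = Max {card B | B. finite B \<and> B \<subseteq> U \<and> indep_mod W B}"

text \<open>The Hilbert function of the quotient of the polynomial ring by \<open>A\<close>.\<close>

definition quot_hilbert :: "nat \<Rightarrow> 'k::field mpoly set \<Rightarrow> nat \<Rightarrow> nat" where
  "quot_hilbert n A d = quot_dim (forms n d) A"

lemma subspace_forms: "mp.subspace (forms n d :: 'k::field mpoly set)"
proof (rule mp.subspaceI)
  show "0 \<in> (forms n d :: 'k mpoly set)" by (simp add: forms_def polyring_def)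
next
  fix x y :: "'k mpoly" assume "x \<in> forms n d" "y \<in> forms n d"
  then show "x + y \<in> forms n d"
    using keys_add[of x y] by (auto simp: forms_def polyring_def)
next
  fix c and x :: "'k mpoly" assume "x \<in> forms n d"
  moreover have "Poly_Mapping.keys (mscale c x) \<subseteq> Poly_Mapping.keys x"
    using keys_mult[of "Poly_Mapping.single 0 c" x] by (auto simp: mscale_def split: if_splits)
  ultimately show "mscale c x \<in> forms n d"
    by (auto simp: forms_def polyring_def)
qed

lemma finite_monoms_deg: "finite {m \<in> monoms n. mdeg m = d}"
proof (rule finite_subset)
  let ?F = "{f :: nat \<Rightarrow> nat. \<forall>i. (i \<in> {1..n} \<longrightarrow> f i \<in> {..d}) \<and> (i \<notin> {1..n} \<longrightarrow> f i = 0)}"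
  have "Poly_Mapping.lookup m i \<le> d" if "mdeg m = d" for m i
  proof (cases "i \<in> Poly_Mapping.keys m")
    case True
    then show ?thesis using that member_le_sum[of i "Poly_Mapping.keys m" "Poly_Mapping.lookup m"]
      by (simp add: mdeg_def)
  qed (simp add: in_keys_iff)
  then have "Poly_Mapping.lookup ` {m \<in> monoms n. mdeg m = d} \<subseteq> ?F"
    by (auto simp: monoms_def in_keys_iff subset_iff)
  moreover have "finite ?F"
    by (rule finite_set_of_finite_funs) auto
  ultimately have "finite (Poly_Mapping.lookup ` {m \<in> monoms n. mdeg m = d})"
    by (rule finite_subset)
  then show "finite {m \<in> monoms n. mdeg m = d}"
    by (rule finite_imageD) (auto simp: inj_on_def intro: poly_mapping_eqI)
qed auto

lemma forms_span:
  "forms n d \<subseteq> mp.span ((\<lambda>m. Poly_Mapping.single m (1::'k::field)) ` {m \<in> monoms n. mdeg m = d})"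
proof
  fix p :: "'k mpoly" assume p: "p \<in> forms n d"
  have "p = (\<Sum>m\<in>Poly_Mapping.keys p. mscale (Poly_Mapping.lookup p m) (Poly_Mapping.single m 1))"
    by (rule poly_mapping_eqI)
       (auto simp: mscale_def mult_single lookup_sum lookup_single when_def in_keys_iff)
  also have "\<dots> \<in> mp.span ((\<lambda>m. Poly_Mapping.single m (1::'k)) ` {m \<in> monoms n. mdeg m = d})"
    using p by (intro mp.span_sum mp.span_scale mp.span_base)
               (auto simp: forms_def polyring_def)
  finally show "p \<in> mp.span ((\<lambda>m. Poly_Mapping.single m (1::'k)) ` {m \<in> monoms n. mdeg m = d})" .
qed

lemma quot_dim_eq:
  fixes U W E :: "'k::field mpoly set"
  assumes W: "mp.subspace W" and U: "mp.subspace U"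
    and E: "finite E" "U \<subseteq> mp.span E"
  shows "quot_dim U W = mp.dim U - mp.dim (W \<inter> U)"
proof -
  have WU: "mp.subspace (W \<inter> U)" using W U by (rule mp.subspace_inter)
  obtain C where C: "C \<subseteq> W \<inter> U" "mp.independent C" "W \<inter> U \<subseteq> mp.span C"
    by (rule mp.maximal_independent_subset)
  have fin: "finite B \<and> card B \<le> mp.dim U" if B: "B \<subseteq> U" "mp.independent B" for B
  proof -
    obtain B' where B': "B \<subseteq> B'" "B' \<subseteq> U" "mp.independent B'" "U \<subseteq> mp.span B'"
      by (rule mp.maximal_independent_subset_extend[OF B])
    have "B' \<subseteq> mp.span E" using B'(2) E(2) by blast
    then have "finite B'" using mp.independent_span_bound[OF E(1) B'(3)] by blast
    then show ?thesis using B' mp.basis_card_eq_dim[of B' U] card_mono finite_subset by metis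
  qed
  have cC: "card C = mp.dim (W \<inter> U)" using C mp.basis_card_eq_dim by blast
  have finC: "finite C" using fin[of C] C by blast
  have CW: "mp.span C = W \<inter> U" using mp.span_minimal[OF C(1) WU] C(3) by (rule subset_antisym)
  have ub: "card B \<le> mp.dim U - mp.dim (W \<inter> U)"
    if B: "finite B" "B \<subseteq> U" "indep_mod W B" for B
  proof -
    have disj: "B \<inter> C = {}"
    proof (rule ccontr)
      assume "B \<inter> C \<noteq> {}"
      then obtain x where x: "x \<in> B" "x \<in> C" by blast
      have "(\<Sum>b\<in>B. mscale (if b = x then 1 else 0) b) = (\<Sum>b\<in>B. if b = x then x else 0)"
        by (intro sum.cong) auto
      also have "\<dots> = x" using B(1) x(1) by simp
      finally have "(\<Sum>b\<in>B. mscale (if b = x then 1 else 0) b) \<in> W" using x(2) C(1) by auto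
      then have "\<forall>b\<in>B. (if b = x then 1 else 0 :: 'k) = 0"
        using B(3)[unfolded indep_mod_def, rule_format, of "\<lambda>b. if b = x then 1 else 0"] by blast
      then show False using x(1) by auto
    qed
    have "mp.independent (B \<union> C)"
    proof (rule mp.independent_if_scalars_zero)
      show "finite (B \<union> C)" using B(1) finC by simp
      fix c x assume s: "(\<Sum>x\<in>B \<union> C. mscale (c x) x) = 0" and x: "x \<in> B \<union> C"
      have s2: "(\<Sum>x\<in>B. mscale (c x) x) + (\<Sum>x\<in>C. mscale (c x) x) = 0"
        using s sum.union_disjoint[OF B(1) finC disj] by metis
      have inC: "- (\<Sum>x\<in>C. mscale (c x) x) \<in> W"
        using C(1) W by (intro mp.subspace_neg mp.subspace_sum mp.subspace_scale) auto
      have "(\<Sum>x\<in>B. mscale (c x) x) \<in> W" using s2 inC by (simp add: eq_neg_iff_add_eq_0[symmetric])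
      then have cB: "\<forall>b\<in>B. c b = 0" using B(3) unfolding indep_mod_def by blast
      then have "(\<Sum>x\<in>C. mscale (c x) x) = 0" using s2 by simp
      then have "\<forall>x\<in>C. c x = 0" using mp.independentD[OF C(2) finC subset_refl] by blast
      then show "c x = 0" using cB x by blast
    qed
    then have "card (B \<union> C) \<le> mp.dim U" using fin[of "B \<union> C"] B(2) C(1) by auto
    then show ?thesis using card_Un_disjoint[OF B(1) finC disj] cC by simp
  qed
  obtain D where D: "C \<subseteq> D" "D \<subseteq> U" "mp.independent D" "U \<subseteq> mp.span D"
    by (rule mp.maximal_independent_subset_extend[of C U]) (use C in auto)
  have finD: "finite D" using fin[of D] D by blast
  have im: "indep_mod W (D - C)" unfolding indep_mod_def
  proof (intro allI impI ballI)
    fix c b assume s: "(\<Sum>b\<in>D - C. mscale (c b) b) \<in> W" and b: "b \<in> D - C"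
    have "(\<Sum>b\<in>D - C. mscale (c b) b) \<in> U"
      using D(2) U by (intro mp.subspace_sum mp.subspace_scale) auto
    then have "(\<Sum>b\<in>D - C. mscale (c b) b) \<in> mp.span C" using s CW by blast
    then obtain u where u: "(\<Sum>b\<in>D - C. mscale (c b) b) = (\<Sum>x\<in>C. mscale (u x) x)"
      using mp.span_finite[OF finC] by (metis (no_types, lifting) imageE)
    let ?w = "\<lambda>x. if x \<in> C then - u x else c x"
    have "(\<Sum>x\<in>D. mscale (?w x) x) = (\<Sum>x\<in>D - C. mscale (?w x) x) + (\<Sum>x\<in>C. mscale (?w x) x)"
      using sum.subset_diff[OF D(1) finD] .
    also have "(\<Sum>x\<in>D - C. mscale (?w x) x) = (\<Sum>x\<in>D - C. mscale (c x) x)"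
      by (intro sum.cong) auto
    also have "(\<Sum>x\<in>C. mscale (?w x) x) = - (\<Sum>x\<in>C. mscale (u x) x)"
      by (simp add: sum_negf)
    finally have "(\<Sum>x\<in>D. mscale (?w x) x) = 0" using u by simp
    then have "?w b = 0" using b by (intro mp.independentD[OF D(3) finD subset_refl]) auto
    then show "c b = 0" using b by simp
  qed
  have cD: "card (D - C) = mp.dim U - mp.dim (W \<inter> U)"
    using card_Diff_subset[OF finC D(1)] cC D mp.basis_card_eq_dim[of D U] by simp
  show ?thesis unfolding quot_dim_def
  proof (rule Max_eqI)
    show "finite {card B |B. finite B \<and> B \<subseteq> U \<and> indep_mod W B}"
      by (rule finite_subset[of _ "{..mp.dim U - mp.dim (W \<inter> U)}"]) (use ub in auto)
    show "mp.dim U - mp.dim (W \<inter> U) \<in> {card B |B. finite B \<and> B \<subseteq> U \<and> indep_mod W B}"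
      using im cD finD D(2) by (intro CollectI exI[of _ "D - C"]) auto
  qed (use ub in auto)
qed

lemma subspace_ideal:
  assumes "ideal I (polyring n :: 'k::field mpoly ring)"
  shows "mp.subspace I"
proof -
  interpret ideal I "polyring n" by fact
  show ?thesis
  proof (rule mp.subspaceI)
    show "0 \<in> I" using additive_subgroup.zero_closed[OF additive_subgroup_axioms] by (simp add: polyring_def)
    show "x + y \<in> I" if "x \<in> I" "y \<in> I" for x y
      using that additive_subgroup.a_closed[OF additive_subgroup_axioms, of x y] by (simp add: polyring_def)
    show "mscale c x \<in> I" if "x \<in> I" for c x
      using that I_l_closed[of x "Poly_Mapping.single 0 c"]
      by (simp add: polyring_def mscale_def monoms_def)
  qed
qed

lemma quot_hilbert_eq:
  assumes "ideal A (polyring n :: 'k::field mpoly ring)"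
  shows "quot_hilbert n A d =
    mp.dim (forms n d :: 'k mpoly set) - mp.dim (A \<inter> forms n d)"
  unfolding quot_hilbert_def
  by (rule quot_dim_eq[OF subspace_ideal[OF assms] subspace_forms _ forms_span])
     (simp add: finite_monoms_deg)

end

theory Submission
  imports Defs "HOL-Computational_Algebra.Polynomial"
begin

text \<open>
  Fix the type and let \<open>b = \<alpha>(I)\<close> be large. The spaces \<open>W j\<close> of forms of degree \<open>b + j\<close> in \<open>I\<close>,
  \<open>j \<le> t\<close>, have dimension at most a constant that depends on the type and on \<open>n\<close> only
  (\<open>dim_forms_bound\<close>). So these spaces are tiny inside the space of all forms, and the question is
  how they grow under multiplication by the variables, given that they contain the members
  \<open>g 1, \<dots>, g r\<close> of the regular sequence whose degree is at most \<open>b + t\<close>. In these degrees a regular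
  sequence behaves like a basis of a free module, because all syzygies have coefficients of degree at
  least \<open>b\<close> (\<open>regular_seq_free\<close>).

  Choose linear coordinates, by a product of elementary substitutions, that maximize finitely many
  ranks. In characteristic \<open>0\<close> the spaces are then stable to first order under the derivations
  \<open>X k' d/dX k\<close> for \<open>k' < k\<close>, \<open>3 \<le> k\<close> (\<open>generic_coordinates\<close>). Order the monomials by their tail, the
  part in the variables \<open>X 3, \<dots>, X n\<close>. The slice of a form at its leading tail is a polynomial in
  \<open>X 2\<close> after setting \<open>X 1 = 1\<close>, and the derivations move leading slices towards the tail \<open>0\<close>
  (\<open>lslice_stable\<close>). So all leading slices are slices at the tail \<open>0\<close>, that is, restrictions to the
  plane \<open>X 3 = \<dots> = X n = 0\<close>.

  The main point is that \<open>g 1, \<dots>, g r\<close> remain free up to a prescribed degree after restriction to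
  this plane (\<open>generic_plane_free\<close>). Otherwise the combinations of the \<open>g k\<close> with forms of some large
  degree \<open>T\<close> would have their leading slices in a module of rank at most \<open>r - 1\<close>, up to a denominator
  of bounded degree. This leaves about \<open>r - 1\<close> times the number of monomials of degree \<open>T\<close>, whereas
  freeness of the \<open>g k\<close> in \<open>n\<close> variables gives \<open>r\<close> times that number.

  Extend the restrictions of the \<open>g k\<close> by further slices to a maximal free family. Its coordinates,
  together with the tails, assign to each form a leading datum, and the dimension of a space is the
  number of its leading data. For each component \<open>i\<close> of the free module the data of \<open>W j\<close> form a
  strongly stable set \<open>B j i\<close> of monomials in \<open>X 2, \<dots>, X n\<close>; here \<open>B j k\<close> contains all monomials of
  degree at most \<open>j - a k\<close> for \<open>k \<le> r\<close>, and the shadow of \<open>B j i\<close> lies in \<open>B (j + 1) i\<close>. Setting the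
  last variables to \<open>0\<close> restricts these sets (\<open>stable_families_exist\<close>).

  The rest is combinatorics. Subtract the monomials contributed by \<open>g 2, \<dots>, g r\<close>, and replace what
  remains of all components by one initial segment \<open>S j\<close> of the same size. The excess of the family
  over these cones grows at least as fast as the segment (\<open>stable_family_growth\<close>), and its
  restriction to fewer variables is at least as large as that of the segment
  (\<open>stable_family_restriction\<close>). The first fact says that the segments \<open>S j\<close> describe a lex ideal
  \<open>L\<close>. For large \<open>b\<close> the powers of \<open>X 2, \<dots>, X l\<close> are disjoint from \<open>L\<close> in the degrees considered, and
  \<open>J = L + (X 1 ^ (b + a 1), \<dots>, X l ^ (b + a l))\<close> has the Hilbert function of \<open>I\<close> (\<open>dim_J\<close>). The second
  fact compares the sections: for \<open>I\<close> the section by the preimages of \<open>X q, \<dots>, X n\<close> is counted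
  exactly by the restricted family, for \<open>J\<close> the same linear forms leave at most the restricted
  segment and cones (\<open>dim_section_J\<close>), because \<open>L\<close> is stable under the coordinate change.
\<close>

section \<open>Monomials, polynomials and their substitutions\<close>

abbreviation "coef \<equiv> Poly_Mapping.lookup"
abbreviation "supp \<equiv> Poly_Mapping.keys"
abbreviation "unit_at i \<equiv> Poly_Mapping.single i (1::nat)"
abbreviation "xmon m \<equiv> Poly_Mapping.single m 1"

lemma mdeg_superset:
  assumes "finite A" "supp m \<subseteq> A" shows "mdeg m = (\<Sum>i\<in>A. coef m i)"
  unfolding mdeg_def using assms by (intro sum.mono_neutral_left) (auto simp: in_keys_iff)

lemma mdeg_add [simp]: "mdeg (a + b) = mdeg a + mdeg b"
proof -
  let ?A = "supp a \<union> supp b"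
  have "supp (a + b) \<subseteq> ?A" by (rule keys_add)
  then show ?thesis
    by (simp add: mdeg_superset[of ?A] lookup_add sum.distrib)
qed

lemma mdeg_single [simp]: "mdeg (Poly_Mapping.single i k) = k"
  by (simp add: mdeg_def)

lemma mdeg_zero [simp]: "mdeg 0 = 0"
  by (simp add: mdeg_def)

lemma mdeg_eq_0_iff [simp]: "mdeg m = 0 \<longleftrightarrow> m = 0"
  by (auto simp: mdeg_def in_keys_iff intro!: poly_mapping_eqI)

lemma supp_add [simp]: "supp (a + b) = supp a \<union> supp (b :: mono)"
  by (auto simp: in_keys_iff lookup_add)

lemma coef_le_mdeg: "coef m i \<le> mdeg m"
  by (cases "i \<in> supp m") (auto simp: mdeg_def in_keys_iff intro: member_le_sum)

lemma mono_minus_add: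
  assumes "i \<in> supp (m :: mono)" shows "m - unit_at i + unit_at i = m"
  by (rule poly_mapping_eqI) (use assms in \<open>auto simp: lookup_add lookup_minus lookup_single when_def in_keys_iff\<close>)

lemma coef_mscale [simp]: "coef (mscale c p) m = c * coef p m"
proof -
  have "mscale c p = Poly_Mapping.map ((*) c) p" by (simp add: mscale_def mult_map_scale_conv_mult)
  then show ?thesis by (simp add: Poly_Mapping.map.rep_eq when_def)
qed

lemma mscale_mult: "mscale c p * q = mscale c (p * q)" "q * mscale c p = mscale c (q * p)"
  by (simp_all add: mscale_def mult.assoc mult.left_commute)

lemma mscale_single [simp]: "mscale c (Poly_Mapping.single m d) = Poly_Mapping.single m (c * d)"
  by (simp add: mscale_def mult_single)

lemma mpoly_decomp: "p = (\<Sum>m\<in>supp p. Poly_Mapping.single m (coef p m))"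
  by (rule poly_mapping_eqI) (auto simp: lookup_sum lookup_single when_def in_keys_iff)

lemma additive_eq_on_singles:
  fixes f g :: "('a \<Rightarrow>\<^sub>0 'c::comm_monoid_add) \<Rightarrow> 'b::ab_group_add"
  assumes f: "\<And>a b. f (a + b) = f a + f b" and g: "\<And>a b. g (a + b) = g a + g b"
    and s: "\<And>m. m \<in> supp p \<Longrightarrow> f (Poly_Mapping.single m (coef p m)) = g (Poly_Mapping.single m (coef p m))"
  shows "f p = g p"
proof -
  have f0: "f 0 = 0" "g 0 = 0" using f[of 0 0] g[of 0 0] by auto
  have S: "f (sum h A) = (\<Sum>a\<in>A. f (h a))" "g (sum h A) = (\<Sum>a\<in>A. g (h a))"
    if "finite A" for A and h :: "'a \<Rightarrow> ('a \<Rightarrow>\<^sub>0 'c)"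
    using that by (induction A rule: finite_induct) (auto simp: f g f0)
  have d: "p = (\<Sum>m\<in>supp p. Poly_Mapping.single m (coef p m))"
    by (rule poly_mapping_eqI) (auto simp: lookup_sum lookup_single when_def in_keys_iff)
  show ?thesis
    by (subst (1 2) d) (simp add: S s)
qed

subsection \<open>Coordinate projections\<close>

definition restr :: "mono set \<Rightarrow> 'k::field mpoly \<Rightarrow> 'k mpoly" where
  "restr A p = Poly_Mapping.mapp (\<lambda>m c. if m \<in> A then c else 0) p"

lemma coef_restr [simp]: "coef (restr A p) m = (if m \<in> A then coef p m else 0)"
  by (auto simp: restr_def lookup_mapp when_def in_keys_iff)

lemma supp_restr: "supp (restr A p) = supp p \<inter> A"
  by (auto simp: in_keys_iff split: if_splits)

lemma linear_restr: "Vector_Spaces.linear mscale mscale (restr A)"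
  by (rule Vector_Spaces.linear_iff[THEN iffD2])
     (auto intro!: conjI mp.vector_space_axioms poly_mapping_eqI simp: lookup_add)

lemma restr_add: "restr A (p + q) = restr A p + restr A q"
  by (rule poly_mapping_eqI) (simp add: lookup_add)

lemma restr_mscale: "restr A (mscale c p) = mscale c (restr A p)"
  by (rule poly_mapping_eqI) simp

lemma restr_0 [simp]: "restr A 0 = 0"
  by (rule poly_mapping_eqI) simp

lemma restr_single: "restr A (Poly_Mapping.single m c) = (if m \<in> A then Poly_Mapping.single m c else 0)"
  by (rule poly_mapping_eqI) (auto simp: lookup_single when_def)

lemma restr_id: "supp p \<subseteq> A \<Longrightarrow> restr A p = p"
  by (rule poly_mapping_eqI) (auto simp: in_keys_iff)

lemma restr_eq_0_iff: "restr A p = 0 \<longleftrightarrow> supp p \<inter> A = {}"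
  by (metis keys_eq_empty supp_restr keys_zero poly_mapping_eqI in_keys_iff empty_iff lookup_zero)

subsection \<open>Substitution homomorphisms\<close>

definition mono_val :: "(nat \<Rightarrow> 'a::comm_monoid_mult) \<Rightarrow> mono \<Rightarrow> 'a" where
  "mono_val f m = (\<Prod>i\<in>supp m. f i ^ coef m i)"

lemma mono_val_superset:
  assumes "finite A" "supp m \<subseteq> A" shows "mono_val f m = (\<Prod>i\<in>A. f i ^ coef m i)"
  unfolding mono_val_def using assms by (intro prod.mono_neutral_left) (auto simp: in_keys_iff)

lemma mono_val_add: "mono_val f (a + b) = mono_val f a * mono_val f b"
proof -
  let ?A = "supp a \<union> supp b"
  show ?thesis
    by (simp add: mono_val_superset[of ?A] lookup_add power_add prod.distrib)
qed

lemma mono_val_0 [simp]: "mono_val f 0 = 1"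
  by (simp add: mono_val_def)

lemma mono_val_single [simp]: "mono_val f (Poly_Mapping.single i k) = f i ^ k"
  by (cases "k = 0") (auto simp: mono_val_def)

definition subst :: "(nat \<Rightarrow> 'k::field mpoly) \<Rightarrow> 'k mpoly \<Rightarrow> 'k mpoly" where
  "subst f p = (\<Sum>m\<in>supp p. mscale (coef p m) (mono_val f m))"

lemma subst_single [simp]: "subst f (Poly_Mapping.single m c) = mscale c (mono_val f m)"
  by (cases "c = 0") (auto simp: subst_def)

lemma subst_add: "subst f (p + q) = subst f p + subst f q"
  unfolding subst_def
  by (rule setsum_keys_plus_distrib) (auto simp: mp.scale_left_distrib)

lemma subst_0 [simp]: "subst f 0 = 0"
  by (simp add: subst_def)

lemma subst_X [simp]: "subst f (X i) = f i"
  by (simp add: X_def)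

lemma subst_mult: "subst f (p * q) = subst f p * subst f q"
proof (rule additive_eq_on_singles[of "\<lambda>p. subst f (p * q)" "\<lambda>p. subst f p * subst f q"])
  fix m
  let ?s = "Poly_Mapping.single m (coef p m)"
  show "subst f (?s * q) = subst f ?s * subst f q"
    by (rule additive_eq_on_singles[of "\<lambda>q. subst f (?s * q)" "\<lambda>q. subst f ?s * subst f q"])
       (auto simp: distrib_left subst_add mult_single mono_val_add mscale_mult)
qed (auto simp: distrib_right subst_add)

lemma subst_mscale: "subst f (mscale c p) = mscale c (subst f p)"
  by (simp add: mscale_def subst_mult)

lemma subst_1 [simp]: "subst f 1 = 1"
  using subst_single[of f 0 1] by (simp del: subst_single add: mscale_def)

lemma subst_power: "subst f (p ^ k) = subst f p ^ k"
  by (induction k) (auto simp: subst_mult)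

lemma subst_sum: "subst f (sum h A) = (\<Sum>a\<in>A. subst f (h a))"
  by (induction A rule: infinite_finite_induct) (auto simp: subst_add)

lemma linear_subst: "Vector_Spaces.linear mscale mscale (subst f)"
  by (rule Vector_Spaces.linear_iff[THEN iffD2])
     (auto intro!: conjI mp.vector_space_axioms simp: subst_add subst_mscale)

lemma X_power: "(X i :: 'k::field mpoly) ^ k = xmon (Poly_Mapping.single i k)"
  by (induction k) (auto simp: X_def mult_single simp flip: single_add)

lemma mono_val_X: "mono_val X m = (xmon m :: 'k::field mpoly)"
proof -
  have "(\<Prod>i\<in>A. X i ^ coef m i) = (xmon (\<Sum>i\<in>A. Poly_Mapping.single i (coef m i)) :: 'k mpoly)"
    if "finite A" for A
    using that by (induction A rule: finite_induct) (auto simp: X_power mult_single)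
  moreover have "(\<Sum>i\<in>supp m. Poly_Mapping.single i (coef m i)) = m"
    using mpoly_decomp[of m] by simp
  ultimately show ?thesis by (simp add: mono_val_def)
qed

lemma subst_comp: "subst f (subst g p) = subst (\<lambda>i. subst f (g i)) p"
proof (rule additive_eq_on_singles[of "\<lambda>p. subst f (subst g p)" "subst (\<lambda>i. subst f (g i))"])
  fix m
  have "subst f (prod h A) = (\<Prod>a\<in>A. subst f (h a))" if "finite A" for A h
    using that by (induction A rule: finite_induct) (auto simp: subst_mult)
  from this[of "supp m" "\<lambda>i. g i ^ coef m i"] show "subst f (subst g (Poly_Mapping.single m (coef p m))) =
      subst (\<lambda>i. subst f (g i)) (Poly_Mapping.single m (coef p m))"
    by (simp add: subst_mscale mono_val_def subst_power)
qed (auto simp: subst_add)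

lemma subst_id [simp]: "subst X p = p"
  by (rule additive_eq_on_singles[of "subst X" "\<lambda>p. p"]) (auto simp: subst_add mono_val_X)

subsection \<open>Dimensions of finite-dimensional spaces\<close>

lemma independent_card_le:
  assumes "finite E" "S \<subseteq> mp.span E" "mp.independent B" "B \<subseteq> S"
  shows "finite B \<and> card B \<le> mp.dim S"
proof -
  obtain C where C: "B \<subseteq> C" "C \<subseteq> S" "mp.independent C" "S \<subseteq> mp.span C"
    by (rule mp.maximal_independent_subset_extend[OF assms(4,3)])
  have "finite C" using mp.independent_span_bound[OF assms(1) C(3)] C(2) assms(2) by blast
  then show ?thesis using C mp.basis_card_eq_dim[OF C(2,4,3)] card_mono finite_subset by metis
qed

lemma dim_mono_fin:
  assumes "finite E" "S \<subseteq> mp.span E" "U \<subseteq> S"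
  shows "mp.dim U \<le> mp.dim S"
proof -
  obtain C where C: "C \<subseteq> U" "mp.independent C" "U \<subseteq> mp.span C" "card C = mp.dim U"
    using mp.basis_exists by blast
  then show ?thesis using independent_card_le[OF assms(1,2) C(2)] assms(3) by auto
qed

definition fam_indep :: "'b set \<Rightarrow> ('b \<Rightarrow> 'k::field mpoly) \<Rightarrow> bool" where
  "fam_indep B w \<longleftrightarrow> (\<forall>c. (\<Sum>b\<in>B. mscale (c b) (w b)) = 0 \<longrightarrow> (\<forall>b\<in>B. c b = 0))"

lemma fam_indep_independent:
  fixes w :: "'b \<Rightarrow> 'k::field mpoly"
  assumes "finite B" "fam_indep B w"
  shows "inj_on w B" "mp.independent (w ` B)"
proof -
  show inj: "inj_on w B"
  proof (rule inj_onI, rule ccontr)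
    fix x y assume xy: "x \<in> B" "y \<in> B" "w x = w y" "x \<noteq> y"
    let ?c = "\<lambda>b. if b = x then 1 else if b = y then - 1 else (0::'k)"
    have "(\<Sum>b\<in>B. mscale (?c b) (w b)) = (\<Sum>b\<in>{x,y}. mscale (?c b) (w b))"
      using assms(1) xy by (intro sum.mono_neutral_right) auto
    also have "\<dots> = 0" using xy by simp
    finally have "\<forall>b\<in>B. ?c b = 0" using assms(2)[unfolded fam_indep_def, rule_format, of ?c] by blast
    then show False using xy by auto
  qed
  show "mp.independent (w ` B)"
  proof (rule mp.independent_if_scalars_zero)
    fix f x assume s: "(\<Sum>x\<in>w ` B. mscale (f x) x) = 0" and x: "x \<in> w ` B"
    have "(\<Sum>b\<in>B. mscale (f (w b)) (w b)) = 0" using s by (simp add: sum.reindex[OF inj])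
    then have "\<forall>b\<in>B. f (w b) = 0"
      using assms(2)[unfolded fam_indep_def, rule_format, of "\<lambda>b. f (w b)"] by blast
    then show "f x = 0" using x by blast
  qed (use assms in simp)
qed

lemma fam_indep_card_le:
  assumes "finite E" "S \<subseteq> mp.span E" "finite B" "fam_indep B w" "w ` B \<subseteq> S"
  shows "card B \<le> mp.dim S"
  using independent_card_le[OF assms(1,2) fam_indep_independent(2)[OF assms(3,4)] assms(5)]
    card_image[OF fam_indep_independent(1)[OF assms(3,4)]] by simp

lemma fam_indep_of_independent:
  assumes "finite B" "mp.independent B" shows "fam_indep B (\<lambda>b. b)"
  unfolding fam_indep_def using mp.independentD[OF assms(2) assms(1) subset_refl] by blast

lemma fam_indep_mon: "finite A \<Longrightarrow> fam_indep A (\<lambda>m. xmon m :: 'k::field mpoly)"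
  unfolding fam_indep_def
proof (intro allI impI ballI)
  fix c :: "mono \<Rightarrow> 'k" and b
  assume A: "finite A" and s: "(\<Sum>b\<in>A. mscale (c b) (xmon b)) = 0" and b: "b \<in> A"
  have "coef (\<Sum>b\<in>A. mscale (c b) (xmon b)) b = c b"
    using b A by (simp add: lookup_sum lookup_single when_def)
  then show "c b = 0" using s by simp
qed

subsection \<open>Dimension as a number of leading values\<close>

lemma finite_total_least:
  assumes "finite F" "F \<noteq> {}"
    and tr: "\<And>x y z. x \<in> F \<Longrightarrow> y \<in> F \<Longrightarrow> z \<in> F \<Longrightarrow> lt x y \<Longrightarrow> lt y z \<Longrightarrow> lt x z"
    and tot: "\<And>x y. x \<in> F \<Longrightarrow> y \<in> F \<Longrightarrow> x \<noteq> y \<Longrightarrow> lt x y \<or> lt y x"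
  shows "\<exists>a\<in>F. \<forall>x\<in>F - {a}. lt a x"
  using assms
proof (induction F rule: finite_ne_induct)
  case (singleton x)
  then show ?case by simp
next
  case (insert x F)
  have "\<exists>a\<in>F. \<forall>x\<in>F - {a}. lt a x"
  proof (rule insert.IH)
    show "lt y z" if "y \<in> F" "w \<in> F" "z \<in> F" "lt y w" "lt w z" for y w z
      using insert.prems(1)[of y w z] that by blast
    show "lt y z \<or> lt z y" if "y \<in> F" "z \<in> F" "y \<noteq> z" for y z
      using insert.prems(2)[of y z] that by blast
  qed
  then obtain a where a: "a \<in> F" "\<forall>x\<in>F - {a}. lt a x" by blast
  show ?case
  proof (cases "lt a x")
    case True
    then show ?thesis using a insert.hyps by (intro bexI[of _ a]) auto
  next
    case False
    then have xa: "lt x a" using insert.prems(2)[of a x] a insert.hyps by auto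
    have "lt x y" if "y \<in> F" for y
    proof (cases "y = a")
      case False
      then have "lt a y" using a that by blast
      then show ?thesis using insert.prems(1)[of x a y] xa a(1) that by blast
    qed (use xa in simp)
    then show ?thesis by (intro bexI[of _ x]) auto
  qed
qed

text \<open>
  Vectors with distinct values are independent, and subtracting multiples of vectors of equal value until
  nothing is left shows that one vector for each value spans.
\<close>

lemma dim_eq_card_val:
  fixes U :: "'k::field mpoly set" and val :: "'k mpoly \<Rightarrow> 'c"
  assumes E: "finite E" "U \<subseteq> mp.span E" and U: "mp.subspace U"
    and V: "V = val ` (U - {0})"
    and irr: "\<And>x. x \<in> V \<Longrightarrow> \<not> lt x x"
    and tr: "\<And>x y z. x \<in> V \<Longrightarrow> y \<in> V \<Longrightarrow> z \<in> V \<Longrightarrow> lt x y \<Longrightarrow> lt y z \<Longrightarrow> lt x z"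
    and tot: "\<And>x y. x \<in> V \<Longrightarrow> y \<in> V \<Longrightarrow> x \<noteq> y \<Longrightarrow> lt x y \<or> lt y x"
    and same: "\<And>v w. v \<in> U - {0} \<Longrightarrow> w \<in> U - {0} \<Longrightarrow> val v = val w \<Longrightarrow>
        \<exists>c. v - mscale c w = 0 \<or> lt (val v) (val (v - mscale c w))"
    and less: "\<And>v w. v \<in> U - {0} \<Longrightarrow> w \<in> U - {0} \<Longrightarrow> lt (val v) (val w) \<Longrightarrow>
        v + w \<noteq> 0 \<and> val (v + w) = val v"
    and scl: "\<And>v c. v \<in> U - {0} \<Longrightarrow> c \<noteq> 0 \<Longrightarrow> val (mscale c v) = val v"
  shows "finite V \<and> mp.dim U = card V"
proof -
  define w where "w g = (SOME v. v \<in> U - {0} \<and> val v = g)" for g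
  have w: "w g \<in> U" "w g \<noteq> 0" "val (w g) = g" if "g \<in> V" for g
  proof -
    have "\<exists>v. v \<in> U - {0} \<and> val v = g" using that V by auto
    then have "w g \<in> U - {0} \<and> val (w g) = g" unfolding w_def by (rule someI_ex)
    then show "w g \<in> U" "w g \<noteq> 0" "val (w g) = g" by auto
  qed
  have lead: "(\<Sum>g\<in>F. mscale (c g) (w g)) \<noteq> 0 \<and> (\<Sum>g\<in>F. mscale (c g) (w g)) \<in> U \<and>
      val (\<Sum>g\<in>F. mscale (c g) (w g)) \<in> F"
    if "finite F" "F \<noteq> {}" "F \<subseteq> V" "\<forall>g\<in>F. c g \<noteq> 0" for F c
    using that
  proof (induction "card F" arbitrary: F)
    case 0
    then show ?case by simp
  next
    case (Suc k)
    have "\<exists>a\<in>F. \<forall>x\<in>F - {a}. lt a x"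
      using Suc.prems(3)
      by (intro finite_total_least[OF Suc.prems(1,2)]) (meson tr subsetD, meson tot subsetD)
    then obtain a where a: "a \<in> F" "\<forall>x\<in>F - {a}. lt a x" by blast
    have ca: "mscale (c a) (w a) \<in> U - {0}" "val (mscale (c a) (w a)) = a"
      using w[of a] a Suc.prems scl[of "w a" "c a"] mp.subspace_scale[OF U] by auto
    let ?r = "\<Sum>g\<in>F - {a}. mscale (c g) (w g)"
    have sum: "(\<Sum>g\<in>F. mscale (c g) (w g)) = mscale (c a) (w a) + ?r"
      using Suc.prems(1) a(1) by (simp add: sum.remove)
    show ?case
    proof (cases "F - {a} = {}")
      case True
      have "?r = 0" by (subst True) simp
      then show ?thesis using sum ca a(1) by simp
    next
      case False
      have IH: "?r \<noteq> 0 \<and> ?r \<in> U \<and> val ?r \<in> F - {a}"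
        using Suc.hyps(2) Suc.prems a(1) False by (intro Suc.hyps(1)) auto
      then have "lt (val (mscale (c a) (w a))) (val ?r)" using a ca by auto
      then have "mscale (c a) (w a) + ?r \<noteq> 0 \<and> val (mscale (c a) (w a) + ?r) = a"
        using less[of "mscale (c a) (w a)" ?r] ca IH by auto
      then show ?thesis using sum IH ca a(1) mp.subspace_add[OF U] by auto
    qed
  qed
  have ind: "fam_indep F w" if "finite F" "F \<subseteq> V" for F
    unfolding fam_indep_def
  proof (intro allI impI)
    fix c assume s: "(\<Sum>b\<in>F. mscale (c b) (w b)) = 0"
    let ?F = "{b\<in>F. c b \<noteq> 0}"
    have "(\<Sum>b\<in>F. mscale (c b) (w b)) = (\<Sum>b\<in>?F. mscale (c b) (w b))"
      using that(1) by (intro sum.mono_neutral_right) auto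
    then have z: "(\<Sum>b\<in>?F. mscale (c b) (w b)) = 0" using s by simp
    have "?F = {}"
    proof (rule ccontr)
      assume ne: "?F \<noteq> {}"
      have "finite ?F" "?F \<subseteq> V" "\<forall>g\<in>?F. c g \<noteq> 0" using that by auto
      then show False using lead[of ?F c, OF _ ne] z by blast
    qed
    then show "\<forall>b\<in>F. c b = 0" by auto
  qed
  have le: "card F \<le> mp.dim U" if "finite F" "F \<subseteq> V" for F
    using fam_indep_card_le[OF E that(1) ind[OF that]] w(1) that(2) by auto
  have fin: "finite V"
    using le finite_if_finite_subsets_card_bdd[of V "mp.dim U"] by blast
  have sp: "v \<in> mp.span (w ` V)" if "v \<in> U" for v
    using that
  proof (induction "card {g\<in>V. lt (val v) g}" arbitrary: v rule: less_induct)
    case less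
    show ?case
    proof (cases "v = 0")
      case False
      then have vV: "val v \<in> V" using less.prems V by auto
      obtain c where c: "v - mscale c (w (val v)) = 0 \<or> lt (val v) (val (v - mscale c (w (val v))))"
        using same[of v "w (val v)"] less.prems False w[OF vV] by auto
      let ?u = "v - mscale c (w (val v))"
      have uU: "?u \<in> U" using less.prems w(1)[OF vV] U by (intro mp.subspace_diff mp.subspace_scale)
      have "?u \<in> mp.span (w ` V)"
      proof (cases "?u = 0")
        case False
        then have lt: "lt (val v) (val ?u)" and uV: "val ?u \<in> V" using c uU V by auto
        have "{g\<in>V. lt (val ?u) g} \<subset> {g\<in>V. lt (val v) g}"
          using tr[OF vV uV _ lt] lt irr uV by blast
        then show ?thesis using fin uU by (intro less.hyps psubset_card_mono) auto
      qed (simp add: mp.span_zero)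
      moreover have "mscale c (w (val v)) \<in> mp.span (w ` V)"
        using vV by (intro mp.span_scale mp.span_base) auto
      ultimately have "?u + mscale c (w (val v)) \<in> mp.span (w ` V)" by (rule mp.span_add)
      then show ?thesis by simp
    qed (simp add: mp.span_zero)
  qed
  have "mp.dim U \<le> card (w ` V)" using sp fin by (intro mp.dim_le_card) auto
  also have "\<dots> \<le> card V" using fin by (rule card_image_le)
  finally show ?thesis using le[OF fin subset_refl] fin by simp
qed

subsection \<open>Forms\<close>

lemma carrier_polyring: "p \<in> carrier (polyring n) \<longleftrightarrow> (\<forall>m\<in>supp p. m \<in> monoms n)"
  by (auto simp: polyring_def)

lemma polyring_ops [simp]:
  "monoid.mult (polyring n) = (*)" "one (polyring n) = 1" "zero (polyring n) = 0" "add (polyring n) = (+)"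
  by (simp_all add: polyring_def)

lemma forms_iff: "p \<in> forms n d \<longleftrightarrow> (\<forall>m\<in>supp p. m \<in> monoms n \<and> mdeg m = d)"
  by (auto simp: forms_def polyring_def)

lemma monoms_add [simp]: "a + b \<in> monoms n \<longleftrightarrow> a \<in> monoms n \<and> b \<in> monoms n"
  by (auto simp: monoms_def)

lemma zero_monoms [simp]: "0 \<in> monoms n"
  by (simp add: monoms_def)

lemma single_monoms [simp]: "Poly_Mapping.single i k \<in> monoms n \<longleftrightarrow> k = 0 \<or> i \<in> {1..n}"
  by (auto simp: monoms_def)

lemma forms_mult: "p \<in> forms n a \<Longrightarrow> q \<in> forms n b \<Longrightarrow> p * q \<in> forms n (a + b)"
  using keys_mult[of p q] unfolding forms_iff by fastforce

lemma forms_add: "p \<in> forms n d \<Longrightarrow> q \<in> forms n d \<Longrightarrow> p + q \<in> forms n d"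
  by (rule mp.subspace_add[OF subspace_forms])

lemma forms_mscale: "p \<in> forms n d \<Longrightarrow> mscale c p \<in> forms n d"
  by (rule mp.subspace_scale[OF subspace_forms])

lemma forms_0 [simp]: "0 \<in> forms n d"
  by (rule mp.subspace_0[OF subspace_forms])

lemma forms_sum: "(\<And>a. a \<in> A \<Longrightarrow> h a \<in> forms n d) \<Longrightarrow> sum h A \<in> forms n d"
  by (rule mp.subspace_sum[OF subspace_forms])

lemma forms_xmon [simp]: "xmon m \<in> forms n d \<longleftrightarrow> m \<in> monoms n \<and> mdeg m = d"
  by (auto simp: forms_iff)

lemma X_forms [simp]: "i \<in> {1..n} \<Longrightarrow> X i \<in> forms n (Suc 0)"
  by (simp add: X_def)

lemma one_forms: "1 \<in> forms n 0"
  using forms_xmon[of 0 n 0] by (simp del: forms_xmon)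

lemma forms_power: "p \<in> forms n a \<Longrightarrow> p ^ k \<in> forms n (k * a)"
  by (induction k) (auto intro: forms_mult one_forms)

lemma forms_prod: "(\<And>i. i \<in> A \<Longrightarrow> p i \<in> forms n (a i)) \<Longrightarrow> (\<Prod>i\<in>A. p i) \<in> forms n (\<Sum>i\<in>A. a i)"
  by (induction A rule: infinite_finite_induct) (auto intro: forms_mult one_forms)

lemma forms_carrier: "p \<in> forms n d \<Longrightarrow> p \<in> carrier (polyring n)"
  by (simp add: forms_def)

lemma forms_restr: "p \<in> forms n d \<Longrightarrow> restr A p \<in> forms n d"
  by (auto simp: forms_iff supp_restr)

lemma carrier_hom_comp: "p \<in> carrier (polyring n) \<Longrightarrow> restr {m. mdeg m = d} p \<in> forms n d"
  by (auto simp: carrier_polyring forms_iff supp_restr)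

lemma forms_hom_comp: "p \<in> forms n d \<Longrightarrow> restr {m. mdeg m = e} p = (if e = d then p else 0)"
  by (auto simp: forms_iff restr_eq_0_iff intro: restr_id)

lemma finite_forms_basis: "finite (xmon ` {m \<in> monoms n. mdeg m = d})"
  by (simp add: finite_monoms_deg)

lemma subspace_carrier: "mp.subspace (carrier (polyring n))"
proof (rule mp.subspaceI)
  show "x + y \<in> carrier (polyring n)" if "x \<in> carrier (polyring n)" "y \<in> carrier (polyring n)" for x y
    using that keys_add[of x y] by (auto simp: carrier_polyring)
  show "mscale c x \<in> carrier (polyring n)" if "x \<in> carrier (polyring n)" for c x
    using that by (auto simp: carrier_polyring in_keys_iff)
qed (simp add: carrier_polyring)

lemma carrier_mult: "p \<in> carrier (polyring n) \<Longrightarrow> q \<in> carrier (polyring n) \<Longrightarrow> p * q \<in> carrier (polyring n)"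
  using keys_mult[of p q] unfolding carrier_polyring by fastforce

lemma genideal_span:
  fixes G :: "'k::field mpoly set"
  assumes G: "G \<subseteq> carrier (polyring n)"
  shows "genideal (polyring n) G = mp.span {xmon m * g | m g. m \<in> monoms n \<and> g \<in> G}"
    (is "_ = mp.span ?M")
proof (rule subset_antisym)
  interpret R: cring "polyring n :: 'k mpoly ring" by (rule cring_polyring)
  have MC: "?M \<subseteq> carrier (polyring n)"
    using G by (auto intro!: carrier_mult) (auto simp: carrier_polyring)
  have SC: "mp.span ?M \<subseteq> carrier (polyring n)"
    using mp.span_minimal[OF MC subspace_carrier] .
  have mul: "x * a \<in> mp.span ?M" if a: "a \<in> mp.span ?M" and x: "x \<in> carrier (polyring n)" for a x
  proof -
    have mm: "xmon m * a \<in> mp.span ?M" if m: "m \<in> monoms n" for m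
      using a
    proof (induction rule: mp.span_induct_alt)
      case (step c y z)
      then obtain m' g where y: "y = xmon m' * g" "m' \<in> monoms n" "g \<in> G" by blast
      have "xmon m * y = xmon (m + m') * g" unfolding y(1) mult.assoc[symmetric] mult_single by simp
      then have "xmon m * y \<in> ?M" using y m by (intro CollectI exI[of _ "m + m'"] exI[of _ g]) simp
      then have "mscale c (xmon m * y) + xmon m * z \<in> mp.span ?M"
        using step by (intro mp.span_add mp.span_scale[OF mp.span_base])
      then show ?case by (simp only: distrib_left mscale_mult)
    qed (simp add: mp.span_zero)
    have sc: "Poly_Mapping.single m c * a = mscale c (xmon m * a)" for m c
      using mscale_mult(1)[of c "xmon m" a] by simp
    have "x * a = (\<Sum>m\<in>supp x. Poly_Mapping.single m (coef x m)) * a"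
      by (rule arg_cong[OF mpoly_decomp[of x], of "\<lambda>y. y * a"])
    also have "\<dots> = (\<Sum>m\<in>supp x. mscale (coef x m) (xmon m * a))"
      unfolding sum_distrib_right by (rule sum.cong[OF refl sc])
    also have "\<dots> \<in> mp.span ?M"
      using mm x by (intro mp.span_sum mp.span_scale) (auto simp: carrier_polyring)
    finally show ?thesis .
  qed
  have id: "ideal (mp.span ?M) (polyring n)"
  proof (rule idealI)
    show "subgroup (mp.span ?M) (add_monoid (polyring n))"
    proof (rule R.add.subgroupI)
      show "mp.span ?M \<noteq> {}" using mp.span_zero by blast
      fix a assume a: "a \<in> mp.span ?M"
      then have "a \<in> carrier (polyring n)" using SC by blast
      moreover have "- a \<in> mp.span ?M" using a by (rule mp.span_neg)
      moreover have "- a \<in> carrier (polyring n)" using calculation SC by blast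
      ultimately have "\<ominus>\<^bsub>polyring n\<^esub> a = - a"
        using R.minus_equality[of "- a" a] by simp
      then show "\<ominus>\<^bsub>polyring n\<^esub> a \<in> mp.span ?M" using \<open>- a \<in> mp.span ?M\<close> by simp
    qed (use SC mp.span_add in auto)
  qed (use mul R.ring_axioms in \<open>auto simp: mult.commute\<close>)
  show "genideal (polyring n) G \<subseteq> mp.span ?M"
  proof (rule R.genideal_minimal[OF id])
    show "G \<subseteq> mp.span ?M"
    proof
      fix g assume "g \<in> G"
      then have "xmon 0 * g \<in> ?M" by (metis (mono_tags, lifting) mem_Collect_eq zero_monoms)
      then have "g \<in> ?M" by simp
      then show "g \<in> mp.span ?M" by (rule mp.span_base)
    qed
  qed
  have gi: "ideal (genideal (polyring n) G) (polyring n)" using G by (rule R.genideal_ideal)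
  show "mp.span ?M \<subseteq> genideal (polyring n) G"
  proof (rule mp.span_minimal[OF _ subspace_ideal[OF gi]], safe)
    fix m g assume m: "m \<in> monoms n" and g: "g \<in> G"
    have "g \<in> genideal (polyring n) G" using R.genideal_self[OF G] g by blast
    moreover have "xmon m \<in> carrier (polyring n)" using m by (simp add: carrier_polyring)
    ultimately show "xmon m * g \<in> genideal (polyring n) G" using ideal.I_l_closed[OF gi] by simp
  qed
qed

lemma span_image_linear:
  assumes "Vector_Spaces.linear mscale mscale f" shows "f ` mp.span S = mp.span (f ` S)"
proof -
  interpret Vector_Spaces.linear mscale mscale f by fact
  show ?thesis by (rule span_image[symmetric])
qed

lemma subspace_linear_image:
  assumes "Vector_Spaces.linear mscale mscale f" "mp.subspace S" shows "mp.subspace (f ` S)"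
proof -
  interpret Vector_Spaces.linear mscale mscale f by fact
  show ?thesis using assms(2) by (rule subspace_image)
qed

text \<open>
  In a representation of a form by homogeneous generators only the terms of the right degree matter.
\<close>

lemma genideal_forms:
  fixes G :: "'k::field mpoly set"
  assumes G: "\<And>g. g \<in> G \<Longrightarrow> g \<in> forms n (dg g)" and v: "v \<in> genideal (polyring n) G" "v \<in> forms n d"
  shows "v \<in> mp.span {xmon m * g | m g. m \<in> monoms n \<and> g \<in> G \<and> mdeg m + dg g = d}"
proof -
  let ?M = "{xmon m * g | m g. m \<in> monoms n \<and> g \<in> G}"
  let ?M' = "{xmon m * g | m g. m \<in> monoms n \<and> g \<in> G \<and> mdeg m + dg g = d}"
  have "v \<in> mp.span ?M" using genideal_span[of G n] G v(1) forms_carrier by blast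
  then have "restr {m. mdeg m = d} v \<in> mp.span (restr {m. mdeg m = d} ` ?M)"
    using span_image_linear[OF linear_restr] by blast
  moreover have "restr {m. mdeg m = d} ` ?M \<subseteq> mp.span ?M'"
  proof safe
    fix m g assume mg: "m \<in> monoms n" "g \<in> G"
    then have "xmon m * g \<in> forms n (mdeg m + dg g)" using G by (intro forms_mult) auto
    then have r: "restr {m. mdeg m = d} (xmon m * g) = (if d = mdeg m + dg g then xmon m * g else 0)"
      by (rule forms_hom_comp)
    show "restr {m. mdeg m = d} (xmon m * g) \<in> mp.span ?M'"
    proof (cases "d = mdeg m + dg g")
      case True
      then have "xmon m * g \<in> ?M'" using mg by blast
      moreover have "restr {m. mdeg m = d} (xmon m * g) = xmon m * g" by (subst r) (simp add: True)
      ultimately show ?thesis by (simp only: mp.span_base)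
    qed (simp add: r mp.span_zero)
  qed
  ultimately have "restr {m. mdeg m = d} v \<in> mp.span ?M'"
    using mp.span_minimal[OF _ mp.subspace_span] by blast
  then show ?thesis using forms_hom_comp[OF v(2), of d] by simp
qed

lemma dim_monomial_space:
  fixes A :: "mono set"
  assumes A: "finite A"
  shows "mp.dim {p :: 'k::field mpoly. supp p \<subseteq> A} = card A"
proof -
  let ?S = "{p :: 'k mpoly. supp p \<subseteq> A}"
  have sp: "?S \<subseteq> mp.span (xmon ` A)"
  proof
    fix p :: "'k mpoly" assume p: "p \<in> ?S"
    have "p = (\<Sum>m\<in>supp p. mscale (coef p m) (xmon m))" by (subst mpoly_decomp[of p]) simp
    also have "\<dots> \<in> mp.span (xmon ` A)" using p by (intro mp.span_sum mp.span_scale mp.span_base) auto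
    finally show "p \<in> mp.span (xmon ` A)" .
  qed
  have "mp.dim ?S \<le> card (xmon ` A :: 'k mpoly set)" using sp A by (intro mp.dim_le_card) auto
  also have "\<dots> \<le> card A" using A by (rule card_image_le)
  finally show ?thesis
    using fam_indep_card_le[OF _ sp A fam_indep_mon[OF A]] A by fastforce
qed

section \<open>Lexicographic segments and strongly stable sets\<close>

definition ymonos :: "nat \<Rightarrow> mono set" where
  "ymonos p = {u. supp u \<subseteq> {2..p}}"

text \<open>
  Setting \<open>X 1 = 1\<close> turns the lex order on the monomials of one degree into this order on monomials
  in the remaining variables: a large power of \<open>X 1\<close> becomes a small degree.
\<close>

definition prec :: "mono \<Rightarrow> mono \<Rightarrow> bool" where
  "prec u v \<longleftrightarrow> mdeg u < mdeg v \<or> (mdeg u = mdeg v \<and> lex_greater u v)"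

lemma lex_greater_irrefl: "\<not> lex_greater u u"
  by (auto simp: lex_greater_def)

lemma lex_greater_trans: "lex_greater u v \<Longrightarrow> lex_greater v w \<Longrightarrow> lex_greater u w"
proof -
  assume "lex_greater u v" "lex_greater v w"
  then obtain i j where i: "coef u i > coef v i" "\<forall>k<i. coef u k = coef v k"
    and j: "coef v j > coef w j" "\<forall>k<j. coef v k = coef w k"
    unfolding lex_greater_def by blast
  show ?thesis unfolding lex_greater_def
  proof (intro exI[of _ "min i j"] conjI allI impI)
    show "coef u (min i j) > coef w (min i j)"
      using i j by (cases i j rule: linorder_cases) (auto simp: min_def)
  qed (use i j in auto)
qed

lemma lex_greater_total: "u \<noteq> v \<Longrightarrow> lex_greater u v \<or> lex_greater v u"
proof -
  assume "u \<noteq> v"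
  then obtain i0 where i0: "coef u i0 \<noteq> coef v i0" by (meson poly_mapping_eqI)
  define i where "i = (LEAST i. coef u i \<noteq> coef v i)"
  have i: "coef u i \<noteq> coef v i" unfolding i_def using i0 by (rule LeastI)
  have eq: "\<forall>k<i. coef u k = coef v k" unfolding i_def using not_less_Least by blast
  from i consider "coef u i > coef v i" | "coef v i > coef u i" by linarith
  then show ?thesis
  proof cases
    case 1
    then show ?thesis unfolding lex_greater_def using eq by blast
  next
    case 2
    have "\<forall>k<i. coef v k = coef u k" using eq by simp
    then show ?thesis unfolding lex_greater_def using 2 by blast
  qed
qed

lemma prec_irrefl [simp]: "\<not> prec u u"
  by (simp add: prec_def lex_greater_irrefl)

lemma prec_trans: "prec u v \<Longrightarrow> prec v w \<Longrightarrow> prec u w"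
  unfolding prec_def using lex_greater_trans by auto

lemma prec_total: "u \<noteq> v \<Longrightarrow> prec u v \<or> prec v u"
  unfolding prec_def using lex_greater_total by (metis linorder_neqE_nat)

lemma ymonos_monoms: "ymonos p \<subseteq> monoms p"
  by (auto simp: ymonos_def monoms_def)

lemma ymonos_mono: "p \<le> q \<Longrightarrow> ymonos p \<subseteq> ymonos q"
  by (fastforce simp: ymonos_def)

lemma ymonos_add [simp]: "u + v \<in> ymonos p \<longleftrightarrow> u \<in> ymonos p \<and> v \<in> ymonos p"
  by (auto simp: ymonos_def)

lemma single_ymonos [simp]: "Poly_Mapping.single k c \<in> ymonos p \<longleftrightarrow> c = 0 \<or> k \<in> {2..p}"
  by (auto simp: ymonos_def)

lemma zero_ymonos [simp]: "0 \<in> ymonos p"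
  by (simp add: ymonos_def)

lemma ymonos_1: "ymonos (Suc 0) = {0}"
  by (auto simp: ymonos_def)

lemma finite_ymonos_less: "finite {u \<in> ymonos p. mdeg u < d}"
proof -
  have "{u \<in> ymonos p. mdeg u < d} \<subseteq> (\<Union>e<d. {m \<in> monoms p. mdeg m = e})"
    using ymonos_monoms by auto
  then show ?thesis using finite_subset finite_monoms_deg by blast
qed

definition iseg :: "nat \<Rightarrow> mono set \<Rightarrow> bool" where
  "iseg p S \<longleftrightarrow> finite S \<and> S \<subseteq> ymonos p \<and> (\<forall>v\<in>S. \<forall>u\<in>ymonos p. prec u v \<longrightarrow> u \<in> S)"

lemma iseg_linear: "iseg p S \<Longrightarrow> iseg p T \<Longrightarrow> S \<subseteq> T \<or> T \<subseteq> S"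
proof (rule ccontr)
  assume S: "iseg p S" and T: "iseg p T" and n: "\<not> (S \<subseteq> T \<or> T \<subseteq> S)"
  then obtain u v where u: "u \<in> S" "u \<notin> T" and v: "v \<in> T" "v \<notin> S" by blast
  have "u \<noteq> v" using u v by blast
  moreover have "\<not> prec u v" "\<not> prec v u" using u v S T unfolding iseg_def by blast+
  ultimately show False using prec_total by blast
qed

lemma iseg_card_mono: "iseg p S \<Longrightarrow> iseg p T \<Longrightarrow> card S \<le> card T \<Longrightarrow> S \<subseteq> T"
  using iseg_linear[of p S T] by (metis card_seteq iseg_def subset_refl)

lemma infinite_ymonos: "2 \<le> p \<Longrightarrow> infinite (ymonos p)"
proof
  assume p: "2 \<le> p" and f: "finite (ymonos p)"
  have "range (\<lambda>k. Poly_Mapping.single 2 k) \<subseteq> ymonos p" using p by auto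
  then have "finite (range (\<lambda>k. Poly_Mapping.single (2::nat) (k::nat)))" using f finite_subset by blast
  moreover have "inj (\<lambda>k. Poly_Mapping.single (2::nat) (k::nat))"
    by (rule injI) (metis lookup_single_eq)
  ultimately show False using finite_imageD by blast
qed

lemma iseg_exists: "2 \<le> p \<Longrightarrow> \<exists>S. iseg p S \<and> card S = m"
proof (induction m)
  case 0
  then show ?case by (intro exI[of _ "{}"]) (simp add: iseg_def)
next
  case (Suc m)
  then obtain S where S: "iseg p S" "card S = m" by blast
  have "infinite (ymonos p - S)"
    using infinite_ymonos[OF Suc.prems] S by (simp add: iseg_def)
  then obtain w where w: "w \<in> ymonos p - S" by (metis ex_in_conv finite.emptyI)
  let ?F = "{u \<in> ymonos p - S. u = w \<or> prec u w}"
  have "?F \<subseteq> {u \<in> ymonos p. mdeg u < Suc (mdeg w)}" by (auto simp: prec_def)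
  then have "finite ?F" using finite_ymonos_less finite_subset by blast
  then have "\<exists>a\<in>?F. \<forall>x\<in>?F - {a}. prec a x"
    using w by (intro finite_total_least prec_total) (auto intro: prec_trans)
  then obtain a where a: "a \<in> ?F" "\<forall>x\<in>?F - {a}. prec a x" by blast
  have "iseg p (insert a S)" unfolding iseg_def
  proof (intro conjI ballI impI)
    fix v u assume v: "v \<in> insert a S" and u: "u \<in> ymonos p" "prec u v"
    show "u \<in> insert a S"
    proof (cases "v = a")
      case True
      show ?thesis
      proof (rule ccontr)
        assume n: "u \<notin> insert a S"
        then have "u \<in> ?F - {a}" using u True a(1) prec_trans by blast
        then have "prec a u" using a(2) by blast
        then show False using u(2) True prec_trans prec_irrefl by blast
      qed
    qed (use S v u in \<open>auto simp: iseg_def\<close>)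
  next
    show "finite (insert a S)" "insert a S \<subseteq> ymonos p" using S a(1) by (auto simp: iseg_def)
  qed
  moreover have "card (insert a S) = Suc m" using S a(1) by (auto simp: iseg_def)
  ultimately show ?case by blast
qed

text \<open>
  A set contains itself in its shadow because multiplication by \<open>X 1\<close> is invisible after setting
  \<open>X 1 = 1\<close>.
\<close>

definition shadow :: "nat \<Rightarrow> mono set \<Rightarrow> mono set" where
  "shadow p S = S \<union> {u + unit_at k | u k. u \<in> S \<and> k \<in> {2..p}}"

lemma shadow_mono: "S \<subseteq> T \<Longrightarrow> shadow p S \<subseteq> shadow p T"
  by (auto simp: shadow_def)

lemma shadow_empty [simp]: "shadow p {} = {}"
  by (simp add: shadow_def)

lemma finite_shadow: "finite S \<Longrightarrow> finite (shadow p S)"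
proof -
  assume "finite S"
  moreover have "{u + unit_at k | u k. u \<in> S \<and> k \<in> {2..p}} = (\<lambda>(u,k). u + unit_at k) ` (S \<times> {2..p})"
    by (auto simp: image_iff) blast
  ultimately show ?thesis by (simp add: shadow_def)
qed

lemma shadow_ymonos: "S \<subseteq> ymonos p \<Longrightarrow> shadow p S \<subseteq> ymonos p"
  by (fastforce simp: shadow_def)

text \<open>
  The Borel condition for the exponents \<open>2, \<dots>, p\<close>, together with the exchange of a variable for the
  invisible \<open>X 1\<close>, which makes the set closed under divisors.
\<close>

definition sstable :: "nat \<Rightarrow> mono set \<Rightarrow> bool" where
  "sstable p B \<longleftrightarrow> finite B \<and> B \<subseteq> ymonos p \<and>
     (\<forall>u k. u + unit_at k \<in> B \<longrightarrow> u \<in> B \<and> (\<forall>k'\<in>{2..<k}. u + unit_at k' \<in> B))"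

lemma lex_greater_units: "k' < k \<Longrightarrow> lex_greater (u + unit_at k') (u + unit_at k)"
  unfolding lex_greater_def
  by (rule exI[of _ k']) (auto simp: lookup_add lookup_single when_def)

lemma iseg_sstable: "iseg p S \<Longrightarrow> sstable p S"
  unfolding sstable_def
proof (intro conjI allI impI ballI)
  fix u k assume S: "iseg p S" and u: "u + unit_at k \<in> S"
  then have m: "u + unit_at k \<in> ymonos p" by (auto simp: iseg_def)
  have "u \<in> ymonos p" "prec u (u + unit_at k)" using m by (simp_all add: prec_def)
  then show "u \<in> S" using S u unfolding iseg_def by blast
  fix k' assume k': "k' \<in> {2..<k}"
  then have "u + unit_at k' \<in> ymonos p" "prec (u + unit_at k') (u + unit_at k)"
    using m lex_greater_units by (auto simp: prec_def)
  then show "u + unit_at k' \<in> S" using S u unfolding iseg_def by blast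
qed (auto simp: iseg_def)

lemma Max_supp: "v \<noteq> 0 \<Longrightarrow> Max (supp v) \<in> supp v"
  by (intro Max_in) auto

lemma Max_supp_add_unit: "u \<in> ymonos p' \<Longrightarrow> 2 \<le> p' \<Longrightarrow> Max (supp (u + unit_at p')) = p'"
  by (intro Max_eqI) (auto simp: ymonos_def)

lemma sstable_0: "sstable p B \<Longrightarrow> B \<noteq> {} \<Longrightarrow> 0 \<in> B"
proof -
  assume B: "sstable p B" "B \<noteq> {}"
  have "v \<in> B \<Longrightarrow> 0 \<in> B" for v
  proof (induction "mdeg v" arbitrary: v)
    case (Suc d)
    then have "v \<noteq> 0" by auto
    then have e: "v - unit_at (Max (supp v)) + unit_at (Max (supp v)) = v"
      using Max_supp mono_minus_add by blast
    then have "v - unit_at (Max (supp v)) \<in> B" using Suc.prems B(1) unfolding sstable_def by metis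
    moreover have "mdeg v = Suc (mdeg (v - unit_at (Max (supp v))))"
      using arg_cong[OF e, of mdeg] by simp
    ultimately show ?case using Suc.hyps by simp
  qed auto
  then show ?thesis using B(2) by blast
qed

text \<open>
  An element of the shadow of a strongly stable set arises in exactly one way as the product of an
  element of the set with a variable that is at least its largest variable.
\<close>

lemma card_shadow_sstable:
  assumes B: "sstable p B" and p: "1 \<le> p"
  shows "card (shadow p B) = (\<Sum>p'=1..p. card (B \<inter> ymonos p'))"
proof -
  let ?f = "\<lambda>(p', u). if p' = 1 then 0 else u + unit_at p'"
  let ?D = "SIGMA p':{1..p}. B \<inter> ymonos p'"
  have fin: "finite B" using B by (simp add: sstable_def)
  have inj: "inj_on ?f ?D"
  proof (rule inj_onI)
    fix x y assume xy: "x \<in> ?D" "y \<in> ?D" "?f x = ?f y"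
    obtain a u b w where ab: "x = (a, u)" "y = (b, w)" by fastforce
    have h: "(if a = 1 then 0 else u + unit_at a) = (if b = 1 then 0 else w + unit_at b)"
      and d: "1 \<le> a" "u \<in> ymonos a" "1 \<le> b" "w \<in> ymonos b"
      using xy ab by auto
    have nz: "x + unit_at y \<noteq> 0" for x :: mono and y
      by (metis mdeg_add mdeg_single mdeg_zero add_is_0 one_neq_zero)
    have "a = b \<and> u = w"
    proof (cases "a = 1 \<or> b = 1")
      case True
      then show ?thesis using h d nz[of u a] nz[of w b] by (auto simp: ymonos_1 split: if_splits)
    next
      case False
      then have e: "u + unit_at a = w + unit_at b" using h by simp
      have "a = b" using Max_supp_add_unit[of u a] Max_supp_add_unit[of w b] e d False by fastforce
      then show ?thesis using e by simp
    qed
    then show "x = y" using ab by simp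
  qed
  have im: "?f ` ?D = shadow p B"
  proof (intro subset_antisym subsetI)
    fix v assume "v \<in> ?f ` ?D"
    then obtain a u where a: "a \<in> {1..p}" "u \<in> B" "u \<in> ymonos a" "v = ?f (a, u)" by auto
    then show "v \<in> shadow p B" using sstable_0[OF B] by (auto simp: shadow_def)
  next
    fix v assume v: "v \<in> shadow p B"
    show "v \<in> ?f ` ?D"
    proof (cases "v = 0")
      case True
      have "B \<noteq> {}" using v by (auto simp: shadow_def)
      then have "(1, 0) \<in> ?D" using sstable_0[OF B] p by (simp add: ymonos_def)
      then show ?thesis using True by (intro image_eqI[of _ _ "(1, 0)"]) auto
    next
      case False
      let ?k = "Max (supp v)"
      have vp: "v \<in> ymonos p" using v shadow_ymonos B unfolding sstable_def by blast
      have k: "?k \<in> supp v" using Max_supp[OF False] .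
      then have kp: "?k \<in> {2..p}" using vp by (auto simp: ymonos_def)
      have e: "v - unit_at ?k + unit_at ?k = v" using mono_minus_add[OF k] .
      have y: "v - unit_at ?k \<in> ymonos ?k"
      proof -
        have "v \<in> ymonos ?k" using vp by (auto simp: ymonos_def)
        then show ?thesis using e by (metis ymonos_add)
      qed
      have "v - unit_at ?k \<in> B"
      proof (cases "v \<in> B")
        case True
        then show ?thesis using B e unfolding sstable_def by metis
      next
        case False
        then obtain u k' where u: "u \<in> B" "k' \<in> {2..p}" "v = u + unit_at k'"
          using v by (auto simp: shadow_def)
        show ?thesis
        proof (cases "k' = ?k")
          case True
          then show ?thesis using u e by (metis add_right_cancel)
        next
          case False
          then have "k' < ?k" using u(3) by (metis Max_ge finite_keys keys_single le_neq_implies_less one_neq_zero singletonI supp_add UnCI)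
          moreover have ku: "?k \<in> supp u" using k u(3) False by auto
          ultimately have "u - unit_at ?k + unit_at k' \<in> B"
            using B u(1,2) mono_minus_add[OF ku] unfolding sstable_def
            by (metis atLeastAtMost_iff atLeastLessThan_iff)
          moreover have "u - unit_at ?k + unit_at k' = v - unit_at ?k"
          proof (rule add_right_imp_eq)
            have "u - unit_at ?k + unit_at k' + unit_at ?k = u - unit_at ?k + unit_at ?k + unit_at k'"
              by (simp only: ac_simps)
            also have "\<dots> = v" unfolding mono_minus_add[OF ku] using u(3) by (rule sym)
            finally show "u - unit_at ?k + unit_at k' + unit_at ?k = v - unit_at ?k + unit_at ?k"
              using e by (rule trans[OF _ sym])
          qed
          ultimately show ?thesis by simp
        qed
      qed
      then have "(?k, v - unit_at ?k) \<in> ?D" using kp y by auto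
      moreover have "v = ?f (?k, v - unit_at ?k)" using e kp by simp
      ultimately show ?thesis by (rule rev_image_eqI)
    qed
  qed
  have "card (shadow p B) = card ?D" using card_image[OF inj] im by simp
  also have "\<dots> = (\<Sum>p'=1..p. card (B \<inter> ymonos p'))" using fin by (simp add: card_SigmaI)
  finally show ?thesis .
qed

lemma iseg_shadow:
  assumes S: "iseg p S" and p: "2 \<le> p"
  shows "iseg p (shadow p S)"
  unfolding iseg_def
proof (intro conjI ballI impI)
  show "finite (shadow p S)" "shadow p S \<subseteq> ymonos p"
    using S finite_shadow shadow_ymonos unfolding iseg_def by blast+
  fix w v assume w: "w \<in> shadow p S" and v: "v \<in> ymonos p" "prec v w"
  have S0: "0 \<in> S" using w sstable_0[OF iseg_sstable[OF S]] by (auto simp: shadow_def)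
  have down: "u \<in> S" if "u \<in> ymonos p" "u = x \<or> prec u x" "x \<in> S" for u x
    using S that unfolding iseg_def by blast
  show "v \<in> shadow p S"
  proof (cases "w \<in> S \<or> v = 0")
    case True
    then show ?thesis using down[OF v(1)] v(2) S0 by (auto simp: shadow_def)
  next
    case False
    then obtain u k where u: "u \<in> S" "k \<in> {2..p}" "w = u + unit_at k"
      using w by (auto simp: shadow_def)
    let ?j = "Max (supp v)"
    have j: "?j \<in> supp v" using False Max_supp by blast
    have e: "v - unit_at ?j + unit_at ?j = v" using mono_minus_add[OF j] .
    have vj: "v - unit_at ?j \<in> ymonos p" "?j \<in> {2..p}"
      using v(1) e j by (metis ymonos_add) (use v(1) j in \<open>auto simp: ymonos_def\<close>)
    have dv: "mdeg v = Suc (mdeg (v - unit_at ?j))" using arg_cong[OF e, of mdeg] by simp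
    have "v - unit_at ?j \<in> S"
    proof (cases "mdeg v < mdeg w")
      case True
      then have "prec (v - unit_at ?j) u" using dv u(3) by (simp add: prec_def)
      then show ?thesis using down vj(1) u(1) by blast
    next
      case False
      then have deg: "mdeg v = mdeg w" "lex_greater v w" using v(2) by (auto simp: prec_def)
      then obtain i where i: "coef v i > coef w i" "\<forall>k<i. coef v k = coef w k"
        unfolding lex_greater_def by blast
      have w0: "w \<noteq> 0" using u(3) by (metis add_is_0 mdeg_add mdeg_single mdeg_zero one_neq_zero)
      let ?m = "Max (supp w)"
      have m: "?m \<in> supp w" using Max_supp[OF w0] .
      have ew: "w - unit_at ?m + unit_at ?m = w" using mono_minus_add[OF m] .
      have km: "k \<le> ?m" using u(3) by (intro Max_ge) auto
      have wp: "w \<in> ymonos p" using u S unfolding iseg_def by auto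
      have wm: "w - unit_at ?m \<in> ymonos p" using wp ew by (metis ymonos_add)
      have wS: "w - unit_at ?m \<in> S"
      proof (rule down[OF wm _ u(1)], cases "k = ?m")
        case True
        then have "w - unit_at ?m = u" using u(3) ew by (metis add_right_cancel)
        then show "w - unit_at ?m = u \<or> prec (w - unit_at ?m) u" by simp
      next
        case False
        then have mu: "?m \<in> supp u" using m u(3) by auto
        have eu: "u - unit_at ?m + unit_at ?m = u" using mono_minus_add[OF mu] .
        have "(u - unit_at ?m + unit_at k) + unit_at ?m = (u - unit_at ?m + unit_at ?m) + unit_at k"
          by (simp only: ac_simps)
        also have "\<dots> = w" unfolding eu using u(3) by (rule sym)
        finally have "(w - unit_at ?m) + unit_at ?m = (u - unit_at ?m + unit_at k) + unit_at ?m"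
          using ew by (rule trans[OF _ sym, rotated])
        then have "w - unit_at ?m = u - unit_at ?m + unit_at k" by (rule add_right_imp_eq)
        moreover have "lex_greater (u - unit_at ?m + unit_at k) (u - unit_at ?m + unit_at ?m)"
          using km False by (intro lex_greater_units) simp
        ultimately have "lex_greater (w - unit_at ?m) u" unfolding eu by simp
        moreover have "mdeg (w - unit_at ?m) = mdeg u"
          using arg_cong[OF ew, of mdeg] arg_cong[OF u(3), of mdeg] by simp
        ultimately show "w - unit_at ?m = u \<or> prec (w - unit_at ?m) u" by (simp add: prec_def)
      qed
      have cv: "coef (v - unit_at ?j) x = coef v x - (if x = ?j then 1 else 0)" for x
        by (simp add: lookup_minus lookup_single when_def)
      have cw: "coef (w - unit_at ?m) x = coef w x - (if x = ?m then 1 else 0)" for x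
        by (simp add: lookup_minus lookup_single when_def)
      have iv: "i \<in> supp v" using i(1) by (simp add: in_keys_iff)
      then have ij: "i \<le> ?j" by simp
      have sumv: "mdeg v = (\<Sum>x\<le>max ?j ?m. coef v x)" by (intro mdeg_superset) (auto simp: le_max_iff_disj)
      have sumw: "mdeg w = (\<Sum>x\<le>max ?j ?m. coef w x)" by (intro mdeg_superset) (auto simp: le_max_iff_disj)
      have zv: "coef v x = 0" if "x > ?j" for x using that by (metis Max_ge finite_keys in_keys_iff leD)
      have zw: "coef w x = 0" if "x > ?m" for x using that by (metis Max_ge finite_keys in_keys_iff leD)
      \<comment> \<open>The last variable of \<open>w\<close> lies beyond the first place \<open>i\<close> where \<open>v\<close> and \<open>w\<close> differ.\<close>
      have im: "i < ?m"
      proof (rule ccontr)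
        assume "\<not> i < ?m"
        have "(\<Sum>x\<le>max ?j ?m. coef w x) < (\<Sum>x\<le>max ?j ?m. coef v x)"
        proof (rule sum_strict_mono_ex1)
          show "\<forall>x\<in>{..max ?j ?m}. coef w x \<le> coef v x"
          proof
            fix x show "coef w x \<le> coef v x"
              using i zw[of x] \<open>\<not> i < ?m\<close> by (cases x i rule: linorder_cases) auto
          qed
          show "\<exists>a\<in>{..max ?j ?m}. coef w a < coef v a" using i(1) ij by (intro bexI[of _ i]) auto
        qed simp
        then show False using sumv sumw deg(1) by simp
      qed
      have degS: "mdeg (v - unit_at ?j) = mdeg (w - unit_at ?m)"
        using dv deg(1) arg_cong[OF ew, of mdeg] by simp
      have "v - unit_at ?j = w - unit_at ?m \<or> prec (v - unit_at ?j) (w - unit_at ?m)"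
      proof (cases "coef (v - unit_at ?j) i > coef (w - unit_at ?m) i")
        case True
        have "lex_greater (v - unit_at ?j) (w - unit_at ?m)" unfolding lex_greater_def
          using True i(2) ij im cv cw by (intro exI[of _ i]) auto
        then show ?thesis using degS by (simp add: prec_def)
      next
        case False
        then have ji: "?j = i" "coef v i = Suc (coef w i)" using cv cw i(1) im by (auto split: if_splits)
        have agree: "coef (v - unit_at ?j) x = coef (w - unit_at ?m) x" if "x \<le> i" for x
          unfolding cv cw using that i(2) ji im by (cases "x = i") auto
        have "coef (w - unit_at ?m) x = 0" if "x > i" for x
        proof -
          have s1: "mdeg (v - unit_at ?j) = (\<Sum>x\<le>i. coef (v - unit_at ?j) x)"
          proof (rule mdeg_superset)
            have "coef (v - unit_at ?j) y = 0" if "y > i" for y unfolding cv using zv[of y] that ji(1) by simp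
            then show "supp (v - unit_at ?j) \<subseteq> {..i}" by (meson atMost_iff in_keys_iff not_le subsetI)
          qed simp
          have s2: "mdeg (w - unit_at ?m) = (\<Sum>y\<le>max x ?m. coef (w - unit_at ?m) y)"
          proof (rule mdeg_superset)
            have "coef (w - unit_at ?m) y = 0" if "y > max x ?m" for y unfolding cw using zw[of y] that by simp
            then show "supp (w - unit_at ?m) \<subseteq> {..max x ?m}" by (meson atMost_iff in_keys_iff not_le subsetI)
          qed simp
          have "(\<Sum>y\<in>insert x {..i}. coef (w - unit_at ?m) y) \<le> (\<Sum>y\<le>max x ?m. coef (w - unit_at ?m) y)"
            using that by (intro sum_mono2) auto
          moreover have "(\<Sum>y\<in>insert x {..i}. coef (w - unit_at ?m) y) =
              coef (w - unit_at ?m) x + (\<Sum>y\<le>i. coef (v - unit_at ?j) y)"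
            using that agree by (subst sum.insert) auto
          ultimately show ?thesis using s1 s2 degS by simp
        qed
        moreover have "coef (v - unit_at ?j) x = 0" if "x > i" for x unfolding cv using zv[of x] that ji(1) by simp
        ultimately have "coef (v - unit_at ?j) x = coef (w - unit_at ?m) x" for x
          using agree[of x] by (metis linorder_not_le)
        then have "v - unit_at ?j = w - unit_at ?m" by (rule poly_mapping_eqI)
        then show ?thesis ..
      qed
      then show ?thesis using down[OF vj(1) _ wS] by blast
    qed
    then show ?thesis using e vj(2) unfolding shadow_def by (intro UnI2) (metis (mono_tags, lifting) mem_Collect_eq)
  qed
qed


subsection \<open>Slices along the last variable\<close>

definition slc :: "nat \<Rightarrow> nat \<Rightarrow> mono set \<Rightarrow> mono set" where
  "slc q e B = {u \<in> ymonos q. u + Poly_Mapping.single (Suc q) e \<in> B}"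

lemma ymonos_coef_gt: "u \<in> ymonos q \<Longrightarrow> q < k \<Longrightarrow> coef u k = 0"
  by (auto simp: ymonos_def in_keys_iff)

lemma ymonos_Suc_split:
  assumes "v \<in> ymonos (Suc q)"
  shows "\<exists>u\<in>ymonos q. v = u + Poly_Mapping.single (Suc q) (coef v (Suc q))"
proof (intro bexI)
  show "v = Poly_Mapping.update (Suc q) 0 v + Poly_Mapping.single (Suc q) (coef v (Suc q))"
    by (rule poly_mapping_eqI) (simp add: lookup_add lookup_update lookup_single when_def)
  show "Poly_Mapping.update (Suc q) 0 v \<in> ymonos q"
    using assms by (auto simp: ymonos_def in_keys_iff lookup_update split: if_splits) (metis in_keys_iff subsetD atLeastAtMost_iff le_Suc_eq not_gr_zero)+
qed

lemma finite_slc: "finite B \<Longrightarrow> finite (slc q e B)"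
  unfolding slc_def by (rule finite_subset[of _ "(\<lambda>v. v - Poly_Mapping.single (Suc q) e) ` B"])
    (auto simp: image_iff intro!: bexI[of _ "_ + Poly_Mapping.single (Suc q) e"])

lemma card_slices:
  assumes B: "finite B" "B \<subseteq> ymonos (Suc q)" and E: "\<And>u. u \<in> B \<Longrightarrow> coef u (Suc q) < E"
  shows "card B = (\<Sum>e<E. card (slc q e B))"
proof -
  let ?f = "\<lambda>(e, u). u + Poly_Mapping.single (Suc q) e"
  let ?D = "SIGMA e:{..<E}. slc q e B"
  have ce: "coef (u + Poly_Mapping.single (Suc q) e) (Suc q) = e" if "u \<in> ymonos q" for u e
    using ymonos_coef_gt[OF that, of "Suc q"] by (simp add: lookup_add)
  have inj: "inj_on ?f ?D"
  proof (rule inj_onI)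
    fix x y assume xy: "x \<in> ?D" "y \<in> ?D" "?f x = ?f y"
    obtain a u b w where ab: "x = (a, u)" "y = (b, w)" by fastforce
    have h: "u + Poly_Mapping.single (Suc q) a = w + Poly_Mapping.single (Suc q) b"
      and m: "u \<in> ymonos q" "w \<in> ymonos q" using xy ab by (auto simp: slc_def)
    have "a = b" using ce[OF m(1), of a] ce[OF m(2), of b] h by simp
    then show "x = y" using h ab by simp
  qed
  have im: "?f ` ?D = B"
  proof (intro subset_antisym subsetI)
    fix v assume "v \<in> ?f ` ?D" then show "v \<in> B" by (auto simp: slc_def)
  next
    fix v assume v: "v \<in> B"
    obtain u where u: "u \<in> ymonos q" "v = u + Poly_Mapping.single (Suc q) (coef v (Suc q))"
      using ymonos_Suc_split[of v q] v B(2) by blast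
    have "(coef v (Suc q), u) \<in> ?D" using u E[OF v] v by (simp add: slc_def)
    then show "v \<in> ?f ` ?D" using u(2) by (intro image_eqI[of _ _ "(coef v (Suc q), u)"]) simp_all
  qed
  have "card B = card ?D" using card_image[OF inj] im by simp
  also have "\<dots> = (\<Sum>e<E. card (slc q e B))" using B(1) by (simp add: finite_slc card_SigmaI)
  finally show ?thesis .
qed

lemma slc_0: "B \<subseteq> ymonos (Suc q) \<Longrightarrow> slc q 0 B = B \<inter> ymonos q"
  by (auto simp: slc_def)

lemma sstable_slc:
  assumes B: "sstable (Suc q) B"
  shows "sstable q (slc q e B)"
  unfolding sstable_def
proof (intro conjI allI impI ballI)
  show "finite (slc q e B)" using B finite_slc by (auto simp: sstable_def)
  show "slc q e B \<subseteq> ymonos q" by (auto simp: slc_def)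
  fix u k assume u: "u + unit_at k \<in> slc q e B"
  then have "(u + Poly_Mapping.single (Suc q) e) + unit_at k \<in> B" and y: "u + unit_at k \<in> ymonos q"
    by (auto simp: slc_def ac_simps)
  then have s: "u + Poly_Mapping.single (Suc q) e \<in> B"
    "\<forall>k'\<in>{2..<k}. (u + Poly_Mapping.single (Suc q) e) + unit_at k' \<in> B"
    using B unfolding sstable_def by blast+
  show "u \<in> slc q e B" using s(1) y by (auto simp: slc_def)
  show "u + unit_at k' \<in> slc q e B" if "k' \<in> {2..<k}" for k'
    using bspec[OF s(2) that] y that by (auto simp: slc_def ac_simps)
qed

lemma shadow_slc:
  assumes B: "sstable (Suc q) B"
  shows "shadow q (slc q (Suc e) B) \<subseteq> slc q e B"
proof
  fix v assume v: "v \<in> shadow q (slc q (Suc e) B)"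
  have st: "u \<in> slc q e B \<and> (\<forall>k\<in>{2..q}. u + unit_at k \<in> slc q e B)"
    if u: "u \<in> slc q (Suc e) B" for u
  proof -
    have "(u + Poly_Mapping.single (Suc q) e) + unit_at (Suc q) \<in> B" and y: "u \<in> ymonos q"
      using u by (auto simp: slc_def add.assoc simp flip: single_add)
    then have s: "u + Poly_Mapping.single (Suc q) e \<in> B"
      "\<forall>k'\<in>{2..<Suc q}. (u + Poly_Mapping.single (Suc q) e) + unit_at k' \<in> B"
      using B unfolding sstable_def by blast+
    have "u + unit_at k \<in> slc q e B" if "k \<in> {2..q}" for k
      using bspec[OF s(2), of k] y that by (auto simp: slc_def ac_simps)
    then show ?thesis using s(1) y by (auto simp: slc_def)
  qed
  then show "v \<in> slc q e B" using v by (auto simp: shadow_def)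
qed

text \<open>
  After setting \<open>X 1 = 1\<close>, these are the multiples of one generator that lies \<open>c - 1\<close> degrees below.
\<close>

definition low :: "nat \<Rightarrow> nat \<Rightarrow> mono set" where
  "low p c = {u \<in> ymonos p. mdeg u < c}"

lemma finite_low [simp]: "finite (low p c)"
  using finite_ymonos_less[of p c] by (simp only: low_def)

lemma low_0 [simp]: "low p 0 = {}"
  by (simp add: low_def)

lemma low_1: "low p (Suc 0) = {0}"
  by (auto simp: low_def)

lemma zero_low: "0 < c \<Longrightarrow> 0 \<in> low p c"
  by (simp add: low_def)

lemma sstable_low: "sstable p (low p c)"
  unfolding sstable_def by (auto simp: low_def simp del: finite_low intro: finite_low[unfolded low_def])

lemma low_Int: "p' \<le> p \<Longrightarrow> low p c \<inter> ymonos p' = low p' c"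
  using ymonos_mono[of p' p] by (auto simp: low_def)

lemma slc_low: "1 \<le> q \<Longrightarrow> slc q e (low (Suc q) c) = low q (c - e)"
  using ymonos_mono[of q "Suc q"] by (auto simp: slc_def low_def)

lemma shadow_low: "shadow p (low p (Suc c)) = low p (Suc (Suc c))"
proof (intro subset_antisym subsetI)
  fix v assume "v \<in> low p (Suc (Suc c))"
  then have v: "v \<in> ymonos p" "mdeg v \<le> Suc c" by (auto simp: low_def)
  show "v \<in> shadow p (low p (Suc c))"
  proof (cases "v = 0")
    case False
    let ?k = "Max (supp v)"
    have k: "?k \<in> supp v" using Max_supp[OF False] .
    have e: "v - unit_at ?k + unit_at ?k = v" using mono_minus_add[OF k] .
    have "v - unit_at ?k \<in> ymonos p" using e v(1) by (metis ymonos_add)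
    moreover have "mdeg v = Suc (mdeg (v - unit_at ?k))" using arg_cong[OF e, of mdeg] by simp
    ultimately have "v - unit_at ?k \<in> low p (Suc c)" using v(2) by (simp add: low_def)
    moreover have "?k \<in> {2..p}" using k v(1) by (auto simp: ymonos_def)
    ultimately show ?thesis unfolding shadow_def using e
      by (intro UnI2 CollectI exI[of _ "v - unit_at ?k"] exI[of _ ?k]) simp
  qed (simp add: shadow_def low_def)
qed (auto simp: shadow_def low_def)

lemma card_low_Suc:
  assumes "1 \<le> p"
  shows "(\<Sum>p'=1..p. card (low p' (Suc c))) = card (low p (Suc (Suc c)))"
proof -
  have "card (shadow p (low p (Suc c))) = (\<Sum>p'=1..p. card (low p (Suc c) \<inter> ymonos p'))"
    by (rule card_shadow_sstable[OF sstable_low assms])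
  also have "\<dots> = (\<Sum>p'=1..p. card (low p' (Suc c)))"
    by (intro sum.cong) (auto simp: low_Int)
  finally show ?thesis by (simp add: shadow_low)
qed

subsection \<open>Extremality of segments\<close>

lemma iseg_ymonos: "iseg (Suc q) S \<Longrightarrow> iseg q (S \<inter> ymonos q)"
proof -
  assume S: "iseg (Suc q) S"
  have sub: "u \<in> ymonos (Suc q)" if "u \<in> ymonos q" for u using ymonos_mono[of q "Suc q"] that by auto
  show ?thesis using S sub unfolding iseg_def by auto
qed

text \<open>
  Suppose that \<open>w\<close> lies in \<open>S\<close>, involves only the first variables and is missed by the segment with
  \<open>s 0\<close> elements. The growth condition places all \<open>\<Sum>e<E. s e\<close> monomials that the segments contribute,
  multiplied by powers of the last variable, before \<open>w\<close>. With \<open>w\<close> itself these are too many for \<open>S\<close>.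
\<close>

lemma iseg_slice_extremal:
  assumes q: "2 \<le> q" and S: "iseg (Suc q) S"
    and gr: "\<And>e T. iseg q T \<Longrightarrow> card T = s (Suc e) \<Longrightarrow> card (shadow q T) \<le> s e"
    and le: "card S \<le> (\<Sum>e<E. s e)"
  shows "card (S \<inter> ymonos q) \<le> s 0"
proof (rule ccontr)
  assume "\<not> ?thesis"
  then have gt: "s 0 < card (S \<inter> ymonos q)" by simp
  define T where "T e = (SOME T. iseg q T \<and> card T = s e)" for e
  have T: "iseg q (T e)" "card (T e) = s e" for e
    using someI_ex[OF iseg_exists[OF q, of "s e"]] unfolding T_def by auto
  have "T 0 \<subseteq> S \<inter> ymonos q" using iseg_card_mono[OF T(1) iseg_ymonos[OF S]] gt T(2) by simp
  then obtain w where w: "w \<in> S" "w \<in> ymonos q" "w \<notin> T 0"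
    using gt T(2)[of 0] by (metis Int_iff less_irrefl subsetI subset_antisym)
  \<comment> \<open>Everything counted by \<open>s\<close> precedes \<open>w\<close>, hence lies in \<open>S - {w}\<close>.\<close>
  have pr: "prec (u + Poly_Mapping.single (Suc q) e) w" if "u \<in> T e" for u e
    using that
  proof (induction e arbitrary: u)
    case 0
    then have "u \<noteq> w" "\<not> prec w u" using w T(1)[of 0] unfolding iseg_def by blast+
    then show ?case using prec_total by auto
  next
    case (Suc e)
    have uq: "u \<in> ymonos q" using Suc.prems T(1) unfolding iseg_def by blast
    have "card (shadow q (T (Suc e))) \<le> card (T e)" using gr[OF T(1) T(2)] T(2) by simp
    then have "shadow q (T (Suc e)) \<subseteq> T e"
      by (intro iseg_card_mono[OF iseg_shadow[OF T(1) q] T(1)])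
    moreover have "u + unit_at q \<in> shadow q (T (Suc e))" using Suc.prems q by (auto simp: shadow_def)
    ultimately have p: "prec (u + unit_at q + Poly_Mapping.single (Suc q) e) w" using Suc.IH by blast
    show ?case
    proof (cases "mdeg u + Suc e < mdeg w")
      case False
      then have d: "mdeg w = mdeg u + Suc e" and
        "lex_greater (u + unit_at q + Poly_Mapping.single (Suc q) e) w"
        using p by (auto simp: prec_def)
      then obtain i where i: "coef (u + unit_at q + Poly_Mapping.single (Suc q) e) i > coef w i"
        "\<forall>k<i. coef (u + unit_at q + Poly_Mapping.single (Suc q) e) k = coef w k"
        unfolding lex_greater_def by blast
      have u0: "coef u k = 0" "coef w k = 0" if "q < k" for k
        using ymonos_coef_gt[OF uq that] ymonos_coef_gt[OF w(2) that] .
      have sumw: "mdeg w = (\<Sum>k\<le>q. coef w k)" and sumu: "mdeg u = (\<Sum>k\<le>q. coef u k)"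
        using w(2) uq by (intro mdeg_superset; auto simp: ymonos_def)+
      have iq: "i < q"
      proof (rule ccontr)
        assume n: "\<not> i < q"
        have agree: "coef w k = coef u k" if "k < q" for k
          using i(2)[rule_format, of k] that n by (simp add: lookup_add lookup_single when_def)
        have "{..q} = insert q {..<q}" using q by auto
        then have "mdeg w = coef w q + (\<Sum>k<q. coef u k)" "mdeg u = coef u q + (\<Sum>k<q. coef u k)"
          using sumw sumu agree by simp_all
        then have wq: "coef w q = coef u q + Suc e" using d by simp
        show False
        proof (cases "i = q")
          case True
          then show False using i(1) wq by (simp add: lookup_add lookup_single when_def)
        next
          case False
          then have "coef w q = coef u q + 1"
            using i(2)[rule_format, of q] n by (simp add: lookup_add lookup_single when_def)
          then have "e = 0" using wq by simp
          then show False using i(1) u0[of i] n False by (simp add: lookup_add lookup_single when_def)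
        qed
      qed
      have "lex_greater (u + Poly_Mapping.single (Suc q) (Suc e)) w" unfolding lex_greater_def
        using i iq by (intro exI[of _ i]) (auto simp: lookup_add lookup_single when_def)
      then show ?thesis using d by (simp add: prec_def)
    qed (simp add: prec_def)
  qed
  let ?f = "\<lambda>(e, u). u + Poly_Mapping.single (Suc q) e"
  let ?D = "SIGMA e:{..<E}. T e"
  have Ty: "T e \<subseteq> ymonos q" "finite (T e)" for e using T(1) unfolding iseg_def by blast+
  have inj: "inj_on ?f ?D"
  proof (rule inj_onI)
    fix x y assume xy: "x \<in> ?D" "y \<in> ?D" "?f x = ?f y"
    obtain a u b z where ab: "x = (a, u)" "y = (b, z)" by fastforce
    have h: "u + Poly_Mapping.single (Suc q) a = z + Poly_Mapping.single (Suc q) b"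
      and m: "u \<in> ymonos q" "z \<in> ymonos q" using xy ab Ty by auto
    have "a = b" using arg_cong[OF h, of "\<lambda>v. coef v (Suc q)"] ymonos_coef_gt[OF m(1)] ymonos_coef_gt[OF m(2)]
      by (simp add: lookup_add)
    then show "x = y" using h ab by simp
  qed
  have "?f ` ?D \<subseteq> S - {w}"
  proof
    fix z assume "z \<in> ?f ` ?D"
    then obtain e u where eu: "e < E" "u \<in> T e" and z: "z = u + Poly_Mapping.single (Suc q) e" by auto
    have "u + Poly_Mapping.single (Suc q) e \<in> ymonos (Suc q)"
      using eu Ty ymonos_mono[of q "Suc q"] q by auto
    then have "z \<in> S" using S w(1) pr[OF eu(2)] unfolding iseg_def z by blast
    moreover have "z \<noteq> w" using pr[OF eu(2)] unfolding z by auto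
    ultimately show "z \<in> S - {w}" by simp
  qed
  then have "card ?D \<le> card (S - {w})"
    using card_inj_on_le[OF inj] S by (auto simp: iseg_def)
  also have "\<dots> < card S" using w(1) S by (intro psubset_card_mono) (auto simp: iseg_def)
  also have "card ?D = (\<Sum>e<E. s e)" using Ty T(2) by (simp add: card_SigmaI)
  finally show False using le by simp
qed

text \<open>
  The sets \<open>B i\<close> are the components of a strongly stable subset of a free module. The component \<open>i\<close>
  contains the multiples of a member of the regular sequence, and the distinguished component \<open>i1\<close>,
  which belongs to a member of least degree, contains all these cones as well.
\<close>

definition stable_family :: "nat \<Rightarrow> 'i set \<Rightarrow> 'i \<Rightarrow> ('i \<Rightarrow> mono set) \<Rightarrow> ('i \<Rightarrow> nat) \<Rightarrow> bool" where
  "stable_family p ix i1 B c \<longleftrightarrow> finite ix \<and> i1 \<in> ix \<and> c i1 = 0 \<and>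
     (\<forall>i\<in>ix. sstable p (B i) \<and> low p (c i) \<subseteq> B i \<and> low p (c i) \<subseteq> B i1)"

definition excess :: "nat \<Rightarrow> 'i set \<Rightarrow> ('i \<Rightarrow> mono set) \<Rightarrow> ('i \<Rightarrow> nat) \<Rightarrow> nat" where
  "excess p ix B c = (\<Sum>i\<in>ix. card (B i \<inter> ymonos p) - card (low p (c i)))"

lemma sstable_Int_1: "sstable p B \<Longrightarrow> card (B \<inter> ymonos (Suc 0)) = (if B = {} then 0 else 1)"
  using sstable_0[of p B] by (auto simp: ymonos_1)

text \<open>
  The shadow of a strongly stable set is counted by its restrictions to all smaller numbers of
  variables, and so are the cones \<open>low p (c i)\<close> and the segment. It remains to sum the inequality for
  restrictions. The monomial \<open>0\<close> of the segment is accounted for by the component \<open>i1\<close> or, if that is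
  empty, by any nonempty component, since then there are no cones.
\<close>

lemma excess_growth_from_restriction:
  assumes p: "2 \<le> p" and F: "stable_family p ix i1 B c"
    and R: "\<And>p' S. p' \<in> {2..p} \<Longrightarrow> iseg p S \<Longrightarrow> card S = excess p ix B c \<Longrightarrow>
        card (S \<inter> ymonos p') \<le> excess p' ix B c"
    and C: "\<And>i. i \<in> ix \<Longrightarrow> finite (C i) \<and> C i \<subseteq> ymonos p \<and> shadow p (B i) \<subseteq> C i \<and>
        low p (c' i) \<subseteq> C i \<and> low p (c' i) \<subseteq> C i1"
    and c': "c' i1 = 0" "\<And>i. i \<in> ix \<Longrightarrow> c i > 0 \<Longrightarrow> c' i = Suc (c i)" "\<And>i. i \<in> ix \<Longrightarrow> c i = 0 \<Longrightarrow> c' i \<le> 1"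
    and S: "iseg p S" "card S = excess p ix B c"
  shows "card (shadow p S) \<le> excess p ix C c'"
proof (cases "S = {}")
  case False
  have ix: "finite ix" "i1 \<in> ix" using F by (auto simp: stable_family_def)
  have st: "sstable p (B i)" and lB: "low p (c i) \<subseteq> B i" if "i \<in> ix" for i
    using F that by (auto simp: stable_family_def)
  have finB: "finite (B i)" "B i \<subseteq> ymonos p" if "i \<in> ix" for i using st[OF that] by (auto simp: sstable_def)
  let ?one = "\<lambda>b. if b then 1 else (0::nat)"
  let ?g = "\<lambda>i. \<Sum>p'=2..p. card (B i \<inter> ymonos p') - card (low p' (c i))"
  have split: "(\<Sum>p'=1..p. f p') = f 1 + (\<Sum>p'=2..p. f p')" for f :: "nat \<Rightarrow> nat"
    using p by (simp add: sum.atLeast_Suc_atMost numeral_2_eq_2)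
  have lowB: "card (low p' (c i)) \<le> card (B i \<inter> ymonos p')" if "i \<in> ix" "p' \<le> p" for i p'
    using lB[OF that(1)] finB[OF that(1)] low_Int[OF that(2), of "c i"]
    by (intro card_mono) auto
  have each: "?g i + (?one (C i \<noteq> {}) - ?one (c' i > 0)) \<le> card (C i \<inter> ymonos p) - card (low p (c' i))"
    if i: "i \<in> ix" for i
  proof -
    have Cp: "C i \<inter> ymonos p = C i" using C[OF i] by blast
    have "card (shadow p (B i)) \<le> card (C i)" using C[OF i] by (intro card_mono) auto
    then have 1: "card (C i) \<ge> ?one (B i \<noteq> {}) + (\<Sum>p'=2..p. card (B i \<inter> ymonos p'))"
      using card_shadow_sstable[OF st[OF i]] p sstable_Int_1[OF st[OF i]]
      unfolding split by (auto split: if_splits)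
    have c1: "card (C i) \<ge> ?one (C i \<noteq> {})" using C[OF i] by (simp add: Suc_le_eq card_gt_0_iff)
    have BC: "C i \<noteq> {}" if "B i \<noteq> {}" using C[OF i] that by (auto simp: shadow_def)
    have s0: "(\<Sum>p'=2..p. card (B i \<inter> ymonos p')) = 0" if "B i = {}" using that by simp
    have 2: "card (C i) \<ge> ?one (C i \<noteq> {}) + (\<Sum>p'=2..p. card (B i \<inter> ymonos p'))"
      using 1 c1 BC s0 by (cases "B i = {}") auto
    have 3: "card (low p (c' i)) = ?one (c' i > 0) + (\<Sum>p'=2..p. card (low p' (c i)))"
    proof (cases "c i")
      case 0
      then have "c' i = 0 \<or> c' i = Suc 0" using c'(3)[OF i] by auto
      then show ?thesis using 0 by (auto simp: low_1)
    next
      case (Suc d)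
      then have "c' i = Suc (Suc d)" using c'(2)[OF i] by simp
      moreover have "low (Suc 0) (Suc d) = {0}" by (auto simp: low_def ymonos_1)
      ultimately show ?thesis using card_low_Suc[of p d] p Suc unfolding split by simp
    qed
    have 4: "?g i + (\<Sum>p'=2..p. card (low p' (c i))) = (\<Sum>p'=2..p. card (B i \<inter> ymonos p'))"
      using lowB[OF i] by (simp flip: sum.distrib)
    have 5: "?one (c' i > 0) \<le> ?one (C i \<noteq> {})"
      using C[OF i] zero_low[of "c' i" p] by (cases "c' i > 0") auto
    show ?thesis unfolding Cp using 2 3 4 5 by linarith
  qed
  have ex1: "\<exists>i\<in>ix. C i \<noteq> {} \<and> c' i = 0"
  proof (cases "C i1 = {}")
    case True
    then have z: "c' i = 0" if "i \<in> ix" for i using C[OF that] True zero_low[of "c' i" p] by (cases "c' i = 0") auto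
    have "excess p ix B c > 0" unfolding S(2)[symmetric] using S(1) False by (simp add: iseg_def card_gt_0_iff)
    then have "excess p ix B c \<noteq> 0" by simp
    have "\<not> (\<forall>i\<in>ix. card (B i \<inter> ymonos p) - card (low p (c i)) = 0)"
    proof
      assume "\<forall>i\<in>ix. card (B i \<inter> ymonos p) - card (low p (c i)) = 0"
      then have "excess p ix B c = 0" unfolding excess_def by (rule sum.neutral)
      with \<open>excess p ix B c \<noteq> 0\<close> show False by simp
    qed
    then obtain i where i: "i \<in> ix" "card (B i \<inter> ymonos p) > 0" by auto
    then have "C i \<noteq> {}" using C[OF i(1)] by (auto simp: shadow_def)
    then show ?thesis using z i(1) by blast
  qed (use ix c' in blast)
  have S1: "card (S \<inter> ymonos (Suc 0)) = 1" using sstable_Int_1[OF iseg_sstable[OF S(1)]] False by simp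
  have "card (shadow p S) = 1 + (\<Sum>p'=2..p. card (S \<inter> ymonos p'))"
    using card_shadow_sstable[OF iseg_sstable[OF S(1)]] p S1 unfolding split by simp
  also have "\<dots> \<le> 1 + (\<Sum>p'=2..p. excess p' ix B c)"
    using R[OF _ S] by (intro add_left_mono sum_mono) auto
  also have "(\<Sum>p'=2..p. excess p' ix B c) = (\<Sum>i\<in>ix. ?g i)"
    unfolding excess_def by (rule sum.swap)
  also have "1 \<le> (\<Sum>i\<in>ix. ?one (C i \<noteq> {}) - ?one (c' i > 0))"
  proof -
    obtain i where i: "i \<in> ix" "C i \<noteq> {}" "c' i = 0" using ex1 by blast
    then have "1 = ?one (C i \<noteq> {}) - ?one (c' i > 0)" by simp
    also have "\<dots> \<le> (\<Sum>i\<in>ix. ?one (C i \<noteq> {}) - ?one (c' i > 0))"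
      using ix i(1) by (intro member_le_sum) auto
    finally show ?thesis .
  qed
  then have "1 + (\<Sum>i\<in>ix. ?g i) \<le> (\<Sum>i\<in>ix. ?g i + (?one (C i \<noteq> {}) - ?one (c' i > 0)))"
    by (simp add: sum.distrib)
  also have "\<dots> \<le> excess p ix C c'" unfolding excess_def using each by (rule sum_mono)
  finally show ?thesis by simp
qed simp

text \<open>
  By induction on the number of variables. The slices along the last variable form stable families
  in one variable less, with cones of decreasing degree, and the shadow of each slice lies in the
  previous one. Hence the excesses of the slices grow at least like segments, and the extremality
  of the slices of a segment applies.
\<close>

theorem stable_family_restriction:
  assumes "2 \<le> p" "stable_family p ix i1 B c" "p' \<in> {2..p}" "iseg p S" "card S = excess p ix B c"
  shows "card (S \<inter> ymonos p') \<le> excess p' ix B c"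
  using assms
proof (induction p arbitrary: B c S p' rule: dec_induct)
  case base
  then have "p' = 2" by simp
  moreover have "card (S \<inter> ymonos 2) \<le> card S" using base.prems(3) by (intro card_mono) (auto simp: iseg_def)
  ultimately show ?case using base.prems(4) by simp
next
  case (step q)
  have F: "stable_family (Suc q) ix i1 B c" by fact
  have q1: "1 \<le> q" using step.hyps(1) by simp
  have ix: "finite ix" "i1 \<in> ix" "c i1 = 0" using F by (auto simp: stable_family_def)
  have st: "sstable (Suc q) (B i)" and lB: "low (Suc q) (c i) \<subseteq> B i" "low (Suc q) (c i) \<subseteq> B i1"
    if "i \<in> ix" for i using F that by (auto simp: stable_family_def)
  have finB: "finite (B i)" "B i \<subseteq> ymonos (Suc q)" if "i \<in> ix" for i using st[OF that] by (auto simp: sstable_def)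
  let ?B = "\<lambda>e i. slc q e (B i)" and ?c = "\<lambda>e i. c i - e"
  have slm: "slc q e A \<subseteq> slc q e A'" if "A \<subseteq> A'" for e A A' using that by (auto simp: slc_def)
  have Fe: "stable_family q ix i1 (?B e) (?c e)" for e
    unfolding stable_family_def
  proof (intro conjI ballI)
    fix i assume i: "i \<in> ix"
    show "sstable q (?B e i)" by (rule sstable_slc[OF st[OF i]])
    show "low q (?c e i) \<subseteq> ?B e i" "low q (?c e i) \<subseteq> ?B e i1"
      unfolding slc_low[OF q1, symmetric] by (intro slm lB[OF i])+
  qed (use ix in auto)
  let ?X = "\<lambda>e. excess q ix (?B e) (?c e)"
  have Xgrow: "card (shadow q T) \<le> ?X e" if T: "iseg q T" "card T = ?X (Suc e)" for e T
  proof (rule excess_growth_from_restriction[OF step.hyps(1) Fe _ _ _ _ _ T])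
    show "card (S \<inter> ymonos p') \<le> excess p' ix (?B (Suc e)) (?c (Suc e))"
      if "p' \<in> {2..q}" "iseg q S" "card S = ?X (Suc e)" for p' S
      using step.IH[OF Fe that] .
    show "finite (?B e i) \<and> ?B e i \<subseteq> ymonos q \<and> shadow q (?B (Suc e) i) \<subseteq> ?B e i \<and>
        low q (?c e i) \<subseteq> ?B e i \<and> low q (?c e i) \<subseteq> ?B e i1" if "i \<in> ix" for i
      using shadow_slc[OF st[OF that]] Fe[of e] that finite_slc finB
      by (auto simp: stable_family_def slc_def)
  qed (use ix in auto)
  have "finite (\<Union>i\<in>ix. (\<lambda>u. coef u (Suc q)) ` B i)" using ix finB by auto
  then obtain E where E: "\<And>i u. i \<in> ix \<Longrightarrow> u \<in> B i \<Longrightarrow> coef u (Suc q) < E"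
    unfolding finite_nat_set_iff_bounded by blast
  have "excess (Suc q) ix B c = (\<Sum>i\<in>ix. \<Sum>e<E. card (?B e i \<inter> ymonos q) - card (low q (?c e i)))"
    unfolding excess_def
  proof (rule sum.cong[OF refl])
    fix i assume i: "i \<in> ix"
    have "coef u (Suc q) < E" if "u \<in> low (Suc q) (c i)" for u using lB(1)[OF i] E[OF i] that by blast
    then have "card (low (Suc q) (c i)) = (\<Sum>e<E. card (low q (?c e i)))"
      using card_slices[of "low (Suc q) (c i)" q E] by (simp add: slc_low[OF q1]) (simp add: low_def)
    moreover have "card (B i) = (\<Sum>e<E. card (?B e i))" by (rule card_slices[OF finB[OF i] E[OF i]])
    moreover have "B i \<inter> ymonos (Suc q) = B i" "?B e i \<inter> ymonos q = ?B e i" for e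
      using finB[OF i] by (auto simp: slc_def)
    moreover have "card (low q (?c e i)) \<le> card (?B e i)" for e
      using Fe[of e] i finite_slc finB[OF i] by (intro card_mono) (auto simp: stable_family_def)
    ultimately show "card (B i \<inter> ymonos (Suc q)) - card (low (Suc q) (c i)) =
        (\<Sum>e<E. card (?B e i \<inter> ymonos q) - card (low q (?c e i)))"
      by (simp add: sum_subtractf_nat)
  qed
  also have "\<dots> = (\<Sum>e<E. ?X e)" unfolding excess_def by (rule sum.swap)
  finally have "card S \<le> (\<Sum>e<E. ?X e)" using step.prems(4) by simp
  then have Sq: "card (S \<inter> ymonos q) \<le> ?X 0"
    using iseg_slice_extremal[OF step.hyps(1) step.prems(3), of ?X E] Xgrow by blast
  have B0: "?B 0 i \<inter> ymonos p'' = B i \<inter> ymonos p''" if "i \<in> ix" "p'' \<le> q" for i p''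
    using slc_0[OF finB(2)[OF that(1)]] ymonos_mono[OF that(2)] by blast
  have X0: "excess p'' ix (?B 0) (?c 0) = excess p'' ix B c" if "p'' \<le> q" for p''
    unfolding excess_def using B0 that by (intro sum.cong) auto
  consider "p' = Suc q" | "p' \<in> {2..q}" using step.prems(2) by force
  then show ?case
  proof cases
    case 1
    have "S \<inter> ymonos (Suc q) = S" using step.prems(3) by (auto simp: iseg_def)
    then show ?thesis using 1 step.prems(4) by simp
  next
    case 2
    obtain T where T: "iseg q T" "card T = ?X 0" using iseg_exists[OF step.hyps(1)] by blast
    have "S \<inter> ymonos q \<subseteq> T" using iseg_card_mono[OF iseg_ymonos[OF step.prems(3)] T(1)] Sq T(2) by simp
    then have "S \<inter> ymonos p' \<subseteq> T \<inter> ymonos p'" using ymonos_mono[of p' q] 2 by auto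
    then have "card (S \<inter> ymonos p') \<le> card (T \<inter> ymonos p')"
      using T(1) by (intro card_mono) (auto simp: iseg_def)
    also have "\<dots> \<le> excess p' ix (?B 0) (?c 0)" by (rule step.IH[OF Fe 2 T])
    finally show ?thesis using X0 2 by simp
  qed
qed

theorem stable_family_growth:
  assumes p: "2 \<le> p" and F: "stable_family p ix i1 B c" and F': "stable_family p ix i1 C c'"
    and sh: "\<And>i. i \<in> ix \<Longrightarrow> shadow p (B i) \<subseteq> C i"
    and c': "\<And>i. i \<in> ix \<Longrightarrow> c i > 0 \<Longrightarrow> c' i = Suc (c i)" "\<And>i. i \<in> ix \<Longrightarrow> c i = 0 \<Longrightarrow> c' i \<le> 1"
    and S: "iseg p S" "card S = excess p ix B c"
  shows "card (shadow p S) \<le> excess p ix C c'"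
proof (rule excess_growth_from_restriction[OF p F _ _ _ _ _ S])
  show "card (S \<inter> ymonos p') \<le> excess p' ix B c"
    if "p' \<in> {2..p}" "iseg p S" "card S = excess p ix B c" for p' S
    by (rule stable_family_restriction[OF p F that])
  show "finite (C i) \<and> C i \<subseteq> ymonos p \<and> shadow p (B i) \<subseteq> C i \<and>
        low p (c' i) \<subseteq> C i \<and> low p (c' i) \<subseteq> C i1" if "i \<in> ix" for i
    using F' sh[OF that] that by (auto simp: stable_family_def sstable_def)
qed (use F' c' in \<open>auto simp: stable_family_def\<close>)

section \<open>Generic unipotent coordinates\<close>

subsection \<open>Linear independence is an open condition\<close>

text \<open>
  Gaussian elimination over polynomials in one parameter: the product of the pivots does not vanish
  at \<open>0\<close>, and independence persists wherever it does not vanish.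
\<close>

lemma poly_indep_open:
  fixes p :: "'b \<Rightarrow> 'm \<Rightarrow> 'k::field poly"
  assumes "finite B"
    and "\<And>c. (\<And>m. (\<Sum>b\<in>B. c b * poly (p b m) 0) = 0) \<Longrightarrow> \<forall>b\<in>B. c b = 0"
  shows "\<exists>D. poly D 0 \<noteq> 0 \<and> (\<forall>x. poly D x \<noteq> 0 \<longrightarrow>
    (\<forall>c. (\<forall>m. (\<Sum>b\<in>B. c b * poly (p b m) x) = 0) \<longrightarrow> (\<forall>b\<in>B. c b = 0)))"
  using assms
proof (induction B arbitrary: p rule: finite_induct)
  case empty
  then show ?case by (intro exI[of _ 1]) simp
next
  case (insert a B)
  have "\<exists>m0. poly (p a m0) 0 \<noteq> 0"
  proof (rule ccontr)
    assume n: "\<not> ?thesis"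
    have "(\<Sum>b\<in>insert a B. (if b = a then 1 else 0) * poly (p b m) 0) = 0" for m
      using n insert.hyps by (simp add: sum.insert) (intro sum.neutral, auto)
    then have "\<forall>b\<in>insert a B. (if b = a then 1 else (0::'k)) = 0" by (rule insert.prems)
    then show False by auto
  qed
  then obtain m0 where m0: "poly (p a m0) 0 \<noteq> 0" by blast
  \<comment> \<open>Eliminate the vector with index \<open>a\<close> by means of its coordinate \<open>m0\<close>.\<close>
  let ?q = "\<lambda>b m. p a m0 * p b m - p b m0 * p a m"
  have "\<exists>D. poly D 0 \<noteq> 0 \<and> (\<forall>x. poly D x \<noteq> 0 \<longrightarrow>
    (\<forall>c. (\<forall>m. (\<Sum>b\<in>B. c b * poly (?q b m) x) = 0) \<longrightarrow> (\<forall>b\<in>B. c b = 0)))"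
  proof (rule insert.IH)
    fix c assume s: "\<And>m. (\<Sum>b\<in>B. c b * poly (?q b m) 0) = 0"
    let ?S = "\<lambda>m. \<Sum>b\<in>B. c b * poly (p b m) 0"
    have eq: "(\<Sum>b\<in>B. c b * poly (?q b m) 0) = poly (p a m0) 0 * ?S m - ?S m0 * poly (p a m) 0" for m
      by (simp add: algebra_simps sum_subtractf sum_distrib_left sum_distrib_right)
    let ?c = "\<lambda>b. if b = a then - ?S m0 else poly (p a m0) 0 * c b"
    have "(\<Sum>b\<in>insert a B. ?c b * poly (p b m) 0) = 0" for m
    proof -
      have "(\<Sum>b\<in>B. ?c b * poly (p b m) 0) = (\<Sum>b\<in>B. poly (p a m0) 0 * (c b * poly (p b m) 0))"
        using insert.hyps by (intro sum.cong) (auto simp: mult.assoc)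
      then show ?thesis using s[of m] eq[of m] insert.hyps by (simp add: sum_distrib_left)
    qed
    then have z: "\<forall>b\<in>insert a B. ?c b = 0" by (rule insert.prems)
    show "\<forall>b\<in>B. c b = 0"
    proof
      fix b assume "b \<in> B"
      then show "c b = 0" using bspec[OF z, of b] m0 insert.hyps(2) by (cases "b = a") simp_all
    qed
  qed
  then obtain D where D: "poly D 0 \<noteq> 0" "\<And>x c. poly D x \<noteq> 0 \<Longrightarrow>
      (\<And>m. (\<Sum>b\<in>B. c b * poly (?q b m) x) = 0) \<Longrightarrow> \<forall>b\<in>B. c b = 0" by blast
  show ?case
  proof (intro exI[of _ "D * p a m0"] conjI allI impI)
    show "poly (D * p a m0) 0 \<noteq> 0" using D(1) m0 by simp
    fix x c assume x: "poly (D * p a m0) x \<noteq> 0"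
      and s: "\<forall>m. (\<Sum>b\<in>insert a B. c b * poly (p b m) x) = 0"
    let ?S = "\<lambda>m. \<Sum>b\<in>B. c b * poly (p b m) x"
    have S: "?S m = - (c a * poly (p a m) x)" for m
      using s[rule_format, of m] insert.hyps by (simp add: eq_neg_iff_add_eq_0 add.commute)
    have "(\<Sum>b\<in>B. c b * poly (?q b m) x) = poly (p a m0) x * ?S m - ?S m0 * poly (p a m) x" for m
      by (simp add: algebra_simps sum_subtractf sum_distrib_left sum_distrib_right)
    then have "(\<Sum>b\<in>B. c b * poly (?q b m) x) = 0" for m by (simp add: S)
    then have B: "\<forall>b\<in>B. c b = 0" using D(2)[of x c] x by auto
    then have "c a * poly (p a m0) x = 0" using S[of m0] by simp
    then show "\<forall>b\<in>insert a B. c b = 0" using B x by simp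
  qed
qed

lemma fam_indep_generic:
  fixes a :: "'b \<Rightarrow> nat \<Rightarrow> 'k::field mpoly"
  assumes B: "finite B" and ind: "fam_indep B (\<lambda>b. a b 0)"
  shows "finite {x. \<not> fam_indep B (\<lambda>b. \<Sum>l\<le>N. mscale (x ^ l) (a b l))}"
proof -
  let ?p = "\<lambda>b m. \<Sum>l\<le>N. monom (coef (a b l) m) l"
  have px: "poly (?p b m) x = coef (\<Sum>l\<le>N. mscale (x ^ l) (a b l)) m" for b m x
    by (simp add: poly_sum poly_monom lookup_sum mult.commute)
  have p0: "poly (?p b m) 0 = coef (a b 0) m" for b m
  proof -
    have "(\<Sum>l\<le>N. coef (a b l) m * 0 ^ l) = (\<Sum>l\<in>{0}. coef (a b l) m * 0 ^ l)"
      by (rule sum.mono_neutral_right) auto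
    then show ?thesis by (simp add: poly_sum poly_monom)
  qed
  have lk: "(\<forall>m. (\<Sum>b\<in>B. c b * coef (w b) m) = 0) \<longleftrightarrow> (\<Sum>b\<in>B. mscale (c b) (w b)) = 0"
    for c and w :: "'b \<Rightarrow> 'k mpoly"
    by (auto simp: poly_mapping_eq_iff fun_eq_iff lookup_sum)
  obtain D where D: "poly D 0 \<noteq> 0" "\<forall>x. poly D x \<noteq> 0 \<longrightarrow>
      (\<forall>c. (\<forall>m. (\<Sum>b\<in>B. c b * poly (?p b m) x) = 0) \<longrightarrow> (\<forall>b\<in>B. c b = 0))"
    using poly_indep_open[OF B, of ?p] ind unfolding p0 fam_indep_def lk[symmetric] by blast
  have "{x. \<not> fam_indep B (\<lambda>b. \<Sum>l\<le>N. mscale (x ^ l) (a b l))} \<subseteq> {x. poly D x = 0}"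
    using D(2) unfolding px fam_indep_def lk by blast
  moreover have "D \<noteq> 0" using D(1) by auto
  ultimately show ?thesis using poly_roots_finite finite_subset by blast
qed

subsection \<open>Elementary substitutions\<close>

definition elem_sub :: "nat \<Rightarrow> nat \<Rightarrow> 'k::field \<Rightarrow> nat \<Rightarrow> 'k mpoly" where
  "elem_sub k k' c i = (if i = k then X k + mscale c (X k') else X i)"

text \<open>The divided powers of the derivation that replaces one factor \<open>X k\<close> by \<open>X k'\<close>.\<close>

definition divop :: "nat \<Rightarrow> nat \<Rightarrow> nat \<Rightarrow> 'k::field mpoly \<Rightarrow> 'k mpoly" where
  "divop k k' l v = (\<Sum>m\<in>supp v. Poly_Mapping.single
     (m - Poly_Mapping.single k l + Poly_Mapping.single k' l) (coef v m * of_nat (coef m k choose l)))"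

lemma divop_add: "divop k k' l (v + w) = divop k k' l v + divop k k' l w"
  unfolding divop_def
  by (rule setsum_keys_plus_distrib) (auto simp: distrib_right single_add)

lemma divop_single: "divop k k' l (Poly_Mapping.single m c) =
    Poly_Mapping.single (m - Poly_Mapping.single k l + Poly_Mapping.single k' l) (c * of_nat (coef m k choose l))"
  by (cases "c = 0") (auto simp: divop_def)

lemma divop_0: "divop k k' 0 v = v"
  by (rule additive_eq_on_singles[of "divop k k' 0" "\<lambda>v. v"]) (auto simp: divop_add divop_single)

lemma mono_val_cong: "(\<And>i. i \<in> supp m \<Longrightarrow> f i = g i) \<Longrightarrow> mono_val f m = mono_val g m"
  by (auto simp: mono_val_def intro: prod.cong)

lemma subst_elem_single:
  fixes x :: "'k::field"
  assumes N: "coef m k \<le> N"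
  shows "subst (elem_sub k k' x) (Poly_Mapping.single m c) = (\<Sum>l\<le>N. mscale (x ^ l) (divop k k' l (Poly_Mapping.single m c)))"
proof -
  let ?e = "coef m k" and ?r = "Poly_Mapping.update k 0 m"
  have m: "m = Poly_Mapping.single k ?e + ?r"
    by (rule poly_mapping_eqI) (simp add: lookup_add lookup_single lookup_update when_def)
  have r: "mono_val (elem_sub k k' x) ?r = xmon ?r"
    unfolding mono_val_X[symmetric]
    by (rule mono_val_cong) (auto simp: elem_sub_def in_keys_iff lookup_update)
  have mon: "Poly_Mapping.single k (?e - l) + ?r + Poly_Mapping.single k' l =
      m - Poly_Mapping.single k l + Poly_Mapping.single k' l" if "l \<le> ?e" for l
    using that by (intro poly_mapping_eqI) (auto simp: lookup_add lookup_minus lookup_single lookup_update when_def)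
  have "(X k + mscale x (X k')) ^ ?e = (mscale x (X k') + X k) ^ ?e" by (simp add: add.commute)
  also have "\<dots> = (\<Sum>l\<le>?e. of_nat (?e choose l) * mscale x (X k') ^ l * X k ^ (?e - l))"
    by (rule binomial_ring)
  also have "\<dots> = (\<Sum>l\<le>?e. mscale (x ^ l * of_nat (?e choose l))
      (xmon (Poly_Mapping.single k' l + Poly_Mapping.single k (?e - l))))"
  proof (rule sum.cong[OF refl])
    fix l
    have p: "mscale x (X k') ^ l = mscale (x ^ l) (X k' ^ l)"
      by (induction l) (simp_all add: mscale_mult)
    have q: "of_nat j * w = mscale (of_nat j) w" for j and w :: "'k mpoly"
      by (simp add: mscale_def)
    show "of_nat (?e choose l) * mscale x (X k') ^ l * X k ^ (?e - l) = mscale (x ^ l * of_nat (?e choose l))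
      (xmon (Poly_Mapping.single k' l + Poly_Mapping.single k (?e - l)))"
      unfolding p q X_power mscale_single mult_single by (simp add: mult.commute)
  qed
  finally have bin: "(X k + mscale x (X k')) ^ ?e = \<dots>" .
  have "mono_val (elem_sub k k' x) m = (X k + mscale x (X k')) ^ ?e * xmon ?r"
    by (subst m) (simp add: mono_val_add r elem_sub_def)
  also have "\<dots> = (\<Sum>l\<le>?e. Poly_Mapping.single (m - Poly_Mapping.single k l + Poly_Mapping.single k' l)
      (x ^ l * of_nat (?e choose l)))"
    unfolding bin sum_distrib_right
  proof (rule sum.cong[OF refl])
    fix l assume "l \<in> {..?e}"
    then have eq: "Poly_Mapping.single k' l + Poly_Mapping.single k (?e - l) + ?r =
        m - Poly_Mapping.single k l + Poly_Mapping.single k' l"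
      using mon[of l] by (simp only: ac_simps atMost_iff)
    show "mscale (x ^ l * of_nat (?e choose l)) (xmon (Poly_Mapping.single k' l + Poly_Mapping.single k (?e - l))) * xmon ?r =
        Poly_Mapping.single (m - Poly_Mapping.single k l + Poly_Mapping.single k' l) (x ^ l * of_nat (?e choose l))"
      unfolding mscale_single mult_single eq by simp
  qed
  finally have "subst (elem_sub k k' x) (Poly_Mapping.single m c) = (\<Sum>l\<le>?e. mscale (x ^ l) (divop k k' l (Poly_Mapping.single m c)))"
    by (simp add: mp.scale_sum_right divop_single mult.commute mult.left_commute)
  also have "\<dots> = (\<Sum>l\<le>N. mscale (x ^ l) (divop k k' l (Poly_Mapping.single m c)))"
    using N by (intro sum.mono_neutral_left) (auto simp: divop_single binomial_eq_0)
  finally show ?thesis .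
qed

lemma subst_elem:
  assumes "v \<in> forms n d"
  shows "subst (elem_sub k k' x) v = (\<Sum>l\<le>d. mscale (x ^ l) (divop k k' l v))"
proof (rule additive_eq_on_singles[of "subst (elem_sub k k' x)" "\<lambda>v. \<Sum>l\<le>d. mscale (x ^ l) (divop k k' l v)"])
  show "(\<Sum>l\<le>d. mscale (x ^ l) (divop k k' l (a + b))) =
     (\<Sum>l\<le>d. mscale (x ^ l) (divop k k' l a)) + (\<Sum>l\<le>d. mscale (x ^ l) (divop k k' l b))" for a b
    by (simp add: divop_add mp.scale_right_distrib sum.distrib)
  fix m assume "m \<in> supp v"
  then have "coef m k \<le> d" using assms coef_le_mdeg[of m k] by (auto simp: forms_iff)
  then show "subst (elem_sub k k' x) (Poly_Mapping.single m (coef v m)) =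
      (\<Sum>l\<le>d. mscale (x ^ l) (divop k k' l (Poly_Mapping.single m (coef v m))))"
    by (rule subst_elem_single)
qed (rule subst_add)

text \<open>
  Substitutions are triangular and fix \<open>X 1\<close> and \<open>X 2\<close>, so a monomial is replaced by lex-larger ones.
  They still move the plane on which \<open>X 3, \<dots>, X n\<close> vanish to a generic position.
\<close>

inductive_set unip :: "nat \<Rightarrow> ('k::field mpoly \<Rightarrow> 'k mpoly) set" for n where
  id: "(\<lambda>v. v) \<in> unip n"
| step: "s \<in> unip n \<Longrightarrow> k \<in> {3..n} \<Longrightarrow> k' \<in> {1..<k} \<Longrightarrow> (\<lambda>v. subst (elem_sub k k' c) (s v)) \<in> unip n"

lemma forms_subst:
  assumes f: "\<And>i. i \<in> {1..n} \<Longrightarrow> f i \<in> forms n 1" and v: "v \<in> forms n d"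
  shows "subst f v \<in> forms n d"
  unfolding subst_def
proof (intro forms_sum forms_mscale)
  fix m assume m: "m \<in> supp v"
  then have mm: "supp m \<subseteq> {1..n}" "mdeg m = d" using v by (auto simp: forms_iff monoms_def)
  have "mono_val f m \<in> forms n (\<Sum>i\<in>supp m. coef m i * 1)"
    unfolding mono_val_def using mm(1) by (intro forms_prod forms_power f) auto
  then show "mono_val f m \<in> forms n d" using mm(2) by (simp add: mdeg_def)
qed

lemma elem_sub_forms: "k \<in> {1..n} \<Longrightarrow> k' \<in> {1..n} \<Longrightarrow> i \<in> {1..n} \<Longrightarrow> elem_sub k k' c i \<in> forms n 1"
  by (auto simp: elem_sub_def intro!: forms_add forms_mscale X_forms)

lemma unip_subst: "s \<in> unip n \<Longrightarrow> \<exists>f. s = subst f \<and> (\<forall>i\<in>{1..n}. f i \<in> forms n 1)"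
proof (induction rule: unip.induct)
  case id
  then show ?case by (intro exI[of _ X]) auto
next
  case (step s k k' c)
  then obtain f where f: "s = subst f" "\<forall>i\<in>{1..n}. f i \<in> forms n 1" by blast
  have "subst (elem_sub k k' c) (f i) \<in> forms n 1" if "i \<in> {1..n}" for i
    using step.hyps f(2) that by (intro forms_subst elem_sub_forms) auto
  then show ?case using f(1) by (intro exI[of _ "\<lambda>i. subst (elem_sub k k' c) (f i)"]) (auto simp: subst_comp)
qed

lemma unip_comp: "s \<in> unip n \<Longrightarrow> s' \<in> unip n \<Longrightarrow> (\<lambda>v. s (s' v)) \<in> unip n"
  by (induction rule: unip.induct) (auto intro: unip.intros)

lemma subst_diff: "subst f (p - q) = subst f p - subst f q"
  using subst_add[of f "p - q" q] by simp

lemma elem_sub_inverse: "k \<noteq> k' \<Longrightarrow> subst (elem_sub k k' c) (subst (elem_sub k k' (- c)) v) = v"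
proof -
  assume "k \<noteq> k'"
  have e: "elem_sub k k' (- c) i = (if i = k then X k + mscale (- c) (X k') else X i)" for i
    by (simp add: elem_sub_def)
  have "(\<lambda>i. subst (elem_sub k k' c) (elem_sub k k' (- c) i)) = X"
    unfolding e using \<open>k \<noteq> k'\<close>
    by (auto simp: elem_sub_def fun_eq_iff subst_add subst_diff subst_mscale)
  then show ?thesis by (simp add: subst_comp)
qed

lemma unip_inverse: "s \<in> unip n \<Longrightarrow> \<exists>s'\<in>unip n. (\<forall>v. s (s' v) = v) \<and> (\<forall>v. s' (s v) = v)"
proof (induction rule: unip.induct)
  case id
  show ?case by (rule bexI[OF _ unip.id]) simp
next
  case (step s k k' c)
  then obtain s' where s': "s' \<in> unip n" "\<forall>v. s (s' v) = v" "\<forall>v. s' (s v) = v" by blast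
  have e: "subst (elem_sub k k' c) (subst (elem_sub k k' (- c)) v) = v"
    "subst (elem_sub k k' (- c)) (subst (elem_sub k k' c) v) = v" for v
    using elem_sub_inverse[of k k' c v] elem_sub_inverse[of k k' "- c" v] step.hyps by auto
  have "(\<lambda>v. subst (elem_sub k k' (- c)) v) \<in> unip n" using unip.step[OF unip.id] step.hyps by blast
  from unip_comp[OF s'(1) this] show ?case
    using s'(2,3) e by (intro bexI[of _ "\<lambda>v. s' (subst (elem_sub k k' (- c)) v)"]) auto
qed

subsection \<open>Maximal ranks\<close>

lemma finite_preimages:
  fixes P :: "'k::field mpoly \<Rightarrow> 'k mpoly"
  assumes "finite E" "P ` W \<subseteq> mp.span E"
  obtains C g where "finite C" "mp.independent C" "card C = mp.dim (P ` W)" "\<And>x. x \<in> C \<Longrightarrow> g x \<in> W \<and> P (g x) = x"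
proof -
  obtain C where C: "C \<subseteq> P ` W" "mp.independent C" "P ` W \<subseteq> mp.span C" "card C = mp.dim (P ` W)"
    using mp.basis_exists by blast
  define g where "g x = (SOME w. w \<in> W \<and> P w = x)" for x
  have "g x \<in> W \<and> P (g x) = x" if "x \<in> C" for x
  proof -
    have "\<exists>w. w \<in> W \<and> P w = x" using that C(1) by auto
    then show ?thesis unfolding g_def by (rule someI_ex)
  qed
  moreover have "finite C" using independent_card_le[OF assms C(2,1)] by simp
  ultimately show ?thesis using that C by blast
qed

text \<open>
  The rank of a family of linear maps does not drop outside a finite set of parameters. It rises
  if the linear coefficient of the substitution maps a vector of the kernel outside the image: dividing
  by the parameter gives one more independent vector.
\<close>

lemma generic_rank:
  fixes W :: "'k::field mpoly set" and A :: "mono set"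
  assumes W: "mp.subspace W" "W \<subseteq> forms n d" and k: "k \<in> {1..n}" "k' \<in> {1..n}"
  defines "r \<equiv> \<lambda>x. mp.dim ((\<lambda>v. restr A (subst (elem_sub k k' x) v)) ` W)"
  shows "finite {x. r x < mp.dim (restr A ` W)}"
    and "v \<in> W \<Longrightarrow> restr A v = 0 \<Longrightarrow> restr A (divop k k' 1 v) \<notin> restr A ` W \<Longrightarrow>
      finite {x. r x \<le> mp.dim (restr A ` W)}"
proof -
  let ?E = "xmon ` {m \<in> monoms n. mdeg m = d} :: 'k mpoly set"
  have E: "finite ?E" by (rule finite_forms_basis)
  have sub: "S \<subseteq> mp.span ?E" if "S \<subseteq> forms n d" for S :: "'k mpoly set" using forms_span that by blast
  have rW: "restr A ` W \<subseteq> forms n d" using W(2) by (auto intro: forms_restr)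
  have tW: "(\<lambda>v. restr A (subst (elem_sub k k' x) v)) ` W \<subseteq> forms n d" for x
    using W(2) k by (auto intro!: forms_restr forms_subst elem_sub_forms)
  obtain C g where C: "finite C" "mp.independent C" "card C = mp.dim (restr A ` W)"
    and g: "\<And>x. x \<in> C \<Longrightarrow> g x \<in> W \<and> restr A (g x) = x"
    using finite_preimages[OF E sub[OF rW]] by blast
  have rs: "restr A (subst (elem_sub k k' x) w) = (\<Sum>l\<le>d. mscale (x ^ l) (restr A (divop k k' l w)))"
    if "w \<in> W" for x w
  proof -
    have rsum: "restr A (sum h I) = (\<Sum>l\<in>I. restr A (h l))" if "finite I" for h and I :: "nat set"
      using that by (induction I rule: finite_induct) (auto simp: restr_add)
    have "w \<in> forms n d" using that W(2) by blast
    then show ?thesis by (simp add: subst_elem rsum restr_mscale)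
  qed
  let ?a = "\<lambda>y l. restr A (divop k k' l (g y))"
  have "fam_indep C (\<lambda>y. y)" by (rule fam_indep_of_independent[OF C(1,2)])
  then have "fam_indep C (\<lambda>y. ?a y 0)" using g by (simp add: fam_indep_def divop_0)
  then have fin: "finite {x. \<not> fam_indep C (\<lambda>b. \<Sum>l\<le>d. mscale (x ^ l) (?a b l))}"
    by (rule fam_indep_generic[OF C(1)])
  have "mp.dim (restr A ` W) \<le> r x" if "fam_indep C (\<lambda>b. \<Sum>l\<le>d. mscale (x ^ l) (?a b l))" for x
    unfolding r_def C(3)[symmetric]
  proof (rule fam_indep_card_le[OF E sub[OF tW] C(1) that])
    show "(\<lambda>b. \<Sum>l\<le>d. mscale (x ^ l) (?a b l)) ` C \<subseteq> (\<lambda>v. restr A (subst (elem_sub k k' x) v)) ` W"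
      using g rs by (auto simp flip: rs)
  qed
  then have "{x. r x < mp.dim (restr A ` W)} \<subseteq> {x. \<not> fam_indep C (\<lambda>b. \<Sum>l\<le>d. mscale (x ^ l) (?a b l))}"
    by fastforce
  then show "finite {x. r x < mp.dim (restr A ` W)}" using fin finite_subset by blast
  assume v: "v \<in> W" "restr A v = 0" "restr A (divop k k' 1 v) \<notin> restr A ` W"
  \<comment> \<open>The extra vector is the image of \<open>v\<close> divided by the parameter.\<close>
  let ?b = "\<lambda>y l. case y of None \<Rightarrow> restr A (divop k k' (Suc l) v) | Some y \<Rightarrow> ?a y l"
  let ?C = "insert None (Some ` C)"
  have sA: "mp.subspace (restr A ` W)"
    using linear_restr W(1) by (rule subspace_linear_image)
  have ind: "fam_indep ?C (\<lambda>y. ?b y 0)" unfolding fam_indep_def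
  proof (intro allI impI)
    fix c assume s: "(\<Sum>b\<in>?C. mscale (c b) (?b b 0)) = 0"
    have s': "mscale (c None) (restr A (divop k k' 1 v)) + (\<Sum>y\<in>C. mscale (c (Some y)) y) = 0"
    proof -
      have "(\<Sum>y\<in>C. mscale (c (Some y)) (?a y 0)) = (\<Sum>y\<in>C. mscale (c (Some y)) y)"
        using g by (intro sum.cong) (auto simp: divop_0)
      then show ?thesis using s C(1) by (simp add: sum.reindex)
    qed
    have mem: "(\<Sum>y\<in>C. mscale (c (Some y)) y) \<in> restr A ` W"
      using g sA by (intro mp.subspace_sum mp.subspace_scale) (auto simp: image_iff, metis)
    have "c None = 0"
    proof (rule ccontr)
      assume c: "c None \<noteq> 0"
      have "mscale (c None) (restr A (divop k k' 1 v)) = - (\<Sum>y\<in>C. mscale (c (Some y)) y)"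
        using s' by (simp add: eq_neg_iff_add_eq_0)
      also have "\<dots> \<in> restr A ` W" using mem sA by (rule mp.subspace_neg[rotated])
      finally have "mscale (c None) (restr A (divop k k' 1 v)) \<in> restr A ` W" .
      from mp.subspace_scale[OF sA this, of "inverse (c None)"] show False using v(3) c by simp
    qed
    moreover have "\<forall>y\<in>C. c (Some y) = 0"
      using s' calculation mp.independentD[OF C(2,1) subset_refl, of "\<lambda>y. c (Some y)"] by auto
    ultimately show "\<forall>b\<in>?C. c b = 0" by auto
  qed
  have fin2: "finite {x. \<not> fam_indep ?C (\<lambda>b. \<Sum>l\<le>d. mscale (x ^ l) (?b b l))}"
    by (rule fam_indep_generic[of ?C ?b, OF _ ind]) (use C(1) in simp)
  have "mp.dim (restr A ` W) < r x"
    if x: "x \<noteq> 0" and i: "fam_indep ?C (\<lambda>b. \<Sum>l\<le>d. mscale (x ^ l) (?b b l))" for x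
  proof -
    have sT: "mp.subspace ((\<lambda>v. restr A (subst (elem_sub k k' x) v)) ` W)"
    proof (rule subspace_linear_image[OF _ W(1)])
      show "Vector_Spaces.linear mscale mscale (\<lambda>v. restr A (subst (elem_sub k k' x) v))"
        using Vector_Spaces.linear_compose[OF linear_subst linear_restr] by (simp add: o_def)
    qed
    have vN: "(\<Sum>l\<le>d. mscale (x ^ l) (restr A (divop k k' (Suc l) v))) \<in> (\<lambda>v. restr A (subst (elem_sub k k' x) v)) ` W"
    proof -
      have dN: "divop k k' (Suc d) v = 0"
      proof -
        have "coef m k choose Suc d = 0" if "m \<in> supp v" for m
          using that v(1) W(2) coef_le_mdeg[of m k] by (intro binomial_eq_0) (auto simp: forms_iff)
        then have "(of_nat (coef m k choose Suc d) :: 'k) = 0" if "m \<in> supp v" for m using that by (simp only: of_nat_0)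
        then show ?thesis unfolding divop_def by (intro sum.neutral ballI) (simp only: mult_zero_right single_zero)
      qed
      have "restr A (subst (elem_sub k k' x) v) = (\<Sum>l\<le>Suc d. mscale (x ^ l) (restr A (divop k k' l v)))"
        using rs[OF v(1), of x] dN by simp
      also have "\<dots> = (\<Sum>l\<le>d. mscale (x ^ Suc l) (restr A (divop k k' (Suc l) v)))"
        by (subst sum.atMost_Suc_shift) (simp add: divop_0 v(2))
      also have "\<dots> = mscale x (\<Sum>l\<le>d. mscale (x ^ l) (restr A (divop k k' (Suc l) v)))"
        by (simp add: mp.scale_sum_right)
      finally have "mscale x (\<Sum>l\<le>d. mscale (x ^ l) (restr A (divop k k' (Suc l) v)))
          \<in> (\<lambda>v. restr A (subst (elem_sub k k' x) v)) ` W" using v(1) by (metis image_eqI)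
      from mp.subspace_scale[OF sT this, of "inverse x"] show ?thesis using x by simp
    qed
    have "card ?C \<le> r x" unfolding r_def
    proof (rule fam_indep_card_le[OF E sub[OF tW] _ i])
      show "(\<lambda>b. \<Sum>l\<le>d. mscale (x ^ l) (?b b l)) ` ?C \<subseteq> (\<lambda>v. restr A (subst (elem_sub k k' x) v)) ` W"
        using g vN by (auto simp flip: rs)
    qed (use C(1) in simp)
    moreover have "card ?C = Suc (card C)" using C(1) by (simp add: card_image)
    ultimately show ?thesis using C(3) by simp
  qed
  then have "{x. r x \<le> mp.dim (restr A ` W)} \<subseteq>
      insert 0 {x. \<not> fam_indep ?C (\<lambda>b. \<Sum>l\<le>d. mscale (x ^ l) (?b b l))}"
    by fastforce
  then show "finite {x. r x \<le> mp.dim (restr A ` W)}" using fin2 finite_subset by blast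
qed

text \<open>
  Coordinates in which the ranks of finitely many coordinate projections of finitely many spaces of
  forms have maximal sum: then no elementary substitution increases any of these ranks, so
  every derivation \<open>X k' d/dX k\<close> preserves the spaces to first order.
\<close>

theorem generic_coordinates:
  fixes U :: "'i \<Rightarrow> 'k::field_char_0 mpoly set" and A :: "'e \<Rightarrow> mono set"
  assumes Ix: "finite Ix" and E: "finite E"
    and U: "\<And>i. i \<in> Ix \<Longrightarrow> mp.subspace (U i)" "\<And>i. i \<in> Ix \<Longrightarrow> U i \<subseteq> forms n (d i)"
  shows "\<exists>s\<in>unip n. \<forall>i\<in>Ix. \<forall>e\<in>E. \<forall>k\<in>{3..n}. \<forall>k'\<in>{1..<k}. \<forall>v\<in>s ` U i.
     restr (A e) v = 0 \<longrightarrow> restr (A e) (divop k k' 1 v) \<in> restr (A e) ` s ` U i"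
proof -
  let ?r = "\<lambda>s (i, e). mp.dim (restr (A e) ` s ` U i)"
  let ?P = "\<lambda>s. \<Sum>q\<in>Ix \<times> E. ?r s q"
  have sU: "mp.subspace (s ` U i)" "s ` U i \<subseteq> forms n (d i)" if su: "s \<in> unip n" and iI: "i \<in> Ix" for s i
  proof -
    obtain f where f: "s = subst f" "\<forall>i\<in>{1..n}. f i \<in> forms n 1" using unip_subst[OF su] by blast
    show "mp.subspace (s ` U i)" unfolding f(1) by (rule subspace_linear_image[OF linear_subst U(1)[OF iI]])
    show "s ` U i \<subseteq> forms n (d i)" unfolding f(1) using U(2)[OF iI] f(2) forms_subst by blast
  qed
  let ?M = "\<Sum>(i, e)\<in>Ix \<times> E. mp.dim (forms n (d i) :: 'k mpoly set)"
  have bd: "?P s < Suc ?M" if "s \<in> unip n" for s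
  proof -
    have "?r s (i, e) \<le> mp.dim (forms n (d i) :: 'k mpoly set)" if "i \<in> Ix" for i e
      using sU(2)[OF \<open>s \<in> unip n\<close> that]
      by (auto intro!: dim_mono_fin[OF finite_forms_basis forms_span] forms_restr)
    then have "?P s \<le> ?M" by (intro sum_mono) auto
    then show ?thesis by simp
  qed
  obtain s where s: "s \<in> unip n" "\<And>s'. s' \<in> unip n \<Longrightarrow> ?P s' \<le> ?P s"
  proof -
    have "\<exists>s. s \<in> unip n \<and> (\<forall>s'. s' \<in> unip n \<longrightarrow> ?P s' \<le> ?P s)"
      using unip.id bd by (intro ex_has_greatest_nat[of _ "\<lambda>v. v" _ "Suc ?M"]) (auto intro: less_imp_le)
    then show ?thesis using that by blast
  qed
  show ?thesis
  proof (intro bexI[OF _ s(1)] ballI impI, rule ccontr)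
    fix i e k k' v
    assume i: "i \<in> Ix" and e: "e \<in> E" and k: "k \<in> {3..n}" "k' \<in> {1..<k}"
      and v: "v \<in> s ` U i" "restr (A e) v = 0" "restr (A e) (divop k k' 1 v) \<notin> restr (A e) ` s ` U i"
    have k1: "k \<in> {1..n}" "k' \<in> {1..n}" using k by auto
    let ?t = "\<lambda>x v. subst (elem_sub k k' x) (s v)"
    have im: "restr (A e) ` ?t x ` U i = (\<lambda>v. restr (A e) (subst (elem_sub k k' x) v)) ` s ` U i" for x i e
      by (simp add: image_image)
    have f1: "finite {x. ?r (?t x) q < ?r s q}" if "q \<in> Ix \<times> E" for q
      using that generic_rank(1)[OF sU[OF s(1)] k1] by (cases q) (auto simp: im)
    have f2: "finite {x. ?r (?t x) (i, e) \<le> ?r s (i, e)}"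
      using generic_rank(2)[OF sU[OF s(1) i] k1 v] by (simp add: im)
    let ?bad = "(\<Union>q\<in>Ix \<times> E. {x. ?r (?t x) q < ?r s q}) \<union> {x. ?r (?t x) (i, e) \<le> ?r s (i, e)}"
    have fb: "finite ?bad" using f1 f2 Ix E by auto
    from ex_new_if_finite[OF infinite_UNIV_char_0 fb] obtain x where x: "x \<notin> ?bad" by (rule exE)
    have "?P s < ?P (?t x)"
    proof (rule sum_strict_mono_ex1)
      show "\<forall>q\<in>Ix \<times> E. ?r s q \<le> ?r (?t x) q" using x by (auto simp: not_less)
      show "\<exists>q\<in>Ix \<times> E. ?r s q < ?r (?t x) q" using x i e by (intro bexI[of _ "(i, e)"]) auto
    qed (use Ix E in simp)
    moreover have "?t x \<in> unip n" using unip.step[OF s(1) k] .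
    ultimately show False using s(2)[of "?t x"] by simp
  qed
qed

section \<open>Slices of forms along two variables\<close>

definition tail :: "mono \<Rightarrow> mono" where
  "tail m = Poly_Mapping.update 1 0 (Poly_Mapping.update 2 0 m)"

text \<open>
  Tails are compared at their largest differing index, so that tails without the last variables come
  first.
\<close>

definition tlt :: "mono \<Rightarrow> mono \<Rightarrow> bool" where
  "tlt e f \<longleftrightarrow> (\<exists>i. coef e i < coef f i \<and> (\<forall>j>i. coef e j = coef f j))"

definition below :: "mono \<Rightarrow> mono set" where
  "below e = {m. tlt (tail m) e}"

lemma coef_tail: "coef (tail m) i = (if i = 1 \<or> i = 2 then 0 else coef m i)"
  by (simp add: tail_def lookup_update)

lemma tail_add [simp]: "tail (a + b) = tail a + tail b"
  by (rule poly_mapping_eqI) (simp add: coef_tail lookup_add)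

lemma tail_0 [simp]: "tail 0 = 0"
  by (rule poly_mapping_eqI) (simp add: coef_tail)

lemma tail_single: "tail (Poly_Mapping.single i c) = (if i = 1 \<or> i = 2 then 0 else Poly_Mapping.single i c)"
  by (rule poly_mapping_eqI) (auto simp: coef_tail lookup_single when_def)

lemma tlt_irrefl [simp]: "\<not> tlt e e"
  by (simp add: tlt_def)

lemma tlt_0 [simp]: "\<not> tlt e 0"
  by (simp add: tlt_def)

lemma tlt_trans: "tlt e f \<Longrightarrow> tlt f g \<Longrightarrow> tlt e g"
proof -
  assume "tlt e f" "tlt f g"
  then obtain i j where i: "coef e i < coef f i" "\<forall>k>i. coef e k = coef f k"
    and j: "coef f j < coef g j" "\<forall>k>j. coef f k = coef g k"
    unfolding tlt_def by blast
  show ?thesis unfolding tlt_def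
  proof (intro exI[of _ "max i j"] conjI allI impI)
    show "coef e (max i j) < coef g (max i j)"
      using i j by (cases i j rule: linorder_cases) (auto simp: max_def)
  qed (use i j in auto)
qed

lemma tlt_total: "e \<noteq> f \<Longrightarrow> tlt e f \<or> tlt f e"
proof -
  assume "e \<noteq> f"
  let ?D = "{i. coef e i \<noteq> coef f i}"
  have "?D \<subseteq> supp e \<union> supp f" by (auto simp: in_keys_iff)
  then have fin: "finite ?D" by (rule finite_subset) simp
  have ne: "?D \<noteq> {}"
  proof
    assume "?D = {}"
    then have "coef e i = coef f i" for i by blast
    then show False using \<open>e \<noteq> f\<close> poly_mapping_eqI by blast
  qed
  define i where "i = Max ?D"
  have i: "coef e i \<noteq> coef f i" using Max_in[OF fin ne] by (simp add: i_def)
  have eq: "coef e j = coef f j" if "i < j" for j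
  proof (rule ccontr)
    assume "coef e j \<noteq> coef f j"
    then have "j \<le> i" unfolding i_def by (intro Max_ge fin) simp
    then show False using that by simp
  qed
  from i consider "coef e i < coef f i" | "coef f i < coef e i" by linarith
  then show ?thesis
  proof cases
    case 1
    then show ?thesis unfolding tlt_def using eq by blast
  next
    case 2
    have "\<forall>j>i. coef f j = coef e j" using eq by simp
    then show ?thesis unfolding tlt_def using 2 by blast
  qed
qed

lemma tlt_add_right [simp]: "tlt (e + g) (f + g) \<longleftrightarrow> tlt e f"
  by (simp add: tlt_def lookup_add)

lemma tlt_add_unit: "tlt e (e + Poly_Mapping.single k (Suc c))"
  by (auto simp: tlt_def lookup_add lookup_single when_def)

lemma tlt_units: "i < k \<Longrightarrow> tlt (e + unit_at i) (e + unit_at k)"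
  unfolding tlt_def by (rule exI[of _ k]) (auto simp: lookup_add lookup_single when_def)

lemma tlt_supp: "tlt e f \<Longrightarrow> supp f \<subseteq> {..p} \<Longrightarrow> supp e \<subseteq> {..p}"
proof -
  assume "tlt e f" and f: "supp f \<subseteq> {..p}"
  then obtain i where i: "coef e i < coef f i" "\<forall>j>i. coef e j = coef f j" unfolding tlt_def by blast
  have "i \<in> supp f" using i(1) by (simp add: in_keys_iff)
  then have ip: "i \<le> p" using f by blast
  show ?thesis
  proof
    fix j assume j: "j \<in> supp e"
    show "j \<in> {..p}"
    proof (cases "j \<le> i")
      case False
      then have "coef f j = coef e j" using i(2) by simp
      then have "j \<in> supp f" using j by (simp add: in_keys_iff)
      then show ?thesis using f by blast
    qed (use ip in simp)
  qed
qed

text \<open>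
  The coefficient of the tail \<open>e\<close>, with \<open>X 1 = 1\<close> and \<open>X 2\<close> as the variable of the polynomial. For a form
  nothing is lost, because the exponent of \<open>X 1\<close> is determined by the degree.
\<close>

definition slice :: "mono \<Rightarrow> 'k::field mpoly \<Rightarrow> 'k poly" where
  "slice e v = (\<Sum>m\<in>supp v. if tail m = e then monom (coef v m) (coef m 2) else 0)"

lemma slice_add: "slice e (v + w) = slice e v + slice e w"
  unfolding slice_def
  by (rule setsum_keys_plus_distrib) (auto simp: add_monom)

lemma slice_0 [simp]: "slice e 0 = 0"
  by (simp add: slice_def)

lemma slice_single: "slice e (Poly_Mapping.single m c) = (if tail m = e then monom c (coef m 2) else 0)"
  by (cases "c = 0") (auto simp: slice_def)

lemma slice_mscale: "slice e (mscale c v) = smult c (slice e v)"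
  by (rule additive_eq_on_singles[of "\<lambda>v. slice e (mscale c v)" "\<lambda>v. smult c (slice e v)"])
    (auto simp: slice_add mp.scale_right_distrib smult_add_right slice_single smult_monom)

lemma slice_diff: "slice e (v - w) = slice e v - slice e w"
  using slice_add[of e "v - w" w] by simp

lemma slice_sum: "slice e (sum h A) = (\<Sum>a\<in>A. slice e (h a))"
  by (induction A rule: infinite_finite_induct) (auto simp: slice_add)

lemma slice_restr: "(\<And>m. m \<in> supp v \<Longrightarrow> tail m = e \<Longrightarrow> m \<in> A) \<Longrightarrow> slice e (restr A v) = slice e v"
  by (rule additive_eq_on_singles[of "\<lambda>v. slice e (restr A v)" "slice e"])
    (auto simp: slice_add restr_add restr_single slice_single)

lemma slice_eq_0: "(\<And>m. m \<in> supp v \<Longrightarrow> tail m \<noteq> e) \<Longrightarrow> slice e v = 0"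
  unfolding slice_def by (intro sum.neutral) auto

lemma slice_below: "restr (below f) v = 0 \<Longrightarrow> tlt e f \<Longrightarrow> slice e v = 0"
  by (rule slice_eq_0) (auto simp: restr_eq_0_iff below_def)

lemma slice_0_mult: "slice 0 (v * w) = slice 0 v * slice 0 w"
proof (rule additive_eq_on_singles[of "\<lambda>v. slice 0 (v * w)" "\<lambda>v. slice 0 v * slice 0 w"])
  fix m
  let ?s = "Poly_Mapping.single m (coef v m)"
  show "slice 0 (?s * w) = slice 0 ?s * slice 0 w"
  proof (rule additive_eq_on_singles[of "\<lambda>w. slice 0 (?s * w)" "\<lambda>w. slice 0 ?s * slice 0 w"])
    fix m'
    have "tail m + tail m' = 0 \<longleftrightarrow> tail m = 0 \<and> tail m' = 0"
      by (metis add_is_0 mdeg_add mdeg_eq_0_iff)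
    then show "slice 0 (?s * Poly_Mapping.single m' (coef w m')) = slice 0 ?s * slice 0 (Poly_Mapping.single m' (coef w m'))"
      by (auto simp: mult_single slice_single lookup_add mult_monom)
  qed (auto simp: slice_add distrib_left)
qed (auto simp: slice_add distrib_right)

lemma slice_X_mult:
  "slice (e + tail (unit_at k)) (X k * v) = monom 1 (if k = 2 then 1 else 0) * slice e v"
  by (rule additive_eq_on_singles[of "\<lambda>v. slice (e + tail (unit_at k)) (X k * v)" "\<lambda>v. monom 1 (if k = 2 then 1 else 0) * slice e v"])
    (auto simp: slice_add distrib_left X_def mult_single slice_single lookup_add lookup_single add.commute mult_monom when_def)

lemma restr_below_X_mult:
  assumes "restr (below e) v = 0" shows "restr (below (e + tail (unit_at k))) (X k * v) = 0"
proof -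
  have "supp (X k * v) \<subseteq> {a + b | a b. a \<in> supp (X k :: 'a mpoly) \<and> b \<in> supp v}" by (rule keys_mult)
  then show ?thesis
    using assms by (fastforce simp: restr_eq_0_iff below_def X_def add.commute[of "tail (unit_at k)"] simp del: One_nat_def)
qed

lemma degree_slice_0: "v \<in> forms n d \<Longrightarrow> degree (slice 0 v) \<le> d"
  unfolding slice_def
proof (rule degree_sum_le)
  fix m assume v: "v \<in> forms n d" and m: "m \<in> supp v"
  have "coef m 2 \<le> d" using coef_le_mdeg[of m 2] v m by (auto simp: forms_iff)
  then show "degree (if tail m = 0 then monom (coef v m) (coef m 2) else 0) \<le> d"
    using degree_monom_le[of "coef v m" "coef m 2"] by auto
qed simp

lemma mdeg_tail: "mdeg m = coef m 1 + coef m 2 + mdeg (tail m)"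
proof -
  have "m = Poly_Mapping.single 1 (coef m 1) + Poly_Mapping.single 2 (coef m 2) + tail m"
    by (rule poly_mapping_eqI) (auto simp: lookup_add lookup_single coef_tail when_def)
  then have "mdeg m = mdeg (Poly_Mapping.single 1 (coef m 1) + Poly_Mapping.single 2 (coef m 2) + tail m)" by simp
  then show ?thesis by simp
qed

lemma coeff_slice:
  assumes v: "v \<in> forms n d" and m: "m \<in> supp v"
  shows "coeff (slice (tail m) v) (coef m 2) = coef v m"
proof -
  have "m' = m" if "m' \<in> supp v" "tail m' = tail m" "coef m' 2 = coef m 2" for m'
  proof (rule poly_mapping_eqI)
    have "mdeg m' = mdeg m" using v m that(1) by (simp add: forms_iff)
    then have "coef m' 1 = coef m 1" using mdeg_tail[of m] mdeg_tail[of m'] that by simp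
    then show "coef m' i = coef m i" for i
      using that(3) arg_cong[OF that(2), of "\<lambda>e. coef e i"] by (cases "i = 1 \<or> i = 2") (auto simp: coef_tail)
  qed
  then have "(\<Sum>m'\<in>supp v. coeff (if tail m' = tail m then monom (coef v m') (coef m' 2) else 0) (coef m 2)) =
     (\<Sum>m'\<in>{m}. coef v m')"
    using m by (intro sum.mono_neutral_cong_right) auto
  then show ?thesis by (simp add: slice_def coeff_sum)
qed

lemma leading_tail:
  assumes v: "v \<in> forms n d" "v \<noteq> 0"
  shows "\<exists>!e. restr (below e) v = 0 \<and> slice e v \<noteq> 0"
proof (rule ex_ex1I)
  have "\<exists>a\<in>tail ` supp v. \<forall>x\<in>tail ` supp v - {a}. tlt a x"
  proof (rule finite_total_least)
    show "tail ` supp v \<noteq> {}" using v(2) by auto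
    show "tlt x z" if "tlt x y" "tlt y z" for x y z using that by (rule tlt_trans)
    show "tlt x y \<or> tlt y x" if "x \<noteq> y" for x y using that by (rule tlt_total)
  qed simp
  then obtain m where m: "m \<in> supp v" "\<forall>x\<in>tail ` supp v - {tail m}. tlt (tail m) x" by blast
  have "restr (below (tail m)) v = 0"
    unfolding restr_eq_0_iff below_def
  proof (rule ccontr)
    assume "supp v \<inter> {ma. tlt (tail ma) (tail m)} \<noteq> {}"
    then obtain m' where m': "m' \<in> supp v" "tlt (tail m') (tail m)" by blast
    then have "tail m' \<noteq> tail m" by auto
    then have "tlt (tail m) (tail m')" using m(2) m'(1) by blast
    then show False using m'(2) tlt_trans tlt_irrefl by blast
  qed
  moreover have "slice (tail m) v \<noteq> 0" using coeff_slice[OF v(1) m(1)] m(1) by (auto simp: in_keys_iff)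
  ultimately show "\<exists>e. restr (below e) v = 0 \<and> slice e v \<noteq> 0" by blast
next
  fix e f assume "restr (below e) v = 0 \<and> slice e v \<noteq> 0" "restr (below f) v = 0 \<and> slice f v \<noteq> 0"
  then show "e = f" using tlt_total[of e f] slice_below by blast
qed

subsection \<open>Leading slices\<close>

definition lslice :: "'k::field mpoly set \<Rightarrow> mono \<Rightarrow> 'k poly set" where
  "lslice W e = {slice e v | v. v \<in> W \<and> restr (below e) v = 0}"

lemma lslice_X_mult:
  assumes "w \<in> lslice W e" "\<And>v. v \<in> W \<Longrightarrow> X k * v \<in> W'"
  shows "monom 1 (if k = 2 then 1 else 0) * w \<in> lslice W' (e + tail (unit_at k))"
proof -
  obtain v where v: "v \<in> W" "restr (below e) v = 0" "w = slice e v" using assms(1) by (auto simp: lslice_def)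
  show ?thesis unfolding lslice_def mem_Collect_eq
    using assms(2)[OF v(1)] slice_X_mult[of e k v] restr_below_X_mult[OF v(2), of k] v(3)
    by (intro exI[of _ "X k * v"]) (simp only:)
qed

definition stable_coords :: "nat \<Rightarrow> mono set \<Rightarrow> 'k::field mpoly set \<Rightarrow> bool" where
  "stable_coords n E W \<longleftrightarrow> (\<forall>e\<in>E. \<forall>k\<in>{3..n}. \<forall>k'\<in>{1..<k}. \<forall>v\<in>W.
     restr (below e) v = 0 \<longrightarrow> restr (below e) (divop k k' 1 v) \<in> restr (below e) ` W)"

text \<open>
  The derivation \<open>X k' d/dX k\<close> lowers the leading tail by one factor \<open>X k\<close>; characteristic zero enters
  because the leading slice is multiplied by the exponent of \<open>X k\<close>.
\<close>

lemma lslice_stable: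
  fixes W :: "'k::field_char_0 mpoly set"
  assumes W: "mp.subspace W" "stable_coords n E W" and e: "e + unit_at k \<in> E" and k: "k \<in> {3..n}" "k' \<in> {1..<k}"
    and w: "w \<in> lslice W (e + unit_at k)"
  shows "monom 1 (if k' = 2 then 1 else 0) * w \<in> lslice W (e + tail (unit_at k'))"
proof -
  let ?f = "e + unit_at k" and ?g = "e + tail (unit_at k')" and ?y = "monom (1::'k) (if k' = 2 then 1 else 0)"
  have gf: "tlt ?g ?f"
    using tlt_add_unit[of e k 0] tlt_units[of k' k e] k by (auto simp: tail_single)
  obtain v where v: "v \<in> W" "restr (below ?f) v = 0" "w = slice ?f v" using w by (auto simp: lslice_def)
  then obtain u where u: "u \<in> W" "restr (below ?f) u = restr (below ?f) (divop k k' 1 v)"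
    using W(2) e k unfolding stable_coords_def by (metis imageE)
  have shift: "tail (m - unit_at k + unit_at k') + unit_at k = tail m + tail (unit_at k')"
    "coef (m - unit_at k + unit_at k') 2 = coef m 2 + (if k' = 2 then 1 else 0)"
    if "coef m k \<noteq> 0" for m
  proof -
    have "m - unit_at k + unit_at k = m" using that by (intro mono_minus_add) (simp add: in_keys_iff)
    then have "tail (m - unit_at k) + unit_at k = tail m"
      using tail_add[of "m - unit_at k" "unit_at k"] k by (simp add: tail_single)
    have "tail (m - unit_at k + unit_at k') + unit_at k = (tail (m - unit_at k) + unit_at k) + tail (unit_at k')"
      by (simp only: tail_add ac_simps)
    then show "tail (m - unit_at k + unit_at k') + unit_at k = tail m + tail (unit_at k')"
      unfolding \<open>tail (m - unit_at k) + unit_at k = tail m\<close> .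
    show "coef (m - unit_at k + unit_at k') 2 = coef m 2 + (if k' = 2 then 1 else 0)"
      using k by (auto simp: lookup_add lookup_minus lookup_single when_def)
  qed
  have sl: "slice ?g (divop k k' 1 v) = smult (of_nat (coef ?f k)) (?y * slice ?f v)"
  proof (rule additive_eq_on_singles[of "\<lambda>v. slice ?g (divop k k' 1 v)" "\<lambda>v. smult (of_nat (coef ?f k)) (?y * slice ?f v)"])
    fix m
    show "slice ?g (divop k k' 1 (Poly_Mapping.single m (coef v m))) =
      smult (of_nat (coef ?f k)) (?y * slice ?f (Poly_Mapping.single m (coef v m)))"
    proof (cases "coef m k = 0")
      case True
      have "tail m \<noteq> ?f"
      proof
        assume t: "tail m = ?f"
        have "coef (tail m) k = 0" using True k by (simp add: coef_tail)
        then show False unfolding t by (simp add: lookup_add)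
      qed
      then show ?thesis using True by (simp add: divop_single slice_single)
    next
      case False
      have "tail (m - unit_at k + unit_at k') = ?g \<longleftrightarrow> tail m = ?f"
      proof -
        have "tail (m - unit_at k + unit_at k') = ?g \<longleftrightarrow>
            tail (m - unit_at k + unit_at k') + unit_at k = ?g + unit_at k" by simp
        also have "\<dots> \<longleftrightarrow> tail m + tail (unit_at k') = ?f + tail (unit_at k')"
          unfolding shift(1)[OF False] by (simp only: ac_simps)
        finally show ?thesis by simp
      qed
      moreover have "coef m k = coef ?f k" if "tail m = ?f"
        using arg_cong[OF that, of "\<lambda>e. coef e k"] k by (simp add: coef_tail)
      moreover have "divop k k' 1 (Poly_Mapping.single m (coef v m)) =
         Poly_Mapping.single (m - unit_at k + unit_at k') (coef v m * of_nat (coef m k))"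
        by (simp add: divop_single)
      ultimately show ?thesis using shift(2)[OF False]
        by (auto simp: slice_single mult_monom smult_monom mult.commute add.commute simp del: One_nat_def)
    qed
  qed (auto simp: divop_add slice_add distrib_left smult_add_right)
  have su: "restr (below ?g) u = 0" unfolding restr_eq_0_iff
  proof (rule ccontr)
    assume "supp u \<inter> below ?g \<noteq> {}"
    then obtain m where m: "m \<in> supp u" "tlt (tail m) ?g" by (auto simp: below_def)
    then have mf: "m \<in> below ?f" using gf tlt_trans unfolding below_def by blast
    have "coef (restr (below ?f) u) m = coef (restr (below ?f) (divop k k' 1 v)) m" using u(2) by simp
    then have "m \<in> supp (divop k k' 1 v)" using mf m(1) by (simp add: in_keys_iff)
    moreover have "supp (divop k k' 1 v) \<subseteq> {m - unit_at k + unit_at k' | m. m \<in> supp v \<and> coef m k \<noteq> 0}"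
    proof -
      have "supp (divop k k' 1 v) \<subseteq> (\<Union>m\<in>supp v. supp (Poly_Mapping.single
          (m - unit_at k + unit_at k') (coef v m * of_nat (coef m k choose 1))))"
        unfolding divop_def by (rule keys_sum)
      then show ?thesis by (fastforce split: if_splits simp del: One_nat_def)
    qed
    ultimately obtain m' where m': "m = m' - unit_at k + unit_at k'" "m' \<in> supp v" "coef m' k \<noteq> 0" by blast
    have "tlt (tail m + unit_at k) (?g + unit_at k)" using m(2) by simp
    then have "tlt (tail m' + tail (unit_at k')) (?f + tail (unit_at k'))"
      unfolding m'(1) shift(1)[OF m'(3)] by (simp only: ac_simps)
    then have "tlt (tail m') ?f" by simp
    then show False using v(2) m'(2) by (auto simp: restr_eq_0_iff below_def)
  qed
  have "slice ?g u = slice ?g (restr (below ?f) u)"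
    using gf by (intro slice_restr[symmetric]) (auto simp: below_def)
  also have "\<dots> = slice ?g (divop k k' 1 v)"
    unfolding u(2) using gf by (intro slice_restr) (auto simp: below_def)
  finally have sg: "slice ?g u = smult (of_nat (coef ?f k)) (?y * w)" using sl v(3) by simp
  let ?c = "inverse (of_nat (coef ?f k)) :: 'k"
  have nz: "(of_nat (coef ?f k) :: 'k) \<noteq> 0" unfolding of_nat_eq_0_iff by (simp add: lookup_add)
  have "mscale ?c u \<in> W" using W(1) u(1) by (rule mp.subspace_scale)
  moreover have "restr (below ?g) (mscale ?c u) = 0" using su by (simp add: restr_mscale)
  moreover have "slice ?g (mscale ?c u) = ?y * w" unfolding slice_mscale sg using nz by simp
  ultimately show ?thesis unfolding lslice_def by (intro CollectI exI[of _ "mscale ?c u"]) simp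
qed

definition tails :: "nat \<Rightarrow> nat \<Rightarrow> mono set" where
  "tails n D = {e. supp e \<subseteq> {3..n} \<and> mdeg e \<le> D}"

lemma finite_tails: "finite (tails n D)"
proof -
  have "tails n D \<subseteq> {u \<in> ymonos n. mdeg u < Suc D}" by (auto simp: tails_def ymonos_def)
  then show ?thesis using finite_ymonos_less finite_subset by blast
qed

text \<open>
  Apply \<open>lslice_stable\<close> once for each factor of the tail, with \<open>X 2\<close> as the replacement for \<open>b\<close> of the
  factors and with \<open>X 1\<close> for the others.
\<close>

lemma lslice_descend:
  fixes W :: "'k::field_char_0 mpoly set"
  assumes W: "mp.subspace W" "stable_coords n (tails n D) W"
    and e: "e \<in> tails n D" and w: "w \<in> lslice W e" and b: "b \<le> mdeg e"
  shows "monom 1 b * w \<in> lslice W 0"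
  using e w b
proof (induction "mdeg e" arbitrary: e w b)
  case 0
  then show ?case by (simp flip: one_pCons add: monom_0)
next
  case (Suc d)
  then have "e \<noteq> 0" by auto
  let ?k = "Max (supp e)"
  let ?f = "e - unit_at ?k"
  have k: "?k \<in> supp e" using \<open>e \<noteq> 0\<close> Max_supp by blast
  have e: "?f + unit_at ?k = e" using mono_minus_add[OF k] .
  have k3: "?k \<in> {3..n}" using k Suc.prems(1) by (auto simp: tails_def)
  have df: "d = mdeg ?f" using Suc.hyps(2) arg_cong[OF e, of mdeg] by simp
  have f: "?f \<in> tails n D"
    using Suc.prems(1) e df Suc.hyps(2) supp_add[of ?f "unit_at ?k"] by (auto simp: tails_def)
  have st: "monom 1 (if k' = 2 then 1 else 0) * w \<in> lslice W (?f + tail (unit_at k'))" if "k' \<in> {1..<?k}" for k'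
    using lslice_stable[OF W, of ?f ?k k' w] that e k3 Suc.prems(1,2) by simp
  have s1: "w \<in> lslice W ?f" using st[of 1] k3 by (simp add: tail_single flip: one_pCons add: monom_0)
  have s2: "monom 1 1 * w \<in> lslice W ?f" using st[of 2] k3 by (simp add: tail_single)
  show ?case
  proof (cases b)
    case 0
    then show ?thesis using Suc.hyps(1)[OF df f s1, of 0] by simp
  next
    case (Suc b')
    then have "b' \<le> mdeg ?f" using Suc.prems(3) df Suc.hyps(2) by simp
    then have "monom 1 b' * (monom 1 1 * w) \<in> lslice W 0" using Suc.hyps(1)[OF df f s2] by blast
    then show ?thesis using Suc by (simp add: mult_monom flip: mult.assoc)
  qed
qed

section \<open>Frames: embedding slices into a free module\<close>

definition pfree :: "nat \<Rightarrow> nat set \<Rightarrow> (nat \<Rightarrow> 'k::field poly) \<Rightarrow> bool" where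
  "pfree F A q \<longleftrightarrow> (\<forall>h. (\<forall>i\<in>A. degree (h i) \<le> F) \<and> (\<Sum>i\<in>A. h i * q i) = 0 \<longrightarrow> (\<forall>i\<in>A. h i = 0))"

lemma pfreeD: "pfree F A q \<Longrightarrow> (\<And>i. i \<in> A \<Longrightarrow> degree (h i) \<le> F) \<Longrightarrow> (\<Sum>i\<in>A. h i * q i) = 0 \<Longrightarrow> i \<in> A \<Longrightarrow> h i = 0"
  unfolding pfree_def by blast

lemma pfree_antimono: "pfree F A q \<Longrightarrow> G \<le> F \<Longrightarrow> pfree G A q"
  unfolding pfree_def using le_trans by blast

text \<open>
  Cramer's rule expresses \<open>z\<close> by the family only after multiplication by a denominator \<open>D\<close>, which is the
  same for all \<open>z\<close>.
\<close>

definition rep :: "nat set \<Rightarrow> (nat \<Rightarrow> 'k::field poly) \<Rightarrow> 'k poly \<Rightarrow> nat \<Rightarrow> 'k poly \<Rightarrow> (nat \<Rightarrow> 'k poly) \<Rightarrow> bool" where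
  "rep A q D c z h \<longleftrightarrow> (\<forall>i\<in>A. degree (h i) \<le> c) \<and> (\<forall>i. i \<notin> A \<longrightarrow> h i = 0) \<and> D * z = (\<Sum>i\<in>A. h i * q i)"

text \<open>
  The properties of the leading data that come from the derivations: a factor \<open>X k\<close> of the tail is
  replaced by \<open>X 1\<close>, by \<open>X 2\<close>, or by \<open>X k'\<close>.
\<close>

definition tail_closed :: "nat \<Rightarrow> (mono \<times> nat \<times> nat) set \<Rightarrow> bool" where
  "tail_closed n V \<longleftrightarrow> (\<forall>e k i b. (e + unit_at k, i, b) \<in> V \<longrightarrow>
     (e, i, b) \<in> V \<and> (e, i, Suc b) \<in> V \<and> (\<forall>k'\<in>{3..<k}. (e + unit_at k', i, b) \<in> V))"

text \<open>
  The properties of the leading data that come from multiplication by \<open>X 1\<close>, \<open>X 2\<close> and \<open>X k\<close>.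
\<close>

definition tail_shadow :: "nat \<Rightarrow> (mono \<times> nat \<times> nat) set \<Rightarrow> (mono \<times> nat \<times> nat) set \<Rightarrow> bool" where
  "tail_shadow n V V' \<longleftrightarrow> (\<forall>e i b. (e, i, b) \<in> V \<longrightarrow>
     (e, i, b) \<in> V' \<and> (e, i, Suc b) \<in> V' \<and> (\<forall>k\<in>{3..n}. (e + unit_at k, i, b) \<in> V'))"

locale poly_frame =
  fixes A :: "nat set" and q :: "nat \<Rightarrow> 'k::field_char_0 poly" and D :: "'k poly" and c F :: nat
  assumes finA: "finite A" and free: "pfree F A q" and D0: "D \<noteq> 0" and cF: "c < F"
begin

definition dom :: "'k poly set" where "dom = {z. \<exists>h. rep A q D c z h}"

definition crd :: "'k poly \<Rightarrow> nat \<Rightarrow> 'k poly" where "crd z = (THE h. rep A q D F z h)"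

lemma rep_unique: "rep A q D F z h \<Longrightarrow> rep A q D F z h' \<Longrightarrow> h = h'"
proof
  fix i assume h: "rep A q D F z h" and h': "rep A q D F z h'"
  show "h i = h' i"
  proof (cases "i \<in> A")
    case True
    have "(\<Sum>i\<in>A. (h i - h' i) * q i) = 0"
      using h h' by (simp add: rep_def left_diff_distrib sum_subtractf)
    moreover have "degree (h i - h' i) \<le> F" if "i \<in> A" for i
      using h h' that by (intro degree_diff_le) (auto simp: rep_def)
    ultimately have "h i - h' i = 0" using pfreeD[OF free, of "\<lambda>i. h i - h' i"] True by blast
    then show ?thesis by simp
  qed (use h h' in \<open>simp add: rep_def\<close>)
qed

lemma crd_eq: "rep A q D F z h \<Longrightarrow> crd z = h"
  unfolding crd_def using rep_unique by blast

lemma rep_mono: "rep A q D b z h \<Longrightarrow> b \<le> b' \<Longrightarrow> rep A q D b' z h"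
  unfolding rep_def using le_trans by blast

lemma rep_crd: "z \<in> dom \<Longrightarrow> rep A q D c z (crd z)"
  unfolding dom_def using crd_eq rep_mono[of c _ _ F] cF by fastforce

lemma rep_add: "rep A q D b z h \<Longrightarrow> rep A q D b w g \<Longrightarrow> rep A q D b (z + w) (\<lambda>i. h i + g i)"
  by (auto simp: rep_def distrib_left distrib_right sum.distrib intro: degree_add_le)

lemma smult_sum_right: "smult a (sum h B) = (\<Sum>i\<in>B. smult a (h i :: 'k poly))"
  by (induction B rule: infinite_finite_induct) (auto simp: smult_add_right)

lemma rep_smult: "rep A q D b z h \<Longrightarrow> rep A q D b (smult a z) (\<lambda>i. smult a (h i))"
  by (auto simp: rep_def smult_sum_right intro: le_trans[OF degree_smult_le])

lemma dom_add: "z \<in> dom \<Longrightarrow> w \<in> dom \<Longrightarrow> z + w \<in> dom \<and> crd (z + w) = (\<lambda>i. crd z i + crd w i)"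
  using rep_add[OF rep_crd rep_crd, of z w] crd_eq[OF rep_mono[of c]] cF unfolding dom_def by fastforce

lemma dom_smult: "z \<in> dom \<Longrightarrow> smult a z \<in> dom \<and> crd (smult a z) = (\<lambda>i. smult a (crd z i))"
  using rep_smult[OF rep_crd, of z a] crd_eq[OF rep_mono[of c]] cF unfolding dom_def by fastforce

lemma dom_diff_smult: "z \<in> dom \<Longrightarrow> w \<in> dom \<Longrightarrow>
    z - smult a w \<in> dom \<and> crd (z - smult a w) = (\<lambda>i. crd z i - smult a (crd w i))"
  using dom_add[of z "smult (- a) w"] dom_smult[of w "- a"] by (simp add: fun_eq_iff)

lemma crd_monom:
  assumes "z \<in> dom" "c + b \<le> F"
  shows "crd (monom 1 b * z) = (\<lambda>i. monom 1 b * crd z i)"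
proof (rule crd_eq)
  have r: "rep A q D c z (crd z)" using assms(1) by (rule rep_crd)
  have "degree (monom 1 b * crd z i) \<le> F" if "i \<in> A" for i
  proof -
    have "degree (monom 1 b * crd z i) \<le> b + degree (crd z i)"
      using degree_mult_le[of "monom 1 b" "crd z i"] degree_monom_le[of 1 b] by (meson add_le_mono1 le_trans)
    moreover have "degree (crd z i) \<le> c" using r that by (simp add: rep_def)
    ultimately show ?thesis using assms(2) by linarith
  qed
  moreover have "D * (monom 1 b * z) = (\<Sum>i\<in>A. monom 1 b * crd z i * q i)"
  proof -
    have "D * (monom 1 b * z) = monom 1 b * (D * z)" by (simp add: mult.left_commute)
    also have "D * z = (\<Sum>i\<in>A. crd z i * q i)" using r by (simp add: rep_def)
    finally show ?thesis by (simp add: sum_distrib_left mult.assoc)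
  qed
  ultimately show "rep A q D F (monom 1 b * z) (\<lambda>i. monom 1 b * crd z i)"
    using r by (simp add: rep_def)
qed

definition idx :: "'k poly \<Rightarrow> nat" where "idx z = Max {i. crd z i \<noteq> 0}"

definition lead :: "'k poly \<Rightarrow> nat \<times> nat" where "lead z = (idx z, degree (crd z (idx z)))"

lemma crd_support: "z \<in> dom \<Longrightarrow> {i. crd z i \<noteq> 0} \<subseteq> A"
  using rep_crd[of z] by (auto simp: rep_def)

lemma finite_crd_support: "z \<in> dom \<Longrightarrow> finite {i. crd z i \<noteq> 0}"
  using crd_support finA finite_subset by blast

lemma crd_idx:
  assumes "z \<in> dom" "z \<noteq> 0"
  shows "idx z \<in> A" "crd z (idx z) \<noteq> 0" "j > idx z \<Longrightarrow> crd z j = 0"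
proof -
  have "{i. crd z i \<noteq> 0} \<noteq> {}"
  proof
    assume "{i. crd z i \<noteq> 0} = {}"
    then have "D * z = 0" using rep_crd[OF assms(1)] by (simp add: rep_def)
    then show False using D0 assms(2) by simp
  qed
  then have i: "idx z \<in> {i. crd z i \<noteq> 0}"
    unfolding idx_def using finite_crd_support[OF assms(1)] by (intro Max_in)
  then show "idx z \<in> A" "crd z (idx z) \<noteq> 0" using crd_support[OF assms(1)] by auto
  show "crd z j = 0" if "j > idx z"
  proof (rule ccontr)
    assume "crd z j \<noteq> 0"
    then have "j \<le> idx z" unfolding idx_def using finite_crd_support[OF assms(1)] by (intro Max_ge) auto
    then show False using that by simp
  qed
qed

lemma leadI:
  assumes "z \<in> dom" "crd z i \<noteq> 0" "\<And>j. j > i \<Longrightarrow> crd z j = 0"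
  shows "lead z = (i, degree (crd z i))" "z \<noteq> 0"
proof -
  have "idx z = i" unfolding idx_def
    using finite_crd_support[OF assms(1)] assms(2,3) by (intro Max_eqI) (auto intro: leI)
  then show "lead z = (i, degree (crd z i))" by (simp add: lead_def)
  have "rep A q D F 0 (\<lambda>i. 0)" by (simp add: rep_def)
  then have "crd 0 = (\<lambda>i. 0)" by (rule crd_eq)
  then show "z \<noteq> 0" using assms(2) by auto
qed

lemma zero_dom: "0 \<in> dom"
  unfolding dom_def by (auto simp: rep_def intro!: exI[of _ "\<lambda>i. 0"])

definition llt :: "nat \<times> nat \<Rightarrow> nat \<times> nat \<Rightarrow> bool" where
  "llt a b \<longleftrightarrow> fst a < fst b \<or> (fst a = fst b \<and> snd a < snd b)"

lemma lead_add_less: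
  assumes z: "z \<in> dom" "z \<noteq> 0" and w: "w \<in> dom" "w \<noteq> 0" and l: "llt (lead w) (lead z)"
  shows "lead (z + w) = lead z" "z + w \<noteq> 0"
proof -
  have s: "z + w \<in> dom" "crd (z + w) = (\<lambda>i. crd z i + crd w i)" using dom_add z w by auto
  note cz = crd_idx[OF z] and cw = crd_idx[OF w]
  have iw: "idx w < idx z \<or> (idx w = idx z \<and> degree (crd w (idx z)) < degree (crd z (idx z)))"
    using l by (auto simp: llt_def lead_def)
  have d: "crd z (idx z) + crd w (idx z) \<noteq> 0 \<and> degree (crd z (idx z) + crd w (idx z)) = degree (crd z (idx z))"
  proof (cases "idx w < idx z")
    case True
    then show ?thesis using cw(3) cz(2) by simp
  next
    case False
    then have "degree (crd w (idx z)) < degree (crd z (idx z))" using iw by auto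
    then show ?thesis
      using degree_add_eq_left[of "crd w (idx z)" "crd z (idx z)"] by (metis degree_0 gr_implies_not0)
  qed
  have "crd (z + w) j = 0" if "j > idx z" for j
    using s(2) cz(3)[OF that] cw(3)[of j] that iw by auto
  then have "lead (z + w) = (idx z, degree (crd (z + w) (idx z)))" "z + w \<noteq> 0"
    using leadI[OF s(1), of "idx z"] d s(2) by auto
  then show "lead (z + w) = lead z" "z + w \<noteq> 0" using d s(2) by (auto simp: lead_def)
qed

lemma lead_same:
  assumes z: "z \<in> dom" "z \<noteq> 0" and w: "w \<in> dom" "w \<noteq> 0" and l: "lead z = lead w"
  shows "\<exists>a. z - smult a w = 0 \<or> llt (lead (z - smult a w)) (lead z)"
proof -
  note cz = crd_idx[OF z] and cw = crd_idx[OF w]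
  let ?i = "idx z"
  have i: "idx w = ?i" "degree (crd w ?i) = degree (crd z ?i)" using l by (auto simp: lead_def)
  let ?a = "lead_coeff (crd z ?i) / lead_coeff (crd w ?i)"
  let ?u = "z - smult ?a w"
  have u: "?u \<in> dom" "crd ?u = (\<lambda>i. crd z i - smult ?a (crd w i))" using dom_diff_smult z w by auto
  have "?u = 0 \<or> llt (lead ?u) (lead z)"
  proof (rule disjCI)
    assume n: "\<not> llt (lead ?u) (lead z)"
    show "?u = 0"
    proof (rule ccontr)
      assume nz: "?u \<noteq> 0"
      note cu = crd_idx[OF u(1) nz]
      have "crd ?u j = 0" if "j > ?i" for j using u(2) cz(3) cw(3) i(1) that by simp
      then have le: "idx ?u \<le> ?i" using cu(2) by (meson not_le)
      show False
      proof (cases "idx ?u = ?i")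
        case True
        have ci: "crd ?u ?i = crd z ?i - smult ?a (crd w ?i)" using u(2) by simp
        have cwn: "crd w ?i \<noteq> 0" using cw(2) i(1) by simp
        have "degree (crd ?u ?i) \<le> degree (crd z ?i)"
          unfolding ci using i(2) by (intro degree_diff_le) (auto intro: le_trans[OF degree_smult_le])
        moreover have "coeff (crd ?u ?i) (degree (crd z ?i)) = 0"
        proof -
          have "coeff (crd w ?i) (degree (crd z ?i)) \<noteq> 0"
            unfolding i(2)[symmetric] using cwn by simp
          then show ?thesis unfolding ci by (simp add: i(2))
        qed
        moreover have "crd ?u ?i \<noteq> 0" using cu(2) True by simp
        ultimately have "degree (crd ?u ?i) < degree (crd z ?i)"
          by (metis leading_coeff_0_iff le_neq_implies_less)
        then show False using n True by (simp add: llt_def lead_def)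
      qed (use n le in \<open>auto simp: llt_def lead_def\<close>)
    qed
  qed
  then show ?thesis by blast
qed

lemma lead_smult:
  assumes z: "z \<in> dom" "z \<noteq> 0" and a: "a \<noteq> 0"
  shows "lead (smult a z) = lead z"
proof -
  have s: "smult a z \<in> dom" "crd (smult a z) = (\<lambda>i. smult a (crd z i))" using dom_smult z by auto
  have "lead (smult a z) = (idx z, degree (crd (smult a z) (idx z)))"
    using crd_idx[OF z] a s(2) by (intro leadI[OF s(1)]) auto
  then show ?thesis using s(2) a by (simp add: lead_def)
qed

lemma lead_monom:
  assumes z: "z \<in> dom" "z \<noteq> 0" and m: "monom 1 b * z \<in> dom" "c + b \<le> F"
  shows "lead (monom 1 b * z) = (fst (lead z), snd (lead z) + b)"
proof -
  have s: "crd (monom 1 b * z) = (\<lambda>i. monom 1 b * crd z i)" using crd_monom z m by auto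
  have mz: "(monom 1 b :: 'k poly) \<noteq> 0" by simp
  have "lead (monom 1 b * z) = (idx z, degree (crd (monom 1 b * z) (idx z)))"
    using crd_idx[OF z] mz s by (intro leadI[OF m(1)]) auto
  then show ?thesis using s crd_idx(2)[OF z] mz by (simp add: lead_def degree_mult_eq degree_monom_eq)
qed

subsection \<open>Leading data of forms\<close>

definition ltail :: "'k mpoly \<Rightarrow> mono" where
  "ltail v = (THE e. restr (below e) v = 0 \<and> slice e v \<noteq> 0)"

definition lval :: "'k mpoly \<Rightarrow> mono \<times> nat \<times> nat" where
  "lval v = (ltail v, lead (slice (ltail v) v))"

lemma ltail: 
  assumes "v \<in> forms n d" "v \<noteq> 0" shows "restr (below (ltail v)) v = 0" "slice (ltail v) v \<noteq> 0"
  using theI'[OF leading_tail[OF assms]] unfolding ltail_def by auto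

lemma ltail_eq:
  assumes "v \<in> forms n d" "restr (below e) v = 0" "slice e v \<noteq> 0"
  shows "ltail v = e" "v \<noteq> 0" "lval v = (e, lead (slice e v))"
proof -
  show nz: "v \<noteq> 0" using assms(3) by auto
  show "ltail v = e" unfolding ltail_def
    using leading_tail[OF assms(1) nz] assms(2,3) by (intro the1_equality) auto
  then show "lval v = (e, lead (slice e v))" by (simp add: lval_def)
qed

definition admissible :: "nat \<Rightarrow> nat \<Rightarrow> 'k mpoly set \<Rightarrow> bool" where
  "admissible n d W \<longleftrightarrow> mp.subspace W \<and> W \<subseteq> forms n d \<and> (\<forall>e. lslice W e \<subseteq> dom)"

definition lvals :: "'k mpoly set \<Rightarrow> (mono \<times> nat \<times> nat) set" where
  "lvals W = lval ` (W - {0})"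

lemma slice_dom:
  assumes "admissible n d W" "v \<in> W" "restr (below e) v = 0" shows "slice e v \<in> dom"
  using assms unfolding admissible_def lslice_def by blast

lemma mem_lvals_iff:
  assumes W: "admissible n d W"
  shows "(e, l) \<in> lvals W \<longleftrightarrow> (\<exists>z\<in>lslice W e. z \<noteq> 0 \<and> lead z = l)"
proof
  assume "(e, l) \<in> lvals W"
  then obtain v where "v \<in> W - {0}" "(e, l) = lval v" unfolding lvals_def by blast
  then have v: "v \<in> W" "v \<noteq> 0" "lval v = (e, l)" by auto
  then have "v \<in> forms n d" using W by (auto simp: admissible_def)
  then show "\<exists>z\<in>lslice W e. z \<noteq> 0 \<and> lead z = l"
    using ltail[of v n d] v unfolding lslice_def lval_def by blast
next
  assume "\<exists>z\<in>lslice W e. z \<noteq> 0 \<and> lead z = l"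
  then obtain v where v: "v \<in> W" "restr (below e) v = 0" "slice e v \<noteq> 0" "lead (slice e v) = l"
    by (auto simp: lslice_def)
  then have "v \<in> forms n d" using W by (auto simp: admissible_def)
  from ltail_eq[OF this v(2,3)] show "(e, l) \<in> lvals W"
    using v(1,4) unfolding lvals_def by (intro image_eqI[of _ _ v]) auto
qed

lemma lvals_idx: "admissible n d W \<Longrightarrow> (e, i, b) \<in> lvals W \<Longrightarrow> i \<in> A"
  unfolding mem_lvals_iff using crd_idx(1) by (fastforce simp: lead_def admissible_def)

lemma lvals_tails:
  assumes W: "admissible n d W" and e: "(e, i, b) \<in> lvals W"
  shows "e \<in> tails n d"
proof -
  obtain v where v: "v \<in> W" "slice e v \<noteq> 0" using e unfolding mem_lvals_iff[OF W] lslice_def by blast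
  then obtain m where m: "m \<in> supp v" "tail m = e" using slice_eq_0[of v e] by blast
  have mm: "m \<in> monoms n" "mdeg m = d" using v(1) W m(1) by (auto simp: admissible_def forms_iff)
  have "supp e \<subseteq> {3..n}"
  proof
    fix j assume "j \<in> supp e"
    then have "j \<noteq> 1" "j \<noteq> 2" "j \<in> supp m" using m(2) by (auto simp: in_keys_iff coef_tail split: if_splits)
    then show "j \<in> {3..n}" using mm(1) unfolding monoms_def by force
  qed
  moreover have "mdeg e \<le> d" using mdeg_tail[of m] m(2) mm(2) by simp
  ultimately show ?thesis by (simp add: tails_def)
qed

text \<open>
  Leading data behave like a valuation on forms: first by tail, then by component and degree of the
  coordinates of the leading slice.
\<close>

theorem dim_eq_card_lvals:
  assumes W: "admissible n d W"
  shows "finite (lvals W)" "mp.dim W = card (lvals W)"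
proof -
  let ?lt = "\<lambda>a b. tlt (fst a) (fst b) \<or> (fst a = fst b \<and> llt (snd b) (snd a))"
  have sub: "mp.subspace W" and fo: "\<And>v. v \<in> W \<Longrightarrow> v \<in> forms n d" using W by (auto simp: admissible_def)
  have sd: "\<And>v e. v \<in> W \<Longrightarrow> restr (below e) v = 0 \<Longrightarrow> slice e v \<in> dom" using slice_dom[OF W] .
  have dim: "finite (lvals W) \<and> mp.dim W = card (lvals W)"
  proof (rule dim_eq_card_val[where lt = ?lt and val = lval and U = W and E = "xmon ` {m \<in> monoms n. mdeg m = d}"])
    show "lvals W = lval ` (W - {0})" by (rule lvals_def)
    show "W \<subseteq> mp.span (xmon ` {m \<in> monoms n. mdeg m = d})" using forms_span fo by blast
    show "mp.subspace W" by fact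
    show "finite (xmon ` {m \<in> monoms n. mdeg m = d})" by (rule finite_forms_basis)
    fix v w assume v: "v \<in> W - {0}" and w: "w \<in> W - {0}"
    let ?e = "ltail v" and ?f = "ltail w"
    have tv: "restr (below ?e) v = 0" "slice ?e v \<noteq> 0" using ltail[OF fo, of v] v by auto
    have tw: "restr (below ?f) w = 0" "slice ?f w \<noteq> 0" using ltail[OF fo, of w] w by auto
    have dv: "slice ?e v \<in> dom" using sd tv v by simp
    have dw: "slice ?f w \<in> dom" using sd tw w by simp
    show "\<exists>c. v - mscale c w = 0 \<or> ?lt (lval v) (lval (v - mscale c w))" if eq: "lval v = lval w"
    proof -
      have ef: "?f = ?e" and l: "lead (slice ?e v) = lead (slice ?e w)" using eq by (auto simp: lval_def)
      obtain a where a: "slice ?e v - smult a (slice ?e w) = 0 \<or>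
          llt (lead (slice ?e v - smult a (slice ?e w))) (lead (slice ?e v))"
        using lead_same[OF dv tv(2) _ _ l] dw tw(2) ef by auto
      let ?u = "v - mscale a w"
      have uW: "?u \<in> W" using v w sub by (intro mp.subspace_diff mp.subspace_scale) auto
      have su: "slice ?e ?u = slice ?e v - smult a (slice ?e w)" by (simp add: slice_diff slice_mscale)
      have ru: "restr (below ?e) ?u = 0"
      proof -
        have "restr (below ?e) (?u + mscale a w) = restr (below ?e) ?u + restr (below ?e) (mscale a w)"
          by (rule restr_add)
        then show ?thesis using tv(1) tw(1) ef by (simp add: restr_mscale)
      qed
      have "?u = 0 \<or> ?lt (lval v) (lval ?u)"
      proof (cases "?u = 0")
        case False
        note tu = ltail[OF fo[OF uW] False]
        show ?thesis
        proof (cases "slice ?e ?u = 0")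
          case True
          then have "ltail ?u \<noteq> ?e" using tu(2) by auto
          moreover have "\<not> tlt (ltail ?u) ?e" using slice_below[OF ru] tu(2) by blast
          ultimately show ?thesis using tlt_total by (auto simp: lval_def)
        next
          case nz: False
          have "lval ?u = (?e, lead (slice ?e ?u))" by (rule ltail_eq(3)[OF fo[OF uW] ru nz])
          then show ?thesis using a nz su by (auto simp: lval_def)
        qed
      qed simp
      then show ?thesis by blast
    qed
    show "v + w \<noteq> 0 \<and> lval (v + w) = lval v" if lt: "?lt (lval v) (lval w)"
    proof -
      have sW: "v + w \<in> W" using v w sub by (auto intro: mp.subspace_add)
      have "restr (below ?e) w = 0 \<and> slice ?e (v + w) \<noteq> 0 \<and> lead (slice ?e (v + w)) = lead (slice ?e v)"
      proof (cases "tlt ?e ?f")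
        case True
        then have "below ?e \<subseteq> below ?f" using tlt_trans by (auto simp: below_def)
        then have "restr (below ?e) w = 0" using tw(1) by (auto simp: restr_eq_0_iff)
        moreover have "slice ?e w = 0" by (rule slice_below[OF tw(1) True])
        ultimately show ?thesis using tv(2) by (simp add: slice_add)
      next
        case False
        then have "?f = ?e" "llt (lead (slice ?e w)) (lead (slice ?e v))" using lt by (auto simp: lval_def)
        then show ?thesis using lead_add_less[OF dv tv(2), of "slice ?e w"] dw tw by (simp add: slice_add)
      qed
      moreover then have "restr (below ?e) (v + w) = 0" using tv(1) by (simp add: restr_add)
      ultimately show ?thesis using ltail_eq[OF fo[OF sW], of ?e] by (simp add: lval_def)
    qed
    show "lval (mscale a v) = lval v" if a: "a \<noteq> 0" for a
    proof -
      have "mscale a v \<in> W" using v sub by (auto intro: mp.subspace_scale)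
      moreover have "slice ?e (mscale a v) \<noteq> 0" "restr (below ?e) (mscale a v) = 0"
        using tv a by (simp_all add: slice_mscale restr_mscale)
      ultimately have "lval (mscale a v) = (?e, lead (slice ?e (mscale a v)))" using fo ltail_eq(3) by blast
      then show ?thesis using lead_smult[OF dv tv(2) a] by (simp add: slice_mscale lval_def)
    qed
  next
    fix x y :: "mono \<times> nat \<times> nat" assume "x \<noteq> y"
    show "?lt x y \<or> ?lt y x" using \<open>x \<noteq> y\<close> tlt_total[of "fst x" "fst y"]
      by (cases x; cases y) (auto simp: llt_def)
  next
    fix x y z :: "mono \<times> nat \<times> nat" assume "?lt x y" "?lt y z"
    then show "?lt x z" using tlt_trans by (auto simp: llt_def)
  qed (simp add: llt_def)
  then show "finite (lvals W)" "mp.dim W = card (lvals W)" by auto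
qed

lemma lead_in_lvals:
  "admissible n d W \<Longrightarrow> z \<in> lslice W e \<Longrightarrow> z \<noteq> 0 \<Longrightarrow> (e, lead z) \<in> lvals W"
  using mem_lvals_iff by blast

text \<open>
  Setting the last variables to zero keeps exactly those leading data whose tail involves none of
  them, because tails are compared at the largest index first.
\<close>

lemma restr_vars:
  assumes W: "admissible n d W" and p: "2 \<le> p"
  defines "W' \<equiv> restr {m. supp m \<subseteq> {..p}} ` W"
  shows "admissible n d W'" "lvals W' = {g \<in> lvals W. supp (fst g) \<subseteq> {..p}}"
proof -
  let ?P = "{m. supp m \<subseteq> {..p}}"
  have W0: "mp.subspace W" "W \<subseteq> forms n d" "\<And>e. lslice W e \<subseteq> dom" using W by (auto simp: admissible_def)
  have tP: "m \<in> ?P" if "supp (tail m) \<subseteq> {..p}" for m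
  proof safe
    fix j assume j: "j \<in> supp m"
    show "j \<le> p"
    proof (cases "j = 1 \<or> j = 2")
      case False
      then have "j \<in> supp (tail m)" using j by (simp add: in_keys_iff coef_tail)
      then show ?thesis using that by auto
    qed (use p in auto)
  qed
  have tP': "supp (tail m) \<subseteq> {..p}" if "m \<in> ?P" for m
  proof
    fix j assume "j \<in> supp (tail m)"
    then have "j \<in> supp m" by (auto simp: in_keys_iff coef_tail split: if_splits)
    then show "j \<in> {..p}" using that by blast
  qed
  have sl: "slice e (restr ?P v) = slice e v" if "supp e \<subseteq> {..p}" for e v
    using that tP by (intro slice_restr) auto
  have sl0: "slice e (restr ?P v) = 0" if "\<not> supp e \<subseteq> {..p}" for e v
    using that tP' by (intro slice_eq_0) (auto simp: supp_restr)
  have bl: "restr (below e) (restr ?P v) = 0 \<longleftrightarrow> restr (below e) v = 0" if "supp e \<subseteq> {..p}" for e v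
  proof -
    have "m \<in> ?P" if "m \<in> below e" for m
      using tP tlt_supp[OF _ \<open>supp e \<subseteq> {..p}\<close>] that by (auto simp: below_def)
    then have "below e \<subseteq> ?P" by (rule subsetI)
    then show ?thesis unfolding restr_eq_0_iff supp_restr by blast
  qed
  have ls: "lslice W' e = (if supp e \<subseteq> {..p} then lslice W e else lslice W' e \<inter> {0})" for e
  proof (cases "supp e \<subseteq> {..p}")
    case True
    have "lslice W' e = lslice W e"
    proof (intro subset_antisym subsetI)
      fix z assume "z \<in> lslice W e"
      then obtain v where v: "v \<in> W" "restr (below e) v = 0" "z = slice e v" by (auto simp: lslice_def)
      then show "z \<in> lslice W' e" unfolding lslice_def W'_def
        using sl[OF True, of v] bl[OF True, of v] by (intro CollectI exI[of _ "restr ?P v"]) auto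
    qed (use sl[OF True] bl[OF True] in \<open>auto simp: lslice_def W'_def\<close>)
    then show ?thesis using True by simp
  next
    case False
    then show ?thesis using sl0[OF False] unfolding lslice_def W'_def by auto
  qed
  have "lslice W' e \<subseteq> dom" for e
  proof (cases "supp e \<subseteq> {..p}")
    case True
    then show ?thesis using ls[of e] W0(3)[of e] by simp
  next
    case False
    then have "lslice W' e \<subseteq> {0}" using ls[of e] by auto
    then show ?thesis using zero_dom by blast
  qed
  then show W': "admissible n d W'"
    using W0(1,2) subspace_linear_image[OF linear_restr] forms_restr unfolding admissible_def W'_def by blast
  show "lvals W' = {g \<in> lvals W. supp (fst g) \<subseteq> {..p}}"
  proof (intro subset_antisym subsetI)
    fix g assume g: "g \<in> lvals W'"
    obtain e l where el: "g = (e, l)" by (cases g)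
    obtain z where z: "z \<in> lslice W' e" "z \<noteq> 0" "lead z = l"
      using g unfolding el mem_lvals_iff[OF W'] by blast
    then have e: "supp e \<subseteq> {..p}" using ls[of e] by (auto split: if_splits)
    then have "z \<in> lslice W e" using z(1) ls[of e] by simp
    then have "g \<in> lvals W" using z(2,3) unfolding el mem_lvals_iff[OF W] by blast
    then show "g \<in> {g \<in> lvals W. supp (fst g) \<subseteq> {..p}}" using e el by simp
  next
    fix g assume g: "g \<in> {g \<in> lvals W. supp (fst g) \<subseteq> {..p}}"
    obtain e l where el: "g = (e, l)" by (cases g)
    obtain z where z: "z \<in> lslice W e" "z \<noteq> 0" "lead z = l"
      using g unfolding el mem_Collect_eq mem_lvals_iff[OF W] by blast
    have "supp e \<subseteq> {..p}" using g el by simp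
    then have "z \<in> lslice W' e" using z(1) ls[of e] by simp
    then show "g \<in> lvals W'" using z(2,3) unfolding el mem_lvals_iff[OF W'] by blast
  qed
qed

lemma tail_closed_lvals:
  assumes W: "admissible n d W" and st: "stable_coords n (tails n d) W"
  shows "tail_closed n (lvals W)"
  unfolding tail_closed_def
proof (intro allI impI)
  fix e k i b assume g: "(e + unit_at k, i, b) \<in> lvals W"
  obtain z where z: "z \<in> lslice W (e + unit_at k)" "z \<noteq> 0" "lead z = (i, b)"
    using g unfolding mem_lvals_iff[OF W] by blast
  have W0: "mp.subspace W" "\<And>e. lslice W e \<subseteq> dom" using W by (auto simp: admissible_def)
  have zd: "z \<in> dom" using z(1) W0(2) by blast
  have et: "e + unit_at k \<in> tails n d" using lvals_tails[OF W g] .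
  then have k: "k \<in> {3..n}" by (auto simp: tails_def)
  have s: "monom 1 (if k' = 2 then 1 else 0) * z \<in> lslice W (e + tail (unit_at k'))" if "k' \<in> {1..<k}" for k'
    by (rule lslice_stable[OF W0(1) st et k that z(1)])
  have z0: "monom 1 0 * z = z" by (simp add: monom_0 flip: one_pCons)
  have "z \<in> lslice W e" using s[of 1] k z0 by (simp add: tail_single)
  then have 1: "(e, i, b) \<in> lvals W" using lead_in_lvals[OF W _ z(2)] z(3) by metis
  have y: "monom 1 1 * z \<in> lslice W e" using s[of 2] k by (simp add: tail_single)
  then have "monom 1 1 * z \<in> dom" using W0(2) by blast
  then have "lead (monom 1 1 * z) = (i, Suc b)" using lead_monom[OF zd z(2), of 1] cF z(3) by simp
  moreover have "monom 1 1 * z \<noteq> 0" using z(2) by simp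
  ultimately have 2: "(e, i, Suc b) \<in> lvals W" using lead_in_lvals[OF W y] by metis
  have "(e + unit_at k', i, b) \<in> lvals W" if "k' \<in> {3..<k}" for k'
  proof -
    have "z \<in> lslice W (e + unit_at k')" using s[of k'] that z0 by (simp add: tail_single)
    then show ?thesis using lead_in_lvals[OF W _ z(2)] z(3) by metis
  qed
  then show "(e, i, b) \<in> lvals W \<and> (e, i, Suc b) \<in> lvals W \<and> (\<forall>k'\<in>{3..<k}. (e + unit_at k', i, b) \<in> lvals W)"
    using 1 2 by blast
qed

lemma tail_shadow_lvals:
  assumes W: "admissible n d W" and W': "admissible n d' W'" and n: "2 \<le> n"
    and X: "\<And>k v. k \<in> {1..n} \<Longrightarrow> v \<in> W \<Longrightarrow> X k * v \<in> W'"
  shows "tail_shadow n (lvals W) (lvals W')"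
  unfolding tail_shadow_def
proof (intro allI impI)
  fix e i b assume "(e, i, b) \<in> lvals W"
  then obtain z where z: "z \<in> lslice W e" "z \<noteq> 0" "lead z = (i, b)" unfolding mem_lvals_iff[OF W] by blast
  have zd: "z \<in> dom" using z(1) W by (auto simp: admissible_def)
  have s: "monom 1 (if k = 2 then 1 else 0) * z \<in> lslice W' (e + tail (unit_at k))" if "k \<in> {1..n}" for k
    using lslice_X_mult[OF z(1)] X[OF that] by blast
  have z0: "monom 1 0 * z = z" by (simp add: monom_0 flip: one_pCons)
  have "z \<in> lslice W' e" using s[of 1] n z0 by (simp add: tail_single)
  then have 1: "(e, i, b) \<in> lvals W'" using lead_in_lvals[OF W' _ z(2)] z(3) by metis
  have y: "monom 1 1 * z \<in> lslice W' e" using s[of 2] n by (simp add: tail_single)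
  then have "monom 1 1 * z \<in> dom" using W' by (auto simp: admissible_def)
  then have "lead (monom 1 1 * z) = (i, Suc b)" using lead_monom[OF zd z(2), of 1] cF z(3) by simp
  moreover have "monom 1 1 * z \<noteq> 0" using z(2) by simp
  ultimately have 2: "(e, i, Suc b) \<in> lvals W'" using lead_in_lvals[OF W' y] by metis
  have "(e + unit_at k, i, b) \<in> lvals W'" if "k \<in> {3..n}" for k
  proof -
    have "z \<in> lslice W' (e + unit_at k)" using s[of k] that z0 by (simp add: tail_single)
    then show ?thesis using lead_in_lvals[OF W' _ z(2)] z(3) by metis
  qed
  then show "(e, i, b) \<in> lvals W' \<and> (e, i, Suc b) \<in> lvals W' \<and> (\<forall>k\<in>{3..n}. (e + unit_at k, i, b) \<in> lvals W')"
    using 1 2 by blast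
qed

lemma admissibleI:
  assumes W: "mp.subspace W" "W \<subseteq> forms n d" "lslice W 0 \<subseteq> dom" and st: "stable_coords n (tails n d) W"
  shows "admissible n d W"
proof -
  have sub: "lslice W e \<subseteq> dom" for e
  proof
    fix z assume z: "z \<in> lslice W e"
    show "z \<in> dom"
    proof (cases "z = 0")
      case False
      then obtain v where v: "v \<in> W" "slice e v \<noteq> 0" "z = slice e v" using z by (auto simp: lslice_def)
      then obtain m where m: "m \<in> supp v" "tail m = e" using slice_eq_0[of v e] by blast
      have mm: "m \<in> monoms n" "mdeg m = d" using v(1) W(2) m(1) by (auto simp: forms_iff)
      have "supp e \<subseteq> {3..n}"
      proof
        fix j assume "j \<in> supp e"
        then have "j \<noteq> 1" "j \<noteq> 2" "j \<in> supp m" using m(2) by (auto simp: in_keys_iff coef_tail split: if_splits)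
        then show "j \<in> {3..n}" using mm(1) unfolding monoms_def by force
      qed
      then have "e \<in> tails n d" using mdeg_tail[of m] m(2) mm(2) by (simp add: tails_def)
      then have "monom 1 0 * z \<in> lslice W 0" by (rule lslice_descend[OF W(1) st _ z]) simp
      then show ?thesis using W(3) by (simp add: monom_0 subset_iff flip: one_pCons)
    qed (simp add: zero_dom)
  qed
  then show ?thesis using W by (simp add: admissible_def)
qed

text \<open>
  If \<open>z\<close> is a leading slice at the tail \<open>e\<close>, then its products with powers of the variable up to the
  degree of \<open>e\<close> are slices at the tail \<open>0\<close>; there the coordinates have degree at most \<open>c\<close>.
\<close>

lemma lvals_degree_bound:
  assumes W: "mp.subspace W" "W \<subseteq> forms n d" "lslice W 0 \<subseteq> dom" and st: "stable_coords n (tails n d) W"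
    and F: "2 * c < F" and g: "(e, i, b) \<in> lvals W"
  shows "b + mdeg e \<le> c"
proof -
  have adm: "admissible n d W" by (rule admissibleI[OF W st])
  obtain z where z: "z \<in> lslice W e" "z \<noteq> 0" "lead z = (i, b)" using g unfolding mem_lvals_iff[OF adm] by blast
  have zd: "z \<in> dom" using z(1) adm by (auto simp: admissible_def)
  let ?b = "min (mdeg e) (F - c)"
  have "monom 1 ?b * z \<in> lslice W 0"
    by (rule lslice_descend[OF W(1) st lvals_tails[OF adm g] z(1)]) simp
  then have md: "monom 1 ?b * z \<in> dom" using W(3) by blast
  have l: "lead (monom 1 ?b * z) = (i, b + ?b)" using lead_monom[OF zd z(2) md] cF z(3) by simp
  have nz: "monom 1 ?b * z \<noteq> 0" using z(2) by simp
  have "degree (crd (monom 1 ?b * z) (idx (monom 1 ?b * z))) \<le> c"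
    using rep_crd[OF md] crd_idx(1)[OF md nz] by (simp add: rep_def)
  then have "b + ?b \<le> c" using l unfolding lead_def prod.inject by linarith
  then show "b + mdeg e \<le> c" using F by (simp add: min_def split: if_splits)
qed

end

section \<open>Strongly stable sets from leading data\<close>

text \<open>
  For fixed tail and component only the number of exponents matters; the exponents are compressed
  to an initial interval, which becomes the exponent of the variable with index \<open>2\<close>.
\<close>

definition expcount :: "(mono \<times> nat \<times> nat) set \<Rightarrow> nat \<Rightarrow> mono \<Rightarrow> nat" where
  "expcount V i e = card {b. (e, i, b) \<in> V}"

definition compress :: "nat \<Rightarrow> (mono \<times> nat \<times> nat) set \<Rightarrow> nat \<Rightarrow> mono set" where
  "compress n V i = {u \<in> ymonos n. coef u 2 < expcount V i (Poly_Mapping.update 2 0 u)}"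

lemma finite_exps: "finite V \<Longrightarrow> finite {b. (e, i, b) \<in> V}"
  by (rule finite_subset[of _ "(\<lambda>g. snd (snd g)) ` V"]) force+

lemma expcount_step:
  assumes V: "finite V'" and s: "\<And>b. (e, i, b) \<in> V \<Longrightarrow> (f, j, b) \<in> V'"
  shows "expcount V i e \<le> expcount V' j f"
  unfolding expcount_def using s finite_exps[OF V] by (intro card_mono) auto

lemma expcount_step_Suc:
  assumes V: "finite V'" and s: "\<And>b. (e, i, b) \<in> V \<Longrightarrow> (f, j, b) \<in> V' \<and> (f, j, Suc b) \<in> V'"
    and ne: "expcount V i e \<noteq> 0"
  shows "Suc (expcount V i e) \<le> expcount V' j f"
proof -
  let ?D = "{b. (e, i, b) \<in> V}"
  have fin: "finite ?D" "?D \<noteq> {}" using ne unfolding expcount_def by (metis card.infinite, metis card.empty)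
  have "Suc (Max ?D) \<notin> ?D"
  proof
    assume "Suc (Max ?D) \<in> ?D"
    then have "Suc (Max ?D) \<le> Max ?D" by (rule Max_ge[OF fin(1)])
    then show False by simp
  qed
  then have "Suc (card ?D) = card (insert (Suc (Max ?D)) ?D)" using fin(1) by simp
  also have "\<dots> \<le> card {b. (f, j, b) \<in> V'}"
    using s Max_in[OF fin] finite_exps[OF V] by (intro card_mono) auto
  finally show ?thesis by (simp add: expcount_def)
qed

lemma upd2_add_unit: "Poly_Mapping.update 2 0 (u + Poly_Mapping.single k (Suc 0)) =
    (if k = 2 then Poly_Mapping.update 2 0 u else Poly_Mapping.update 2 0 u + Poly_Mapping.single k (Suc 0))"
  by (rule poly_mapping_eqI) (auto simp: lookup_update lookup_add lookup_single when_def)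

lemma shadow_compress:
  assumes V: "finite V'" and n: "2 \<le> n" and s: "tail_shadow n V V'"
  shows "shadow n (compress n V i) \<subseteq> compress n V' i"
proof
  fix v assume v: "v \<in> shadow n (compress n V i)"
  have main: "u \<in> compress n V' i \<and> (\<forall>k\<in>{2..n}. u + unit_at k \<in> compress n V' i)" if u: "u \<in> compress n V i" for u
  proof -
    let ?e = "Poly_Mapping.update 2 0 u"
    have uy: "u \<in> ymonos n" "coef u 2 < expcount V i ?e" using u by (auto simp: compress_def)
    have g: "Suc (expcount V i ?e) \<le> expcount V' i ?e"
    proof (rule expcount_step_Suc[OF V])
      show "(?e, i, b) \<in> V' \<and> (?e, i, Suc b) \<in> V'" if "(?e, i, b) \<in> V" for b
        using s that unfolding tail_shadow_def by blast
      show "expcount V i ?e \<noteq> 0" using uy(2) by (rule gr_implies_not0)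
    qed
    have "u + unit_at k \<in> compress n V' i" if k: "k \<in> {2..n}" for k
    proof (cases "k = 2")
      case True
      then show ?thesis using uy g n by (simp add: compress_def upd2_add_unit lookup_add)
    next
      case False
      have "expcount V i ?e \<le> expcount V' i (?e + unit_at k)"
      proof (intro expcount_step[OF V])
        have "k \<in> {3..n}" using k False by auto
        then show "(?e + unit_at k, i, b) \<in> V'" if "(?e, i, b) \<in> V" for b
          using s that unfolding tail_shadow_def by blast
      qed
      then show ?thesis using uy k False by (simp add: compress_def upd2_add_unit lookup_add lookup_single when_def)
    qed
    then show ?thesis using uy g by (simp add: compress_def)
  qed
  show "v \<in> compress n V' i" using v main by (auto simp: shadow_def)
qed

lemma supp_fst_subset:
  "e \<in> fst ` V \<Longrightarrow> (\<And>e i b. (e, i, b) \<in> V \<Longrightarrow> supp e \<subseteq> {3..n}) \<Longrightarrow> supp e \<subseteq> {3..n}"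
  by force

lemma card_compress:
  assumes V: "finite V" and n: "2 \<le> n" and t: "\<And>e i b. (e, i, b) \<in> V \<Longrightarrow> supp e \<subseteq> {3..n}"
  shows "finite (compress n V i)" "card (compress n V i) = card {g \<in> V. fst (snd g) = i}"
proof -
  let ?D = "SIGMA e:fst ` V. {..<expcount V i e}"
  let ?f = "\<lambda>(e, a). e + Poly_Mapping.single 2 a"
  have e2: "coef e 2 = 0" if "e \<in> fst ` V" for e
    using supp_fst_subset[OF that t] by (force simp: in_keys_iff)
  have up: "Poly_Mapping.update 2 0 (e + Poly_Mapping.single 2 a) = e" if "e \<in> fst ` V" for e a
    using e2[OF that] by (intro poly_mapping_eqI) (auto simp: lookup_update lookup_add lookup_single when_def)
  have inj: "inj_on ?f ?D"
  proof (rule inj_onI)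
    fix x y assume xy: "x \<in> ?D" "y \<in> ?D" "?f x = ?f y"
    obtain e a f b where ab: "x = (e, a)" "y = (f, b)" by fastforce
    have m: "e \<in> fst ` V" "f \<in> fst ` V" using xy(1,2) ab by auto
    have eq: "e + Poly_Mapping.single 2 a = f + Poly_Mapping.single 2 b" using xy(3) ab by simp
    have "e = f" using up[OF m(1), of a] up[OF m(2), of b] eq by simp
    then have "Poly_Mapping.single (2::nat) a = Poly_Mapping.single 2 b" using eq by simp
    then have "a = b" by (metis lookup_single_eq)
    then show "x = y" using ab \<open>e = f\<close> by simp
  qed
  have im: "?f ` ?D = compress n V i"
  proof (intro subset_antisym subsetI)
    fix v assume "v \<in> ?f ` ?D"
    then obtain e a where ea: "e \<in> fst ` V" "a < expcount V i e" "v = e + Poly_Mapping.single 2 a" by auto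
    have "e \<in> ymonos n" using supp_fst_subset[OF ea(1) t] unfolding ymonos_def by fastforce
    then show "v \<in> compress n V i" using ea n up[OF ea(1)] e2[OF ea(1)] by (simp add: compress_def lookup_add)
  next
    fix v assume "v \<in> compress n V i"
    then have v: "coef v 2 < expcount V i (Poly_Mapping.update 2 0 v)" by (simp add: compress_def)
    then have "{b. (Poly_Mapping.update 2 0 v, i, b) \<in> V} \<noteq> {}" unfolding expcount_def by (metis card.empty not_less_zero)
    then have "Poly_Mapping.update 2 0 v \<in> fst ` V" by force
    moreover have "v = Poly_Mapping.update 2 0 v + Poly_Mapping.single 2 (coef v 2)"
      by (rule poly_mapping_eqI) (auto simp: lookup_update lookup_add lookup_single when_def)
    ultimately show "v \<in> ?f ` ?D" using v by (intro image_eqI[of _ _ "(Poly_Mapping.update 2 0 v, coef v 2)"]) auto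
  qed
  have finD: "finite ?D" using V by auto
  show "finite (compress n V i)" using finD im by (metis finite_imageI)
  have "card (compress n V i) = card ?D" using card_image[OF inj] im by simp
  also have "\<dots> = (\<Sum>e\<in>fst ` V. expcount V i e)" using V by (simp add: card_SigmaI)
  also have "\<dots> = card (SIGMA e:fst ` V. {b. (e, i, b) \<in> V})"
    using V by (simp add: card_SigmaI expcount_def finite_exps[OF V])
  also have "\<dots> = card {g \<in> V. fst (snd g) = i}"
    by (rule bij_betw_same_card[of "\<lambda>(e, b). (e, i, b)"]) (force simp: bij_betw_def inj_on_def)
  finally show "card (compress n V i) = card {g \<in> V. fst (snd g) = i}" .
qed

lemma sstable_compress:
  assumes V: "finite V" and n: "2 \<le> n" and t: "\<And>e i b. (e, i, b) \<in> V \<Longrightarrow> supp e \<subseteq> {3..n}" and s: "tail_closed n V"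
  shows "sstable n (compress n V i)"
  unfolding sstable_def
proof (intro conjI allI impI ballI)
  show "finite (compress n V i)" by (rule card_compress(1)[OF V n t])
  show "compress n V i \<subseteq> ymonos n" by (auto simp: compress_def)
  fix u k assume u: "u + unit_at k \<in> compress n V i"
  let ?e = "Poly_Mapping.update 2 0 u"
  have uy: "u \<in> ymonos n" "k \<in> {2..n}" using u by (auto simp: compress_def)
  have main: "u \<in> compress n V i \<and> (\<forall>k'\<in>{2..<k}. u + unit_at k' \<in> compress n V i)"
  proof (cases "k = 2")
    case True
    then have "coef (u + unit_at k) 2 < expcount V i (Poly_Mapping.update 2 0 (u + unit_at k))"
      using u by (simp add: compress_def)
    then have "coef u 2 < expcount V i ?e" using True upd2_add_unit[of u 2] by (simp add: lookup_add)
    then show ?thesis using uy True by (simp add: compress_def)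
  next
    case False
    have c: "coef u 2 < expcount V i (?e + unit_at k)"
      using u False by (simp add: compress_def upd2_add_unit lookup_add lookup_single when_def)
    have g: "Suc (expcount V i (?e + unit_at k)) \<le> expcount V i ?e"
    proof (rule expcount_step_Suc[OF V])
      show "(?e, i, b) \<in> V \<and> (?e, i, Suc b) \<in> V" if "(?e + unit_at k, i, b) \<in> V" for b
        using s that unfolding tail_closed_def by blast
      show "expcount V i (?e + unit_at k) \<noteq> 0" using c by (rule gr_implies_not0)
    qed
    have "u + unit_at k' \<in> compress n V i" if k': "k' \<in> {2..<k}" for k'
    proof (cases "k' = 2")
      case True
      then show ?thesis using uy c g n by (simp add: compress_def upd2_add_unit lookup_add)
    next
      case False
      have "expcount V i (?e + unit_at k) \<le> expcount V i (?e + unit_at k')"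
      proof (rule expcount_step[OF V])
        have "k' \<in> {3..<k}" using k' False by auto
        then show "(?e + unit_at k', i, b) \<in> V" if "(?e + unit_at k, i, b) \<in> V" for b
          using s that unfolding tail_closed_def by blast
      qed
      then show ?thesis using uy c k' False by (simp add: compress_def upd2_add_unit lookup_add lookup_single when_def)
    qed
    then show ?thesis using uy c g by (simp add: compress_def)
  qed
  then show "u \<in> compress n V i" by blast
  show "u + unit_at k' \<in> compress n V i" if "k' \<in> {2..<k}" for k' using main that by blast
qed

lemma compress_ymonos:
  assumes V: "finite V" and p: "2 \<le> p" "p \<le> n"
  shows "compress n V i \<inter> ymonos p = compress p {g \<in> V. supp (fst g) \<subseteq> {..p}} i"
proof -
  have "supp (Poly_Mapping.update 2 0 u) \<subseteq> {..p}" if "u \<in> ymonos p" for u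
  proof
    fix j assume "j \<in> supp (Poly_Mapping.update 2 0 u)"
    then have "j \<in> supp u" by (auto simp: in_keys_iff lookup_update split: if_splits)
    then show "j \<in> {..p}" using that unfolding ymonos_def by auto
  qed
  then have "expcount {g \<in> V. supp (fst g) \<subseteq> {..p}} i (Poly_Mapping.update 2 0 u) = expcount V i (Poly_Mapping.update 2 0 u)"
    if "u \<in> ymonos p" for u using that by (simp add: expcount_def)
  then show ?thesis using ymonos_mono[OF p(2)] by (auto simp: compress_def)
qed

lemma sum_card_compress:
  assumes V: "finite V" and p: "2 \<le> p" "p \<le> n" and A: "finite A"
    and t: "\<And>e i b. (e, i, b) \<in> V \<Longrightarrow> supp e \<subseteq> {3..n} \<and> i \<in> A"
  shows "(\<Sum>i\<in>A. card (compress n V i \<inter> ymonos p)) = card {g \<in> V. supp (fst g) \<subseteq> {..p}}"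
proof -
  let ?V = "{g \<in> V. supp (fst g) \<subseteq> {..p}}"
  have fin: "finite ?V" using V by simp
  have t3: "supp e \<subseteq> {3..p}" if "(e, i, b) \<in> ?V" for e i b using t[of e i b] that by fastforce
  have "(\<Sum>i\<in>A. card (compress n V i \<inter> ymonos p)) = (\<Sum>i\<in>A. card {g \<in> ?V. fst (snd g) = i})"
    unfolding compress_ymonos[OF V p] by (rule sum.cong[OF refl card_compress(2)[OF fin p(1) t3]])
  also have "\<dots> = card (\<Union>i\<in>A. {g \<in> ?V. fst (snd g) = i})"
    using A finite_subset[OF _ fin] by (subst card_UN_disjoint) (auto simp del: mem_Collect_eq)
  also have "(\<Union>i\<in>A. {g \<in> ?V. fst (snd g) = i}) = ?V" using t by fastforce
  finally show ?thesis .
qed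

section \<open>Regular sequences of forms\<close>

lemma carrier_subst:
  fixes f :: "nat \<Rightarrow> 'k::field mpoly"
  assumes f: "\<And>i. i \<in> V \<Longrightarrow> f i \<in> carrier (polyring n)" and P: "\<And>m. m \<in> supp P \<Longrightarrow> supp m \<subseteq> V"
  shows "subst f P \<in> carrier (polyring n)"
proof -
  have pw: "f i ^ e \<in> carrier (polyring n)" if "i \<in> V" for i e
  proof (induction e)
    case 0
    show ?case by (simp add: carrier_polyring)
  next
    case (Suc e)
    then show ?case using carrier_mult[OF f[OF that]] by simp
  qed
  have pr: "(\<Prod>i\<in>B. f i ^ e i) \<in> carrier (polyring n)" if "B \<subseteq> V" for B e
    using that by (induction B rule: infinite_finite_induct) (auto intro!: carrier_mult pw simp: carrier_polyring[of 1])
  show ?thesis unfolding subst_def mono_val_def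
    by (intro mp.subspace_sum[OF subspace_carrier] mp.subspace_scale[OF subspace_carrier] pr P)
qed

lemma ideal_mult: "ideal I (polyring n) \<Longrightarrow> p \<in> carrier (polyring n) \<Longrightarrow> v \<in> I \<Longrightarrow> p * v \<in> I"
  using ideal.I_l_closed[of I "polyring n" v p] by simp

lemma genideal_ideal': "G \<subseteq> carrier (polyring n) \<Longrightarrow> ideal (genideal (polyring n) G) (polyring n)"
  by (rule ring.genideal_ideal[OF cring.axioms(1)[OF cring_polyring]])

lemma genideal_self': "G \<subseteq> carrier (polyring n) \<Longrightarrow> G \<subseteq> genideal (polyring n) G"
  by (rule ring.genideal_self[OF cring.axioms(1)[OF cring_polyring]])

lemma genideal_mono: "G \<subseteq> G' \<Longrightarrow> G' \<subseteq> carrier (polyring n) \<Longrightarrow> genideal (polyring n) G \<subseteq> genideal (polyring n) G'"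
  using ring.genideal_minimal[OF cring.axioms(1)[OF cring_polyring] genideal_ideal'[of G'], of n G] genideal_self'[of G' n] by blast

lemma genideal_small_forms:
  fixes G :: "'k::field mpoly set"
  assumes G: "\<And>g. g \<in> G \<Longrightarrow> \<exists>d\<ge>a. g \<in> forms n d" and v: "v \<in> genideal (polyring n) G" "v \<in> forms n e" "e < a"
  shows "v = 0"
proof -
  define dg where "dg g = (SOME d. a \<le> d \<and> g \<in> forms n d)" for g :: "'k mpoly"
  have dg: "a \<le> dg g \<and> g \<in> forms n (dg g)" if "g \<in> G" for g
    unfolding dg_def by (rule someI_ex) (use G[OF that] in blast)
  have "v \<in> mp.span {xmon m * g | m g. m \<in> monoms n \<and> g \<in> G \<and> mdeg m + dg g = e}"
    by (rule genideal_forms[OF _ v(1,2)]) (use dg in blast)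
  also have "{xmon m * g | m g. m \<in> monoms n \<and> g \<in> G \<and> mdeg m + dg g = e} = {}"
    using dg v(3) by fastforce
  finally show ?thesis by simp
qed

text \<open>
  Reducing modulo \<open>g 1, \<dots>, g (r - 1)\<close>, regularity puts the coefficient \<open>h r\<close> into an ideal generated in
  degrees above its own, so it vanishes; the remaining relation is shorter.
\<close>

lemma regular_seq_free:
  fixes g :: "nat \<Rightarrow> 'k::field mpoly"
  assumes reg: "regular_seq n l g" and g: "\<And>i. i \<in> {1..l} \<Longrightarrow> \<exists>d\<ge>a. g i \<in> forms n d"
    and r: "r \<le> l" and h: "\<And>i. i \<in> {1..r} \<Longrightarrow> \<exists>e<a. h i \<in> forms n e" and s: "(\<Sum>i\<in>{1..r}. h i * g i) = 0"
  shows "\<forall>i\<in>{1..r}. h i = 0"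
  using r h s
proof (induction r)
  case (Suc r)
  have gc: "g ` {1..l} \<subseteq> carrier (polyring n)" using reg by (simp add: regular_seq_def)
  let ?G = "g ` {1..<Suc r}"
  have Gc: "?G \<subseteq> carrier (polyring n)" using gc Suc.prems(1) by auto
  have id: "ideal (genideal (polyring n) ?G) (polyring n)" by (rule genideal_ideal'[OF Gc])
  have "(\<Sum>i\<in>{1..r}. h i * g i) \<in> genideal (polyring n) ?G"
  proof (rule mp.subspace_sum[OF subspace_ideal[OF id]])
    fix i assume i: "i \<in> {1..r}"
    then obtain e where "h i \<in> forms n e" using Suc.prems(2)[of i] by auto
    moreover have "g i \<in> genideal (polyring n) ?G" using genideal_self'[OF Gc] i by auto
    ultimately show "h i * g i \<in> genideal (polyring n) ?G" by (intro ideal_mult[OF id] forms_carrier)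
  qed
  then have "- (\<Sum>i\<in>{1..r}. h i * g i) \<in> genideal (polyring n) ?G"
    by (rule mp.subspace_neg[OF subspace_ideal[OF id]])
  moreover have "h (Suc r) * g (Suc r) = - (\<Sum>i\<in>{1..r}. h i * g i)"
    using Suc.prems(3) by (simp add: eq_neg_iff_add_eq_0 add.commute)
  ultimately have m: "h (Suc r) * g (Suc r) \<in> genideal (polyring n) ?G" by simp
  obtain e where e: "e < a" "h (Suc r) \<in> forms n e" using Suc.prems(2)[of "Suc r"] by auto
  have hm: "h (Suc r) \<in> genideal (polyring n) ?G"
    using reg m Suc.prems(1) forms_carrier[OF e(2)] unfolding regular_seq_def by auto
  have z: "h (Suc r) = 0"
    by (rule genideal_small_forms[OF _ hm e(2,1)]) (use g Suc.prems(1) in auto)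
  then have "\<forall>i\<in>{1..r}. h i = 0" using Suc.prems by (intro Suc.IH) auto
  then show ?case using z by (auto simp: le_Suc_eq)
qed simp

lemma X_dvd:
  assumes "\<And>m. m \<in> supp P \<Longrightarrow> coef m k \<noteq> 0"
  shows "\<exists>Q. P = X k * Q \<and> supp Q \<subseteq> (\<lambda>m. m - unit_at k) ` supp P"
proof (intro exI conjI)
  let ?Q = "\<Sum>m\<in>supp P. Poly_Mapping.single (m - unit_at k) (coef P m)"
  have "X k * ?Q = (\<Sum>m\<in>supp P. Poly_Mapping.single (m - unit_at k + unit_at k) (coef P m))"
    by (simp add: X_def sum_distrib_left mult_single add.commute)
  also have "\<dots> = (\<Sum>m\<in>supp P. Poly_Mapping.single m (coef P m))"
  proof (rule sum.cong[OF refl])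
    fix m assume "m \<in> supp P"
    then have "m - unit_at k + unit_at k = m" using assms by (intro mono_minus_add) (simp add: in_keys_iff)
    then show "Poly_Mapping.single (m - unit_at k + unit_at k) (coef P m) = Poly_Mapping.single m (coef P m)"
      by (simp only:)
  qed
  finally show "P = X k * ?Q" by (simp flip: mpoly_decomp)
  show "supp ?Q \<subseteq> (\<lambda>m. m - unit_at k) ` supp P"
    using keys_sum[of "\<lambda>m. Poly_Mapping.single (m - unit_at k) (coef P m)" "supp P"] by (auto split: if_splits)
qed

text \<open>
  A regular sequence is algebraically independent: in a relation, the part not divisible by the
  first indeterminate is a relation modulo the first form, and what is left could be divided by the
  indeterminate.
\<close>

lemma regular_seq_alg_indep:
  fixes g :: "nat \<Rightarrow> 'k::field mpoly"
  assumes reg: "regular_seq n l g" and i: "1 \<le> i" "i \<le> Suc l"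
    and P: "\<And>m. m \<in> supp P \<Longrightarrow> supp m \<subseteq> {i..l}" and s: "subst g P \<in> genideal (polyring n) (g ` {1..<i})"
  shows "P = 0"
  using i(2,1) P s
proof (induction i arbitrary: P rule: inc_induct)
  case base
  have c: "m = 0" if "m \<in> supp P" for m using base.prems(2)[OF that] by simp
  have P0: "P = Poly_Mapping.single 0 (coef P 0)"
    by (rule poly_mapping_eqI) (metis c in_keys_iff lookup_single_eq lookup_single_not_eq)
  show ?case
  proof (rule ccontr)
    assume "P \<noteq> 0"
    then have c0: "coef P 0 \<noteq> 0" using P0 by auto
    have gc: "g ` {1..l} \<subseteq> carrier (polyring n)" using reg by (simp add: regular_seq_def)
    have ul: "{1..<Suc l} = {1..l}" by auto
    have id: "ideal (genideal (polyring n) (g ` {1..l})) (polyring n)" by (rule genideal_ideal'[OF gc])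
    have "subst g P = mscale (coef P 0) 1" by (subst P0) simp
    then have "mscale (coef P 0) 1 \<in> genideal (polyring n) (g ` {1..l})" using base.prems(3) unfolding ul by simp
    then have "mscale (inverse (coef P 0)) (mscale (coef P 0) 1) \<in> genideal (polyring n) (g ` {1..l})"
      by (rule mp.subspace_scale[OF subspace_ideal[OF id]])
    then have "1 \<in> genideal (polyring n) (g ` {1..l})" using c0 by simp
    then have "genideal (polyring n) (g ` {1..l}) = carrier (polyring n)"
      using ideal.one_imp_carrier[OF id] by simp
    then show False using reg by (simp add: regular_seq_def)
  qed
next
  case (step i)
  have gc: "g ` {1..l} \<subseteq> carrier (polyring n)" using reg by (simp add: regular_seq_def)
  have il: "i \<in> {1..l}" using step.hyps step.prems(1) by simp
  let ?a = "genideal (polyring n) (g ` {1..<i})" and ?b = "genideal (polyring n) (g ` {1..<Suc i})"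
  have sub: "g ` {1..<i} \<subseteq> g ` {1..<Suc i}" "g ` {1..<Suc i} \<subseteq> carrier (polyring n)" using gc il by auto
  have id: "ideal ?b (polyring n)" by (rule genideal_ideal'[OF sub(2)])
  have ab: "?a \<subseteq> ?b" by (rule genideal_mono[OF sub])
  have bound: "\<exists>N. \<forall>m\<in>supp P. coef m i \<le> N" for P :: "'k mpoly"
    by (rule exI[of _ "Max ((\<lambda>m. coef m i) ` supp P)"]) auto
  have "P = 0" if "\<forall>m\<in>supp P. coef m i \<le> N" "\<And>m. m \<in> supp P \<Longrightarrow> supp m \<subseteq> {i..l}" "subst g P \<in> ?a" for N P
    using that
  proof (induction N arbitrary: P rule: less_induct)
    case (less N)
    let ?A = "{m. coef m i = 0}"
    let ?P0 = "restr ?A P"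
    have split: "P = ?P0 + restr (- ?A) P" by (rule poly_mapping_eqI) (auto simp: lookup_add)
    obtain Q where Q: "restr (- ?A) P = X i * Q" "supp Q \<subseteq> (\<lambda>m. m - unit_at i) ` supp (restr (- ?A) P)"
    proof -
      have "coef m i \<noteq> 0" if "m \<in> supp (restr (- ?A) P)" for m using that by (simp add: supp_restr)
      from X_dvd[OF this] show ?thesis using that by blast
    qed
    have Qm: "\<exists>m'\<in>supp P. coef m' i \<noteq> 0 \<and> m = m' - unit_at i" if "m \<in> supp Q" for m
      using Q(2) that by (auto simp: supp_restr)
    have Qv: "supp m \<subseteq> {i..l}" if mQ: "m \<in> supp Q" for m
    proof -
      obtain m' where m': "m' \<in> supp P" "m = m' - unit_at i" using Qm[OF mQ] by blast
      have "supp m \<subseteq> supp m'" unfolding m'(2) by (auto simp: in_keys_iff lookup_minus)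
      then show ?thesis using less.prems(2)[OF m'(1)] by blast
    qed
    have sQ: "subst g Q \<in> carrier (polyring n)"
      using Qv gc il by (intro carrier_subst[of "{i..l}"]) auto
    have sP: "subst g P = subst g ?P0 + subst g Q * g i"
      by (subst split) (simp add: subst_add Q(1) subst_mult mult.commute)
    have "subst g Q * g i \<in> ?b" using genideal_self'[OF sub(2)] il by (intro ideal_mult[OF id sQ]) auto
    then have "subst g P - subst g Q * g i \<in> ?b"
      using ab less.prems(3) by (intro mp.subspace_diff[OF subspace_ideal[OF id]]) auto
    then have "subst g ?P0 \<in> ?b" using sP by simp
    moreover have "supp m \<subseteq> {Suc i..l}" if "m \<in> supp ?P0" for m
    proof
      fix j assume j: "j \<in> supp m"
      have mP: "m \<in> supp P" "coef m i = 0" using that by (auto simp: supp_restr)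
      then have "j \<noteq> i" using j by (auto simp: in_keys_iff)
      moreover have "j \<in> {i..l}" using j less.prems(2)[OF mP(1)] by blast
      ultimately have "j \<noteq> i" "j \<in> {i..l}" by blast+
      then show "j \<in> {Suc i..l}" by auto
    qed
    ultimately have P0: "?P0 = 0" using step.IH[of ?P0] by simp
    then have "subst g Q * g i \<in> ?a" using sP less.prems(3) by simp
    then have Qa: "subst g Q \<in> ?a" using reg il sQ unfolding regular_seq_def by blast
    have "Q = 0"
    proof (cases "supp Q = {}")
      case False
      then obtain m where "m \<in> supp Q" by blast
      then have N: "N \<noteq> 0" using Qm[of m] less.prems(1) by fastforce
      have "coef m i \<le> N - 1" if "m \<in> supp Q" for m
        using Qm[OF that] less.prems(1) by (fastforce simp: lookup_minus)
      then show ?thesis using N Qv Qa by (intro less.IH[of "N - 1"]) auto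
    qed simp
    then show ?case using split P0 Q(1) by simp
  qed
  then show ?case using bound[of P] step.prems by blast
qed

lemma card_monoms_le: "card {m \<in> monoms n. mdeg m \<le> K} \<le> Suc K ^ n"
proof -
  let ?S = "{m \<in> monoms n. mdeg m \<le> K}"
  have inj: "inj_on (\<lambda>m. restrict (coef m) {1..n}) ?S"
  proof (rule inj_onI)
    fix x y assume x: "x \<in> ?S" and y: "y \<in> ?S" and e: "restrict (coef x) {1..n} = restrict (coef y) {1..n}"
    have "coef x i = coef y i" for i
    proof (cases "i \<in> {1..n}")
      case True
      then show ?thesis using fun_cong[OF e, of i] by simp
    next
      case False
      then have "i \<notin> supp x" "i \<notin> supp y" using x y by (auto simp: monoms_def)
      then show ?thesis by (simp add: in_keys_iff)
    qed
    then show "x = y" by (rule poly_mapping_eqI)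
  qed
  have "(\<lambda>m. restrict (coef m) {1..n}) ` ?S \<subseteq> {1..n} \<rightarrow>\<^sub>E {..K}"
    using coef_le_mdeg le_trans by fastforce
  then have "card ?S \<le> card ({1..n} \<rightarrow>\<^sub>E {..K})"
    by (rule card_inj_on_le[OF inj]) (simp add: finite_PiE)
  also have "\<dots> = Suc K ^ n" by (simp add: card_PiE)
  finally show ?thesis .
qed

lemma finite_monoms_le: "finite {m \<in> monoms n. mdeg m \<le> K}"
proof -
  have "{m \<in> monoms n. mdeg m \<le> K} \<subseteq> (\<Union>d\<le>K. {m \<in> monoms n. mdeg m = d})" by auto
  then show ?thesis by (rule finite_subset) (simp add: finite_monoms_deg)
qed

text \<open>
  More than \<open>n\<close> algebraically independent forms of bounded degree would have more independent products
  than there are monomials in \<open>n\<close> variables.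
\<close>

lemma regular_seq_length:
  fixes g :: "nat \<Rightarrow> 'k::field mpoly"
  assumes reg: "regular_seq n l g" and g: "\<And>i. i \<in> {1..l} \<Longrightarrow> \<exists>d\<le>a. g i \<in> forms n d"
  shows "l \<le> n"
proof (rule ccontr)
  assume "\<not> l \<le> n"
  then have ln: "Suc n \<le> l" by simp
  define M where "M = Suc (Suc (l * a) ^ n)"
  define K where "K = l * (M * a)"
  let ?mk = "\<lambda>f. \<Sum>i\<in>{1..l}. Poly_Mapping.single i (f i :: nat)"
  let ?F = "{1..l} \<rightarrow>\<^sub>E {..<M}"
  let ?S = "{m \<in> monoms n. mdeg m \<le> K}"
  have cm: "coef (?mk f) i = (if i \<in> {1..l} then f i else 0)" for f i
    by (simp add: lookup_sum lookup_single when_def)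
  have inj: "inj_on ?mk ?F"
  proof (rule inj_onI)
    fix x y assume x: "x \<in> ?F" and y: "y \<in> ?F" and e: "?mk x = ?mk y"
    show "x = y"
    proof (rule PiE_ext[OF x y])
      fix i assume "i \<in> {1..l}"
      then show "x i = y i" using cm[of x i] cm[of y i] e by simp
    qed
  qed
  have finF: "finite ?F" by (intro finite_PiE) auto
  have ind: "fam_indep (?mk ` ?F) (\<lambda>m. subst g (xmon m))"
    unfolding fam_indep_def
  proof (intro allI impI)
    fix c assume s: "(\<Sum>b\<in>?mk ` ?F. mscale (c b) (subst g (xmon b))) = 0"
    let ?P = "\<Sum>b\<in>?mk ` ?F. mscale (c b) (xmon b) :: 'k mpoly"
    have "subst g ?P = 0" using s by (simp add: subst_sum subst_mscale)
    moreover have "supp m \<subseteq> {1..l}" if "m \<in> supp ?P" for m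
    proof -
      have "m \<in> (\<Union>b\<in>?mk ` ?F. supp (mscale (c b) (xmon b) :: 'k mpoly))"
        using keys_sum[of "\<lambda>b. mscale (c b) (xmon b) :: 'k mpoly" "?mk ` ?F"] that by blast
      then obtain f where "m = ?mk f" by (auto split: if_splits)
      then show ?thesis using cm by (auto simp: in_keys_iff split: if_splits)
    qed
    moreover have "(0 :: 'k mpoly) \<in> genideal (polyring n) (g ` {1..<1})"
      using mp.subspace_0[OF subspace_ideal[OF genideal_ideal'[of "{}" n]]] by simp
    ultimately have "?P = 0" using regular_seq_alg_indep[OF reg, of 1 ?P] by simp
    then show "\<forall>b\<in>?mk ` ?F. c b = 0"
      using fam_indep_mon[of "?mk ` ?F"] finF unfolding fam_indep_def by blast
  qed
  have c1: "card (?mk ` ?F) \<le> mp.dim {p :: 'k mpoly. supp p \<subseteq> ?S}"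
  proof (rule fam_indep_card_le[of "(\<lambda>m. xmon m :: 'k mpoly) ` ?S"])
    show "finite ((\<lambda>m. xmon m :: 'k mpoly) ` ?S)" using finite_monoms_le by simp
    show "{p. supp p \<subseteq> ?S} \<subseteq> mp.span ((\<lambda>m. xmon m :: 'k mpoly) ` ?S)"
    proof
      fix p :: "'k mpoly" assume p: "p \<in> {p. supp p \<subseteq> ?S}"
      have "p = (\<Sum>m\<in>supp p. mscale (coef p m) (xmon m))" by (subst mpoly_decomp[of p]) simp
      also have "\<dots> \<in> mp.span (xmon ` ?S)" using p by (intro mp.span_sum mp.span_scale mp.span_base) auto
      finally show "p \<in> mp.span (xmon ` ?S)" .
    qed
    show "(\<lambda>m. subst g (xmon m)) ` ?mk ` ?F \<subseteq> {p. supp p \<subseteq> ?S}"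
    proof safe
      fix f m assume f: "f \<in> ?F" and m: "m \<in> supp (subst g (xmon (?mk f)))"
      obtain d where d: "\<And>i. i \<in> {1..l} \<Longrightarrow> d i \<le> a \<and> g i \<in> forms n (d i)" using g by metis
      have "supp (?mk f) \<subseteq> {1..l}"
      proof
        fix j assume "j \<in> supp (?mk f)"
        then have "coef (?mk f) j \<noteq> 0" by (simp only: in_keys_iff not_False_eq_True)
        then show "j \<in> {1..l}" unfolding cm by (metis (full_types))
      qed
      then have "mono_val g (?mk f) = (\<Prod>i\<in>{1..l}. g i ^ coef (?mk f) i)"
        by (intro mono_val_superset) simp
      then have "subst g (xmon (?mk f)) = (\<Prod>i\<in>{1..l}. g i ^ coef (?mk f) i)" by simp
      also have "\<dots> \<in> forms n (\<Sum>i\<in>{1..l}. coef (?mk f) i * d i)"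
        using d by (intro forms_prod forms_power) auto
      finally have fm: "m \<in> monoms n \<and> mdeg m = (\<Sum>i\<in>{1..l}. coef (?mk f) i * d i)" using m by (simp add: forms_iff)
      have "(\<Sum>i\<in>{1..l}. coef (?mk f) i * d i) \<le> (\<Sum>i\<in>{1..l}. M * a)"
      proof (rule sum_mono)
        fix i assume i: "i \<in> {1..l}"
        then have "f i < M" using f by auto
        then show "coef (?mk f) i * d i \<le> M * a" using cm[of f i] i d[OF i] by (simp add: mult_le_mono)
      qed
      then show "m \<in> monoms n" "mdeg m \<le> K" using fm by (simp_all add: K_def)
    qed
  qed (use finF ind in auto)
  have "mp.dim {p :: 'k mpoly. supp p \<subseteq> ?S} = card ?S" by (rule dim_monomial_space[OF finite_monoms_le])
  then have "card (?mk ` ?F) \<le> Suc K ^ n" using c1 card_monoms_le[of n K] by linarith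
  moreover have "card (?mk ` ?F) = M ^ l" using card_image[OF inj] by (simp add: card_PiE)
  ultimately have "M ^ l \<le> Suc K ^ n" by simp
  moreover have "M ^ Suc n \<le> M ^ l" using ln by (intro power_increasing) (auto simp: M_def)
  moreover have "Suc K \<le> M * Suc (l * a)" by (simp add: K_def M_def algebra_simps)
  then have "Suc K ^ n \<le> (M * Suc (l * a)) ^ n" by (rule power_mono) simp
  ultimately have "M ^ Suc n \<le> (M * Suc (l * a)) ^ n" by linarith
  then have le: "M * M ^ n \<le> Suc (l * a) ^ n * M ^ n"
    unfolding power_mult_distrib power_Suc by (simp only: mult.commute)
  have "0 < M" by (simp add: M_def)
  then have "0 < M ^ n" by simp
  then have "M \<le> Suc (l * a) ^ n" using le mult_le_cancel2 by blast
  then show False by (simp add: M_def)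
qed

section \<open>Regular sequences stay free on a generic plane\<close>

lemma common_denominator:
  fixes q :: "nat \<Rightarrow> 'k::field poly" and z :: "'x \<Rightarrow> 'k poly"
  assumes "finite K"
    and "\<And>k. k \<in> K \<Longrightarrow> \<exists>D h. D \<noteq> 0 \<and> degree D \<le> G \<and> (\<forall>i\<in>A. degree (h i) \<le> G) \<and> D * z k = (\<Sum>i\<in>A. h i * q i)"
  shows "\<exists>D. D \<noteq> 0 \<and> degree D \<le> card K * G \<and>
    (\<forall>k\<in>K. \<exists>h. (\<forall>i\<in>A. degree (h i) \<le> card K * G) \<and> D * z k = (\<Sum>i\<in>A. h i * q i))"
  using assms
proof (induction K rule: finite_induct)
  case empty
  show ?case by (intro exI[of _ 1]) simp
next
  case (insert x K)
  obtain D where D: "D \<noteq> 0" "degree D \<le> card K * G"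
    "\<And>k. k \<in> K \<Longrightarrow> \<exists>h. (\<forall>i\<in>A. degree (h i) \<le> card K * G) \<and> D * z k = (\<Sum>i\<in>A. h i * q i)"
    using insert by blast
  obtain E g where E: "E \<noteq> 0" "degree E \<le> G" "\<forall>i\<in>A. degree (g i) \<le> G" "E * z x = (\<Sum>i\<in>A. g i * q i)"
    using insert.prems[of x] by blast
  have c: "card (insert x K) * G = card K * G + G" using insert.hyps by simp
  have dm: "degree (u * v) \<le> card K * G + G" if "degree u \<le> card K * G" "degree v \<le> G" for u v :: "'k poly"
    using degree_mult_le[of u v] that by linarith
  show ?case unfolding c
  proof (intro exI[of _ "D * E"] conjI ballI)
    show "D * E \<noteq> 0" "degree (D * E) \<le> card K * G + G" using D E dm by auto
    fix k assume k: "k \<in> insert x K"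
    show "\<exists>h. (\<forall>i\<in>A. degree (h i) \<le> card K * G + G) \<and> D * E * z k = (\<Sum>i\<in>A. h i * q i)"
    proof (cases "k = x")
      case True
      have "D * E * z k = D * (\<Sum>i\<in>A. g i * q i)" using E(4) True by (simp add: mult.assoc)
      then show ?thesis using E(3) D(2) dm
        by (intro exI[of _ "\<lambda>i. D * g i"]) (simp add: sum_distrib_left mult.assoc)
    next
      case False
      then obtain h where h: "\<forall>i\<in>A. degree (h i) \<le> card K * G" "D * z k = (\<Sum>i\<in>A. h i * q i)"
        using D(3) k by blast
      have "D * E * z k = E * (D * z k)" by (simp add: mult.left_commute mult.commute)
      also have "\<dots> = (\<Sum>i\<in>A. (h i * E) * q i)" unfolding h(2) by (simp add: sum_distrib_left mult.left_commute mult.commute)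
      finally show ?thesis using h(1) E(2) dm by (intro exI[of _ "\<lambda>i. h i * E"]) simp
    qed
  qed
qed

text \<open>
  A polynomial that does not extend a maximal free family has a multiple with small denominator in
  its span.
\<close>

lemma not_free_denominator:
  fixes q :: "nat \<Rightarrow> 'k::field poly"
  assumes A: "finite A" "k \<notin> A" "pfree F A q" "G \<le> F" and n: "\<not> pfree G (insert k A) q"
  shows "\<exists>D h. D \<noteq> 0 \<and> degree D \<le> G \<and> (\<forall>i\<in>A. degree (h i) \<le> G) \<and> D * q k = (\<Sum>i\<in>A. h i * q i)"
proof -
  obtain h where h: "\<forall>i\<in>insert k A. degree (h i) \<le> G" "(\<Sum>i\<in>insert k A. h i * q i) = 0" "\<exists>i\<in>insert k A. h i \<noteq> 0"
    using n unfolding pfree_def by blast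
  have s: "h k * q k + (\<Sum>i\<in>A. h i * q i) = 0" using h(2) A by simp
  have "h k \<noteq> 0"
  proof
    assume z: "h k = 0"
    then have "(\<Sum>i\<in>A. h i * q i) = 0" using s by simp
    then have "\<forall>i\<in>A. h i = 0" using A(3) h(1) le_trans[OF _ A(4)] unfolding pfree_def by blast
    then show False using h(3) z by blast
  qed
  moreover have "h k * q k = (\<Sum>i\<in>A. (- h i) * q i)"
    using s by (simp add: sum_negf eq_neg_iff_add_eq_0)
  ultimately show ?thesis using h(1) by (intro exI[of _ "h k"] exI[of _ "\<lambda>i. - h i"]) simp
qed

lemma card_low_le: "card (low n (Suc c)) \<le> Suc c ^ n"
proof -
  have "low n (Suc c) \<subseteq> {m \<in> monoms n. mdeg m \<le> c}" using ymonos_monoms by (auto simp: low_def)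
  then have "card (low n (Suc c)) \<le> card {m \<in> monoms n. mdeg m \<le> c}"
    by (rule card_mono[OF finite_monoms_le])
  then show ?thesis using card_monoms_le[of n c] by simp
qed

lemma power_beats_polynomial:
  fixes q c :: real
  assumes q: "q > 1" and c: "c \<ge> 0"
  shows "\<exists>k. (1 + real k * c) ^ n < q ^ k"
proof -
  have b: "ln q > 0" using q by simp
  define K where "K = ((1 + c) / ln q) ^ n"
  have K: "K > 0" using b c by (simp add: K_def)
  have "((\<lambda>x::real. x ^ n / exp x) \<longlongrightarrow> 0) at_top" by (rule tendsto_power_div_exp_0)
  then have "\<forall>\<^sub>F x in at_top. (x::real) ^ n / exp x < 1 / K" using K by (intro order_tendstoD) auto
  then obtain x0 where x0: "\<And>x. x \<ge> x0 \<Longrightarrow> x ^ n / exp x < 1 / K" unfolding eventually_at_top_linorder by blast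
  obtain k0 :: nat where k0: "x0 / ln q < real k0" using reals_Archimedean2 by blast
  let ?k = "Suc k0"
  have "x0 \<le> real ?k * ln q" using k0 b by (simp add: field_simps)
  then have "(real ?k * ln q) ^ n / exp (real ?k * ln q) < 1 / K" by (rule x0)
  then have l: "(real ?k * ln q) ^ n * K < exp (real ?k * ln q)" using K by (simp add: field_simps)
  have e: "exp (real ?k * ln q) = q ^ ?k"
    using q exp_of_nat_mult[of ?k "ln q"] by simp
  have "1 + real ?k * c \<le> real ?k * (1 + c)" by (simp add: algebra_simps)
  then have "(1 + real ?k * c) ^ n \<le> (real ?k * (1 + c)) ^ n" using c by (intro power_mono) auto
  also have "\<dots> = (real ?k * ln q) ^ n * K"
  proof -
    have eq: "real ?k * (1 + c) = (real ?k * ln q) * ((1 + c) / ln q)" using b by simp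
    show ?thesis unfolding K_def power_mult_distrib[symmetric] by (rule arg_cong[OF eq, of "\<lambda>x. x ^ n"])
  qed
  finally show ?thesis using l e by (intro exI[of _ ?k]) linarith
qed

text \<open>
  The number of monomials of degree at most \<open>T\<close> is polynomial in \<open>T\<close>. If a shift by a constant
  multiplied it by at least \<open>r / (r - 1)\<close> every time, it would grow exponentially.
\<close>

lemma low_ratio:
  assumes r: "1 \<le> r"
  shows "\<exists>T\<ge>t. (r - 1) * card (low n (T + d + 1)) < r * card (low n (T + 1 - t))"
proof (cases "r = 1")
  case True
  then show ?thesis by (intro exI[of _ t]) (simp add: low_1)
next
  case False
  show ?thesis
  proof (rule ccontr)
    assume "\<not> ?thesis"
    then have n: "r * card (low n (T + 1 - t)) \<le> (r - 1) * card (low n (T + d + 1))" if "T \<ge> t" for T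
      using that by (meson not_le)
    let ?c = "t + d"
    have step: "r * card (low n (Suc x)) \<le> (r - 1) * card (low n (Suc (x + ?c)))" for x
    proof -
      have "x + t + 1 - t = Suc x" "x + t + d + 1 = Suc (x + ?c)" by simp_all
      then show ?thesis using n[of "x + t"] by (simp add: add.assoc)
    qed
    have pw: "r ^ k \<le> (r - 1) ^ k * card (low n (Suc (k * ?c)))" for k
    proof (induction k)
      case (Suc k)
      have "r ^ Suc k \<le> (r - 1) ^ k * (r * card (low n (Suc (k * ?c))))"
        using mult_le_mono2[OF Suc, of r] by (simp add: mult.left_commute)
      also have "\<dots> \<le> (r - 1) ^ k * ((r - 1) * card (low n (Suc (k * ?c + ?c))))"
        by (rule mult_le_mono2[OF step])
      finally show ?case by (simp add: add.commute mult.assoc mult.left_commute)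
    qed (simp add: low_1)
    define q where "q = real r / real (r - 1)"
    have r1: "real (r - 1) > 0" using r False by simp
    have "q > 1" using r False r1 by (simp add: q_def)
    then obtain k where k: "(1 + real k * real ?c) ^ n < q ^ k" using power_beats_polynomial[of q "real ?c" n] by auto
    have "r ^ k \<le> (r - 1) ^ k * Suc (k * ?c) ^ n"
      using pw[of k] mult_le_mono2[OF card_low_le[of n "k * ?c"], of "(r - 1) ^ k"] by (rule le_trans)
    then have "real (r ^ k) \<le> real ((r - 1) ^ k * Suc (k * ?c) ^ n)" by (rule of_nat_mono)
    then have "q ^ k \<le> real (Suc (k * ?c)) ^ n"
      using r1 unfolding q_def power_divide by (simp add: pos_divide_le_eq mult.commute)
    then show False using k by (simp add: add.commute)
  qed
qed

definition pick :: "nat \<Rightarrow> nat \<Rightarrow> nat \<Rightarrow> nat \<Rightarrow> nat" where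
  "pick n r t d = (SOME T. T \<ge> t \<and> (r - 1) * card (low n (T + d + 1)) < r * card (low n (T + 1 - t)))"

lemma pick:
  "1 \<le> r \<Longrightarrow> pick n r t d \<ge> t"
  "1 \<le> r \<Longrightarrow> (r - 1) * card (low n (pick n r t d + d + 1)) < r * card (low n (pick n r t d + 1 - t))"
  using someI_ex[OF low_ratio[of r t n d]] unfolding pick_def by auto

text \<open>
  The degree up to which a subfamily that lacks \<open>u\<close> members is required to be free. Each further member of the
  regular sequence lowers the requirement, since clearing its denominator costs degree.
\<close>

primrec thr :: "nat \<Rightarrow> nat \<Rightarrow> nat \<Rightarrow> nat \<Rightarrow> nat \<Rightarrow> nat" where
  "thr n r t F 0 = F"
| "thr n r t F (Suc u) = 2 * (pick n r t (r * thr n r t F u) + r * thr n r t F u) + 1 + thr n r t F u"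

definition times :: "nat \<Rightarrow> nat \<Rightarrow> nat \<Rightarrow> nat \<Rightarrow> nat set" where
  "times n r t F = (\<lambda>u. pick n r t (r * thr n r t F u)) ` {..<r}"

lemma thr_mono: "u \<le> w \<Longrightarrow> thr n r t F u \<le> thr n r t F w"
  by (induction w rule: dec_induct) auto

definition combos :: "nat \<Rightarrow> nat \<Rightarrow> (nat \<Rightarrow> 'k::field mpoly) \<Rightarrow> (nat \<Rightarrow> nat) \<Rightarrow> nat \<Rightarrow> 'k mpoly set" where
  "combos n r g a T = {\<Sum>k\<in>{1..r}. p k * g k | p. \<forall>k\<in>{1..r}. p k \<in> forms n (T - a k)}"

lemma subspace_combos: "mp.subspace (combos n r g a T)"
proof (rule mp.subspaceI)
  show "0 \<in> combos n r g a T" unfolding combos_def by (intro CollectI exI[of _ "\<lambda>_. 0"]) simp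
next
  fix x y assume "x \<in> combos n r g a T" "y \<in> combos n r g a T"
  then obtain p p' where "x = (\<Sum>k\<in>{1..r}. p k * g k)" "\<forall>k\<in>{1..r}. p k \<in> forms n (T - a k)"
    "y = (\<Sum>k\<in>{1..r}. p' k * g k)" "\<forall>k\<in>{1..r}. p' k \<in> forms n (T - a k)" unfolding combos_def by blast
  then show "x + y \<in> combos n r g a T" unfolding combos_def
    by (intro CollectI exI[of _ "\<lambda>k. p k + p' k"]) (auto simp: distrib_right sum.distrib intro: forms_add)
next
  fix c x assume "x \<in> combos n r g a T"
  then obtain p where "x = (\<Sum>k\<in>{1..r}. p k * g k)" "\<forall>k\<in>{1..r}. p k \<in> forms n (T - a k)" unfolding combos_def by blast
  then show "mscale c x \<in> combos n r g a T" unfolding combos_def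
    by (intro CollectI exI[of _ "\<lambda>k. mscale c (p k)"]) (auto simp: mp.scale_sum_right mscale_mult intro: forms_mscale)
qed

lemma combos_forms:
  assumes "\<And>k. k \<in> {1..r} \<Longrightarrow> a k \<le> T \<and> g k \<in> forms n (b + a k)"
  shows "combos n r g a T \<subseteq> forms n (b + T)"
proof
  fix x assume "x \<in> combos n r g a T"
  then obtain p where x: "x = (\<Sum>k\<in>{1..r}. p k * g k)" "\<forall>k\<in>{1..r}. p k \<in> forms n (T - a k)" unfolding combos_def by blast
  show "x \<in> forms n (b + T)" unfolding x(1)
  proof (rule forms_sum)
    fix k assume k: "k \<in> {1..r}"
    have "p k * g k \<in> forms n ((T - a k) + (b + a k))" using x(2) assms k by (intro forms_mult) auto
    then show "p k * g k \<in> forms n (b + T)" using assms[OF k] by (simp add: add.commute)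
  qed
qed

lemma unip_props:
  assumes s: "s \<in> unip n"
  shows "s (x + y) = s x + s y" "s (mscale c x) = mscale c (s x)" "s (x * y) = s x * s y"
    "s (sum h B) = (\<Sum>b\<in>B. s (h b))" "s x = 0 \<longleftrightarrow> x = 0" "x \<in> forms n d \<Longrightarrow> s x \<in> forms n d"
    "Vector_Spaces.linear mscale mscale s" "inj s"
proof -
  obtain f where f: "s = subst f" "\<forall>i\<in>{1..n}. f i \<in> forms n 1" using unip_subst[OF s] by blast
  obtain s' where s': "\<forall>v. s' (s v) = v" using unip_inverse[OF s] by blast
  show "s (x + y) = s x + s y" "s (mscale c x) = mscale c (s x)" "s (x * y) = s x * s y"
    "s (sum h B) = (\<Sum>b\<in>B. s (h b))" by (simp_all add: f(1) subst_add subst_mscale subst_mult subst_sum)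
  show "inj s" using s' by (metis injI)
  show "s x = 0 \<longleftrightarrow> x = 0" using s' by (metis f(1) subst_0)
  show "x \<in> forms n d \<Longrightarrow> s x \<in> forms n d" unfolding f(1) using f(2) by (intro forms_subst) auto
  show "Vector_Spaces.linear mscale mscale s" unfolding f(1) by (rule linear_subst)
qed

lemma dim_unip_image:
  assumes s: "s \<in> unip n" and U: "mp.subspace U"
  shows "mp.dim (s ` U) = mp.dim U"
proof -
  interpret Vector_Spaces.linear mscale mscale s by (rule unip_props(7)[OF s])
  obtain B where B: "B \<subseteq> U" "mp.independent B" "U \<subseteq> mp.span B" "card B = mp.dim U" using mp.basis_exists by blast
  have "mp.independent (s ` B)" using B(2) unip_props(8)[OF s] by (intro independent_injective_image) (auto intro: inj_on_subset)
  moreover have "s ` U \<subseteq> mp.span (s ` B)" using B(3) span_image by blast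
  ultimately have "card (s ` B) = mp.dim (s ` U)" using B(1) by (intro mp.basis_card_eq_dim) auto
  then show ?thesis using B(4) card_image[OF inj_on_subset[OF unip_props(8)[OF s] subset_UNIV], of B] by simp
qed

lemma card_forms_low: "card {m \<in> monoms n. mdeg m = d} = card (low n (Suc d))" if "1 \<le> n"
proof -
  let ?f = "\<lambda>u. u + Poly_Mapping.single 1 (d - mdeg u)"
  have c1: "coef u 1 = 0" if "u \<in> ymonos n" for u using that by (force simp: ymonos_def in_keys_iff)
  have "inj_on ?f (low n (Suc d))"
  proof (rule inj_onI)
    fix u w assume u: "u \<in> low n (Suc d)" and w: "w \<in> low n (Suc d)" and e: "?f u = ?f w"
    have "coef u i = coef w i" for i
    proof (cases "i = 1")
      case True
      then show ?thesis using c1 u w by (simp add: low_def)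
    next
      case False
      then show ?thesis using arg_cong[OF e, of "\<lambda>m. coef m i"] by (simp add: lookup_add lookup_single when_def)
    qed
    then show "u = w" by (rule poly_mapping_eqI)
  qed
  moreover have "?f ` low n (Suc d) = {m \<in> monoms n. mdeg m = d}"
  proof (intro subset_antisym subsetI)
    fix m assume "m \<in> ?f ` low n (Suc d)"
    then show "m \<in> {m \<in> monoms n. mdeg m = d}" using ymonos_monoms[of n] \<open>1 \<le> n\<close> by (auto simp: low_def)
  next
    fix m assume m: "m \<in> {m \<in> monoms n. mdeg m = d}"
    let ?u = "Poly_Mapping.update 1 0 m"
    have e: "m = ?u + Poly_Mapping.single 1 (coef m 1)"
      by (rule poly_mapping_eqI) (auto simp: lookup_update lookup_add lookup_single when_def)
    have d: "d = mdeg ?u + coef m 1" using arg_cong[OF e, of mdeg] m by simp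
    have "supp ?u \<subseteq> {2..n}"
    proof
      fix j assume "j \<in> supp ?u"
      then have "j \<noteq> 1" "j \<in> supp m" by (auto simp: in_keys_iff lookup_update split: if_splits)
      moreover have "j \<in> {1..n}" using calculation m by (auto simp: monoms_def)
      ultimately show "j \<in> {2..n}" by auto
    qed
    then have "?u \<in> low n (Suc d)" using d by (simp add: low_def ymonos_def)
    moreover have "m = ?f ?u" using e d by simp
    ultimately show "m \<in> ?f ` low n (Suc d)" by blast
  qed
  ultimately show ?thesis using card_image[of ?f "low n (Suc d)"] by simp
qed

lemma low_mono: "c \<le> d \<Longrightarrow> low p c \<subseteq> low p d"
  by (auto simp: low_def)

text \<open>
  By freeness distinct coefficients give distinct combinations, and there are at least as many as \<open>r\<close>
  copies of the forms of degree \<open>T - t\<close> provide.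
\<close>

lemma dim_combos:
  fixes g :: "nat \<Rightarrow> 'k::field mpoly"
  assumes n: "1 \<le> n" and g: "\<And>k. k \<in> {1..r} \<Longrightarrow> a k \<le> t \<and> g k \<in> forms n (b + a k)" and T: "t \<le> T" "T < b"
    and free: "\<And>h. (\<And>k. k \<in> {1..r} \<Longrightarrow> \<exists>e<b. h k \<in> forms n e) \<Longrightarrow> (\<Sum>k\<in>{1..r}. h k * g k) = 0 \<Longrightarrow> \<forall>k\<in>{1..r}. h k = 0"
  shows "r * card (low n (T + 1 - t)) \<le> mp.dim (combos n r g a T)"
proof -
  let ?M = "\<lambda>k. {m \<in> monoms n. mdeg m = T - a k}"
  let ?B = "SIGMA k:{1..r}. ?M k"
  let ?w = "\<lambda>(k, m). xmon m * g k"
  have finB: "finite ?B" using finite_monoms_deg by auto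
  have ind: "fam_indep ?B ?w" unfolding fam_indep_def
  proof (intro allI impI)
    fix c assume s: "(\<Sum>x\<in>?B. mscale (c x) (?w x)) = 0"
    let ?h = "\<lambda>k. \<Sum>m\<in>?M k. mscale (c (k, m)) (xmon m) :: 'k mpoly"
    have "(\<Sum>x\<in>?B. mscale (c x) (?w x)) = (\<Sum>k\<in>{1..r}. \<Sum>m\<in>?M k. mscale (c (k, m)) (xmon m * g k))"
      using finite_monoms_deg by (subst sum.Sigma) (auto simp: split_def)
    then have "(\<Sum>k\<in>{1..r}. ?h k * g k) = 0" using s by (simp only: sum_distrib_right mscale_mult)
    moreover have "\<exists>e<b. ?h k \<in> forms n e" if "k \<in> {1..r}" for k
      using T by (intro exI[of _ "T - a k"] conjI forms_sum forms_mscale) auto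
    ultimately have h0: "\<forall>k\<in>{1..r}. ?h k = 0" by (intro free)
    show "\<forall>x\<in>?B. c x = 0"
    proof
      fix x assume "x \<in> ?B"
      then obtain k m where x: "x = (k, m)" "k \<in> {1..r}" "m \<in> ?M k" by auto
      then have "?h k = 0" using h0 by blast
      then have "\<forall>m\<in>?M k. c (k, m) = 0"
        using fam_indep_mon[OF finite_monoms_deg, of n "T - a k", unfolded fam_indep_def, rule_format, of "\<lambda>m. c (k, m)"] by blast
      then show "c x = 0" using x by blast
    qed
  qed
  have "card ?B \<le> mp.dim (combos n r g a T)"
  proof (rule fam_indep_card_le[OF finite_forms_basis _ finB ind])
    show "combos n r g a T \<subseteq> mp.span (xmon ` {m \<in> monoms n. mdeg m = b + T})"
      using combos_forms[of r a T g n b] forms_span[of n "b + T"] g T(1) le_trans by blast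
    show "?w ` ?B \<subseteq> combos n r g a T"
    proof safe
      fix k m assume k: "k \<in> {1..r}" and m: "m \<in> monoms n" "mdeg m = T - a k"
      let ?p = "\<lambda>j. if j = k then xmon m else (0 :: 'k mpoly)"
      have "(\<Sum>j\<in>{1..r}. ?p j * g j) = (\<Sum>j\<in>{1..r}. if j = k then xmon m * g k else 0)"
        by (intro sum.cong) auto
      also have "\<dots> = xmon m * g k" using k by simp
      finally have "xmon m * g k = (\<Sum>j\<in>{1..r}. ?p j * g j)" by simp
      then show "xmon m * g k \<in> combos n r g a T" unfolding combos_def using m
        by (intro CollectI exI[of _ ?p]) auto
    qed
  qed
  moreover have "card ?B = (\<Sum>k\<in>{1..r}. card (?M k))" using finite_monoms_deg by (simp add: card_SigmaI)
  moreover have "(\<Sum>k\<in>{1..r}. card (low n (T + 1 - t))) \<le> (\<Sum>k\<in>{1..r}. card (?M k))"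
  proof (rule sum_mono)
    fix k assume k: "k \<in> {1..r}"
    have "T + 1 - t \<le> Suc (T - a k)" using g[OF k] T by linarith
    then show "card (low n (T + 1 - t)) \<le> card (?M k)"
      unfolding card_forms_low[OF n] by (intro card_mono low_mono) auto
  qed
  ultimately show ?thesis by simp
qed

lemma card_lvals_bound:
  assumes A: "finite A" and V: "\<And>e i b. (e, i, b) \<in> V \<Longrightarrow> i \<in> A \<and> supp e \<subseteq> {3..n} \<and> b + mdeg e \<le> c" and n: "2 \<le> n"
  shows "card (V :: (mono \<times> nat \<times> nat) set) \<le> card A * card (low n (Suc c))"
proof -
  let ?f = "\<lambda>(e, i, b). (i, e + Poly_Mapping.single 2 b)"
  have inj: "inj_on ?f V"
  proof (rule inj_onI)
    fix x y assume xy: "x \<in> V" "y \<in> V" "?f x = ?f y"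
    obtain e i b where x: "x = (e, i, b)" by (cases x)
    obtain e' i' b' where y: "y = (e', i', b')" by (cases y)
    have s: "supp e \<subseteq> {3..n}" "supp e' \<subseteq> {3..n}" using V xy x y by blast+
    then have "2 \<notin> supp e" "2 \<notin> supp e'" by auto
    then have c: "coef e 2 = 0" "coef e' 2 = 0" by (simp_all add: in_keys_iff)
    have eq: "e + Poly_Mapping.single 2 b = e' + Poly_Mapping.single 2 b'" "i = i'" using xy(3) x y by auto
    have "b = b'" using arg_cong[OF eq(1), of "\<lambda>m. coef m 2"] c by (simp add: lookup_add)
    then show "x = y" using eq x y by simp
  qed
  have "?f ` V \<subseteq> A \<times> low n (Suc c)"
  proof
    fix z assume "z \<in> ?f ` V"
    then obtain e i b where z: "z = (i, e + Poly_Mapping.single 2 b)" "(e, i, b) \<in> V" by auto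
    have v: "i \<in> A" "supp e \<subseteq> {3..n}" "b + mdeg e \<le> c" using V[OF z(2)] by auto
    have "e \<in> ymonos n" using v(2) unfolding ymonos_def by fastforce
    then show "z \<in> A \<times> low n (Suc c)" using v n z(1) by (auto simp: low_def)
  qed
  then have "card V \<le> card (A \<times> low n (Suc c))" by (rule card_inj_on_le[OF inj]) (use A in simp)
  then show ?thesis by (simp add: card_cartesian_product)
qed

text \<open>
  Take a subfamily of largest size that is free up to its threshold. If it is proper, the remaining
  restrictions are combinations of it with small denominators. Then all leading data of the combinations
  of degree \<open>T\<close> have a component in the subfamily, and there are fewer of them than the dimension of
  the space.
\<close>

theorem generic_plane_free:
  fixes g :: "nat \<Rightarrow> 'k::field_char_0 mpoly"
  assumes n: "2 \<le> n" and g: "\<And>k. k \<in> {1..r} \<Longrightarrow> a k \<le> t \<and> g k \<in> forms n (b + a k)"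
    and gfree: "\<And>h. (\<And>k. k \<in> {1..r} \<Longrightarrow> \<exists>e<b. h k \<in> forms n e) \<Longrightarrow> (\<Sum>k\<in>{1..r}. h k * g k) = 0 \<Longrightarrow> \<forall>k\<in>{1..r}. h k = 0"
    and T: "\<And>T. T \<in> times n r t F \<Longrightarrow> T < b"
    and s: "s \<in> unip n" and st: "\<And>T. T \<in> times n r t F \<Longrightarrow> stable_coords n (tails n (b + T)) (s ` combos n r g a T)"
  shows "pfree F {1..r} (\<lambda>k. slice 0 (s (g k)))"
proof (rule ccontr)
  assume contra: "\<not> ?thesis"
  let ?q = "\<lambda>k. slice 0 (s (g k))" and ?F = "\<lambda>A. thr n r t F (r - card A)"
  let ?P = "\<lambda>A. A \<subseteq> {1..r} \<and> pfree (?F A) A ?q"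
  have P0: "?P {}" by (simp add: pfree_def)
  have Pr: "\<forall>A. ?P A \<longrightarrow> card A < Suc r"
    using card_mono[of "{1..r}"] by (auto simp: less_Suc_eq_le)
  obtain A where A: "?P A" "\<And>B. ?P B \<Longrightarrow> card B \<le> card A"
    using ex_has_greatest_nat[of ?P "{}" card "Suc r", OF P0 Pr] by blast
  have fA: "finite A" using A(1) finite_subset by blast
  have "A \<noteq> {1..r}" using A(1) contra by auto
  then have cA: "card A < r" using A(1) psubset_card_mono[of "{1..r}" A] by auto
  then have r: "1 \<le> r" by simp
  define u where "u = r - card A - 1"
  have u: "r - card A = Suc u" "u < r" using cA by (auto simp: u_def)
  let ?G = "thr n r t F u"
  have frA: "pfree (thr n r t F (Suc u)) A ?q" using A(1) u by simp
  have GF: "?G \<le> thr n r t F (Suc u)" by (rule thr_mono) simp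
  have den: "\<exists>D h. D \<noteq> 0 \<and> degree D \<le> ?G \<and> (\<forall>i\<in>A. degree (h i) \<le> ?G) \<and> D * ?q k = (\<Sum>i\<in>A. h i * ?q i)"
    if k: "k \<in> {1..r}" for k
  proof (cases "k \<in> A")
    case True
    have "(\<Sum>i\<in>A. (if i = k then 1 else 0) * ?q i) = (\<Sum>i\<in>A. if i = k then ?q k else 0)"
      by (intro sum.cong) auto
    also have "\<dots> = 1 * ?q k" using True fA by simp
    finally show ?thesis by (intro exI[of _ 1] exI[of _ "\<lambda>i. if i = k then 1 else 0"]) auto
  next
    case False
    have "card (insert k A) = Suc (card A)" using False fA by simp
    moreover have "r - Suc (card A) = u" using u_def by simp
    ultimately have "\<not> pfree ?G (insert k A) ?q"
      using A(1) A(2)[of "insert k A"] k by auto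
    then show ?thesis by (rule not_free_denominator[OF fA False frA GF])
  qed
  obtain D where D: "D \<noteq> 0" "degree D \<le> r * ?G"
    "\<And>k. k \<in> {1..r} \<Longrightarrow> \<exists>h. (\<forall>i\<in>A. degree (h i) \<le> r * ?G) \<and> D * ?q k = (\<Sum>i\<in>A. h i * ?q i)"
    using common_denominator[of "{1..r}" ?G A ?q ?q] den by auto
  define T where "T = pick n r t (r * ?G)"
  define c where "c = T + r * ?G"
  have TT: "T \<in> times n r t F" using u(2) by (auto simp: times_def T_def)
  have tT: "t \<le> T" using pick(1)[OF r] by (simp add: T_def)
  have c2F: "2 * c < thr n r t F (Suc u)" by (simp add: c_def T_def)
  interpret poly_frame A ?q D c "thr n r t F (Suc u)"
    using fA frA D(1) c2F by unfold_locales auto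
  let ?W = "s ` combos n r g a T"
  have Wf: "?W \<subseteq> forms n (b + T)"
    using combos_forms[of r a T g n b] g tT unip_props(6)[OF s] le_trans by blast
  have sW: "mp.subspace ?W" by (rule subspace_linear_image[OF unip_props(7)[OF s] subspace_combos])
  have dom0: "lslice ?W 0 \<subseteq> dom"
  proof
    fix z assume "z \<in> lslice ?W 0"
    then obtain p where p: "\<forall>k\<in>{1..r}. p k \<in> forms n (T - a k)" "z = slice 0 (s (\<Sum>k\<in>{1..r}. p k * g k))"
      by (auto simp: lslice_def combos_def)
    obtain h where h: "\<And>k. k \<in> {1..r} \<Longrightarrow> (\<forall>i\<in>A. degree (h k i) \<le> r * ?G) \<and> D * ?q k = (\<Sum>i\<in>A. h k i * ?q i)"
      using D(3) by metis
    let ?p = "\<lambda>k. slice 0 (s (p k))"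
    have dp: "degree (?p k) \<le> T" if "k \<in> {1..r}" for k
      using degree_slice_0[OF unip_props(6)[OF s, of "p k" "T - a k"]] p(1) that by fastforce
    have "D * z = (\<Sum>k\<in>{1..r}. ?p k * (D * ?q k))"
      unfolding p(2) unip_props(3,4)[OF s] slice_sum slice_0_mult by (simp add: sum_distrib_left mult.left_commute)
    also have "\<dots> = (\<Sum>k\<in>{1..r}. \<Sum>i\<in>A. ?p k * h k i * ?q i)"
      using h by (intro sum.cong) (auto simp: sum_distrib_left mult.assoc)
    also have "\<dots> = (\<Sum>i\<in>A. (\<Sum>k\<in>{1..r}. ?p k * h k i) * ?q i)"
      unfolding sum_distrib_right by (rule sum.swap)
    finally have e: "D * z = (\<Sum>i\<in>A. (\<Sum>k\<in>{1..r}. ?p k * h k i) * ?q i)" .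
    have "degree (\<Sum>k\<in>{1..r}. ?p k * h k i) \<le> c" if "i \<in> A" for i
    proof (rule degree_sum_le)
      fix k assume k: "k \<in> {1..r}"
      have "degree (?p k * h k i) \<le> degree (?p k) + degree (h k i)" by (rule degree_mult_le)
      also have "\<dots> \<le> c" unfolding c_def using dp[OF k] h[OF k] that by (intro add_mono) auto
      finally show "degree (?p k * h k i) \<le> c" .
    qed simp
    then show "z \<in> dom" unfolding dom_def rep_def using e
      by (intro CollectI exI[of _ "\<lambda>i. if i \<in> A then \<Sum>k\<in>{1..r}. ?p k * h k i else 0"]) auto
  qed
  have adm: "admissible n (b + T) ?W" by (rule admissibleI[OF sW Wf dom0 st[OF TT]])
  have "card (lvals ?W) \<le> card A * card (low n (Suc c))"
  proof (rule card_lvals_bound[OF fA _ n])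
    fix e i b' assume v: "(e, i, b') \<in> lvals ?W"
    show "i \<in> A \<and> supp e \<subseteq> {3..n} \<and> b' + mdeg e \<le> c"
      using lvals_idx[OF adm v] lvals_tails[OF adm v] lvals_degree_bound[OF sW Wf dom0 st[OF TT] c2F v]
      by (simp add: tails_def)
  qed
  also have "\<dots> \<le> (r - 1) * card (low n (T + r * ?G + 1))"
    using cA by (intro mult_le_mono) (auto simp: c_def)
  also have "\<dots> < r * card (low n (T + 1 - t))" unfolding T_def by (rule pick(2)[OF r])
  also have "\<dots> \<le> mp.dim (combos n r g a T)"
    using n T[OF TT] by (intro dim_combos[OF _ g tT _ gfree]) auto
  also have "\<dots> = card (lvals ?W)"
    using dim_unip_image[OF s subspace_combos] dim_eq_card_lvals(2)[OF adm] by metis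
  finally show False by simp
qed

section \<open>Strongly stable families attached to spaces of forms\<close>

text \<open>
  The degree up to which a free family of slices is required to be free when at most \<open>u\<close> slices can
  still be added.
\<close>

primrec ext_thr :: "nat \<Rightarrow> nat \<Rightarrow> nat" where
  "ext_thr C 0 = 0"
| "ext_thr C (Suc u) = C * ext_thr C u + 1 + ext_thr C u"

lemma ext_thr_mono: "u \<le> w \<Longrightarrow> ext_thr C u \<le> ext_thr C w"
  by (induction w rule: dec_induct) auto

lemma stable_coords_mono: "stable_coords n E W \<Longrightarrow> E' \<subseteq> E \<Longrightarrow> stable_coords n E' W"
  unfolding stable_coords_def by blast

lemma tails_mono: "D \<le> D' \<Longrightarrow> tails n D \<subseteq> tails n D'"
  by (auto simp: tails_def)

text \<open>
  The frame consists of the restrictions of the \<open>g k\<close> to the generic plane, extended by slices of \<open>W t\<close>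
  to a maximal free family. Since \<open>dim (W t)\<close> is bounded, so is the denominator, and all leading slices
  have coordinates. The sets \<open>B j i\<close> are the leading data of \<open>W j\<close> in the component \<open>i\<close>, compressed
  to initial intervals.
\<close>

theorem stable_families_exist:
  fixes n r t C :: nat
  assumes n: "2 \<le> n"
  obtains D where "\<And>b (W :: nat \<Rightarrow> 'k::field_char_0 mpoly set) g a.
    D \<le> b \<Longrightarrow> (\<And>j. j \<le> t \<Longrightarrow> mp.subspace (W j) \<and> W j \<subseteq> forms n (b + j) \<and> mp.dim (W j) \<le> C) \<Longrightarrow>
    (\<And>j k v. j < t \<Longrightarrow> k \<in> {1..n} \<Longrightarrow> v \<in> W j \<Longrightarrow> X k * v \<in> W (Suc j)) \<Longrightarrow> W 0 \<noteq> {0} \<Longrightarrow>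
    (\<And>k. k \<in> {1..r} \<Longrightarrow> a k \<le> t \<and> a 1 \<le> a k \<and> g k \<in> W (a k)) \<Longrightarrow>
    (\<And>h. (\<And>k. k \<in> {1..r} \<Longrightarrow> \<exists>e<b. h k \<in> forms n e) \<Longrightarrow> (\<Sum>k\<in>{1..r}. h k * g k) = 0 \<Longrightarrow> \<forall>k\<in>{1..r}. h k = 0) \<Longrightarrow>
    \<exists>s\<in>unip n. \<exists>A B. {1..r} \<subseteq> A \<and>
      (\<forall>j\<le>t. stable_family n A 1 (B j) (\<lambda>i. if i \<in> {2..r} then Suc j - a i else 0)) \<and>
      (\<forall>j<t. \<forall>i\<in>A. shadow n (B j i) \<subseteq> B (Suc j) i) \<and>
      (\<forall>j\<le>t. \<forall>p\<in>{2..n}. (\<Sum>i\<in>A. card (B j i \<inter> ymonos p)) = mp.dim (restr {m. supp m \<subseteq> {..p}} ` s ` W j))"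
proof -
  define F where "F = ext_thr C (Suc C)"
  define D where "D = Suc (\<Sum>T\<in>times n r t F. T)"
  have fT: "finite (times n r t F)" by (simp add: times_def)
  show thesis
  proof (rule that[of D])
    fix b and W :: "nat \<Rightarrow> 'k mpoly set" and g a
    assume Db: "D \<le> b"
      and W: "\<And>j. j \<le> t \<Longrightarrow> mp.subspace (W j) \<and> W j \<subseteq> forms n (b + j) \<and> mp.dim (W j) \<le> C"
      and WX: "\<And>j k v. j < t \<Longrightarrow> k \<in> {1..n} \<Longrightarrow> v \<in> W j \<Longrightarrow> X k * v \<in> W (Suc j)" and W0: "W 0 \<noteq> {0}"
      and g: "\<And>k. k \<in> {1..r} \<Longrightarrow> a k \<le> t \<and> a 1 \<le> a k \<and> g k \<in> W (a k)"
      and free: "\<And>h. (\<And>k. k \<in> {1..r} \<Longrightarrow> \<exists>e<b. h k \<in> forms n e) \<Longrightarrow> (\<Sum>k\<in>{1..r}. h k * g k) = 0 \<Longrightarrow> \<forall>k\<in>{1..r}. h k = 0"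
    have Tb: "T < b" if "T \<in> times n r t F" for T
      using member_le_sum[OF that, of "\<lambda>T. T"] fT Db by (simp add: D_def)
    have gf: "a k \<le> t \<and> g k \<in> forms n (b + a k)" if "k \<in> {1..r}" for k using g[OF that] W by blast
    have tT: "t \<le> T" if "T \<in> times n r t F" for T using that pick(1)[of r t n] by (auto simp: times_def)
    let ?U = "\<lambda>x. case x of Inl j \<Rightarrow> W j | Inr T \<Rightarrow> combos n r g a T"
    let ?d = "\<lambda>x. case x of Inl j \<Rightarrow> b + j | Inr T \<Rightarrow> b + T"
    let ?Ix = "Inl ` {..t} \<union> Inr ` times n r t F"
    define Dm where "Dm = b + t + b"
    obtain s where s: "s \<in> unip n" and gen: "\<forall>i\<in>?Ix. \<forall>e\<in>tails n Dm. \<forall>k\<in>{3..n}. \<forall>k'\<in>{1..<k}. \<forall>v\<in>s ` ?U i.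
       restr (below e) v = 0 \<longrightarrow> restr (below e) (divop k k' 1 v) \<in> restr (below e) ` s ` ?U i"
    proof -
      have "\<exists>s\<in>unip n. \<forall>i\<in>?Ix. \<forall>e\<in>tails n Dm. \<forall>k\<in>{3..n}. \<forall>k'\<in>{1..<k}. \<forall>v\<in>s ` ?U i.
       restr (below e) v = 0 \<longrightarrow> restr (below e) (divop k k' 1 v) \<in> restr (below e) ` s ` ?U i"
      proof (rule generic_coordinates[where d = ?d])
        show "finite ?Ix" using fT by simp
        show "finite (tails n Dm)" by (rule finite_tails)
        show "mp.subspace (?U i)" if "i \<in> ?Ix" for i using that W subspace_combos by auto
        show "?U i \<subseteq> forms n (?d i)" if "i \<in> ?Ix" for i
        proof (cases i)
          case (Inl j)
          then show ?thesis using that W[of j] by auto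
        next
          case (Inr T)
          then have "T \<in> times n r t F" using that by auto
          then have "combos n r g a T \<subseteq> forms n (b + T)"
            using gf tT le_trans by (intro combos_forms) blast
          then show ?thesis using Inr by simp
        qed
      qed
      then show ?thesis using that by blast
    qed
    have stW: "stable_coords n (tails n (b + j)) (s ` W j)" if "j \<le> t" for j
    proof -
      have "stable_coords n (tails n Dm) (s ` W j)"
        unfolding stable_coords_def using bspec[OF gen, of "Inl j"] that by simp
      from stable_coords_mono[OF this tails_mono[of "b + j" Dm]] that show ?thesis by (simp add: Dm_def)
    qed
    have stQ: "stable_coords n (tails n (b + T)) (s ` combos n r g a T)" if "T \<in> times n r t F" for T
    proof -
      have "stable_coords n (tails n Dm) (s ` combos n r g a T)"
        unfolding stable_coords_def using bspec[OF gen, of "Inr T"] that by simp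
      from stable_coords_mono[OF this tails_mono[of "b + T" Dm]] Tb[OF that] show ?thesis by (simp add: Dm_def)
    qed
    let ?q0 = "\<lambda>k. slice 0 (s (g k))"
    have fr0: "pfree F {1..r} ?q0"
      by (rule generic_plane_free[OF n gf free Tb s stQ])
    have sW: "mp.subspace (s ` W j)" "s ` W j \<subseteq> forms n (b + j)" if "j \<le> t" for j
      using W[OF that] subspace_linear_image[OF unip_props(7)[OF s]] unip_props(6)[OF s] by auto
    have dW: "mp.dim (s ` W j) = mp.dim (W j)" if "j \<le> t" for j using dim_unip_image[OF s] W[OF that] by blast
    have X1: "s (X 1) = X 1"
      using s by (induction rule: unip.induct) (auto simp: elem_sub_def)
    define Z where "Z = slice 0 ` s ` W t"
    have sliceX: "slice 0 (X 1 * v) = slice 0 v" for v :: "'k mpoly"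
      using slice_X_mult[of 0 1 v] by (simp add: tail_single monom_0 flip: one_pCons)
    have up: "slice 0 ` s ` W j \<subseteq> slice 0 ` s ` W (j + i)" if "j + i \<le> t" for i j
      using that
    proof (induction i)
      case (Suc i)
      have "slice 0 (s v) \<in> slice 0 ` s ` W (j + Suc i)" if "v \<in> W (j + i)" for v
      proof -
        have "X 1 * v \<in> W (j + Suc i)" using WX[of "j + i" 1 v] Suc.prems that n by simp
        then have "slice 0 (s (X 1 * v)) \<in> slice 0 ` s ` W (j + Suc i)" by (intro imageI)
        moreover have "slice 0 (s (X 1 * v)) = slice 0 (s v)" by (simp only: unip_props(3)[OF s] X1 sliceX)
        ultimately show ?thesis by simp
      qed
      then have "slice 0 ` s ` W (j + i) \<subseteq> slice 0 ` s ` W (j + Suc i)" by auto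
      moreover have "slice 0 ` s ` W j \<subseteq> slice 0 ` s ` W (j + i)" using Suc.IH Suc.prems by simp
      ultimately show ?case by (rule order_trans[rotated])
    qed simp
    have ZW: "slice 0 ` s ` W j \<subseteq> Z" if "j \<le> t" for j using up[of j "t - j"] that by (simp add: Z_def)
    have l0: "lslice U 0 = slice 0 ` U" for U :: "'k mpoly set"
      by (auto simp: lslice_def below_def restr_eq_0_iff)
    have le0: "(0::nat) \<le> t" by simp
    have Znz: "\<exists>z\<in>Z. z \<noteq> 0"
    proof -
      obtain v where v: "v \<in> W 0" "v \<noteq> 0" using W0 mp.subspace_0 W[of 0] by blast
      then have v': "s v \<in> forms n (b + 0)" "s v \<noteq> 0" using W[of 0] unip_props(5,6)[OF s] by auto
      obtain e where e: "restr (below e) (s v) = 0" "slice e (s v) \<noteq> 0" using leading_tail[OF v'] by blast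
      then obtain m where m: "m \<in> supp (s v)" "tail m = e" using slice_eq_0[of "s v" e] by blast
      have mm: "m \<in> monoms n" "mdeg m = b + 0" using v'(1) m(1) by (auto simp: forms_iff)
      have "supp e \<subseteq> {3..n}"
      proof
        fix j assume "j \<in> supp e"
        then have "j \<noteq> 1" "j \<noteq> 2" "j \<in> supp m" using m(2) by (auto simp: in_keys_iff coef_tail split: if_splits)
        then show "j \<in> {3..n}" using mm(1) unfolding monoms_def by force
      qed
      then have et: "e \<in> tails n (b + 0)" using mdeg_tail[of m] m(2) mm(2) by (simp add: tails_def)
      have "slice e (s v) \<in> lslice (s ` W 0) e" using e v by (auto simp: lslice_def)
      then have "monom 1 0 * slice e (s v) \<in> lslice (s ` W 0) 0"
        by (rule lslice_descend[OF sW(1)[OF le0] stW[OF le0] et]) simp_all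
      then have "slice e (s v) \<in> Z" using ZW[of 0] l0 by (simp add: monom_0 subset_iff flip: one_pCons)
      then show ?thesis using e(2) by blast
    qed
    \<comment> \<open>Extend the restricted regular sequence to a maximal free family in \<open>Z\<close>.\<close>
    let ?P = "\<lambda>m. r \<le> m \<and> (\<exists>q. (\<forall>i\<in>{1..r}. q i = ?q0 i) \<and> (\<forall>i\<in>{1..m}. q i \<in> Z) \<and> pfree (ext_thr C (Suc C - m)) {1..m} q)"
    have q0Z: "?q0 i \<in> Z" if "i \<in> {1..r}" for i using g[OF that] ZW[of "a i"] by auto
    have Pr: "?P r"
    proof (intro conjI exI[of _ ?q0])
      show "pfree (ext_thr C (Suc C - r)) {1..r} ?q0"
        by (rule pfree_antimono[OF fr0]) (unfold F_def, rule ext_thr_mono, simp)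
    qed (use q0Z in auto)
    have Pbound: "m \<le> C" if P: "?P m" for m
    proof -
      obtain q where q: "\<forall>i\<in>{1..m}. q i \<in> Z" "pfree (ext_thr C (Suc C - m)) {1..m} q" using P by blast
      have "\<forall>i\<in>{1..m}. \<exists>v. v \<in> s ` W t \<and> slice 0 v = q i"
      proof
        fix i assume "i \<in> {1..m}"
        then have "q i \<in> slice 0 ` s ` W t" using q(1) by (simp add: Z_def)
        then obtain v where "v \<in> s ` W t" "q i = slice 0 v" by (rule imageE)
        then show "\<exists>v. v \<in> s ` W t \<and> slice 0 v = q i" by metis
      qed
      from bchoice[OF this] obtain v where v: "\<And>i. i \<in> {1..m} \<Longrightarrow> v i \<in> s ` W t \<and> slice 0 (v i) = q i" by blast
      have "fam_indep {1..m} v" unfolding fam_indep_def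
      proof (intro allI impI)
        fix c assume "(\<Sum>i\<in>{1..m}. mscale (c i) (v i)) = 0"
        then have "slice 0 (\<Sum>i\<in>{1..m}. mscale (c i) (v i)) = 0" by simp
        then have cs: "(\<Sum>i\<in>{1..m}. [:c i:] * q i) = 0" using v by (simp add: slice_sum slice_mscale)
        have "[:c i:] = 0" if "i \<in> {1..m}" for i
          by (rule pfreeD[OF q(2) _ cs that]) simp
        then show "\<forall>i\<in>{1..m}. c i = 0" by simp
      qed
      then have "card {1..m} \<le> mp.dim (s ` W t)"
        using v sW(2)[of t] forms_span[of n "b + t"] by (intro fam_indep_card_le[OF finite_forms_basis[of n "b + t"]]) auto
      then show ?thesis using dW[of t] W[of t] by simp
    qed
    obtain m where m: "?P m" "\<And>m'. ?P m' \<Longrightarrow> m' \<le> m"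
    proof -
      have "\<forall>m. ?P m \<longrightarrow> m < Suc C" using Pbound by (simp add: less_Suc_eq_le)
      from ex_has_greatest_nat[of ?P r "\<lambda>m. m" "Suc C", OF Pr this] show ?thesis using that by blast
    qed
    have m1: "1 \<le> m"
    proof (cases "r = 0")
      case True
      obtain z where z: "z \<in> Z" "z \<noteq> 0" using Znz by blast
      have "?P 1" using True z by (intro conjI exI[of _ "\<lambda>_. z"]) (auto simp: pfree_def)
      then show ?thesis by (rule m(2))
    qed (use m(1) in simp)
    have mC: "m \<le> C" using Pbound m(1) by blast
    obtain q where q: "\<forall>i\<in>{1..r}. q i = ?q0 i" "\<forall>i\<in>{1..m}. q i \<in> Z" "pfree (ext_thr C (Suc C - m)) {1..m} q"
      using m(1) by blast
    let ?G = "ext_thr C (C - m)"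
    have thG: "ext_thr C (Suc C - m) = C * ?G + 1 + ?G" using mC by (simp add: Suc_diff_le)
    have den: "\<exists>D h. D \<noteq> 0 \<and> degree D \<le> ?G \<and> (\<forall>i\<in>{1..m}. degree (h i) \<le> ?G) \<and> D * z = (\<Sum>i\<in>{1..m}. h i * q i)"
      if z: "z \<in> Z" for z
    proof -
      let ?q = "q(Suc m := z)"
      have ins: "{1..Suc m} = insert (Suc m) {1..m}" by auto
      have "\<not> pfree ?G {1..Suc m} ?q"
      proof
        assume "pfree ?G {1..Suc m} ?q"
        moreover have "Suc C - Suc m = C - m" by simp
        ultimately have "?P (Suc m)" using m(1) q(1,2) z by (intro conjI exI[of _ ?q]) (auto simp: le_Suc_eq)
        then show False using m(2)[of "Suc m"] by simp
      qed
      moreover have "pfree (ext_thr C (Suc C - m)) {1..m} ?q"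
      proof -
        have "(\<Sum>i\<in>{1..m}. h i * ?q i) = (\<Sum>i\<in>{1..m}. h i * q i)" for h by (intro sum.cong) auto
        then show ?thesis using q(3) unfolding pfree_def by simp
      qed
      moreover have "?G \<le> ext_thr C (Suc C - m)" unfolding thG by simp
      ultimately obtain D h where Dh: "D \<noteq> 0" "degree D \<le> ?G" "\<forall>i\<in>{1..m}. degree (h i) \<le> ?G"
        "D * ?q (Suc m) = (\<Sum>i\<in>{1..m}. h i * ?q i)"
        using not_free_denominator[of "{1..m}" "Suc m" "ext_thr C (Suc C - m)" ?q ?G] unfolding ins by auto
      have "(\<Sum>i\<in>{1..m}. h i * ?q i) = (\<Sum>i\<in>{1..m}. h i * q i)" by (intro sum.cong) auto
      then show ?thesis using Dh by (intro exI[of _ D] exI[of _ h]) simp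
    qed
    obtain Bs where Bs: "Bs \<subseteq> s ` W t" "mp.independent Bs" "s ` W t \<subseteq> mp.span Bs" "card Bs = mp.dim (s ` W t)"
      using mp.basis_exists by blast
    have fBs: "finite Bs"
      using independent_card_le[OF finite_forms_basis[of n "b + t"] _ Bs(2,1)] sW(2)[of t] forms_span[of n "b + t"] by blast
    have cBs: "card Bs \<le> C" using Bs(4) dW[of t] W[of t] by simp
    obtain Dl where Dl: "Dl \<noteq> 0" "degree Dl \<le> card Bs * ?G"
      "\<And>v. v \<in> Bs \<Longrightarrow> \<exists>h. (\<forall>i\<in>{1..m}. degree (h i) \<le> card Bs * ?G) \<and> Dl * slice 0 v = (\<Sum>i\<in>{1..m}. h i * q i)"
    proof -
      have "slice 0 v \<in> Z" if "v \<in> Bs" for v using Bs(1) that by (auto simp: Z_def)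
      from common_denominator[OF fBs, of ?G "{1..m}" "slice 0" q, OF den[OF this]] show ?thesis
        using that by blast
    qed
    define c where "c = C * ?G"
    have cl: "card Bs * ?G \<le> c" using cBs by (simp add: c_def)
    interpret poly_frame "{1..m}" q Dl c "ext_thr C (Suc C - m)"
      using q(3) Dl(1) by unfold_locales (auto simp: thG c_def)
    have Zdom: "Z \<subseteq> dom"
    proof -
      have "slice 0 v \<in> dom" if "v \<in> mp.span Bs" for v
        using that
      proof (induction rule: mp.span_induct_alt)
        case base
        show ?case using zero_dom by simp
      next
        case (step x v w)
        obtain h where h: "\<forall>i\<in>{1..m}. degree (h i) \<le> card Bs * ?G" "Dl * slice 0 v = (\<Sum>i\<in>{1..m}. h i * q i)"
          using Dl(3) step.hyps by blast
        have "rep {1..m} q Dl c (slice 0 v) (\<lambda>i. if i \<in> {1..m} then h i else 0)"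
          unfolding rep_def using h cl by (auto intro: le_trans)
        then have "slice 0 v \<in> dom" unfolding dom_def by blast
        then show ?case unfolding slice_add slice_mscale using dom_add dom_smult step by blast
      qed
      then show ?thesis unfolding Z_def using Bs(3) by blast
    qed
    have adm: "admissible n (b + j) (s ` W j)" if "j \<le> t" for j
      using sW[OF that] stW[OF that] ZW[OF that] Zdom by (intro admissibleI) (auto simp: l0)
    let ?V = "\<lambda>j. lvals (s ` W j)" and ?B = "\<lambda>j. compress n (lvals (s ` W j))"
    have finV: "finite (?V j)" if "j \<le> t" for j using dim_eq_card_lvals(1)[OF adm[OF that]] .
    have suppV: "supp e \<subseteq> {3..n} \<and> i \<in> {1..m}" if "j \<le> t" "(e, i, x) \<in> ?V j" for j e i x
      using lvals_tails[OF adm[OF that(1)] that(2)] lvals_idx[OF adm[OF that(1)] that(2)] by (auto simp: tails_def)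
    have ssB: "sstable n (?B j i)" if "j \<le> t" for j i
    proof (rule sstable_compress[OF finV[OF that] n])
      show "supp e \<subseteq> {3..n}" if "(e, i, x) \<in> ?V j" for e i x
        using suppV[OF \<open>j \<le> t\<close> that] by blast
      show "tail_closed n (?V j)" by (rule tail_closed_lvals[OF adm[OF that] stW[OF that]])
    qed
    have shB: "shadow n (?B j i) \<subseteq> ?B (Suc j) i" if j: "j < t" for j i
    proof (rule shadow_compress[OF finV n])
      show "tail_shadow n (?V j) (?V (Suc j))"
      proof (rule tail_shadow_lvals[OF adm adm n])
        fix k v assume k: "k \<in> {1..n}" and v: "v \<in> s ` W j"
        obtain s' where s': "s' \<in> unip n" "\<forall>v. s (s' v) = v" "\<forall>v. s' (s v) = v" using unip_inverse[OF s] by blast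
        then obtain w where w: "w \<in> W j" "v = s w" using v by blast
        have "s' (X k) \<in> forms n 1" using unip_props(6)[OF s'(1), of "X k" 1] k by simp
        then have sub: "supp (s' (X k)) \<subseteq> unit_at ` {1..n}"
        proof (intro subsetI)
          fix m assume "m \<in> supp (s' (X k))"
          then have m: "m \<in> monoms n" "mdeg m = 1" using \<open>s' (X k) \<in> forms n 1\<close> by (auto simp: forms_iff)
          then have "m \<noteq> 0" by auto
          then obtain i where i: "i \<in> supp m" using Max_supp by blast
          have "m - unit_at i + unit_at i = m" by (rule mono_minus_add[OF i])
          then have "mdeg (m - unit_at i) + 1 = mdeg m" by (metis mdeg_add mdeg_single)
          then have "m - unit_at i = 0" using m(2) by simp
          then have "m = unit_at i" using \<open>m - unit_at i + unit_at i = m\<close> by simp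
          then show "m \<in> unit_at ` {1..n}" using i m(1) by (auto simp: monoms_def)
        qed
        have "s' (X k) * w = (\<Sum>m\<in>supp (s' (X k)). Poly_Mapping.single m (coef (s' (X k)) m)) * w"
          by (rule arg_cong[OF mpoly_decomp, of "\<lambda>x. x * w"])
        also have "\<dots> = (\<Sum>m\<in>supp (s' (X k)). mscale (coef (s' (X k)) m) (xmon m * w))"
          unfolding sum_distrib_right by (intro sum.cong[OF refl]) (simp add: mscale_mult(1)[symmetric])
        also have "\<dots> \<in> W (Suc j)"
        proof (rule mp.subspace_sum)
          show "mp.subspace (W (Suc j))" using W[of "Suc j"] j by simp
          fix m assume "m \<in> supp (s' (X k))"
          then obtain i where i: "i \<in> {1..n}" "m = unit_at i" using sub by blast
          have "X i * w \<in> W (Suc j)" by (rule WX[OF j i(1) w(1)])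
          then have "xmon m * w \<in> W (Suc j)" using i(2) by (simp add: X_def)
          then show "mscale (coef (s' (X k)) m) (xmon m * w) \<in> W (Suc j)"
            using W[of "Suc j"] j mp.subspace_scale by auto
        qed
        finally have "s (s' (X k) * w) \<in> s ` W (Suc j)" by blast
        moreover have "s (s' (X k) * w) = X k * v" using s'(2) w(2) unip_props(3)[OF s] by simp
        ultimately show "X k * v \<in> s ` W (Suc j)" by simp
      qed (use j in auto)
    qed (use j in auto)
    have zeroB: "0 \<in> ?B (a i) i" if i: "i \<in> {1..r}" for i
    proof -
      have im: "i \<in> {1..m}" using i m(1) by auto
      have z: "q i \<in> lslice (s ` W (a i)) 0" using q(1) i g[OF i] unfolding l0 by auto
      let ?h = "\<lambda>k. if k = i then Dl else 0"
      have "(\<Sum>k\<in>{1..m}. ?h k * q k) = (\<Sum>k\<in>{1..m}. if k = i then Dl * q i else 0)" by (intro sum.cong) auto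
      also have "\<dots> = Dl * q i" using im by simp
      finally have "rep {1..m} q Dl c (q i) ?h" unfolding rep_def using im Dl(2) cl by auto
      then have rd: "q i \<in> dom" "crd (q i) = ?h"
        unfolding dom_def using crd_eq[OF rep_mono[of c]] cF by (auto simp: less_imp_le)
      have ld: "lead (q i) = (i, degree Dl)" "q i \<noteq> 0"
        using leadI[OF rd(1), of i] rd(2) Dl(1) by auto
      have "(0, i, degree Dl) \<in> ?V (a i)" using lead_in_lvals[OF adm z ld(2)] ld(1) g[OF i] by simp
      then have "{x. (0, i, x) \<in> ?V (a i)} \<noteq> {}" by blast
      then have "0 < expcount (?V (a i)) i 0"
        unfolding expcount_def using finite_exps[OF finV] g[OF i] by (simp add: card_gt_0_iff)
      moreover have "Poly_Mapping.update 2 0 (0 :: mono) = 0" by (rule poly_mapping_eqI) (simp add: lookup_update)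
      ultimately show ?thesis by (simp add: compress_def)
    qed
    have lowB: "low n (Suc j - a i) \<subseteq> ?B j i" if i: "i \<in> {1..r}" and j: "j \<le> t" for i j
    proof (cases "a i \<le> j")
      case True
      then show ?thesis using j
      proof (induction j rule: dec_induct)
        case base
        then show ?case using zeroB[OF i] by (simp add: low_1 Suc_diff_le)
      next
        case (step j)
        have "Suc (Suc j) - a i = Suc (Suc (j - a i))" "Suc j - a i = Suc (j - a i)" using step.hyps by auto
        then have "low n (Suc (Suc j) - a i) = shadow n (low n (Suc j - a i))" by (simp add: shadow_low)
        also have "\<dots> \<subseteq> shadow n (?B j i)" using step by (intro shadow_mono) simp
        also have "\<dots> \<subseteq> ?B (Suc j) i" using shB step.prems by simp
        finally show ?case .
      qed
    qed simp
    show "\<exists>s\<in>unip n. \<exists>A B. {1..r} \<subseteq> A \<and>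
      (\<forall>j\<le>t. stable_family n A 1 (B j) (\<lambda>i. if i \<in> {2..r} then Suc j - a i else 0)) \<and>
      (\<forall>j<t. \<forall>i\<in>A. shadow n (B j i) \<subseteq> B (Suc j) i) \<and>
      (\<forall>j\<le>t. \<forall>p\<in>{2..n}. (\<Sum>i\<in>A. card (B j i \<inter> ymonos p)) = mp.dim (restr {m. supp m \<subseteq> {..p}} ` s ` W j))"
    proof (intro bexI[OF _ s] exI[of _ "{1..m}"] exI[of _ ?B] conjI allI impI ballI)
      show "{1..r} \<subseteq> {1..m}" using m(1) by auto
      show "shadow n (?B j i) \<subseteq> ?B (Suc j) i" if "j < t" for j i by (rule shB[OF that])
    next
      fix j assume j: "j \<le> t"
      show "stable_family n {1..m} 1 (?B j) (\<lambda>i. if i \<in> {2..r} then Suc j - a i else 0)"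
        unfolding stable_family_def
      proof (intro conjI ballI)
        show "sstable n (?B j i)" for i by (rule ssB[OF j])
        show "low n (if i \<in> {2..r} then Suc j - a i else 0) \<subseteq> ?B j i" for i using lowB[OF _ j, of i] by auto
        show "low n (if i \<in> {2..r} then Suc j - a i else 0) \<subseteq> ?B j 1" for i
        proof (cases "i \<in> {2..r}")
          case True
          then have "a 1 \<le> a i" using g[of i] by auto
          then have "low n (Suc j - a i) \<subseteq> low n (Suc j - a 1)" by (intro low_mono) simp
          also have "\<dots> \<subseteq> ?B j 1" using True by (intro lowB[OF _ j]) auto
          finally show ?thesis using True by simp
        next
          case False
          show ?thesis unfolding if_not_P[OF False] by simp
        qed
      qed (use m1 in auto)
    next
      fix j p assume j: "j \<le> t" and p: "p \<in> {2..n}"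
      have p2: "2 \<le> p" "p \<le> n" using p by auto
      have "(\<Sum>i\<in>{1..m}. card (?B j i \<inter> ymonos p)) = card {g \<in> ?V j. supp (fst g) \<subseteq> {..p}}"
        by (rule sum_card_compress[OF finV[OF j] p2 _ suppV[OF j]]) auto
      also have "\<dots> = card (lvals (restr {m. supp m \<subseteq> {..p}} ` s ` W j))"
        using restr_vars(2)[OF adm[OF j] p2(1)] by simp
      also have "\<dots> = mp.dim (restr {m. supp m \<subseteq> {..p}} ` s ` W j)"
        using dim_eq_card_lvals(2)[OF restr_vars(1)[OF adm[OF j] p2(1)]] by simp
      finally show "(\<Sum>i\<in>{1..m}. card (?B j i \<inter> ymonos p)) = mp.dim (restr {m. supp m \<subseteq> {..p}} ` s ` W j)" .
    qed
  qed
qed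

section \<open>Lex-plus-powers ideals\<close>

lemma span_xmon: "mp.span (xmon ` A) = {p :: 'k::field mpoly. supp p \<subseteq> A}"
proof (rule subset_antisym)
  have "mp.subspace {p :: 'k mpoly. supp p \<subseteq> A}"
  proof (rule mp.subspaceI)
    show "x + y \<in> {p. supp p \<subseteq> A}" if "x \<in> {p. supp p \<subseteq> A}" "y \<in> {p. supp p \<subseteq> A}" for x y :: "'k mpoly"
      using that keys_add[of x y] by auto
    show "mscale c x \<in> {p. supp p \<subseteq> A}" if "x \<in> {p. supp p \<subseteq> A}" for c and x :: "'k mpoly"
      using that by (auto simp: in_keys_iff)
  qed simp
  then show "mp.span (xmon ` A) \<subseteq> {p :: 'k mpoly. supp p \<subseteq> A}" by (intro mp.span_minimal) auto
  show "{p :: 'k mpoly. supp p \<subseteq> A} \<subseteq> mp.span (xmon ` A)"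
  proof
    fix p :: "'k mpoly" assume p: "p \<in> {p. supp p \<subseteq> A}"
    have "p = (\<Sum>m\<in>supp p. mscale (coef p m) (xmon m))" by (subst mpoly_decomp[of p]) simp
    also have "\<dots> \<in> mp.span (xmon ` A)" using p by (intro mp.span_sum mp.span_scale mp.span_base) auto
    finally show "p \<in> mp.span (xmon ` A)" .
  qed
qed

lemma genideal_monomials:
  assumes "G \<subseteq> monoms n"
  shows "genideal (polyring n) (xmon ` G) = {p :: 'k::field mpoly. supp p \<subseteq> {m + g | m g. m \<in> monoms n \<and> g \<in> G}}"
proof -
  have "{xmon m * h | m h. m \<in> monoms n \<and> h \<in> (\<lambda>g. xmon g :: 'k mpoly) ` G} = xmon ` {m + g | m g. m \<in> monoms n \<and> g \<in> G}"
    by (auto simp: mult_single image_iff) (metis mult_single mult_1)+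
  moreover have "(\<lambda>g. xmon g :: 'k mpoly) ` G \<subseteq> carrier (polyring n)" using assms by (auto simp: carrier_polyring)
  ultimately show ?thesis using genideal_span[of "(\<lambda>g. xmon g :: 'k mpoly) ` G" n] span_xmon by simp
qed

lemma supp_sum_split: "{p :: 'k::field mpoly. supp p \<subseteq> A} <+>\<^bsub>polyring n\<^esub> {p. supp p \<subseteq> B} = {p. supp p \<subseteq> A \<union> B}"
proof (intro subset_antisym subsetI)
  fix p assume "p \<in> {p :: 'k mpoly. supp p \<subseteq> A} <+>\<^bsub>polyring n\<^esub> {p. supp p \<subseteq> B}"
  then obtain x y where "supp x \<subseteq> A" "supp y \<subseteq> B" "p = x + y"
    by (auto simp: set_add_def set_mult_def)
  then show "p \<in> {p. supp p \<subseteq> A \<union> B}" using keys_add[of x y] by auto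
next
  fix p assume p: "p \<in> {p :: 'k mpoly. supp p \<subseteq> A \<union> B}"
  have e: "p = restr A p + restr (- A) p" by (rule poly_mapping_eqI) (auto simp: lookup_add)
  have "supp (restr A p) \<subseteq> A" "supp (restr (- A) p) \<subseteq> B" using p by (auto simp: supp_restr)
  then show "p \<in> {p :: 'k mpoly. supp p \<subseteq> A} <+>\<^bsub>polyring n\<^esub> {p. supp p \<subseteq> B}"
    using e by (auto simp: set_add_def set_mult_def)
qed

text \<open>
  The segment \<open>S j\<close> is homogenized with \<open>X 1\<close> in degree \<open>b + j\<close>.
\<close>

definition lexset :: "nat \<Rightarrow> nat \<Rightarrow> (nat \<Rightarrow> mono set) \<Rightarrow> mono set" where
  "lexset n b S = {m \<in> monoms n. b \<le> mdeg m \<and> Poly_Mapping.update 1 0 m \<in> S (mdeg m - b)}"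

definition powset :: "nat \<Rightarrow> nat \<Rightarrow> nat \<Rightarrow> (nat \<Rightarrow> nat) \<Rightarrow> mono set" where
  "powset n l b a = {m + Poly_Mapping.single i (b + a i) | m i. m \<in> monoms n \<and> i \<in> {1..l}}"

lemma upd1_add: "Poly_Mapping.update 1 0 (m + m') = Poly_Mapping.update 1 0 m + Poly_Mapping.update 1 0 (m' :: mono)"
  by (rule poly_mapping_eqI) (simp add: lookup_update lookup_add)

lemma upd1_single: "Poly_Mapping.update 1 0 (Poly_Mapping.single k c) = (if k = 1 then 0 else Poly_Mapping.single k (c :: nat))"
  by (rule poly_mapping_eqI) (auto simp: lookup_update lookup_single when_def)

lemma upd1_split: "m = Poly_Mapping.update 1 0 m + Poly_Mapping.single 1 (coef m 1)"
  by (rule poly_mapping_eqI) (auto simp: lookup_update lookup_add lookup_single when_def)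

lemma mdeg_upd1: "mdeg m = mdeg (Poly_Mapping.update 1 0 m) + coef m 1"
  using arg_cong[OF upd1_split[of m], of mdeg] by simp

lemma upd1_ymonos: "m \<in> monoms n \<Longrightarrow> Poly_Mapping.update 1 0 m \<in> ymonos n"
proof -
  assume m: "m \<in> monoms n"
  have "supp (Poly_Mapping.update 1 0 m) \<subseteq> {2..n}"
  proof
    fix j assume "j \<in> supp (Poly_Mapping.update 1 0 m)"
    then have "j \<noteq> 1" "j \<in> supp m" by (auto simp: in_keys_iff lookup_update split: if_splits)
    moreover have "j \<in> {1..n}" using calculation m by (auto simp: monoms_def)
    ultimately show "j \<in> {2..n}" by auto
  qed
  then show ?thesis by (simp add: ymonos_def)
qed

text \<open>
  Strongly stable sets are closed under divisors, so a monomial brings along one of each smaller degree.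
\<close>

lemma sstable_mdeg_less:
  assumes B: "sstable p B" and u: "u \<in> B"
  shows "mdeg u < card B"
proof -
  have ex: "\<exists>w\<in>B. mdeg w = d" if "d \<le> mdeg u" for d
    using u that
  proof (induction "mdeg u - d" arbitrary: u)
    case 0
    then show ?case by (intro bexI[of _ u]) auto
  next
    case (Suc x)
    then have "u \<noteq> 0" by auto
    then have k: "Max (supp u) \<in> supp u" by (rule Max_supp)
    let ?u = "u - unit_at (Max (supp u))"
    have e: "?u + unit_at (Max (supp u)) = u" by (rule mono_minus_add[OF k])
    have "?u + unit_at (Max (supp u)) \<in> B" unfolding e by (rule Suc.prems(1))
    then have "?u \<in> B" using B unfolding sstable_def by blast
    moreover have "mdeg u = Suc (mdeg ?u)" using arg_cong[OF e, of mdeg] by simp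
    ultimately show ?case using Suc.hyps Suc.prems by (intro Suc.hyps(1)[of ?u]) auto
  qed
  have "{..mdeg u} \<subseteq> mdeg ` B"
  proof
    fix d assume "d \<in> {..mdeg u}"
    then have "d \<le> mdeg u" by simp
    from ex[OF this] obtain w where w: "w \<in> B" "mdeg w = d" by (rule bexE)
    from w(1) have "mdeg w \<in> mdeg ` B" by (rule imageI)
    then show "d \<in> mdeg ` B" by (simp only: w(2))
  qed
  moreover have fin: "finite B" using B[unfolded sstable_def] by (rule conjunct1)
  ultimately have "card {..mdeg u} \<le> card (mdeg ` B)" by (intro card_mono finite_imageI)
  also have "\<dots> \<le> card B" by (rule card_image_le[OF fin])
  finally show ?thesis by simp
qed

locale lex_segments =
  fixes n b :: nat and S :: "nat \<Rightarrow> mono set"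
  assumes n: "2 \<le> n" and seg: "\<And>j. iseg n (S j)" and sh: "\<And>j. shadow n (S j) \<subseteq> S (Suc j)" and S0: "0 \<in> S 0"
begin

lemma lexset_add_unit:
  assumes m: "m \<in> lexset n b S" and k: "k \<in> {1..n}"
  shows "unit_at k + m \<in> lexset n b S"
proof -
  let ?u = "Poly_Mapping.update 1 0 m" and ?j = "mdeg m - b"
  have mm: "m \<in> monoms n" "b \<le> mdeg m" "?u \<in> S ?j" using m by (auto simp: lexset_def)
  have "Poly_Mapping.update 1 0 (unit_at k + m) \<in> shadow n (S ?j)"
  proof (cases "k = 1")
    case True
    then have "Poly_Mapping.update 1 0 (unit_at k + m) = ?u" unfolding upd1_add upd1_single by simp
    then show ?thesis using mm(3) by (simp add: shadow_def)
  next
    case False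
    then have "Poly_Mapping.update 1 0 (unit_at k + m) = ?u + unit_at k"
      unfolding upd1_add upd1_single by (simp add: add.commute)
    moreover have "k \<in> {2..n}" using k False by auto
    ultimately show ?thesis unfolding shadow_def using mm(3) by (intro UnI2 CollectI exI[of _ ?u] exI[of _ k]) simp
  qed
  moreover have "mdeg (unit_at k + m) - b = Suc ?j" using mm(2) by simp
  ultimately have "Poly_Mapping.update 1 0 (unit_at k + m) \<in> S (mdeg (unit_at k + m) - b)" using sh by auto
  then show ?thesis using mm k by (simp add: lexset_def)
qed

lemma lexset_up: "m \<in> lexset n b S \<Longrightarrow> m' \<in> monoms n \<Longrightarrow> m' + m \<in> lexset n b S"
proof (induction "mdeg m'" arbitrary: m')
  case (Suc d)
  then have "m' \<noteq> 0" by auto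
  then have k: "Max (supp m') \<in> supp m'" by (rule Max_supp)
  let ?w = "m' - unit_at (Max (supp m'))"
  have e: "?w + unit_at (Max (supp m')) = m'" by (rule mono_minus_add[OF k])
  have w: "?w \<in> monoms n" "Max (supp m') \<in> {1..n}"
    using Suc.prems(2) k monoms_add[of ?w "unit_at (Max (supp m'))" n] unfolding e by (auto simp: monoms_def)
  have "d = mdeg ?w" using arg_cong[OF e, of mdeg] Suc.hyps(2) by simp
  then have "?w + m \<in> lexset n b S" using Suc.hyps(1) Suc.prems(1) w(1) by blast
  then have "unit_at (Max (supp m')) + (?w + m) \<in> lexset n b S" by (rule lexset_add_unit[OF _ w(2)])
  moreover have "unit_at (Max (supp m')) + (?w + m) = m' + m" by (subst (3) e[symmetric]) (simp only: ac_simps)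
  ultimately show ?case by simp
qed simp

lemma lexset_swap:
  assumes m: "m + unit_at k \<in> lexset n b S" and k': "k' \<in> {1..<k}"
  shows "m + unit_at k' \<in> lexset n b S"
proof -
  let ?u = "Poly_Mapping.update 1 0 m" and ?j = "mdeg (m + unit_at k) - b"
  have mm: "m + unit_at k \<in> monoms n" "b \<le> mdeg (m + unit_at k)" "Poly_Mapping.update 1 0 (m + unit_at k) \<in> S ?j"
    using m by (auto simp: lexset_def)
  have "?u + unit_at k \<in> S ?j" using mm(3) k' unfolding upd1_add upd1_single by auto
  then have st: "?u \<in> S ?j" "\<forall>k'\<in>{2..<k}. ?u + unit_at k' \<in> S ?j"
    using iseg_sstable[OF seg, of ?j] unfolding sstable_def by blast+
  have "Poly_Mapping.update 1 0 (m + unit_at k') \<in> S ?j"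
    using st k' unfolding upd1_add upd1_single by auto
  moreover have "m + unit_at k' \<in> monoms n" using mm(1) k' by auto
  ultimately show ?thesis using mm(2) by (simp add: lexset_def)
qed

lemma lexset_swaps:
  assumes m: "m \<in> lexset n b S" and k: "k' \<in> {1..<k}" and l: "i \<le> coef m k"
  shows "m - Poly_Mapping.single k i + Poly_Mapping.single k' i \<in> lexset n b S"
  using l
proof (induction i)
  case (Suc i)
  let ?w = "m - Poly_Mapping.single k (Suc i) + Poly_Mapping.single k' i"
  have "?w + unit_at k = m - Poly_Mapping.single k i + Poly_Mapping.single k' i"
    using Suc.prems k by (intro poly_mapping_eqI) (auto simp: lookup_add lookup_minus lookup_single when_def)
  then have "?w + unit_at k \<in> lexset n b S" using Suc by simp
  then have "?w + unit_at k' \<in> lexset n b S" by (rule lexset_swap[OF _ k])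
  moreover have "?w + unit_at k' = m - Poly_Mapping.single k (Suc i) + Poly_Mapping.single k' (Suc i)"
    by (intro poly_mapping_eqI) (auto simp: lookup_add lookup_minus lookup_single when_def)
  ultimately show ?case by simp
qed (use m in simp)

text \<open>
  Each elementary substitution replaces factors \<open>X k\<close> by factors \<open>X k'\<close> with \<open>k' < k\<close>.
\<close>

lemma unip_lexset:
  fixes v :: "'k::field mpoly"
  assumes "s \<in> unip n" "supp v \<subseteq> lexset n b S" shows "supp (s v) \<subseteq> lexset n b S"
  using assms
proof (induction rule: unip.induct)
  case (step s k k' c)
  let ?v = "s v"
  have sv: "supp ?v \<subseteq> lexset n b S" using step by simp
  have one: "supp (subst (elem_sub k k' c) (Poly_Mapping.single m x)) \<subseteq> lexset n b S" if m: "m \<in> lexset n b S" for m x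
  proof -
    have "supp (subst (elem_sub k k' c) (Poly_Mapping.single m x)) \<subseteq>
        (\<Union>l\<le>coef m k. supp (mscale (c ^ l) (divop k k' l (Poly_Mapping.single m x))))"
      unfolding subst_elem_single[OF le_refl] by (rule keys_sum)
    also have "\<dots> \<subseteq> lexset n b S"
    proof (rule UN_least)
      fix l assume l: "l \<in> {..coef m k}"
      have "supp (mscale (c ^ l) (divop k k' l (Poly_Mapping.single m x))) \<subseteq>
          {m - Poly_Mapping.single k l + Poly_Mapping.single k' l}"
        unfolding divop_single mscale_single by simp
      then show "supp (mscale (c ^ l) (divop k k' l (Poly_Mapping.single m x))) \<subseteq> lexset n b S"
        using lexset_swaps[OF m step.hyps(3), of l] l by auto
    qed
    finally show ?thesis .
  qed
  have "subst (elem_sub k k' c) ?v = (\<Sum>m\<in>supp ?v. subst (elem_sub k k' c) (Poly_Mapping.single m (coef ?v m)))"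
    by (subst mpoly_decomp[of ?v]) (rule subst_sum)
  moreover have "supp (\<Sum>m\<in>supp ?v. subst (elem_sub k k' c) (Poly_Mapping.single m (coef ?v m))) \<subseteq> lexset n b S"
    using keys_sum[of "\<lambda>m. subst (elem_sub k k' c) (Poly_Mapping.single m (coef ?v m))" "supp ?v"] one sv by blast
  ultimately show ?case by simp
qed simp

lemma lex_ideal_lexset: "lex_ideal n {p :: 'k::field mpoly. supp p \<subseteq> lexset n b S}"
  unfolding lex_ideal_def monomial_ideal_def
proof (intro conjI exI[of _ "lexset n b S"] ballI impI)
  show L: "lexset n b S \<subseteq> monoms n" by (auto simp: lexset_def)
  have "{m + g | m g. m \<in> monoms n \<and> g \<in> lexset n b S} = lexset n b S"
  proof (intro subset_antisym subsetI)
    fix m assume m: "m \<in> lexset n b S"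
    show "m \<in> {m + g | m g. m \<in> monoms n \<and> g \<in> lexset n b S}"
      using m by (intro CollectI exI[of _ 0] exI[of _ m]) simp
  qed (auto intro: lexset_up)
  then show "{p :: 'k mpoly. supp p \<subseteq> lexset n b S} = genideal (polyring n) (xmon ` lexset n b S)"
    using genideal_monomials[OF L, where 'k = 'k] by simp
  fix p q assume p: "p \<in> monoms n" and q: "q \<in> monoms n"
    and h: "mdeg p = mdeg q \<and> lex_greater p q \<and> Poly_Mapping.single q 1 \<in> {p :: 'k mpoly. supp p \<subseteq> lexset n b S}"
  let ?u = "Poly_Mapping.update 1 0 p" and ?w = "Poly_Mapping.update 1 0 q"
  have d: "mdeg p = mdeg q" and qL: "q \<in> lexset n b S" using h by auto
  obtain i where i: "coef p i > coef q i" "\<forall>j<i. coef p j = coef q j"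
    using h unfolding lex_greater_def by blast
  have "i \<in> supp p" using i(1) by (simp add: in_keys_iff)
  then have i1: "1 \<le> i" using p by (auto simp: monoms_def)
  have "prec ?u ?w"
  proof (cases "i = 1")
    case True
    then show ?thesis using i(1) mdeg_upd1[of p] mdeg_upd1[of q] d by (simp add: prec_def)
  next
    case False
    then have "coef p 1 = coef q 1" using i(2) i1 by simp
    then have "mdeg ?u = mdeg ?w" using mdeg_upd1[of p] mdeg_upd1[of q] d by simp
    moreover have "lex_greater ?u ?w" unfolding lex_greater_def
      using i False by (intro exI[of _ i]) (auto simp: lookup_update)
    ultimately show ?thesis by (simp add: prec_def)
  qed
  moreover have "?w \<in> S (mdeg q - b)" "b \<le> mdeg q" using qL by (auto simp: lexset_def)
  ultimately have "?u \<in> S (mdeg p - b)" using seg[of "mdeg q - b"] upd1_ymonos[OF p] d unfolding iseg_def by auto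
  then have "p \<in> lexset n b S" using p d \<open>b \<le> mdeg q\<close> by (simp add: lexset_def)
  then show "Poly_Mapping.single p 1 \<in> {p :: 'k mpoly. supp p \<subseteq> lexset n b S}" by simp
qed

lemma lexset_degree:
  assumes "\<And>u. u \<in> S j \<Longrightarrow> mdeg u \<le> b + j"
  shows "{m \<in> lexset n b S. mdeg m = b + j} = (\<lambda>u. u + Poly_Mapping.single 1 (b + j - mdeg u)) ` S j"
    and "inj_on (\<lambda>u. u + Poly_Mapping.single 1 (b + j - mdeg u)) (S j)"
proof -
  let ?f = "\<lambda>u. u + Poly_Mapping.single 1 (b + j - mdeg u)"
  have upf: "Poly_Mapping.update 1 0 (?f u) = u" if "u \<in> S j" for u
  proof -
    have "u \<in> ymonos n" using that seg[of j] by (auto simp: iseg_def)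
    then have "1 \<notin> supp u" by (auto simp: ymonos_def)
    then have "coef u 1 = 0" by (simp add: in_keys_iff)
    then show ?thesis by (intro poly_mapping_eqI) (auto simp: lookup_update lookup_add lookup_single when_def)
  qed
  then show "inj_on ?f (S j)" by (rule inj_on_inverseI)
  show "{m \<in> lexset n b S. mdeg m = b + j} = ?f ` S j"
  proof (intro subset_antisym subsetI)
    fix m assume m: "m \<in> {m \<in> lexset n b S. mdeg m = b + j}"
    then have "Poly_Mapping.update 1 0 m \<in> S j" by (auto simp: lexset_def)
    moreover have "mdeg m = b + j" using m by simp
    then have c: "b + j - mdeg (Poly_Mapping.update 1 0 m) = coef m 1" using mdeg_upd1[of m] by linarith
    have "m = ?f (Poly_Mapping.update 1 0 m)" unfolding c by (rule upd1_split)
    ultimately show "m \<in> ?f ` S j" by blast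
  next
    fix m assume "m \<in> ?f ` S j"
    then obtain u where u: "u \<in> S j" "m = ?f u" by blast
    have "u \<in> monoms n" using u(1) seg[of j] ymonos_monoms by (auto simp: iseg_def)
    then have "m \<in> monoms n" using u(2) n by simp
    moreover have "mdeg m = b + j" using u assms by simp
    ultimately show "m \<in> {m \<in> lexset n b S. mdeg m = b + j}" using upf[OF u(1)] u by (simp add: lexset_def)
  qed
qed

end

locale lex_plus_powers = lex_segments +
  fixes l t C :: nat and a :: "nat \<Rightarrow> nat"
  assumes l: "1 \<le> l" "l \<le> n" and C: "\<And>j. j \<le> t \<Longrightarrow> card (S j) \<le> C" and b: "C + t < b"
begin

definition J :: "'k::field mpoly set" where "J = {p. supp p \<subseteq> lexset n b S \<union> powset n l b a}"

lemma lpp_J: "(J :: 'k::field mpoly set) = {p. supp p \<subseteq> lexset n b S} <+>\<^bsub>polyring n\<^esub>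
    genideal (polyring n) ((\<lambda>i. X i ^ (b + a i)) ` {1..l})"
proof -
  let ?G = "(\<lambda>i. Poly_Mapping.single i (b + a i)) ` {1..l}"
  have G: "?G \<subseteq> monoms n" using l by auto
  have "(\<lambda>i. X i ^ (b + a i)) ` {1..l} = (\<lambda>m. xmon m :: 'k mpoly) ` ?G" by (simp add: X_power image_image)
  moreover have "{m + g | m g. m \<in> monoms n \<and> g \<in> ?G} = powset n l b a" unfolding powset_def by blast
  ultimately have "genideal (polyring n) ((\<lambda>i. X i ^ (b + a i)) ` {1..l}) = {p :: 'k mpoly. supp p \<subseteq> powset n l b a}"
    using genideal_monomials[OF G, where 'k = 'k] by simp
  then show ?thesis by (simp add: J_def supp_sum_split)
qed

lemma ideal_J: "ideal (J :: 'k::field mpoly set) (polyring n)"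
proof -
  let ?L = "lexset n b S" and ?P = "powset n l b a"
  have sub: "?L \<union> ?P \<subseteq> monoms n"
  proof
    fix m assume "m \<in> ?L \<union> ?P"
    then show "m \<in> monoms n" using l by (auto simp: lexset_def powset_def)
  qed
  have "{m + g | m g. m \<in> monoms n \<and> g \<in> ?L \<union> ?P} = ?L \<union> ?P"
  proof (intro subset_antisym subsetI)
    fix x assume "x \<in> {m + g | m g. m \<in> monoms n \<and> g \<in> ?L \<union> ?P}"
    then obtain m g where x: "x = m + g" "m \<in> monoms n" "g \<in> ?L \<union> ?P" by blast
    show "x \<in> ?L \<union> ?P"
    proof (cases "g \<in> ?L")
      case True
      then show ?thesis using lexset_up x by simp
    next
      case False
      then obtain w i where w: "g = w + Poly_Mapping.single i (b + a i)" "w \<in> monoms n" "i \<in> {1..l}"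
        using x(3) by (auto simp: powset_def)
      have "x = (m + w) + Poly_Mapping.single i (b + a i)" using x(1) w(1) by (simp add: add.assoc)
      moreover have "m + w \<in> monoms n" using x(2) w(2) by simp
      ultimately have "x \<in> ?P" unfolding powset_def using w(3) by blast
      then show ?thesis by simp
    qed
  next
    fix x assume x: "x \<in> ?L \<union> ?P"
    then show "x \<in> {m + g | m g. m \<in> monoms n \<and> g \<in> ?L \<union> ?P}"
      by (intro CollectI exI[of _ 0] exI[of _ x]) simp
  qed
  then have "J = genideal (polyring n) ((\<lambda>m. xmon m :: 'k mpoly) ` (?L \<union> ?P))"
    unfolding J_def using genideal_monomials[OF sub, where 'k = 'k] by simp
  moreover have "(\<lambda>m. xmon m :: 'k mpoly) ` (?L \<union> ?P) \<subseteq> carrier (polyring n)"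
    using sub by (auto simp: carrier_polyring)
  ultimately show ?thesis using genideal_ideal' by metis
qed

lemma S_deg: "j \<le> t \<Longrightarrow> u \<in> S j \<Longrightarrow> mdeg u < C"
  using sstable_mdeg_less[OF iseg_sstable[OF seg], of u j] C[of j] by simp

definition pows :: "nat \<Rightarrow> nat \<Rightarrow> mono set" where
  "pows j i = (if a i \<le> j then (\<lambda>m. m + Poly_Mapping.single i (b + a i)) ` {m \<in> monoms n. mdeg m = j - a i} else {})"

text \<open>
  The power of \<open>X 1\<close> adds nothing, since \<open>0 \<in> S 0\<close> puts \<open>X 1 ^ b\<close> into the lex part.
\<close>

lemma J_monomials_degree:
  assumes j: "j \<le> t"
  shows "{m \<in> lexset n b S \<union> powset n l b a. mdeg m = b + j} = {m \<in> lexset n b S. mdeg m = b + j} \<union> (\<Union>i\<in>{2..l}. pows j i)"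
proof (intro subset_antisym subsetI)
  fix m assume m: "m \<in> {m \<in> lexset n b S \<union> powset n l b a. mdeg m = b + j}"
  show "m \<in> {m \<in> lexset n b S. mdeg m = b + j} \<union> (\<Union>i\<in>{2..l}. pows j i)"
  proof (cases "m \<in> lexset n b S")
    case False
    then obtain w i where w: "m = w + Poly_Mapping.single i (b + a i)" "w \<in> monoms n" "i \<in> {1..l}"
      using m by (auto simp: powset_def)
    have "i \<noteq> 1"
    proof
      assume i: "i = 1"
      have one: "Poly_Mapping.update 1 0 (Poly_Mapping.single (1::nat) b) = 0" unfolding upd1_single by simp
      have "Poly_Mapping.single 1 b \<in> lexset n b S"
        unfolding lexset_def mem_Collect_eq one using S0 n by simp
      then have "(w + Poly_Mapping.single 1 (a i)) + Poly_Mapping.single 1 b \<in> lexset n b S"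
        using w(2) n by (intro lexset_up) auto
      moreover have "(w + Poly_Mapping.single 1 (a i)) + Poly_Mapping.single 1 b = m"
        unfolding w(1) i single_add by (simp only: ac_simps)
      ultimately show False using False by simp
    qed
    moreover have "mdeg w + a i = j" using m w(1) by simp
    ultimately have "i \<in> {2..l}" "m \<in> pows j i" using w by (auto simp: pows_def)
    then show ?thesis by blast
  qed (use m in simp)
next
  fix m assume "m \<in> {m \<in> lexset n b S. mdeg m = b + j} \<union> (\<Union>i\<in>{2..l}. pows j i)"
  then show "m \<in> {m \<in> lexset n b S \<union> powset n l b a. mdeg m = b + j}"
  proof
    assume "m \<in> (\<Union>i\<in>{2..l}. pows j i)"
    then obtain i where i: "i \<in> {2..l}" "m \<in> pows j i" by blast
    then have aij: "a i \<le> j" by (auto simp: pows_def split: if_splits)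
    then obtain w where w: "w \<in> monoms n" "mdeg w = j - a i" "m = w + Poly_Mapping.single i (b + a i)"
      using i(2) by (auto simp: pows_def)
    have "m \<in> powset n l b a" unfolding powset_def using w i(1) by (intro CollectI exI[of _ w] exI[of _ i]) auto
    then show ?thesis using w aij by simp
  qed simp
qed

lemma card_pows: "card (pows j i) = card (low n (Suc j - a i))" "finite (pows j i)"
proof -
  show "finite (pows j i)" using finite_monoms_deg by (simp add: pows_def)
  show "card (pows j i) = card (low n (Suc j - a i))"
  proof (cases "a i \<le> j")
    case True
    then have "card (pows j i) = card {m \<in> monoms n. mdeg m = j - a i}"
      by (simp add: pows_def card_image inj_on_def)
    also have "\<dots> = card (low n (Suc (j - a i)))" using n by (intro card_forms_low) simp
    finally show ?thesis using True by (simp add: Suc_diff_le)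
  qed (simp add: pows_def)
qed

text \<open>
  The sets involved are disjoint: monomials of the lex part have exponents below \<open>C\<close> at the indices
  \<open>2, \<dots>, l\<close>, whereas a multiple of a power has an exponent at least \<open>b\<close>, and there is no room for two
  of them in degree \<open>b + j < 2 * b\<close>.
\<close>

lemma dim_J:
  assumes j: "j \<le> t"
  shows "mp.dim (J \<inter> forms n (b + j) :: 'k::field mpoly set) = card (S j) + (\<Sum>i\<in>{2..l}. card (low n (Suc j - a i)))"
proof -
  let ?L = "{m \<in> lexset n b S. mdeg m = b + j}" and ?P = "\<Union>i\<in>{2..l}. pows j i"
  let ?M = "{m \<in> lexset n b S \<union> powset n l b a. mdeg m = b + j}"
  have d: "mdeg u \<le> b + j" if "u \<in> S j" for u using S_deg[OF j that] b by simp
  have fS: "finite (S j)" using seg[of j] by (simp add: iseg_def)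
  have LS: "card ?L = card (S j)" "finite ?L"
    using lexset_degree[OF d] fS by (simp_all add: card_image)
  have cL: "coef m i < C" if m: "m \<in> ?L" and i: "i \<in> {2..l}" for m i
  proof -
    have "Poly_Mapping.update 1 0 m \<in> S j" using m by (auto simp: lexset_def)
    then have "mdeg (Poly_Mapping.update 1 0 m) < C" by (rule S_deg[OF j])
    moreover have "coef m i = coef (Poly_Mapping.update 1 0 m) i" using i by (simp add: lookup_update)
    ultimately show ?thesis using coef_le_mdeg[of "Poly_Mapping.update 1 0 m" i] by simp
  qed
  have cP: "b \<le> coef m i \<and> mdeg m = b + j" if m: "m \<in> pows j i" for m i
    using m by (auto simp: pows_def lookup_add split: if_splits)
  have dis1: "?L \<inter> ?P = {}"
  proof (rule ccontr)
    assume "?L \<inter> ?P \<noteq> {}"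
    then obtain m i where m: "m \<in> ?L" "i \<in> {2..l}" "m \<in> pows j i" by blast
    then show False using cL[OF m(1,2)] cP[OF m(3)] b by simp
  qed
  have dis2: "pows j i \<inter> pows j i' = {}" if ii: "i \<noteq> i'" for i i'
  proof (rule ccontr)
    assume "pows j i \<inter> pows j i' \<noteq> {}"
    then obtain m where m: "m \<in> pows j i" "m \<in> pows j i'" by blast
    have "(\<Sum>x\<in>{i, i'}. coef m x) \<le> (\<Sum>x\<in>{i, i'} \<union> supp m. coef m x)" by (intro sum_mono2) auto
    also have "\<dots> = mdeg m" by (rule mdeg_superset[symmetric]) auto
    finally show False using cP[OF m(1)] cP[OF m(2)] ii j b by simp
  qed
  have M: "?M = ?L \<union> ?P" by (rule J_monomials_degree[OF j])
  have finM: "finite ?M" unfolding M using LS(2) card_pows(2) by simp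
  have "?M \<subseteq> monoms n"
  proof
    fix m assume "m \<in> ?M"
    then show "m \<in> monoms n" using l by (auto simp: lexset_def powset_def)
  qed
  then have "J \<inter> forms n (b + j) = {p :: 'k mpoly. supp p \<subseteq> ?M}" by (auto simp: J_def forms_iff subset_iff)
  then have "mp.dim (J \<inter> forms n (b + j) :: 'k mpoly set) = card ?M" using dim_monomial_space[OF finM] by simp
  also have "\<dots> = card ?L + card ?P" unfolding M using LS(2) card_pows(2) dis1 by (intro card_Un_disjoint) auto
  also have "card ?P = (\<Sum>i\<in>{2..l}. card (pows j i))" using card_pows(2) dis2 by (intro card_UN_disjoint) auto
  finally show ?thesis using LS(1) card_pows(1) by simp
qed

lemma J_small: "d < b \<Longrightarrow> J \<inter> forms n d = {0 :: 'k::field mpoly}"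
proof -
  assume d: "d < b"
  have "supp p = {}" if "p \<in> J \<inter> forms n d" for p :: "'k mpoly"
  proof (rule ccontr)
    assume "supp p \<noteq> {}"
    then obtain m where m: "m \<in> supp p" by blast
    then have "m \<in> lexset n b S \<union> powset n l b a" "mdeg m = d" using that by (auto simp: J_def forms_iff)
    then show False using d by (auto simp: lexset_def powset_def)
  qed
  then show ?thesis by (auto simp: J_def)
qed

end

section \<open>Generic linear sections\<close>

text \<open>
  Modulo the linear forms that \<open>s\<close> maps to \<open>X (p + 1), \<dots>, X n\<close>, the ring becomes a polynomial ring in
  \<open>p\<close> variables; this is the projection.
\<close>

definition sect :: "nat \<Rightarrow> ('k::field mpoly \<Rightarrow> 'k mpoly) \<Rightarrow> 'k mpoly \<Rightarrow> 'k mpoly" where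
  "sect p s v = restr {m. supp m \<subseteq> {..p}} (s v)"

lemma restr_face_mult: "restr {m. supp m \<subseteq> V} (x * y) = restr {m. supp m \<subseteq> V} x * restr {m. supp m \<subseteq> V} (y :: 'k::field mpoly)"
proof (rule additive_eq_on_singles[of "\<lambda>x. restr {m. supp m \<subseteq> V} (x * y)" "\<lambda>x. restr {m. supp m \<subseteq> V} x * restr {m. supp m \<subseteq> V} y"])
  fix m
  let ?s = "Poly_Mapping.single m (coef x m)"
  show "restr {m. supp m \<subseteq> V} (?s * y) = restr {m. supp m \<subseteq> V} ?s * restr {m. supp m \<subseteq> V} y"
    by (rule additive_eq_on_singles[of "\<lambda>y. restr {m. supp m \<subseteq> V} (?s * y)" "\<lambda>y. restr {m. supp m \<subseteq> V} ?s * restr {m. supp m \<subseteq> V} y"])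
      (auto simp: restr_add distrib_left mult_single restr_single)
qed (auto simp: restr_add distrib_right)

lemma sect_props:
  assumes s: "s \<in> unip n"
  shows "Vector_Spaces.linear mscale mscale (sect p s)" "sect p s (x * y) = sect p s x * sect p s y"
    "x \<in> forms n d \<Longrightarrow> sect p s x \<in> forms n d" "sect p s (x + y) = sect p s x + sect p s y"
    "sect p s (mscale c x) = mscale c (sect p s x)" "sect p s 0 = 0"
    "sect p s (sum h B) = (\<Sum>i\<in>B. sect p s (h i))"
proof -
  have "sect p s = restr {m. supp m \<subseteq> {..p}} \<circ> s" by (auto simp: sect_def fun_eq_iff)
  then show "Vector_Spaces.linear mscale mscale (sect p s)"
    using Vector_Spaces.linear_compose[OF unip_props(7)[OF s] linear_restr] by simp
  show m: "sect p s (x * y) = sect p s x * sect p s y" for x y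
    by (simp add: sect_def unip_props(3)[OF s] restr_face_mult)
  show "x \<in> forms n d \<Longrightarrow> sect p s x \<in> forms n d" by (simp add: sect_def forms_restr unip_props(6)[OF s])
  show ad: "sect p s (x + y) = sect p s x + sect p s y" for x y by (simp add: sect_def unip_props(1)[OF s] restr_add)
  show "sect p s (mscale c x) = mscale c (sect p s x)" by (simp add: sect_def unip_props(2)[OF s] restr_mscale)
  show z: "sect p s 0 = 0" using unip_props(5)[OF s, of 0] by (simp add: sect_def)
  show "sect p s (sum h B) = (\<Sum>i\<in>B. sect p s (h i))"
    by (induction B rule: infinite_finite_induct) (auto simp: ad z)
qed

lemma rank_nullity:
  fixes f :: "'k::field mpoly \<Rightarrow> 'k mpoly"
  assumes E: "finite E" "S \<subseteq> mp.span E" and S: "mp.subspace S" and f: "Vector_Spaces.linear mscale mscale f"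
  shows "mp.dim S = mp.dim (f ` S) + mp.dim {x \<in> S. f x = 0}"
proof -
  interpret Vector_Spaces.linear mscale mscale f by fact
  let ?K = "{x \<in> S. f x = 0}"
  have sK: "mp.subspace ?K"
    using S by (intro mp.subspaceI) (auto simp: add scale mp.subspace_0 mp.subspace_add mp.subspace_scale)
  obtain B where B: "B \<subseteq> ?K" "mp.independent B" "?K \<subseteq> mp.span B" "card B = mp.dim ?K" using mp.basis_exists by blast
  have "B \<subseteq> S" using B(1) by blast
  then have fB: "finite B" using independent_card_le[OF E B(2)] by blast
  obtain C where C: "C \<subseteq> f ` S" "mp.independent C" "f ` S \<subseteq> mp.span C" "card C = mp.dim (f ` S)" using mp.basis_exists by blast
  have "f ` S \<subseteq> mp.span (f ` E)" using E(2) span_image by blast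
  then have fC: "finite C" using independent_card_le[OF finite_imageI[OF E(1)] _ C(2,1)] by blast
  have "\<forall>x\<in>C. \<exists>w. w \<in> S \<and> f w = x" using C(1) by auto
  from bchoice[OF this] obtain g where g: "\<And>x. x \<in> C \<Longrightarrow> g x \<in> S \<and> f (g x) = x" by blast
  let ?w = "\<lambda>x. case x of Inl b \<Rightarrow> b | Inr c \<Rightarrow> g c"
  have ind: "fam_indep (B <+> C) ?w" unfolding fam_indep_def
  proof (intro allI impI)
    fix c assume s: "(\<Sum>x\<in>B <+> C. mscale (c x) (?w x)) = 0"
    have s': "(\<Sum>x\<in>B. mscale (c (Inl x)) x) + (\<Sum>x\<in>C. mscale (c (Inr x)) (g x)) = 0"
      using s by (simp add: sum.Plus[OF fB fC])
    have "f (\<Sum>x\<in>B. mscale (c (Inl x)) x) = (\<Sum>x\<in>B. mscale (c (Inl x)) (f x))" by (simp add: sum scale)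
    also have "\<dots> = 0" using B(1) by (intro sum.neutral) auto
    finally have "f (\<Sum>x\<in>C. mscale (c (Inr x)) (g x)) = 0" using arg_cong[OF s', of f] by (simp add: add zero)
    then have "(\<Sum>x\<in>C. mscale (c (Inr x)) x) = 0" using g by (simp add: sum scale)
    then have c0: "\<forall>x\<in>C. c (Inr x) = 0" using mp.independentD[OF C(2) fC subset_refl, of "\<lambda>x. c (Inr x)"] by blast
    then have "(\<Sum>x\<in>B. mscale (c (Inl x)) x) = 0" using s' by simp
    then have "\<forall>x\<in>B. c (Inl x) = 0" using mp.independentD[OF B(2) fB subset_refl, of "\<lambda>x. c (Inl x)"] by blast
    then show "\<forall>x\<in>B <+> C. c x = 0" using c0 by auto
  qed
  have "card (B <+> C) \<le> mp.dim S"
    using g \<open>B \<subseteq> S\<close> fB fC by (intro fam_indep_card_le[OF E _ ind]) auto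
  moreover have "mp.dim S \<le> card (B \<union> g ` C)"
  proof (rule mp.dim_le_card)
    show "S \<subseteq> mp.span (B \<union> g ` C)"
    proof
      fix v assume v: "v \<in> S"
      then have "f v \<in> mp.span C" using C(3) by blast
      then obtain u where u: "f v = (\<Sum>x\<in>C. mscale (u x) x)" using mp.span_finite[OF fC] by auto
      let ?y = "\<Sum>x\<in>C. mscale (u x) (g x)"
      have yS: "?y \<in> S" using g S by (intro mp.subspace_sum mp.subspace_scale) auto
      have "f ?y = f v" unfolding u using g by (simp add: sum scale)
      then have "v - ?y \<in> ?K" using v yS S by (simp add: diff mp.subspace_diff)
      then have "v - ?y \<in> mp.span (B \<union> g ` C)" using B(3) mp.span_mono[of B "B \<union> g ` C"] by blast
      moreover have "?y \<in> mp.span (B \<union> g ` C)" by (intro mp.span_sum mp.span_scale mp.span_base) auto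
      ultimately have "(v - ?y) + ?y \<in> mp.span (B \<union> g ` C)" by (rule mp.span_add)
      then show "v \<in> mp.span (B \<union> g ` C)" by simp
    qed
  qed (use fB fC in simp)
  moreover have "card (B \<union> g ` C) \<le> card B + card C"
    using card_Un_le[of B "g ` C"] card_image_le[OF fC, of g] by linarith
  moreover have "card (B <+> C) = card B + card C" by (rule card_Plus[OF fB fC])
  ultimately show ?thesis using B(4) C(4) by linarith
qed

lemma unip_hom_comp:
  assumes s: "s \<in> unip n" and x: "x \<in> carrier (polyring n)"
  shows "restr {m. mdeg m = d} (s x) = s (restr {m. mdeg m = d} x)"
proof (rule additive_eq_on_singles[of "\<lambda>x. restr {m. mdeg m = d} (s x)" "\<lambda>x. s (restr {m. mdeg m = d} x)"])
  fix m assume m: "m \<in> supp x"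
  let ?s = "Poly_Mapping.single m (coef x m)"
  have "?s \<in> forms n (mdeg m)" using m x by (auto simp: forms_iff carrier_polyring)
  then have f: "s ?s \<in> forms n (mdeg m)" by (rule unip_props(6)[OF s])
  show "restr {m. mdeg m = d} (s ?s) = s (restr {m. mdeg m = d} ?s)"
    using forms_hom_comp[OF f, of d] unip_props(5)[OF s, of 0] by (auto simp: restr_single)
qed (auto simp: restr_add unip_props(1)[OF s])

text \<open>
  The ideal generated by \<open>I\<close> and the linear forms has the same image as \<open>I\<close> under the projection and
  contains its kernel.
\<close>

lemma dim_linear_section:
  fixes I :: "'k::field mpoly set"
  assumes s: "s \<in> unip n" "s' \<in> unip n" "\<And>v. s (s' v) = v" "\<And>v. s' (s v) = v" and q: "1 \<le> q"
    and I: "ideal I (polyring n)" "\<And>x d. x \<in> I \<Longrightarrow> restr {m. mdeg m = d} x \<in> I"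
  shows "mp.dim (genideal (polyring n) (I \<union> (\<lambda>i. s' (X i)) ` {q..n}) \<inter> forms n d) =
    mp.dim (sect (q - 1) s ` (I \<inter> forms n d)) + mp.dim {v \<in> forms n d. sect (q - 1) s v = 0}"
proof -
  let ?f = "\<lambda>i. s' (X i) :: 'k mpoly" and ?\<pi> = "sect (q - 1) s"
  let ?A = "genideal (polyring n) (I \<union> ?f ` {q..n})"
  have f1: "?f i \<in> forms n 1" if "i \<in> {q..n}" for i
    using that q unip_props(6)[OF s(2), of "X i" 1] by simp
  have IC: "I \<subseteq> carrier (polyring n)" using I(1) by (simp add: additive_subgroup.a_subset ideal.axioms(1))
  have G: "I \<union> ?f ` {q..n} \<subseteq> carrier (polyring n)" using IC f1 forms_carrier by blast
  have idA: "ideal ?A (polyring n)" by (rule genideal_ideal'[OF G])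
  have IA: "I \<subseteq> ?A" using genideal_self'[OF G] by blast
  have f0: "?\<pi> (?f i) = 0" if "i \<in> {q..n}" for i
    using that q by (auto simp: sect_def s(3) X_def restr_single)
  have pA: "?\<pi> v \<in> ?\<pi> ` I" if v: "v \<in> ?A" for v
  proof -
    have "v \<in> mp.span {xmon m * g | m g. m \<in> monoms n \<and> g \<in> I \<union> ?f ` {q..n}}"
      using v genideal_span[OF G] by simp
    then show ?thesis
    proof (induction rule: mp.span_induct_alt)
      case base
      show ?case using mp.subspace_0[OF subspace_ideal[OF I(1)]] by (rule imageI)
    next
      case (step c x y)
      then obtain z where z: "z \<in> I" "?\<pi> y = ?\<pi> z" by blast
      obtain m g where x: "x = xmon m * g" "m \<in> monoms n" "g \<in> I \<union> ?f ` {q..n}" using step.hyps by blast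
      show ?case
      proof (cases "g \<in> I")
        case True
        then have "x \<in> I" unfolding x(1) using x(2) by (intro ideal_mult[OF I(1)]) (auto simp: carrier_polyring)
        then have "mscale c x + z \<in> I"
          using z(1) subspace_ideal[OF I(1)] by (intro mp.subspace_add mp.subspace_scale)
        moreover have "?\<pi> (mscale c x + y) = ?\<pi> (mscale c x + z)" unfolding sect_props(4)[OF s(1)] z(2) ..
        ultimately show ?thesis by blast
      next
        case False
        then obtain i where i: "i \<in> {q..n}" "g = ?f i" using x(3) by blast
        have x0: "?\<pi> x = 0" unfolding x(1) i(2) sect_props(2)[OF s(1)] f0[OF i(1)] by simp
        have "?\<pi> (mscale c x + y) = ?\<pi> z" unfolding sect_props(4,5)[OF s(1)] x0 z(2) by simp
        then show ?thesis using z(1) by blast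
      qed
    qed
  qed
  have im: "?\<pi> ` (?A \<inter> forms n d) = ?\<pi> ` (I \<inter> forms n d)"
  proof (intro subset_antisym subsetI)
    fix y assume "y \<in> ?\<pi> ` (?A \<inter> forms n d)"
    then obtain v where v: "v \<in> ?A" "v \<in> forms n d" "y = ?\<pi> v" by blast
    then obtain z where z: "z \<in> I" "y = ?\<pi> z" using pA by blast
    have "y \<in> forms n d" unfolding v(3) by (rule sect_props(3)[OF s(1) v(2)])
    then have "y = restr {m. mdeg m = d} y" using forms_hom_comp[of y n d d] by simp
    also have "\<dots> = restr {m. supp m \<subseteq> {..q - 1}} (restr {m. mdeg m = d} (s z))"
      unfolding z(2) sect_def by (rule poly_mapping_eqI) simp
    also have "\<dots> = ?\<pi> (restr {m. mdeg m = d} z)"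
      using unip_hom_comp[OF s(1), of z d] z(1) IC by (auto simp: sect_def)
    finally have "y = ?\<pi> (restr {m. mdeg m = d} z)" .
    moreover have "restr {m. mdeg m = d} z \<in> I \<inter> forms n d" using I(2)[OF z(1)] carrier_hom_comp[of z n d] z(1) IC by blast
    ultimately show "y \<in> ?\<pi> ` (I \<inter> forms n d)" by blast
  qed (use IA in blast)
  have ker: "{v \<in> ?A \<inter> forms n d. ?\<pi> v = 0} = {v \<in> forms n d. ?\<pi> v = 0}"
  proof (intro subset_antisym subsetI)
    fix v assume "v \<in> {v \<in> forms n d. ?\<pi> v = 0}"
    then have v: "v \<in> forms n d" "?\<pi> v = 0" by auto
    let ?w = "s v"
    have w: "?w \<in> forms n d" by (rule unip_props(6)[OF s(1) v(1)])
    have "s' (Poly_Mapping.single m (coef ?w m)) \<in> ?A" if m: "m \<in> supp ?w" for m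
    proof -
      have mm: "m \<in> monoms n" using w m by (simp add: forms_iff)
      have "\<not> supp m \<subseteq> {..q - 1}" using v(2) m by (auto simp: sect_def restr_eq_0_iff)
      then obtain i where i: "i \<in> supp m" "i \<notin> {..q - 1}" by blast
      have "i \<in> {1..n}" using i(1) mm unfolding monoms_def by blast
      then have iq: "i \<in> {q..n}" using i(2) by auto
      have e: "m - unit_at i + unit_at i = m" by (rule mono_minus_add[OF i(1)])
      have mi: "m - unit_at i \<in> monoms n" using mm monoms_add[of "m - unit_at i" "unit_at i" n] unfolding e by simp
      have "Poly_Mapping.single m (coef ?w m) = Poly_Mapping.single (m - unit_at i) (coef ?w m) * X i"
        unfolding X_def mult_single e by simp
      then have "s' (Poly_Mapping.single m (coef ?w m)) = s' (Poly_Mapping.single (m - unit_at i) (coef ?w m)) * ?f i"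
        by (simp add: unip_props(3)[OF s(2)])
      moreover have "Poly_Mapping.single (m - unit_at i) (coef ?w m) \<in> forms n (mdeg (m - unit_at i))"
        using mi by (auto simp: forms_iff)
      then have "s' (Poly_Mapping.single (m - unit_at i) (coef ?w m)) \<in> carrier (polyring n)"
        by (intro forms_carrier[OF unip_props(6)[OF s(2)]])
      moreover have "?f i \<in> ?A" using genideal_self'[OF G] iq by blast
      ultimately show ?thesis using ideal_mult[OF idA] by simp
    qed
    then have "(\<Sum>m\<in>supp ?w. s' (Poly_Mapping.single m (coef ?w m))) \<in> ?A"
      by (intro mp.subspace_sum[OF subspace_ideal[OF idA]])
    moreover have "v = (\<Sum>m\<in>supp ?w. s' (Poly_Mapping.single m (coef ?w m)))"
    proof -
      have "v = s' ?w" by (simp add: s(4))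
      also have "\<dots> = s' (\<Sum>m\<in>supp ?w. Poly_Mapping.single m (coef ?w m))" by (rule arg_cong[OF mpoly_decomp])
      finally show ?thesis by (simp only: unip_props(4)[OF s(2)])
    qed
    ultimately show "v \<in> {v \<in> ?A \<inter> forms n d. ?\<pi> v = 0}" using v by simp
  qed auto
  have "?A \<inter> forms n d \<subseteq> mp.span (xmon ` {m \<in> monoms n. mdeg m = d})" using forms_span[of n d] by blast
  moreover have "mp.subspace (?A \<inter> forms n d)" by (rule mp.subspace_inter[OF subspace_ideal[OF idA] subspace_forms])
  ultimately have "mp.dim (?A \<inter> forms n d) = mp.dim (?\<pi> ` (?A \<inter> forms n d)) + mp.dim {v \<in> ?A \<inter> forms n d. ?\<pi> v = 0}"
    by (rule rank_nullity[OF finite_forms_basis _ _ sect_props(1)[OF s(1)]])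
  then show ?thesis unfolding im ker .
qed

text \<open>
  The lex part is mapped into itself by the coordinate change, so its projection is spanned by the
  monomials of the lex part in the first \<open>p\<close> variables. The multiples of a power are mapped to the
  multiples of one form in \<open>p\<close> variables.
\<close>

lemma (in lex_plus_powers) dim_section_J:
  fixes s :: "'k::field mpoly \<Rightarrow> 'k mpoly"
  assumes s: "s \<in> unip n" and j: "j \<le> t" and p: "1 \<le> p" "p \<le> n"
  shows "mp.dim (sect p s ` (J \<inter> forms n (b + j))) \<le> card (S j \<inter> ymonos p) + (\<Sum>i\<in>{2..l}. card (low p (Suc j - a i)))"
proof -
  let ?\<pi> = "sect p s" and ?e = "\<lambda>u. u + Poly_Mapping.single 1 (b + j - mdeg u)"
  let ?L = "{m \<in> lexset n b S. mdeg m = b + j}"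
  let ?M = "\<lambda>i. if a i \<le> j then {m \<in> monoms p. mdeg m = j - a i} else {}"
  let ?Q = "\<lambda>i. (\<lambda>m. xmon m * ?\<pi> (X i ^ (b + a i)) :: 'k mpoly) ` ?M i"
  let ?T = "(\<lambda>m. xmon m :: 'k mpoly) ` ?e ` (S j \<inter> ymonos p)"
  let ?E = "?T \<union> (\<Union>i\<in>{2..l}. ?Q i)"
  have d: "mdeg u \<le> b + j" if "u \<in> S j" for u using S_deg[OF j that] b by simp
  have fS: "finite (S j)" using seg[of j] by (simp add: iseg_def)
  have fM: "finite (?M i)" for i using finite_monoms_deg by simp
  have x1: "?\<pi> (xmon m) \<in> mp.span ?E" if m: "m \<in> ?L" for m
  proof -
    have "supp (s (xmon m)) \<subseteq> lexset n b S" using m by (intro unip_lexset[OF s]) auto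
    moreover have "m \<in> monoms n" using m by (simp add: lexset_def)
    then have "s (xmon m) \<in> forms n (b + j)" using m by (intro unip_props(6)[OF s]) simp
    ultimately have sub: "supp (?\<pi> (xmon m)) \<subseteq> {m \<in> ?L. supp m \<subseteq> {..p}}"
      by (auto simp: sect_def supp_restr forms_iff)
    have "{m \<in> ?L. supp m \<subseteq> {..p}} \<subseteq> ?e ` (S j \<inter> ymonos p)"
    proof
      fix x assume x: "x \<in> {m \<in> ?L. supp m \<subseteq> {..p}}"
      then have "x \<in> ?e ` S j" using lexset_degree(1)[OF d] by blast
      then obtain u where u: "u \<in> S j" "x = ?e u" by blast
      have "u \<in> ymonos n" using u(1) seg[of j] by (auto simp: iseg_def)
      moreover have "supp u \<subseteq> {..p}" using x u(2) by auto
      ultimately have "supp u \<subseteq> {2..n} \<inter> {..p}" unfolding ymonos_def by blast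
      moreover have "{2..n} \<inter> {..p} \<subseteq> {2..p}" by (rule subsetI) simp
      ultimately have "u \<in> ymonos p" unfolding ymonos_def by blast
      then show "x \<in> ?e ` (S j \<inter> ymonos p)" using u by blast
    qed
    then have "?\<pi> (xmon m) \<in> mp.span ?T" using sub unfolding span_xmon by blast
    then show ?thesis using mp.span_mono[of ?T ?E] by blast
  qed
  have x2: "?\<pi> (xmon m) \<in> mp.span ?E" if i: "i \<in> {2..l}" and m: "m \<in> pows j i" for m i
  proof -
    have aij: "a i \<le> j" using m by (auto simp: pows_def split: if_splits)
    then obtain w where w: "w \<in> monoms n" "mdeg w = j - a i" "m = w + Poly_Mapping.single i (b + a i)"
      using m by (auto simp: pows_def)
    have e: "?\<pi> (xmon m) = ?\<pi> (xmon w) * ?\<pi> (X i ^ (b + a i))"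
      unfolding w(3) sect_props(2)[OF s, symmetric] X_power mult_single by simp
    let ?y = "?\<pi> (xmon w)"
    have yf: "?y \<in> forms n (j - a i)" using w by (intro sect_props(3)[OF s]) simp
    have ym: "supp ?y \<subseteq> ?M i"
    proof
      fix x assume x: "x \<in> supp ?y"
      then have xm: "x \<in> monoms n" "mdeg x = j - a i" using yf unfolding forms_iff by blast+
      have xp: "supp x \<subseteq> {..p}" using x unfolding sect_def supp_restr by blast
      have "supp x \<subseteq> {1..p}"
      proof
        fix k assume "k \<in> supp x"
        then have "k \<in> {1..n}" "k \<in> {..p}" using xm(1) xp unfolding monoms_def by blast+
        then show "k \<in> {1..p}" by simp
      qed
      then show "x \<in> ?M i" using aij xm(2) by (simp add: monoms_def)
    qed
    have sc: "Poly_Mapping.single x c * ?\<pi> (X i ^ (b + a i)) = mscale c (xmon x * ?\<pi> (X i ^ (b + a i)))" for x c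
      using mscale_mult(1)[of c "xmon x" "?\<pi> (X i ^ (b + a i))"] by simp
    have "?\<pi> (xmon m) = (\<Sum>x\<in>supp ?y. Poly_Mapping.single x (coef ?y x)) * ?\<pi> (X i ^ (b + a i))"
      unfolding e by (rule arg_cong[OF mpoly_decomp, of "\<lambda>z. z * ?\<pi> (X i ^ (b + a i))"])
    also have "\<dots> = (\<Sum>x\<in>supp ?y. mscale (coef ?y x) (xmon x * ?\<pi> (X i ^ (b + a i))))"
      unfolding sum_distrib_right by (rule sum.cong[OF refl sc])
    also have "\<dots> \<in> mp.span ?E"
    proof (intro mp.span_sum mp.span_scale mp.span_base UnI2)
      fix x assume "x \<in> supp ?y"
      then have "x \<in> ?M i" using ym by blast
      then have "xmon x * ?\<pi> (X i ^ (b + a i)) \<in> ?Q i" by (rule imageI)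
      then show "xmon x * ?\<pi> (X i ^ (b + a i)) \<in> (\<Union>i\<in>{2..l}. ?Q i)" using i by blast
    qed
    finally show ?thesis .
  qed
  have sub: "?\<pi> ` (J \<inter> forms n (b + j)) \<subseteq> mp.span ?E"
  proof
    fix y assume "y \<in> ?\<pi> ` (J \<inter> forms n (b + j))"
    then obtain v where v: "v \<in> J" "v \<in> forms n (b + j)" "y = ?\<pi> v" by blast
    have "y = ?\<pi> (\<Sum>m\<in>supp v. Poly_Mapping.single m (coef v m))"
      unfolding v(3) by (rule arg_cong[OF mpoly_decomp])
    also have "\<dots> = (\<Sum>m\<in>supp v. mscale (coef v m) (?\<pi> (xmon m)))"
      unfolding sect_props(7)[OF s] sect_props(5)[OF s, symmetric] by simp
    also have "\<dots> \<in> mp.span ?E"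
    proof (intro mp.span_sum mp.span_scale)
      fix m assume "m \<in> supp v"
      then have "m \<in> {m \<in> lexset n b S \<union> powset n l b a. mdeg m = b + j}" using v by (auto simp: J_def forms_iff)
      then have "m \<in> ?L \<union> (\<Union>i\<in>{2..l}. pows j i)" unfolding J_monomials_degree[OF j] .
      then show "?\<pi> (xmon m) \<in> mp.span ?E"
      proof
        assume "m \<in> (\<Union>i\<in>{2..l}. pows j i)"
        then obtain i where i: "i \<in> {2..l}" "m \<in> pows j i" by blast
        show ?thesis by (rule x2[OF i])
      qed (rule x1)
    qed
    finally show "y \<in> mp.span ?E" .
  qed
  have fE: "finite ?E" using fS fM by (intro finite_UnI finite_UN_I finite_imageI) auto
  have "mp.dim (?\<pi> ` (J \<inter> forms n (b + j))) \<le> card ?E" by (rule mp.dim_le_card[OF sub fE])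
  also have "\<dots> \<le> card ?T + card (\<Union>i\<in>{2..l}. ?Q i)" by (rule card_Un_le)
  also have "card ?T \<le> card (S j \<inter> ymonos p)"
    using fS card_image_le[of "?e ` (S j \<inter> ymonos p)" "\<lambda>m. xmon m :: 'k mpoly"] card_image_le[of "S j \<inter> ymonos p" ?e] by simp
  also have "card (\<Union>i\<in>{2..l}. ?Q i) \<le> (\<Sum>i\<in>{2..l}. card (?Q i))" by (rule card_UN_le) simp
  also have "\<dots> \<le> (\<Sum>i\<in>{2..l}. card (low p (Suc j - a i)))"
  proof (rule sum_mono)
    fix i
    have "card (?Q i) \<le> card (?M i)" by (rule card_image_le[OF fM])
    also have "\<dots> = card (low p (Suc j - a i))"
      using card_forms_low[OF p(1), of "j - a i"] by (auto simp: Suc_diff_le)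
    finally show "card (?Q i) \<le> card (low p (Suc j - a i))" .
  qed
  finally show ?thesis by simp
qed

section \<open>Ideals of a given type\<close>

lemma homogeneous_component:
  fixes I :: "'k::field mpoly set"
  assumes I: "homogeneous_ideal n I" and x: "x \<in> I"
  shows "restr {m. mdeg m = d} x \<in> I"
proof -
  let ?G = "I \<inter> (\<Union>d. forms n d)"
  have idl: "ideal I (polyring n)" and gen: "I = genideal (polyring n) ?G"
    using I unfolding homogeneous_ideal_def by blast+
  have "?G \<subseteq> carrier (polyring n)" using forms_carrier by blast
  then have "x \<in> mp.span {xmon m * g | m g. m \<in> monoms n \<and> g \<in> ?G}"
    using x genideal_span[of ?G n] gen by simp
  then show ?thesis
  proof (induction rule: mp.span_induct_alt)
    case base
    show ?case using mp.subspace_0[OF subspace_ideal[OF idl]] by simp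
  next
    case (step c x y)
    obtain m g e where x: "x = xmon m * g" "m \<in> monoms n" "g \<in> I" "g \<in> forms n e"
      using step.hyps by blast
    have "xmon m \<in> forms n (mdeg m)" using x(2) by simp
    then have "x \<in> forms n (mdeg m + e)" unfolding x(1) using x(4) by (rule forms_mult)
    then have "restr {m. mdeg m = d} x = x \<or> restr {m. mdeg m = d} x = 0" using forms_hom_comp by metis
    moreover have "x \<in> I" unfolding x(1) using x(2) by (intro ideal_mult[OF idl _ x(3)]) (auto simp: carrier_polyring)
    moreover have "0 \<in> I" by (rule mp.subspace_0[OF subspace_ideal[OF idl]])
    ultimately have "restr {m. mdeg m = d} x \<in> I" by metis
    then show ?case unfolding restr_add restr_mscale using step.IH
      by (intro mp.subspace_add mp.subspace_scale subspace_ideal[OF idl])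
  qed
qed

lemma alpha_le:
  "min_hom_gens n I G \<Longrightarrow> g \<in> G \<Longrightarrow> g \<in> forms n d \<Longrightarrow> alpha n I \<le> d"
  unfolding alpha_def by (rule Least_le) blast

lemma min_hom_gens_carrier: "min_hom_gens n I G \<Longrightarrow> G \<subseteq> carrier (polyring n)"
  unfolding min_hom_gens_def using forms_carrier by blast

text \<open>
  Omitting \<open>0\<close> from a generating set does not change the ideal.
\<close>

lemma min_hom_gens_nonzero:
  fixes G :: "'k::field mpoly set"
  assumes G: "min_hom_gens n I G"
  shows "0 \<notin> G"
proof
  assume z: "0 \<in> G"
  have GC: "G - {0} \<subseteq> carrier (polyring n)" using min_hom_gens_carrier[OF G] by blast
  have idl: "ideal (genideal (polyring n) (G - {0})) (polyring n)" by (rule genideal_ideal'[OF GC])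
  have "G \<subseteq> genideal (polyring n) (G - {0})"
    using genideal_self'[OF GC] mp.subspace_0[OF subspace_ideal[OF idl]] by blast
  then have "genideal (polyring n) G \<subseteq> genideal (polyring n) (G - {0})"
    by (rule ring.genideal_minimal[OF cring.axioms(1)[OF cring_polyring] idl])
  moreover have "genideal (polyring n) (G - {0}) \<subseteq> genideal (polyring n) G"
    by (rule genideal_mono[OF _ min_hom_gens_carrier[OF G]]) blast
  moreover have "genideal (polyring n) G = I" "genideal (polyring n) (G - {0}) \<noteq> I"
    using G z unfolding min_hom_gens_def by blast+
  ultimately show False by blast
qed

lemma alpha_form_exists:
  fixes I :: "'k::field mpoly set"
  assumes G: "min_hom_gens n I G" and ne: "I \<noteq> {0}"
  shows "I \<inter> forms n (alpha n I) \<noteq> {0}"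
proof -
  have "G \<noteq> {}"
  proof
    assume "G = {}"
    then have "I = genideal (polyring n) {}" using G by (simp add: min_hom_gens_def)
    then show False using ne genideal_span[of "{} :: 'k mpoly set" n] by simp
  qed
  then obtain g d where "g \<in> G" "g \<in> forms n d" using G unfolding min_hom_gens_def by blast
  then have "\<exists>d G. min_hom_gens n I G \<and> G \<inter> forms n d \<noteq> {}" using G by blast
  then have "\<exists>G. min_hom_gens n I G \<and> G \<inter> forms n (alpha n I) \<noteq> {}" unfolding alpha_def by (rule LeastI_ex)
  then obtain G' x where x: "min_hom_gens n I G'" "x \<in> G'" "x \<in> forms n (alpha n I)" by blast
  have "x \<noteq> 0" using min_hom_gens_nonzero[OF x(1)] x(2) by blast
  moreover have "x \<in> I"
    using genideal_self'[OF min_hom_gens_carrier[OF x(1)]] x(1,2) unfolding min_hom_gens_def by blast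
  ultimately show ?thesis using x(3) by blast
qed

lemma forms_below_alpha:
  fixes I :: "'k::field mpoly set"
  assumes G: "min_hom_gens n I G" and d: "d < alpha n I"
  shows "I \<inter> forms n d = {0}"
proof -
  have gen: "genideal (polyring n) G = I" using G unfolding min_hom_gens_def by blast
  have "\<exists>d\<ge>alpha n I. g \<in> forms n d" if "g \<in> G" for g
    using G alpha_le[OF G that] that unfolding min_hom_gens_def by blast
  then have "v = 0" if "v \<in> I" "v \<in> forms n d" for v
    using genideal_small_forms[of G "alpha n I" n v d] that d gen by blast
  moreover have "0 \<in> I"
    using mp.subspace_0[OF subspace_ideal[OF genideal_ideal'[OF min_hom_gens_carrier[OF G]]]] gen by simp
  ultimately show ?thesis by auto
qed

text \<open>
  Up to degree \<open>\<alpha>(I) + t\<close> only the \<open>b\<^sub>0 + \<dots> + b\<^sub>t\<close> generators of these degrees contribute, each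
  with at most as many monomial multiples as there are monomials of degree \<open>t\<close>. So the
  bound is independent of \<open>\<alpha>(I)\<close>.
\<close>

lemma dim_forms_bound:
  fixes I :: "'k::field mpoly set"
  assumes n: "1 \<le> n" and G: "min_hom_gens n I G" and c: "\<And>j. j \<le> t \<Longrightarrow> card (G \<inter> forms n (alpha n I + j)) = c j"
    and j: "j \<le> t"
  shows "mp.dim (I \<inter> forms n (alpha n I + j)) \<le> (\<Sum>i\<le>t. c i) * card (low n (Suc t))"
proof -
  let ?b = "alpha n I"
  let ?M = "\<lambda>i. {m \<in> monoms n. mdeg m = j - i}"
  let ?E = "\<Union>i\<le>t. (\<lambda>(m, g). xmon m * g) ` (?M i \<times> (G \<inter> forms n (?b + i)))"
  have gen: "genideal (polyring n) G = I" and fG: "finite G" using G unfolding min_hom_gens_def by blast+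
  have "\<forall>g\<in>G. \<exists>d. g \<in> forms n d" using G unfolding min_hom_gens_def by blast
  from bchoice[OF this] obtain dg where dg: "\<And>g. g \<in> G \<Longrightarrow> g \<in> forms n (dg g)" by blast
  have sub: "{xmon m * g | m g. m \<in> monoms n \<and> g \<in> G \<and> mdeg m + dg g = ?b + j} \<subseteq> ?E"
  proof
    fix x assume "x \<in> {xmon m * g | m g. m \<in> monoms n \<and> g \<in> G \<and> mdeg m + dg g = ?b + j}"
    then obtain m g where m: "x = xmon m * g" "m \<in> monoms n" "g \<in> G" "mdeg m + dg g = ?b + j" by blast
    have le: "?b \<le> dg g" using alpha_le[OF G m(3)] dg[OF m(3)] by blast
    let ?i = "dg g - ?b"
    have gi: "g \<in> forms n (?b + ?i)" using dg[OF m(3)] le by simp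
    have "mdeg m = j - ?i" "?i \<le> t" using m(4) le j by linarith+
    then have "(m, g) \<in> ?M ?i \<times> (G \<inter> forms n (?b + ?i))" "?i \<in> {..t}" using m(2,3) gi by auto
    then show "x \<in> ?E" unfolding m(1) by (intro UN_I image_eqI[of _ _ "(m, g)"]) auto
  qed
  have "I \<inter> forms n (?b + j) \<subseteq> mp.span ?E"
  proof
    fix v assume "v \<in> I \<inter> forms n (?b + j)"
    then have "v \<in> genideal (polyring n) G" "v \<in> forms n (?b + j)" using gen by blast+
    from genideal_forms[OF dg this] show "v \<in> mp.span ?E" using mp.span_mono[OF sub] by blast
  qed
  moreover have fM: "finite (?M i)" for i by (rule finite_monoms_deg)
  then have fE: "finite ?E" using fG by (intro finite_UN_I finite_imageI finite_cartesian_product) auto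
  ultimately have "mp.dim (I \<inter> forms n (?b + j)) \<le> card ?E" by (rule mp.dim_le_card)
  also have "\<dots> \<le> (\<Sum>i\<le>t. card ((\<lambda>(m, g). xmon m * g) ` (?M i \<times> (G \<inter> forms n (?b + i)))))"
    by (rule card_UN_le) simp
  also have "\<dots> \<le> (\<Sum>i\<le>t. card (low n (Suc t)) * c i)"
  proof (rule sum_mono)
    fix i assume i: "i \<in> {..t}"
    have "card ((\<lambda>(m, g). xmon m * g) ` (?M i \<times> (G \<inter> forms n (?b + i)))) \<le> card (?M i \<times> (G \<inter> forms n (?b + i)))"
      using fM fG by (intro card_image_le) auto
    also have "\<dots> = card (?M i) * c i" using c[of i] i by (simp add: card_cartesian_product)
    also have "card (?M i) = card (low n (Suc (j - i)))" by (rule card_forms_low[OF n])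
    also have "\<dots> \<le> card (low n (Suc t))" using j by (intro card_mono low_mono) auto
    finally show "card ((\<lambda>(m, g). xmon m * g) ` (?M i \<times> (G \<inter> forms n (?b + i)))) \<le> card (low n (Suc t)) * c i"
      by simp
  qed
  also have "\<dots> = (\<Sum>i\<le>t. c i) * card (low n (Suc t))" by (simp add: sum_distrib_right mult.commute)
  finally show ?thesis .
qed

text \<open>
  If \<open>g 1 = 0\<close>, regularity would put \<open>1\<close> into the zero ideal.
\<close>

lemma regular_seq_nonzero:
  fixes g :: "nat \<Rightarrow> 'k::field mpoly"
  assumes reg: "regular_seq n l g" and l: "1 \<le> l"
  shows "g 1 \<noteq> 0"
proof
  assume z: "g 1 = 0"
  have e: "genideal (polyring n) (g ` {1..<1}) = {0}" using genideal_span[of "{} :: 'k mpoly set" n] by simp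
  have all: "\<forall>i\<in>{1..l}. \<forall>h\<in>carrier (polyring n). h * g i \<in> genideal (polyring n) (g ` {1..<i}) \<longrightarrow>
      h \<in> genideal (polyring n) (g ` {1..<i})"
    using reg unfolding regular_seq_def by blast
  have "1 \<in> {1..l}" using l by simp
  from bspec[OF all this]
  have "\<forall>h\<in>carrier (polyring n). h * g 1 \<in> genideal (polyring n) (g ` {1..<1}) \<longrightarrow>
      h \<in> genideal (polyring n) (g ` {1..<1})" .
  moreover have "(1 :: 'k mpoly) \<in> carrier (polyring n)" by (rule forms_carrier[OF one_forms])
  ultimately have "(1 :: 'k mpoly) \<in> {0}" unfolding e z by auto
  then show False by simp
qed

lemma sorted_prefix:
  fixes a :: "nat \<Rightarrow> nat"
  assumes "\<And>i. i \<in> {1..<l} \<Longrightarrow> a i \<le> a (i + 1)"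
  shows "{i \<in> {1..l}. a i \<le> t} = {1..card {i \<in> {1..l}. a i \<le> t}}"
    and "i \<in> {1..l} \<Longrightarrow> a 1 \<le> a i"
proof -
  let ?P = "{i \<in> {1..l}. a i \<le> t}"
  have mono: "i \<le> k \<Longrightarrow> k \<le> l \<Longrightarrow> 1 \<le> i \<Longrightarrow> a i \<le> a k" for i k
  proof (induction k rule: dec_induct)
    case (step k)
    then have "a i \<le> a k" "a k \<le> a (k + 1)" using assms[of k] by auto
    then show ?case by simp
  qed simp
  show "i \<in> {1..l} \<Longrightarrow> a 1 \<le> a i" using mono[of 1 i] by simp
  show "?P = {1..card ?P}"
  proof (cases "?P = {}")
    case False
    let ?m = "Max ?P"
    have m: "?m \<in> ?P" using False by (intro Max_in) auto
    have "?P = {1..?m}"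
    proof (intro subset_antisym subsetI)
      fix i assume "i \<in> ?P"
      then show "i \<in> {1..?m}" using Max_ge[of ?P i] by simp
    next
      fix i assume i: "i \<in> {1..?m}"
      then have "a i \<le> a ?m" using m by (intro mono) auto
      then show "i \<in> ?P" using i m by auto
    qed
    then show ?thesis by (metis card_atLeastAtMost diff_Suc_1)
  qed simp
qed

section \<open>Comparison with the lex-plus-powers ideal\<close>

text \<open>
  This undoes the subtraction in the definition of the excess, which never truncates.
\<close>

lemma stable_family_count:
  assumes F: "stable_family n A i1 B c" and p: "p \<le> n"
  shows "(\<Sum>i\<in>A. card (B i \<inter> ymonos p)) = excess p A B c + (\<Sum>i\<in>A. card (low p (c i)))"
proof -
  have "card (low p (c i)) \<le> card (B i \<inter> ymonos p)" if i: "i \<in> A" for i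
  proof (rule card_mono)
    have "sstable n (B i)" "low n (c i) \<subseteq> B i" using F i unfolding stable_family_def by blast+
    then show "finite (B i \<inter> ymonos p)" "low p (c i) \<subseteq> B i \<inter> ymonos p"
      unfolding sstable_def low_Int[OF p, symmetric] by blast+
  qed
  then show ?thesis unfolding excess_def sum.distrib[symmetric] by (intro sum.cong) auto
qed

text \<open>
  Beyond \<open>t\<close> the segments are continued by iterated shadows; there is nothing to compare with.
\<close>

lemma lex_segments_of_stable_families:
  assumes n: "2 \<le> n" and F: "\<And>j. j \<le> t \<Longrightarrow> stable_family n A i1 (B j) (c j)"
    and sh: "\<And>j i. j < t \<Longrightarrow> i \<in> A \<Longrightarrow> shadow n (B j i) \<subseteq> B (Suc j) i"
    and c: "\<And>j i. c j i > 0 \<Longrightarrow> c (Suc j) i = Suc (c j i)" "\<And>j i. c j i = 0 \<Longrightarrow> c (Suc j) i \<le> 1"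
    and pos: "excess n A (B 0) (c 0) > 0"
  obtains S where "\<And>j. iseg n (S j)" "\<And>j. shadow n (S j) \<subseteq> S (Suc j)" "0 \<in> S 0"
    "\<And>j. j \<le> t \<Longrightarrow> card (S j) = excess n A (B j) (c j)"
proof -
  have "\<forall>j. \<exists>S. iseg n S \<and> card S = excess n A (B j) (c j)" using iseg_exists[OF n] by blast
  from choice[OF this] obtain T where T: "\<And>j. iseg n (T j)" "\<And>j. card (T j) = excess n A (B j) (c j)" by blast
  define S where "S j = (if j \<le> t then T j else (shadow n ^^ (j - t)) (T t))" for j
  have it: "iseg n ((shadow n ^^ k) (T t))" for k by (induction k) (auto simp: T(1) iseg_shadow n)
  have S1: "iseg n (S j)" for j using T(1) it by (simp add: S_def)
  show ?thesis
  proof (rule that[of S])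
    show "iseg n (S j)" for j by (rule S1)
    show "shadow n (S j) \<subseteq> S (Suc j)" for j
    proof (cases "j < t")
      case True
      have "card (shadow n (T j)) \<le> excess n A (B (Suc j)) (c (Suc j))"
        using True sh c by (intro stable_family_growth[OF n F F _ _ _ T(1) T(2)]) auto
      then have "card (shadow n (T j)) \<le> card (T (Suc j))" unfolding T(2) .
      then have "shadow n (T j) \<subseteq> T (Suc j)" by (rule iseg_card_mono[OF iseg_shadow[OF T(1) n] T(1)])
      then show ?thesis using True by (simp add: S_def)
    next
      case False
      then have "S j = (shadow n ^^ (j - t)) (T t)" by (auto simp: S_def)
      moreover have "S (Suc j) = (shadow n ^^ Suc (j - t)) (T t)" using False by (simp add: S_def Suc_diff_le)
      ultimately show ?thesis by simp
    qed
    have "T 0 \<noteq> {}" using T(2)[of 0] pos by auto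
    then have "0 \<in> T 0" by (rule sstable_0[OF iseg_sstable[OF T(1)]])
    then show "0 \<in> S 0" by (simp add: S_def)
    show "card (S j) = excess n A (B j) (c j)" if "j \<le> t" for j using T(2) that by (simp add: S_def)
  qed
qed

text \<open>
  A cone of positive height forces \<open>0\<close> into the distinguished component, from which nothing is
  subtracted.
\<close>

lemma excess_0_pos:
  assumes F: "stable_family n A 1 B c" and c: "\<And>i. c i \<le> 1" and s: "(\<Sum>i\<in>A. card (B i \<inter> ymonos n)) > 0"
  shows "excess n A B c > 0"
proof (cases "\<exists>i\<in>A. c i > 0")
  case True
  then obtain i where i: "i \<in> A" "c i > 0" by blast
  have f: "finite A" "1 \<in> A" "c 1 = 0" "low n (c i) \<subseteq> B 1" "sstable n (B 1)"
    using F i(1) unfolding stable_family_def by blast+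
  have "0 \<in> B 1" using f(4) zero_low[OF i(2), of n] by blast
  moreover have "finite (B 1)" using f(5) unfolding sstable_def by blast
  ultimately have "0 < card (B 1 \<inter> ymonos n)" by (auto simp: card_gt_0_iff)
  also have "\<dots> = card (B 1 \<inter> ymonos n) - card (low n (c 1))" using f(3) by simp
  also have "\<dots> \<le> excess n A B c" unfolding excess_def using f(1,2)
    by (intro member_le_sum[of 1 A "\<lambda>i. card (B i \<inter> ymonos n) - card (low n (c i))"]) auto
  finally show ?thesis .
next
  case False
  then show ?thesis using s by (simp add: excess_def)
qed

lemma linear_forms_independent:
  fixes s :: "'k::field mpoly \<Rightarrow> 'k mpoly"
  assumes s: "s \<in> unip n" and A: "finite A"
  shows "inj_on (\<lambda>i. s (X i)) A" "mp.independent ((\<lambda>i. s (X i)) ` A)"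
proof -
  have "fam_indep A (\<lambda>i. s (X i))" unfolding fam_indep_def
  proof (intro allI impI)
    fix c assume z: "(\<Sum>i\<in>A. mscale (c i) (s (X i))) = 0"
    have "s (\<Sum>i\<in>A. mscale (c i) (X i)) = 0" using z by (simp add: unip_props(2,4)[OF s])
    then have z: "(\<Sum>i\<in>A. mscale (c i) (X i)) = 0" using unip_props(5)[OF s] by blast
    have u: "(unit_at i = unit_at k) = (i = k)" for i k :: nat
      by (metis lookup_single_eq lookup_single_not_eq zero_neq_one)
    show "\<forall>k\<in>A. c k = 0"
    proof
      fix k assume k: "k \<in> A"
      have "coef (\<Sum>i\<in>A. mscale (c i) (X i)) (unit_at k) = (\<Sum>i\<in>A. if i = k then c k else 0)"
        unfolding lookup_sum X_def mscale_single lookup_single when_def u by (intro sum.cong) auto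
      then show "c k = 0" using z k A by simp
    qed
  qed
  from fam_indep_independent[OF A this]
  show "inj_on (\<lambda>i. s (X i)) A" "mp.independent ((\<lambda>i. s (X i)) ` A)" by blast+
qed

text \<open>
  The segments have the sizes of the excesses, and the cones of the family are those of the powers
  \<open>X i ^ (b + a i)\<close>: for \<open>r < i\<close> both are empty in degrees up to \<open>b + t\<close>. So the counts of \<open>I\<close> and \<open>J\<close>
  agree in \<open>n\<close> variables, and in fewer variables the count of \<open>J\<close> is the smaller one.
\<close>

lemma lpp_of_stable_families:
  fixes I :: "'k::field mpoly set"
  assumes n: "3 \<le> n" and I: "homogeneous_ideal n I" and l: "1 \<le> l" "l \<le> n" and bI: "C + t < b" "b = alpha n I"
    and dimC: "\<And>j. j \<le> t \<Longrightarrow> mp.dim (I \<inter> forms n (b + j)) \<le> C"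
    and small: "\<And>d. d < b \<Longrightarrow> I \<inter> forms n d = {0}" and nz: "I \<inter> forms n b \<noteq> {0}"
    and r: "{i \<in> {1..l}. a_entry v i \<le> t} = {1..r}" and rA: "{1..r} \<subseteq> A" and s: "s \<in> unip n"
    and F: "\<And>j. j \<le> t \<Longrightarrow> stable_family n A 1 (B j) (\<lambda>i. if i \<in> {2..r} then Suc j - a_entry v i else 0)"
    and sh: "\<And>j i. j < t \<Longrightarrow> i \<in> A \<Longrightarrow> shadow n (B j i) \<subseteq> B (Suc j) i"
    and cnt: "\<And>j p. j \<le> t \<Longrightarrow> p \<in> {2..n} \<Longrightarrow> (\<Sum>i\<in>A. card (B j i \<inter> ymonos p)) =
      mp.dim (restr {m. supp m \<subseteq> {..p}} ` s ` (I \<inter> forms n (b + j)))"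
  shows "\<exists>J. lpp_ideal n l v I J \<and> same_hilbert_upto n (alpha n I + t) I J \<and>
       (\<forall>q\<in>{3..n}. \<exists>f :: nat \<Rightarrow> 'k mpoly.
          (\<forall>i\<in>{q..n}. f i \<in> forms n 1) \<and>
          inj_on f {q..n} \<and> mp.independent (f ` {q..n}) \<and>
          (\<forall>k<t. quot_hilbert n (genideal (polyring n) (J \<union> f ` {q..n})) (alpha n I + k)
                \<ge> quot_hilbert n (genideal (polyring n) (I \<union> f ` {q..n})) (alpha n I + k)))"
proof -
  let ?a = "a_entry v"
  define c where "c j i = (if i \<in> {2..r} then Suc j - ?a i else 0)" for j i
  have F: "stable_family n A 1 (B j) (c j)" if "j \<le> t" for j using F[OF that] unfolding c_def .
  have n2: "2 \<le> n" using n by simp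
  have idI: "ideal I (polyring n)" using I unfolding homogeneous_ideal_def by blast
  have sW: "mp.subspace (I \<inter> forms n (b + j))" for j
    by (rule mp.subspace_inter[OF subspace_ideal[OF idI] subspace_forms])
  have fA: "finite A" using F[of 0] by (simp add: stable_family_def)
  have cones: "(\<Sum>i\<in>A. card (low p (c j i))) = (\<Sum>i\<in>{2..l}. card (low p (Suc j - ?a i)))" if j: "j \<le> t" for p j
  proof -
    have "(\<Sum>i\<in>A. card (low p (c j i))) = (\<Sum>i\<in>{2..r}. card (low p (c j i)))"
      using fA rA by (intro sum.mono_neutral_right) (auto simp: c_def)
    also have "\<dots> = (\<Sum>i\<in>{2..r}. card (low p (Suc j - ?a i)))" by (intro sum.cong) (auto simp: c_def)
    also have "\<dots> = (\<Sum>i\<in>{2..l}. card (low p (Suc j - ?a i)))"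
    proof (rule sum.mono_neutral_left)
      show "{2..r} \<subseteq> {2..l}"
      proof
        fix i assume "i \<in> {2..r}"
        then have "i \<in> {1..r}" "2 \<le> i" by auto
        then show "i \<in> {2..l}" unfolding r[symmetric] by simp
      qed
      show "\<forall>i\<in>{2..l} - {2..r}. card (low p (Suc j - ?a i)) = 0"
      proof
        fix i assume i: "i \<in> {2..l} - {2..r}"
        then have "i \<notin> {i \<in> {1..l}. ?a i \<le> t}" unfolding r by auto
        then have "t < ?a i" using i by auto
        then show "card (low p (Suc j - ?a i)) = 0" using j by simp
      qed
    qed simp
    finally show ?thesis .
  qed
  have count: "mp.dim (sect p s ` (I \<inter> forms n (b + j))) =
      excess p A (B j) (c j) + (\<Sum>i\<in>{2..l}. card (low p (Suc j - ?a i)))" if j: "j \<le> t" and p: "p \<in> {2..n}" for j p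
  proof -
    have "sect p s ` (I \<inter> forms n (b + j)) = restr {m. supp m \<subseteq> {..p}} ` s ` (I \<inter> forms n (b + j))"
      unfolding image_image sect_def ..
    then show ?thesis using cnt[OF j p] stable_family_count[OF F[OF j], of p] p cones[OF j, of p] by simp
  qed
  have full: "mp.dim (sect n s ` (I \<inter> forms n (b + j))) = mp.dim (I \<inter> forms n (b + j))" for j
  proof -
    have "sect n s x = s x" if "x \<in> I \<inter> forms n (b + j)" for x unfolding sect_def
    proof (rule restr_id, rule subsetI)
      fix m assume m: "m \<in> supp (s x)"
      have "s x \<in> forms n (b + j)" using that by (intro unip_props(6)[OF s]) blast
      then have "m \<in> monoms n" using m unfolding forms_iff by blast
      then show "m \<in> {m. supp m \<subseteq> {..n}}" by (auto simp: monoms_def)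
    qed
    then have "sect n s ` (I \<inter> forms n (b + j)) = s ` (I \<inter> forms n (b + j))" by (rule image_cong[OF refl])
    then show ?thesis using dim_unip_image[OF s sW] by simp
  qed
  have dimI: "mp.dim (I \<inter> forms n (b + j)) =
      excess n A (B j) (c j) + (\<Sum>i\<in>{2..l}. card (low n (Suc j - ?a i)))" if "j \<le> t" for j
    using count[OF that, of n] full[of j] n2 by simp
  have pos: "excess n A (B 0) (c 0) > 0"
  proof (rule excess_0_pos[OF F])
    show "c 0 i \<le> 1" for i by (simp add: c_def)
    obtain x where x: "x \<in> I \<inter> forms n b" "x \<noteq> 0" using nz mp.subspace_0[OF sW[of 0]] by auto
    have "mp.independent {x}" using x(2) by simp
    then have "card {x} \<le> mp.dim (I \<inter> forms n b)"
      using x(1) forms_span[of n b] independent_card_le[OF finite_forms_basis[of n b], of "I \<inter> forms n b" "{x}"] by blast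
    then have "0 < mp.dim (sect n s ` (I \<inter> forms n (b + 0)))" unfolding full by simp
    moreover have "sect n s ` (I \<inter> forms n (b + 0)) = restr {m. supp m \<subseteq> {..n}} ` s ` (I \<inter> forms n (b + 0))"
      unfolding image_image sect_def ..
    ultimately show "0 < (\<Sum>i\<in>A. card (B 0 i \<inter> ymonos n))" using cnt[of 0 n] n2 by simp
  qed simp
  obtain S where S: "\<And>j. iseg n (S j)" "\<And>j. shadow n (S j) \<subseteq> S (Suc j)" "0 \<in> S 0"
    "\<And>j. j \<le> t \<Longrightarrow> card (S j) = excess n A (B j) (c j)"
  proof (rule lex_segments_of_stable_families[where t = t and A = A and B = B and c = c, OF n2 _ _ _ _ pos])
    show "stable_family n A 1 (B j) (c j)" if "j \<le> t" for j by (rule F[OF that])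
    show "shadow n (B j i) \<subseteq> B (Suc j) i" if "j < t" "i \<in> A" for j i by (rule sh[OF that])
    show "c j i > 0 \<Longrightarrow> c (Suc j) i = Suc (c j i)" for j i by (auto simp: c_def split: if_splits)
    show "c j i = 0 \<Longrightarrow> c (Suc j) i \<le> 1" for j i by (auto simp: c_def split: if_splits)
    fix S assume "\<And>j. iseg n (S j)" "\<And>j. shadow n (S j) \<subseteq> S (Suc j)" "0 \<in> S 0"
      "\<And>j. j \<le> t \<Longrightarrow> card (S j) = excess n A (B j) (c j)"
    then show thesis by (rule that)
  qed
  have SC: "card (S j) \<le> C" if "j \<le> t" for j using S(4)[OF that] dimI[OF that] dimC[OF that] by simp
  interpret lex_plus_powers n b S l t C ?a
    by unfold_locales (use n2 S l SC bI in auto)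
  let ?J = "J :: 'k mpoly set"
  have lpp: "lpp_ideal n l v I ?J" unfolding lpp_ideal_def bI(2)[symmetric] using lex_ideal_lexset lpp_J by blast
  have hil: "same_hilbert_upto n (b + t) I ?J" unfolding same_hilbert_upto_def
  proof (intro allI impI)
    fix d assume d: "d \<le> b + t"
    show "mp.dim (I \<inter> forms n d) = mp.dim (?J \<inter> forms n d)"
    proof (cases "d < b")
      case True
      show ?thesis unfolding small[OF True] J_small[OF True] ..
    next
      case False
      then have "d = b + (d - b)" "d - b \<le> t" using d by auto
      then show ?thesis using dimI[of "d - b"] dim_J[of "d - b"] S(4)[of "d - b"] by metis
    qed
  qed
  obtain s' where s': "s' \<in> unip n" "\<And>v. s (s' v) = v" "\<And>v. s' (s v) = v" using unip_inverse[OF s] by blast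
  have homJ: "restr {m. mdeg m = d} x \<in> ?J" if "x \<in> ?J" for x d using that by (auto simp: J_def supp_restr)
  have sec: "quot_hilbert n (genideal (polyring n) (I \<union> (\<lambda>i. s' (X i)) ` {q..n})) (b + k) \<le>
      quot_hilbert n (genideal (polyring n) (?J \<union> (\<lambda>i. s' (X i)) ` {q..n})) (b + k)"
    if q: "q \<in> {3..n}" and k: "k < t" for q k
  proof -
    have f1: "(\<lambda>i. s' (X i)) ` {q..n} \<subseteq> carrier (polyring n)"
    proof (rule image_subsetI)
      fix i assume "i \<in> {q..n}"
      then have "i \<in> {1..n}" using q by auto
      from forms_carrier[OF unip_props(6)[OF s'(1) X_forms[OF this]]]
      show "s' (X i) \<in> carrier (polyring n)" .
    qed
    have cI: "I \<subseteq> carrier (polyring n)" "?J \<subseteq> carrier (polyring n)"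
      by (rule additive_subgroup.a_subset[OF ideal.axioms(1)], rule idI ideal_J)+
    have p: "q - 1 \<in> {2..n}" and q1: "1 \<le> q" and p1: "1 \<le> q - 1" "q - 1 \<le> n" using q by auto
    have kt: "k \<le> t" using k by simp
    have "mp.dim (sect (q - 1) s ` (?J \<inter> forms n (b + k))) \<le>
        card (S k \<inter> ymonos (q - 1)) + (\<Sum>i\<in>{2..l}. card (low (q - 1) (Suc k - ?a i)))"
      by (rule dim_section_J[OF s kt p1])
    also have "card (S k \<inter> ymonos (q - 1)) \<le> excess (q - 1) A (B k) (c k)"
      by (rule stable_family_restriction[OF n2 F[OF kt] p S(1) S(4)[OF kt]])
    also have "excess (q - 1) A (B k) (c k) + (\<Sum>i\<in>{2..l}. card (low (q - 1) (Suc k - ?a i))) =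
        mp.dim (sect (q - 1) s ` (I \<inter> forms n (b + k)))" by (rule count[OF kt p, symmetric])
    finally have le: "mp.dim (sect (q - 1) s ` (?J \<inter> forms n (b + k))) \<le> mp.dim (sect (q - 1) s ` (I \<inter> forms n (b + k)))"
      by simp
    have "mp.dim (genideal (polyring n) (I \<union> (\<lambda>i. s' (X i)) ` {q..n}) \<inter> forms n (b + k)) =
        mp.dim (sect (q - 1) s ` (I \<inter> forms n (b + k))) + mp.dim {v \<in> forms n (b + k). sect (q - 1) s v = 0}"
      by (rule dim_linear_section[OF s s' q1 idI homogeneous_component[OF I]])
    moreover have "mp.dim (genideal (polyring n) (?J \<union> (\<lambda>i. s' (X i)) ` {q..n}) \<inter> forms n (b + k)) =
        mp.dim (sect (q - 1) s ` (?J \<inter> forms n (b + k))) + mp.dim {v \<in> forms n (b + k). sect (q - 1) s v = 0}"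
      by (rule dim_linear_section[OF s s' q1 ideal_J homJ])
    ultimately have "mp.dim (genideal (polyring n) (?J \<union> (\<lambda>i. s' (X i)) ` {q..n}) \<inter> forms n (b + k)) \<le>
        mp.dim (genideal (polyring n) (I \<union> (\<lambda>i. s' (X i)) ` {q..n}) \<inter> forms n (b + k))"
      using le by linarith
    then show ?thesis
      unfolding quot_hilbert_eq[OF genideal_ideal'[OF Un_least[OF cI(1) f1]]]
        quot_hilbert_eq[OF genideal_ideal'[OF Un_least[OF cI(2) f1]]] by (rule diff_le_mono2)
  qed
  show ?thesis
  proof (intro exI[of _ ?J] conjI ballI exI[of _ "\<lambda>i. s' (X i)"] allI impI)
    show "lpp_ideal n l v I ?J" by (rule lpp)
    show "same_hilbert_upto n (alpha n I + t) I ?J" using hil unfolding bI(2) .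
    fix q assume q: "q \<in> {3..n}"
    show "inj_on (\<lambda>i. s' (X i)) {q..n}" "mp.independent ((\<lambda>i. s' (X i)) ` {q..n})"
      by (rule linear_forms_independent[OF s'(1)], simp)+
    show "s' (X i) \<in> forms n 1" if "i \<in> {q..n}" for i
      using that q unip_props(6)[OF s'(1), of "X i" 1] by simp
    show "quot_hilbert n (genideal (polyring n) (I \<union> (\<lambda>i. s' (X i)) ` {q..n})) (alpha n I + k) \<le>
      quot_hilbert n (genideal (polyring n) (?J \<union> (\<lambda>i. s' (X i)) ` {q..n})) (alpha n I + k)" if "k < t" for k
      using sec[OF q that] unfolding bI(2) .
  qed
qed

section \<open>Existence of the lex-plus-powers ideal\<close>

theorem theorem1p8:
  fixes n l t :: nat and v :: "nat list"
  assumes "n \<ge> 3" and "l \<ge> 1" and "length v = l + t + 1"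
  shows "\<exists>D::nat. \<forall>I :: 'k::field_char_0 mpoly set.
    homogeneous_ideal n I \<and> has_type n l t v I \<and> alpha n I \<ge> D \<longrightarrow>
    (\<exists>J. lpp_ideal n l v I J \<and>
       same_hilbert_upto n (alpha n I + t) I J \<and>
       (\<forall>q\<in>{3..n}. \<exists>f :: nat \<Rightarrow> 'k mpoly.
          (\<forall>i\<in>{q..n}. f i \<in> forms n 1) \<and>
          inj_on f {q..n} \<and> mp.independent (f ` {q..n}) \<and>
          (\<forall>k<t. quot_hilbert n (genideal (polyring n) (J \<union> f ` {q..n})) (alpha n I + k)
                \<ge> quot_hilbert n (genideal (polyring n) (I \<union> f ` {q..n})) (alpha n I + k))))"
proof -
  let ?a = "a_entry v"
  define r where "r = card {i \<in> {1..l}. ?a i \<le> t}"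
  define C where "C = (\<Sum>i\<le>t. b_entry l v i) * card (low n (Suc t))"
  have n2: "2 \<le> n" and n1: "1 \<le> n" using assms(1) by auto
  show ?thesis
  proof (rule stable_families_exist[OF n2, where t = t and C = C and r = r and 'k = 'k])
    fix D
    assume D: "\<And>b (W :: nat \<Rightarrow> 'k mpoly set) g a.
    D \<le> b \<Longrightarrow> (\<And>j. j \<le> t \<Longrightarrow> mp.subspace (W j) \<and> W j \<subseteq> forms n (b + j) \<and> mp.dim (W j) \<le> C) \<Longrightarrow>
    (\<And>j k v. j < t \<Longrightarrow> k \<in> {1..n} \<Longrightarrow> v \<in> W j \<Longrightarrow> X k * v \<in> W (Suc j)) \<Longrightarrow> W 0 \<noteq> {0} \<Longrightarrow>
    (\<And>k. k \<in> {1..r} \<Longrightarrow> a k \<le> t \<and> a 1 \<le> a k \<and> g k \<in> W (a k)) \<Longrightarrow>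
    (\<And>h. (\<And>k. k \<in> {1..r} \<Longrightarrow> \<exists>e<b. h k \<in> forms n e) \<Longrightarrow> (\<Sum>k\<in>{1..r}. h k * g k) = 0 \<Longrightarrow> \<forall>k\<in>{1..r}. h k = 0) \<Longrightarrow>
    \<exists>s\<in>unip n. \<exists>A B. {1..r} \<subseteq> A \<and>
      (\<forall>j\<le>t. stable_family n A 1 (B j) (\<lambda>i. if i \<in> {2..r} then Suc j - a i else 0)) \<and>
      (\<forall>j<t. \<forall>i\<in>A. shadow n (B j i) \<subseteq> B (Suc j) i) \<and>
      (\<forall>j\<le>t. \<forall>p\<in>{2..n}. (\<Sum>i\<in>A. card (B j i \<inter> ymonos p)) = mp.dim (restr {m. supp m \<subseteq> {..p}} ` s ` W j))"
    show ?thesis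
  proof (rule exI[of _ "max D (Suc (C + t))"], intro allI impI)
    fix I :: "'k mpoly set"
    assume asm: "homogeneous_ideal n I \<and> has_type n l t v I \<and> max D (Suc (C + t)) \<le> alpha n I"
    let ?b = "alpha n I" and ?W = "\<lambda>j. I \<inter> forms n (alpha n I + j)"
    have I: "homogeneous_ideal n I" and b: "D \<le> ?b" "C + t < ?b" using asm by auto
    have idI: "ideal I (polyring n)" using I unfolding homogeneous_ideal_def by blast
    have ty: "has_type n l t v I" using asm by blast
    obtain g where g: "regular_seq n l g"
      "\<forall>i\<in>{1..l}. g i \<in> I \<and> g i \<in> forms n (?b + ?a i)" "\<forall>i\<in>{1..<l}. ?b + ?a i \<le> ?b + ?a (i + 1)"
      using ty unfolding has_type_def by blast
    obtain G where G: "min_hom_gens n I G" "\<forall>j\<le>t. card (G \<inter> forms n (?b + j)) = b_entry l v j"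
      using ty unfolding has_type_def by blast
    have srt: "\<And>i. i \<in> {1..<l} \<Longrightarrow> ?a i \<le> ?a (i + 1)" using g(3) by auto
    have r: "{i \<in> {1..l}. ?a i \<le> t} = {1..r}" unfolding r_def by (rule sorted_prefix(1)[where a = ?a and l = l, OF srt])
    have rl: "k \<in> {1..l}" "?a k \<le> t" if "k \<in> {1..r}" for k using that unfolding r[symmetric] by auto
    have r_le: "r \<le> l" using rl(1)[of r] by (cases "r = 0") auto
    have ln: "l \<le> n"
    proof (rule regular_seq_length[OF g(1)])
      fix i assume i: "i \<in> {1..l}"
      show "\<exists>d\<le>?b + Max (?a ` {1..l}). g i \<in> forms n d"
        using g(2) i by (intro exI[of _ "?b + ?a i"] conjI) auto
    qed
    have "g 1 \<in> I" "g 1 \<noteq> 0" using g(2) regular_seq_nonzero[OF g(1) assms(2)] assms(2) by auto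
    then have nz: "I \<inter> forms n ?b \<noteq> {0}" by (intro alpha_form_exists[OF G(1)]) blast
    have dimC: "mp.dim (?W j) \<le> C" if "j \<le> t" for j
      unfolding C_def using G(2) that by (intro dim_forms_bound[OF n1 G(1)]) auto
    have "\<exists>s\<in>unip n. \<exists>A B. {1..r} \<subseteq> A \<and>
      (\<forall>j\<le>t. stable_family n A 1 (B j) (\<lambda>i. if i \<in> {2..r} then Suc j - ?a i else 0)) \<and>
      (\<forall>j<t. \<forall>i\<in>A. shadow n (B j i) \<subseteq> B (Suc j) i) \<and>
      (\<forall>j\<le>t. \<forall>p\<in>{2..n}. (\<Sum>i\<in>A. card (B j i \<inter> ymonos p)) = mp.dim (restr {m. supp m \<subseteq> {..p}} ` s ` ?W j))"
    proof (rule D[OF b(1), of ?W])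
      show "mp.subspace (?W j) \<and> ?W j \<subseteq> forms n (?b + j) \<and> mp.dim (?W j) \<le> C" if "j \<le> t" for j
        using mp.subspace_inter[OF subspace_ideal[OF idI] subspace_forms] dimC[OF that] by blast
      show "X k * w \<in> ?W (Suc j)" if j: "j < t" and k: "k \<in> {1..n}" and w: "w \<in> ?W j" for j k w
      proof
        have X: "X k \<in> forms n (Suc 0)" by (rule X_forms[OF k])
        show "X k * w \<in> I" using w by (intro ideal_mult[OF idI forms_carrier[OF X]]) blast
        have "X k * w \<in> forms n (Suc 0 + (?b + j))" using w by (intro forms_mult[OF X]) blast
        then show "X k * w \<in> forms n (?b + Suc j)" by simp
      qed
      show "?W 0 \<noteq> {0}" using nz by simp
      show "?a k \<le> t \<and> ?a 1 \<le> ?a k \<and> g k \<in> ?W (?a k)" if k: "k \<in> {1..r}" for k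
        using rl[OF k] sorted_prefix(2)[where a = ?a and l = l, OF srt rl(1)[OF k]] g(2) by blast
      show "\<forall>k\<in>{1..r}. h k = 0" if h: "\<And>k. k \<in> {1..r} \<Longrightarrow> \<exists>e<?b. h k \<in> forms n e" and
        z: "(\<Sum>k\<in>{1..r}. h k * g k) = 0" for h
      proof (rule regular_seq_free[OF g(1) _ r_le h z])
        show "\<exists>d\<ge>?b. g i \<in> forms n d" if "i \<in> {1..l}" for i
          using g(2) that by (intro exI[of _ "?b + ?a i"]) simp
      qed
    qed
    then obtain s A B where s: "s \<in> unip n" "{1..r} \<subseteq> A"
      "\<forall>j\<le>t. stable_family n A 1 (B j) (\<lambda>i. if i \<in> {2..r} then Suc j - ?a i else 0)"
      "\<forall>j<t. \<forall>i\<in>A. shadow n (B j i) \<subseteq> B (Suc j) i"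
      "\<forall>j\<le>t. \<forall>p\<in>{2..n}. (\<Sum>i\<in>A. card (B j i \<inter> ymonos p)) = mp.dim (restr {m. supp m \<subseteq> {..p}} ` s ` ?W j)"
      by blast
    show "\<exists>J. lpp_ideal n l v I J \<and>
       same_hilbert_upto n (alpha n I + t) I J \<and>
       (\<forall>q\<in>{3..n}. \<exists>f :: nat \<Rightarrow> 'k mpoly.
          (\<forall>i\<in>{q..n}. f i \<in> forms n 1) \<and>
          inj_on f {q..n} \<and> mp.independent (f ` {q..n}) \<and>
          (\<forall>k<t. quot_hilbert n (genideal (polyring n) (J \<union> f ` {q..n})) (alpha n I + k)
                \<ge> quot_hilbert n (genideal (polyring n) (I \<union> f ` {q..n})) (alpha n I + k)))"
      by (rule lpp_of_stable_families[OF assms(1) I assms(2) ln b(2) refl dimC forms_below_alpha[OF G(1)] nz r s(2,1)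
            s(3)[rule_format] s(4)[rule_format] s(5)[rule_format]])
  qed
qed
qed

end
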